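(* Any two connections in $(1-2)^g$ are topologically equivalent.
   Context: Setting. We consider smooth vector fields on 3-manifolds. A connection $\Gamma$ from a hyperbolic saddle $p$ to a hyperbolic saddle $q$ is the closure of an orbit accumulating on $p$ in negative time and on $q$ in positive time, so $\Gamma\subset W^u(p)\cap W^s(q)$ near $\Gamma$. Standing assumption: near each of $p$ and $q$ there are $C^1$ coordinates in which the vector field is linear. Two connections $\Gamma$ (of a vector field $X$) and $\tilde\Gamma$ (of $\tilde X$) are topologically equivalent if there are neighbourhoods $U$ of $\Gamma$ and $\tilde U$ of $\tilde\Gamma$ and a homeomorphism $h\colon U\to\tilde U$ with $h(\Gamma)=\tilde\Gamma$ mapping orbits of $X|_U$ to orbits of $\tilde X|_{\tilde U}$ and preserving the orientation of orbits given by the vector fields. $(1-2)^g$ is the set of connections $\Gamma$ from $p$ to $q$ with $\dim W^s(p)=1$ and $\dim W^s(q)=2$ (so $\dim W^u(p)=\dim W^s(q)=2$) such that $W^u(p)$ and $W^s(q)$ intersect transversally along $\Gamma$. *)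

theory Defs
  imports "HOL-Analysis.Analysis"
begin

section \<open>Smooth 3-manifolds and smooth vector fields\<close>

text \<open>
  Intended for open sets \<open>S\<close>: all partial derivatives up to order \<open>k\<close> exist and are continuous on
  \<open>S\<close> (the map is totally differentiable at each stage, and every directional derivative
  is again of class \<open>C^(k-1)\<close>).
\<close>

primrec Ck_on ::
  "nat \<Rightarrow> 'a::real_normed_vector set \<Rightarrow> ('a \<Rightarrow> 'b::real_normed_vector) \<Rightarrow> bool" where
  "Ck_on 0 S f \<longleftrightarrow> continuous_on S f"
| "Ck_on (Suc k) S f \<longleftrightarrow>
     (\<forall>x\<in>S. f differentiable (at x)) \<and>
     (\<forall>v. Ck_on k S (\<lambda>x. frechet_derivative f (at x) v))"

definition smooth_on ::
  "'a::real_normed_vector set \<Rightarrow> ('a \<Rightarrow> 'b::real_normed_vector) \<Rightarrow> bool" where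
  "smooth_on S f \<longleftrightarrow> (\<forall>k. Ck_on k S f)"

text \<open>A chart is a pair of a domain and a coordinate map; values off the domain are irrelevant.\<close>

type_synonym 'a chart = "'a set \<times> ('a \<Rightarrow> real^3)"

definition is_chart :: "'a topology \<Rightarrow> 'a chart \<Rightarrow> bool" where
  "is_chart M c \<longleftrightarrow>
     openin M (fst c) \<and> open (snd c ` fst c) \<and>
     homeomorphic_map (subtopology M (fst c)) (top_of_set (snd c ` fst c)) (snd c)"

definition chart_inv :: "'a chart \<Rightarrow> real^3 \<Rightarrow> 'a" where
  "chart_inv c = inv_into (fst c) (snd c)"

text \<open>The coordinate change from \<open>c\<close> to \<open>d\<close>, meaningful on \<open>snd c ` (fst c \<inter> fst d)\<close>.\<close>

definition transition :: "'a chart \<Rightarrow> 'a chart \<Rightarrow> real^3 \<Rightarrow> real^3" where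
  "transition c d = snd d \<circ> chart_inv c"

definition smooth_3manifold :: "'a topology \<Rightarrow> 'a chart set \<Rightarrow> bool" where
  "smooth_3manifold M A \<longleftrightarrow>
     Hausdorff_space M \<and> second_countable M \<and>
     (\<forall>c\<in>A. is_chart M c) \<and> (\<Union>c\<in>A. fst c) = topspace M \<and>
     (\<forall>c\<in>A. \<forall>d\<in>A. smooth_on (snd c ` (fst c \<inter> fst d)) (transition c d))"

text \<open>
  Tangent vectors at \<open>x\<close> are given by their components in each chart of the atlas around \<open>x\<close>, related
  by the derivatives of the coordinate changes.  Accordingly \<open>X c x\<close> is the component vector
  of the vector field \<open>X\<close> at \<open>x\<close> in the chart \<open>c\<close>.
\<close>

type_synonym 'a vfield = "'a chart \<Rightarrow> 'a \<Rightarrow> real^3"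

definition smooth_vector_field :: "'a chart set \<Rightarrow> 'a vfield \<Rightarrow> bool" where
  "smooth_vector_field A X \<longleftrightarrow>
     (\<forall>c\<in>A. \<forall>d\<in>A. \<forall>x \<in> fst c \<inter> fst d.
        X d x = frechet_derivative (transition c d) (at (snd c x)) (X c x)) \<and>
     (\<forall>c\<in>A. smooth_on (snd c ` fst c) (X c \<circ> chart_inv c))"

definition reverse_field :: "'a vfield \<Rightarrow> 'a vfield" where
  "reverse_field X = (\<lambda>c x. - X c x)"


section \<open>Integral curves\<close>

text \<open>Integral curves of the restriction of \<open>X\<close> to \<open>U\<close>, with domain an interval \<open>I\<close>.\<close>

definition integral_curve ::
  "'a topology \<Rightarrow> 'a chart set \<Rightarrow> 'a vfield \<Rightarrow> 'a set \<Rightarrow> real set \<Rightarrow> (real \<Rightarrow> 'a) \<Rightarrow> bool" where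
  "integral_curve M A X U I \<gamma> \<longleftrightarrow>
     is_interval I \<and> continuous_map (top_of_set I) (subtopology M U) \<gamma> \<and>
     (\<forall>t\<in>I. \<forall>c\<in>A. \<gamma> t \<in> fst c \<longrightarrow>
        ((snd c \<circ> \<gamma>) has_vector_derivative X c (\<gamma> t)) (at t within I))"

text \<open>The images of maximal integral curves in \<open>U\<close> are the orbits of the restriction of \<open>X\<close> to \<open>U\<close>.\<close>

definition maximal_integral_curve ::
  "'a topology \<Rightarrow> 'a chart set \<Rightarrow> 'a vfield \<Rightarrow> 'a set \<Rightarrow> real set \<Rightarrow> (real \<Rightarrow> 'a) \<Rightarrow> bool" where
  "maximal_integral_curve M A X U I \<gamma> \<longleftrightarrow>
     open I \<and> I \<noteq> {} \<and> integral_curve M A X U I \<gamma> \<and>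
     (\<forall>J \<delta>. open J \<and> I \<subseteq> J \<and> integral_curve M A X U J \<delta> \<and> (\<forall>t\<in>I. \<delta> t = \<gamma> t) \<longrightarrow> J = I)"


section \<open>Hyperbolic saddles and their invariant manifolds\<close>

definition complex_eigenvalue :: "real^3^3 \<Rightarrow> complex \<Rightarrow> bool" where
  "complex_eigenvalue B l \<longleftrightarrow>
     (\<exists>v::complex^3. v \<noteq> 0 \<and> (\<chi> i j. complex_of_real (B $ i $ j)) *v v = l *s v)"

definition hyperbolic_saddle ::
  "'a topology \<Rightarrow> 'a chart set \<Rightarrow> 'a vfield \<Rightarrow> 'a \<Rightarrow> bool" where
  "hyperbolic_saddle M A X p \<longleftrightarrow>
     p \<in> topspace M \<and>
     (\<forall>c\<in>A. p \<in> fst c \<longrightarrow>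
        X c p = 0 \<and>
        (let B = jacobian (X c \<circ> chart_inv c) (at (snd c p)) in
           (\<forall>l. complex_eigenvalue B l \<longrightarrow> Re l \<noteq> 0) \<and>
           (\<exists>l. complex_eigenvalue B l \<and> Re l < 0) \<and>
           (\<exists>l. complex_eigenvalue B l \<and> Re l > 0)))"

definition C1_coordinates :: "'a topology \<Rightarrow> 'a chart set \<Rightarrow> 'a chart \<Rightarrow> bool" where
  "C1_coordinates M A d \<longleftrightarrow>
     is_chart M d \<and>
     (\<forall>c\<in>A. Ck_on 1 (snd c ` (fst c \<inter> fst d)) (transition c d) \<and>
            Ck_on 1 (snd d ` (fst c \<inter> fst d)) (transition d c))"

definition C1_linearizable ::
  "'a topology \<Rightarrow> 'a chart set \<Rightarrow> 'a vfield \<Rightarrow> 'a \<Rightarrow> bool" where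
  "C1_linearizable M A X p \<longleftrightarrow>
     (\<exists>d L. C1_coordinates M A d \<and> p \<in> fst d \<and> snd d p = 0 \<and> linear L \<and>
        (\<forall>c\<in>A. \<forall>x \<in> fst c \<inter> fst d.
           frechet_derivative (transition c d) (at (snd c x)) (X c x) = L (snd d x)))"

definition stable_set ::
  "'a topology \<Rightarrow> 'a chart set \<Rightarrow> 'a vfield \<Rightarrow> 'a \<Rightarrow> 'a set" where
  "stable_set M A X p =
     {x. \<exists>\<gamma>. integral_curve M A X (topspace M) {0..} \<gamma> \<and> \<gamma> 0 = x \<and> limitin M \<gamma> p at_top}"

abbreviation unstable_set ::
  "'a topology \<Rightarrow> 'a chart set \<Rightarrow> 'a vfield \<Rightarrow> 'a \<Rightarrow> 'a set" where
  "unstable_set M A X p \<equiv> stable_set M A (reverse_field X) p"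

text \<open>
  \<open>S\<close> is, near its point \<open>x\<close>, an embedded \<open>C^1\<close> submanifold, straightened by the \<open>C^1\<close> coordinates \<open>d\<close>
  to the linear subspace \<open>E\<close>; \<open>V\<close> is its tangent space at \<open>x\<close>, read in the chart \<open>c\<close>.
\<close>

definition has_tangent_space ::
  "'a topology \<Rightarrow> 'a chart set \<Rightarrow> 'a set \<Rightarrow> 'a \<Rightarrow> 'a chart \<Rightarrow> (real^3) set \<Rightarrow> bool" where
  "has_tangent_space M A S x c V \<longleftrightarrow>
     x \<in> S \<and>
     (\<exists>d E. C1_coordinates M A d \<and> x \<in> fst d \<and> subspace E \<and>
        snd d ` (S \<inter> fst d) = snd d ` fst d \<inter> E \<and>
        V = {v. frechet_derivative (transition c d) (at (snd c x)) v \<in> E})"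

text \<open>
  The stable manifold is in general only an immersed submanifold: it may accumulate on itself,
  so its tangent spaces cannot be read off from the set \<open>stable_set M A X p\<close> alone.  As usual it is
  exhausted by the preimages, under the time-\<open>T\<close> map of the flow, of local stable manifolds (points of
  a neighbourhood \<open>N\<close> of \<open>p\<close> whose forward orbit stays in \<open>N\<close> and tends to \<open>p\<close>).  These pieces are
  embedded when \<open>N\<close> is small, and define the tangent spaces.  Enlarging \<open>N\<close> or \<open>T\<close> can destroy
  embeddedness but cannot change the tangent space.
\<close>

definition stable_piece ::
  "'a topology \<Rightarrow> 'a chart set \<Rightarrow> 'a vfield \<Rightarrow> 'a \<Rightarrow> 'a set \<Rightarrow> real \<Rightarrow> 'a set" where
  "stable_piece M A X p N T =
     {x. \<exists>\<gamma>. integral_curve M A X (topspace M) {0..} \<gamma> \<and> \<gamma> 0 = x \<and> limitin M \<gamma> p at_top \<and>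
             \<gamma> ` {T..} \<subseteq> N}"

definition stable_tangent ::
  "'a topology \<Rightarrow> 'a chart set \<Rightarrow> 'a vfield \<Rightarrow> 'a \<Rightarrow> 'a \<Rightarrow> 'a chart \<Rightarrow> (real^3) set \<Rightarrow> bool" where
  "stable_tangent M A X p x c V \<longleftrightarrow>
     (\<exists>N T. openin M N \<and> p \<in> N \<and> 0 \<le> T \<and>
        has_tangent_space M A (stable_piece M A X p N T) x c V)"

abbreviation unstable_tangent ::
  "'a topology \<Rightarrow> 'a chart set \<Rightarrow> 'a vfield \<Rightarrow> 'a \<Rightarrow> 'a \<Rightarrow> 'a chart \<Rightarrow> (real^3) set \<Rightarrow> bool" where
  "unstable_tangent M A X p x c V \<equiv> stable_tangent M A (reverse_field X) p x c V"

text \<open>\<open>stable_dim M A X p k\<close> says that \<open>W^s(p)\<close> is an immersed submanifold of dimension \<open>k\<close>.\<close>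

definition stable_dim ::
  "'a topology \<Rightarrow> 'a chart set \<Rightarrow> 'a vfield \<Rightarrow> 'a \<Rightarrow> nat \<Rightarrow> bool" where
  "stable_dim M A X p k \<longleftrightarrow>
     (\<forall>x \<in> stable_set M A X p. \<forall>c\<in>A. x \<in> fst c \<longrightarrow>
        (\<exists>V. stable_tangent M A X p x c V \<and> dim V = k))"


section \<open>Connections\<close>

text \<open>
  An orbit accumulating on \<open>p\<close> in negative time and on \<open>q\<close> in positive time is one that converges to
  \<open>p\<close> and \<open>q\<close> respectively; such an orbit is defined for all times.  The orbits \<open>{p}\<close> and \<open>{q}\<close>
  themselves are excluded.
\<close>

definition connection ::
  "'a topology \<Rightarrow> 'a chart set \<Rightarrow> 'a vfield \<Rightarrow> 'a \<Rightarrow> 'a \<Rightarrow> 'a set \<Rightarrow> bool" where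
  "connection M A X p q \<Gamma> \<longleftrightarrow>
     hyperbolic_saddle M A X p \<and> hyperbolic_saddle M A X q \<and>
     C1_linearizable M A X p \<and> C1_linearizable M A X q \<and>
     (\<exists>\<gamma>. integral_curve M A X (topspace M) UNIV \<gamma> \<and>
        limitin M \<gamma> p at_bot \<and> limitin M \<gamma> q at_top \<and>
        p \<notin> range \<gamma> \<and> q \<notin> range \<gamma> \<and>
        \<Gamma> = M closure_of (range \<gamma>))"

definition transverse_along ::
  "'a topology \<Rightarrow> 'a chart set \<Rightarrow> 'a vfield \<Rightarrow> 'a \<Rightarrow> 'a \<Rightarrow> 'a set \<Rightarrow> bool" where
  "transverse_along M A X p q \<Gamma> \<longleftrightarrow>
     (\<forall>x \<in> \<Gamma> \<inter> unstable_set M A X p \<inter> stable_set M A X q. \<forall>c\<in>A. x \<in> fst c \<longrightarrow>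
        (\<exists>V W. unstable_tangent M A X p x c V \<and> stable_tangent M A X q x c W \<and>
               {v + w |v w. v \<in> V \<and> w \<in> W} = UNIV))"

definition generic_12_connection ::
  "'a topology \<Rightarrow> 'a chart set \<Rightarrow> 'a vfield \<Rightarrow> 'a set \<Rightarrow> bool" where
  "generic_12_connection M A X \<Gamma> \<longleftrightarrow>
     (\<exists>p q. connection M A X p q \<Gamma> \<and>
        stable_dim M A X p 1 \<and> stable_dim M A X q 2 \<and>
        transverse_along M A X p q \<Gamma>)"

text \<open>
  Since \<open>h\<close> is a bijection and orbits are either disjoint or equal, the condition on maximal integral
  curves says that \<open>h\<close> induces a bijection between the orbits in \<open>U\<close> and those in \<open>U'\<close>, and that it
  preserves their orientation.
\<close>

definition topologically_equivalent ::
  "'a topology \<Rightarrow> 'a chart set \<Rightarrow> 'a vfield \<Rightarrow> 'a set \<Rightarrow>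
   'b topology \<Rightarrow> 'b chart set \<Rightarrow> 'b vfield \<Rightarrow> 'b set \<Rightarrow> bool" where
  "topologically_equivalent M A X \<Gamma> M' A' X' \<Gamma>' \<longleftrightarrow>
     (\<exists>U U' h. openin M U \<and> \<Gamma> \<subseteq> U \<and> openin M' U' \<and> \<Gamma>' \<subseteq> U' \<and>
        homeomorphic_map (subtopology M U) (subtopology M' U') h \<and> h ` \<Gamma> = \<Gamma>' \<and>
        (\<forall>I \<gamma>. maximal_integral_curve M A X U I \<gamma> \<longrightarrow>
           (\<exists>J \<gamma>' \<tau>. maximal_integral_curve M' A' X' U' J \<gamma>' \<and>
              strict_mono_on I \<tau> \<and> \<tau> ` I = J \<and> (\<forall>t\<in>I. h (\<gamma> t) = \<gamma>' (\<tau> t)))))"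

end

theory Submission
 imports Defs
begin

text \<open>
 Every generic connection is conjugate, by a map that preserves time, to one and the same model: the orbit from
 \<open>(0,-1,0)\<close> to \<open>(0,1,0)\<close> of the field \<open>(-x, (1 - y\<^sup>2) / 2, z)\<close>.  Two connections are then equivalent
 through the composition of one conjugacy with the inverse of the other (\<open>equivalence_of_conjugacies\<close>).

 A conjugacy only has to be continuous, to map integral curves to solutions, to be injective near each point of the
 compact set \<open>\<Gamma>\<close>, and to be injective on \<open>\<Gamma>\<close>.  It is then injective on a neighbourhood of \<open>\<Gamma>\<close>
 (\<open>locally_conjugates_injective\<close>), invariance of domain makes it a homeomorphism onto an open set, and its inverse maps
 solutions to integral curves because integral curves exist locally and solutions of the model are unique
 (\<open>conjugates_lift\<close>).

 Near \<open>q\<close> the field is linear in C1 coordinates, and the eigenvalues leave two types: a contracting plane with an expanding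
 axis, or the reverse.  The dimensions of the stable manifolds select the first type at \<open>q\<close>
 (\<open>stable_axis_dim\<close>) and the second at \<open>p\<close> (\<open>stable_plane_dim\<close>), so that \<open>p\<close> becomes a saddle of the first type when
 time is reversed.  Pulled back along the flow, the linearizing chart covers a whole half of the connection
 (\<open>sink_side\<close>), and the plane of the chart is the invariant manifold there (\<open>stable_tangent_eq_plane\<close>).
 A homeomorphism turns the linear flow into \<open>(exp t * x, exp (-t) * y, exp (-t) * z)\<close>, whatever the eigenvalues are: the first
 coordinate is a power, and points of the plane are labelled by the time at which they cross the unit circle.

 The two halves have to be matched near a point \<open>m1\<close> of the connection.  Let \<open>x\<close> and \<open>w\<close> be the expanding coordinates at \<open>p\<close>
 (in reversed time) and at \<open>q\<close>, and \<open>r\<close> the radius at \<open>p\<close>.  The map \<open>(x, r, w)\<close> is injective near \<open>m1\<close>: points with the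
 same \<open>x\<close> and \<open>r\<close> lie on a circle around the axis at \<open>p\<close>, and transversality says that \<open>w\<close> has a nonzero derivative along it
 (\<open>crossing_injective\<close>).  Each half is now changed by a homeomorphism that commutes with the flow \<open>(exp t * x, exp (-t) * y, exp (-t) * z)\<close>
 until it uses these three functions near \<open>m1\<close>.  At \<open>p\<close> the third coordinate is replaced by \<open>w\<close>
 (\<open>extend_third\<close>).  At \<open>q\<close> the second coordinate is replaced by \<open>1 / r\<close> (\<open>extend_second\<close>), which preserves injectivity because
 the logarithm of \<open>r\<close> is Lipschitz whereas the logarithm of \<open>w\<close> is steep near zero, and then the third one by \<open>x\<close>.  Both
 changes are equal, up to a reflection, to the identity outside a sector around the connection, so they extend
 continuously to the saddle.
 The two halves now agree near \<open>m1\<close> and can be glued (\<open>matched_embeddings\<close>, \<open>glue_conjugacies\<close>).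
\<close>

section \<open>Maps of class C1\<close>

lemma Ck_on_continuous: "Ck_on k S f ==> continuous_on S f"
proof (cases k)
 case (Suc n)
 assume "Ck_on k S f"
 then have "f differentiable_on S" using Suc by (auto simp: differentiable_on_def intro: differentiable_at_withinI)
 then show ?thesis by (rule differentiable_imp_continuous_on)
qed auto

lemma Ck_on_frechet:
 assumes "Ck_on (Suc k) S f" "x \<in> S"
 shows "(f has_derivative frechet_derivative f (at x)) (at x)"
 using assms frechet_derivative_works by (auto simp: frechet_derivative_works)

lemma C1_has_derivative:
 assumes "Ck_on 1 S f" "x \<in> S"
 shows "(f has_derivative frechet_derivative f (at x)) (at x)" using Ck_on_frechet[of 0 S f x] assms by simp

lemma Ck_on_1_cont:
 assumes "Ck_on 1 S f"
 shows "continuous_on S (%x. frechet_derivative f (at x) v)" using assms by simp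

lemma Ck_on_1I:
 assumes "!!x. x \<in> S ==> (f has_derivative f' x) (at x)"
  and "!!v. continuous_on S (%x. f' x v)"
 shows "Ck_on 1 S f"
proof -
 have "frechet_derivative f (at x) v = f' x v" if "x \<in> S" for x v using assms(1)[OF that] frechet_derivative_at by metis
 then have "continuous_on S (%x. frechet_derivative f (at x) v)" for v
  using assms(2)[of v] by (simp cong: continuous_on_cong)
 moreover have "\<forall>x\<in>S. f differentiable (at x)" using assms(1) differentiable_def by blast
 ultimately show ?thesis by simp
qed

lemma Ck_on_subset: "Ck_on k S f ==> T \<subseteq> S ==> Ck_on k T f"
proof (induction k arbitrary: f)
 case 0
 then show ?case by (auto intro: continuous_on_subset)
qed auto

lemma Ck_on_mono: "Ck_on (Suc k) S f ==> Ck_on k S f"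
proof (induction k arbitrary: f)
 case 0
 then show ?case using Ck_on_continuous by (metis Ck_on.simps(1))
next
 case (Suc k)
 then show ?case by (metis Ck_on.simps(2))
qed

lemma Ck_on_1_cong:
 assumes "Ck_on 1 S f" "open S" "!!x. x \<in> S ==> f x = g x"
 shows "Ck_on 1 S g"
proof (rule Ck_on_1I)
 show "(g has_derivative frechet_derivative f (at x)) (at x)" if "x \<in> S" for x
  using C1_has_derivative[OF assms(1) that] assms(2,3) that by (metis has_derivative_transform_within_open)
 show "continuous_on S (%x. frechet_derivative f (at x) v)" for v using assms(1) by simp
qed

text \<open>A C1 map has locally bounded derivative, which also makes the derivative jointly continuous in
 the base point and the vector.\<close>

lemma linear_norm_le_Basis:
 fixes l :: "'a::euclidean_space => 'b::real_normed_vector"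
 assumes "linear l"
 shows "norm (l v) <= (\<Sum>b\<in>Basis. norm (l b)) * norm v"
proof -
 have "l v = l (\<Sum>b\<in>Basis. (v \<bullet> b) *\<^sub>R b)" by (simp add: euclidean_representation)
 also have "\<dots> = (\<Sum>b\<in>Basis. (v \<bullet> b) *\<^sub>R l b)" using assms by (simp add: linear_sum linear_scale)
 finally have "norm (l v) <= (\<Sum>b\<in>Basis. norm ((v \<bullet> b) *\<^sub>R l b))" by (metis norm_sum)
 also have "\<dots> <= (\<Sum>b\<in>Basis. norm v * norm (l b))"
  by (intro sum_mono) (auto simp: Basis_le_norm intro!: mult_right_mono)
 finally show ?thesis by (simp add: sum_distrib_left mult.commute)
qed

lemma C1_tendsto:
 fixes f :: "'a::euclidean_space => 'b::real_normed_vector"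
 assumes f: "Ck_on 1 S f" and S: "open S" "x0 \<in> S"
  and x: "(x \<longlongrightarrow> x0) F" and v: "(v \<longlongrightarrow> v0) F"
 shows "((%s. frechet_derivative f (at (x s)) (v s)) \<longlongrightarrow> frechet_derivative f (at x0) v0) F"
proof -
 let ?D = "%x. frechet_derivative f (at x)"
 have lin: "linear (?D y)" if "y \<in> S" for y using f that by (simp add: linear_frechet_derivative)
 have ev: "\<forall>\<^sub>F s in F. x s \<in> S" using x S by (rule topological_tendstoD)
 have 1: "((%s. \<Sum>b\<in>Basis. (v s \<bullet> b) *\<^sub>R ?D (x s) b) \<longlongrightarrow> (\<Sum>b\<in>Basis. (v0 \<bullet> b) *\<^sub>R ?D x0 b)) F"
 proof (intro tendsto_sum tendsto_scaleR tendsto_inner tendsto_const v)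
  fix b :: 'a
  have "isCont (%y. ?D y b) x0" using f S continuous_on_eq_continuous_at by (metis Ck_on_1_cont)
  then show "((%s. ?D (x s) b) \<longlongrightarrow> ?D x0 b) F" using x by (rule isCont_tendsto_compose)
 qed
 have rep: "(\<Sum>b\<in>Basis. (w \<bullet> b) *\<^sub>R ?D y b) = ?D y w" if "y \<in> S" for y w
 proof -
  have "?D y w = ?D y (\<Sum>b\<in>Basis. (w \<bullet> b) *\<^sub>R b)" by (simp add: euclidean_representation)
  also have "\<dots> = (\<Sum>b\<in>Basis. (w \<bullet> b) *\<^sub>R ?D y b)"
   using lin[OF that] by (simp add: linear_sum linear_scale)
  finally show ?thesis by simp
 qed
 show ?thesis using 1 S rep tendsto_cong[OF eventually_mono[OF ev rep]] by simp
qed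

lemma C1_compose:
 fixes f :: "'a::euclidean_space => 'b::euclidean_space" and g :: "'b => 'c::real_normed_vector"
 assumes f: "Ck_on 1 S f" and g: "Ck_on 1 T g" and T: "open T" "f ` S \<subseteq> T"
 shows "Ck_on 1 S (g \<circ> f)"
proof (rule Ck_on_1I)
 let ?d = "%x v. frechet_derivative g (at (f x)) (frechet_derivative f (at x) v)"
 show "((g \<circ> f) has_derivative ?d x) (at x)" if "x \<in> S" for x
 proof -
  have "(f has_derivative frechet_derivative f (at x)) (at x)" using C1_has_derivative f that by blast
  moreover have "(g has_derivative frechet_derivative g (at (f x))) (at (f x))" using C1_has_derivative g that T(2) by blast
  ultimately show ?thesis using diff_chain_at by (fastforce simp: o_def)
 qed
 show "continuous_on S (%x. ?d x v)" for v unfolding continuous_on_def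
 proof
  fix x assume x: "x \<in> S"
  show "((%x. ?d x v) \<longlongrightarrow> ?d x v) (at x within S)"
  proof (rule C1_tendsto[OF g T(1)])
   show "f x \<in> T" using x T by auto
   show "(f \<longlongrightarrow> f x) (at x within S)" using Ck_on_continuous[OF f] x by (auto simp: continuous_on_def)
   show "((%x. frechet_derivative f (at x) v) \<longlongrightarrow> frechet_derivative f (at x) v) (at x within S)"
    using Ck_on_1_cont[OF f] x by (auto simp: continuous_on_def)
  qed
 qed
qed

lemma C1_bounded_derivative:
 fixes f :: "'a::euclidean_space => 'b::real_normed_vector"
 assumes f: "Ck_on 1 S f" and C: "compact C" "C \<subseteq> S"
 obtains K where "K \<ge> 0" "!!x v. x \<in> C ==> norm (frechet_derivative f (at x) v) <= K * norm v"
proof -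
 let ?n = "%x. \<Sum>b\<in>Basis. norm (frechet_derivative f (at x) b)"
 have "continuous_on C ?n" using f C by (intro continuous_on_sum continuous_on_norm) (auto intro: continuous_on_subset)
 then have "bounded (?n ` C)" using C compact_continuous_image compact_imp_bounded by blast
 then obtain K where K: "!!x. x \<in> C ==> ?n x <= K" by (auto simp: bounded_iff) (metis abs_le_D1)
 show ?thesis
 proof (rule that[of "max K 0"])
  fix x v assume x: "x \<in> C"
  have "linear (frechet_derivative f (at x))" using f x C by (auto intro: linear_frechet_derivative)
  then have "norm (frechet_derivative f (at x) v) <= ?n x * norm v" by (rule linear_norm_le_Basis)
  also have "\<dots> <= max K 0 * norm v" using K[OF x] by (intro mult_right_mono) auto
  finally show "norm (frechet_derivative f (at x) v) <= max K 0 * norm v" .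
 qed simp
qed

lemma C1_lipschitz:
 fixes f :: "'a::euclidean_space => 'b::real_normed_vector"
 assumes f: "Ck_on 1 S f" and C: "compact C" "convex C" "C \<subseteq> S"
 obtains K where "K \<ge> 0" "!!x y. x \<in> C ==> y \<in> C ==> norm (f x - f y) <= K * norm (x - y)"
proof -
 obtain K where K: "K \<ge> 0" "!!x v. x \<in> C ==> norm (frechet_derivative f (at x) v) <= K * norm v"
  using C1_bounded_derivative[OF f C(1,3)] by blast
 show ?thesis
 proof (rule that[OF K(1)])
  fix x y assume xy: "x \<in> C" "y \<in> C"
  show "norm (f x - f y) <= K * norm (x - y)"
  proof (rule differentiable_bound[OF C(2) _ _ xy])
   show "(f has_derivative frechet_derivative f (at z)) (at z within C)" if "z \<in> C" for z
    using C1_has_derivative[OF f, of z] that C by (blast intro: has_derivative_at_withinI)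
   show "onorm (frechet_derivative f (at z)) <= K" if "z \<in> C" for z using K that by (intro onorm_le) auto
  qed
 qed
qed

section \<open>Ordinary differential equations in Euclidean space\<close>

lemma has_vector_derivative_continuous_on:
 assumes "!!t. t \<in> S ==> (u has_vector_derivative u' t) (at t within S)"
 shows "continuous_on S u" unfolding continuous_on_eq_continuous_within
 using has_vector_derivative_continuous[OF assms] by blast

lemma norm_add_le: "norm a <= s ==> norm b <= t ==> norm (a + b) <= s + t"
 for a b :: "'a::real_normed_vector"
 using norm_triangle_ineq[of a b] by linarith

text \<open>A Gronwall estimate for short times: at a maximum \<open>S\<close> of \<open>norm z\<close> the mean value inequality
 gives \<open>S <= norm (z t0) + d * (K * S + E)\<close>, and \<open>d * K <= 1/2\<close> absorbs the term with \<open>S\<close>.\<close>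

lemma short_time_gronwall:
 fixes z :: "real => 'b::real_normed_vector"
 assumes z: "!!t. t \<in> {a..b} ==> (z has_vector_derivative z' t) (at t within {a..b})"
  and bnd: "!!t. t \<in> {a..b} ==> norm (z' t) <= K * norm (z t) + E"
  and d: "b - a <= d" "d * K <= 1/2" and K: "K \<ge> 0" "E \<ge> 0"
  and t0: "t0 \<in> {a..b}" and t: "t \<in> {a..b}"
 shows "norm (z t) <= 2 * (norm (z t0) + d * E)"
proof -
 have "continuous_on {a..b} z" using z by (rule has_vector_derivative_continuous_on)
 then obtain m where m: "m \<in> {a..b}" "!!s. s \<in> {a..b} ==> norm (z s) <= norm (z m)"
  using continuous_attains_sup[of "{a..b}" "%s. norm (z s)"] t0 continuous_on_norm[of "{a..b}" z] by fastforce
 have K': "norm (z' s) <= K * norm (z m) + E" if "s \<in> {a..b}" for s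
  using bnd[OF that] mult_left_mono[OF m(2)[OF that] K(1)] by linarith
 have "norm (z m - z t0) <= (K * norm (z m) + E) * norm (m - t0)"
 proof (rule differentiable_bound[OF convex_real_interval(5)[of a b] _ _ m(1) t0])
  show "(z has_derivative (%x. x *\<^sub>R z' s)) (at s within {a..b})" if "s \<in> {a..b}" for s
   using z[OF that] by (simp add: has_vector_derivative_def)
  show "onorm (%x. x *\<^sub>R z' s) <= K * norm (z m) + E" if "s \<in> {a..b}" for s
   using K'[OF that] by (intro onorm_le) (auto simp: mult.commute mult_left_mono)
 qed
 also have "\<dots> <= (K * norm (z m) + E) * d" using m(1) t0 d K by (intro mult_left_mono) auto
 finally have "norm (z m) <= norm (z t0) + (d * K) * norm (z m) + d * E"
  using norm_triangle_sub[of "z m" "z t0"] by (simp add: algebra_simps)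
 note 1 = this
 have 2: "(d * K) * norm (z m) <= 1/2 * norm (z m)" using d by (intro mult_right_mono) auto
 have "x <= 2 * (y + e)" if "x <= y + p + e" "p <= 1/2 * x" for x y p e :: real using that by argo
 from this[OF 1 2] have "norm (z m) <= 2 * (norm (z t0) + d * E)" .
 then show ?thesis using m(2)[OF t] by linarith
qed

text \<open>Short-time existence for a globally Lipschitz time-dependent field: Picard iteration.  Times outside
 \<open>[-d, d]\<close> are clamped so that the iteration takes place among bounded continuous functions.\<close>

lemma picard_existence:
 fixes g :: "real => 'b::banach => 'b"
 assumes cont: "continuous_on ({-d..d} \<times> UNIV) (%p. g (fst p) (snd p))"
  and lip: "!!t x y. t \<in> {-d..d} ==> norm (g t x - g t y) <= K * norm (x - y)"
  and d: "0 < d" "d * K <= 1/4" and K: "K \<ge> 0"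
 obtains u where "u 0 = y0"
  "!!t. t \<in> {-d..d} ==> (u has_vector_derivative g t (u t)) (at t within {-d..d})"
proof -
 define cl where "cl t = max (-d) (min d t)" for t
 have cl: "cl t \<in> {-d..d}" "t \<in> {-d..d} ==> cl t = t" for t using d by (auto simp: cl_def)
 define Q where "Q u t = y0 + integral {-d..t} (%s. g s (u s)) - integral {-d..0} (%s. g s (u s))" for u t
 have gc: "continuous_on {-d..d} (%s. g s (u s))" if "continuous_on {-d..d} u" for u
  using continuous_on_compose2[OF cont, of "{-d..d}" "%s. (s, u s)"]
   continuous_on_Pair[OF continuous_on_id that] by auto
 have Qd: "(Q u has_vector_derivative g t (u t)) (at t within {-d..d})"
  if "continuous_on {-d..d} u" "t \<in> {-d..d}" for u t unfolding Q_def
  using integral_has_vector_derivative[OF gc[OF that(1)] that(2)] by (auto intro!: derivative_eq_intros)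
 have Qc: "continuous_on {-d..d} (Q u)" if "continuous_on {-d..d} u" for u
  using Qd[OF that] by (rule has_vector_derivative_continuous_on)
 have bc: "(%t. Q u (cl t)) \<in> bcontfun" if "continuous_on {-d..d} u" for u
 proof -
  have "continuous_on UNIV cl" unfolding cl_def by (intro continuous_intros)
  then have "continuous_on UNIV (%t. Q u (cl t))" by (rule continuous_on_compose2[OF Qc[OF that]]) (use cl(1) in blast)
  moreover have "bounded (Q u ` {-d..d})" using Qc[OF that] compact_continuous_image compact_imp_bounded compact_Icc by blast
  then have "bounded (range (%t. Q u (cl t)))" by (rule bounded_subset) (use cl in auto)
  ultimately show ?thesis by (simp add: bcontfun_def)
 qed
 define P where "P w = Bcontfun (%t. Q (apply_bcontfun w) (cl t))" for w
 have Pa: "apply_bcontfun (P w) t = Q (apply_bcontfun w) (cl t)" for w t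
  unfolding P_def using bc[of w] by (simp add: Bcontfun_inverse continuous_on_apply_bcontfun)
 have contr: "dist (P v) (P w) <= (3/4) * dist v w" for v w
 proof (rule dist_bound)
  fix t
  let ?h = "%s. g s (apply_bcontfun v s) - g s (apply_bcontfun w s)"
  have c1: "continuous_on {-d..d} (%s. g s (apply_bcontfun v s))"
      "continuous_on {-d..d} (%s. g s (apply_bcontfun w s))"
   by (auto intro!: gc continuous_on_apply_bcontfun)
  have hb: "norm (?h s) <= K * dist v w" if "s \<in> {-d..d}" for s
  proof -
   have "norm (?h s) <= K * dist (v s) (w s)" using lip[OF that] by (simp add: dist_norm)
   also have "\<dots> <= K * dist v w" using K by (intro mult_left_mono dist_bounded)
   finally show ?thesis .
  qed
  have i: "norm (integral {-d..x} (%s. g s (apply_bcontfun v s)) - integral {-d..x} (%s. g s (apply_bcontfun w s)))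
    <= K * dist v w * (x + d)" if "x \<in> {-d..d}" for x
  proof -
   have sub: "{-d..x} \<subseteq> {-d..d}" using that by auto
   have "integral {-d..x} (%s. g s (apply_bcontfun v s)) - integral {-d..x} (%s. g s (apply_bcontfun w s))
     = integral {-d..x} ?h"
    using continuous_on_subset[OF c1(1) sub] continuous_on_subset[OF c1(2) sub]
    by (simp add: Henstock_Kurzweil_Integration.integral_diff integrable_continuous_real)
   moreover have "norm (integral {-d..x} ?h) <= K * dist v w * (x - (-d))" by (rule integral_bound)
     (use that sub hb c1 in \<open>auto intro!: continuous_intros intro: continuous_on_subset\<close>)
   ultimately show ?thesis by simp
  qed
  have "dist (P v t) (P w t) <= K * dist v w * (cl t + d) + K * dist v w * (0 + d)"
  proof -
   have "norm ((y0 + p1 - q1) - (y0 + p2 - q2)) <= a + b"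
    if "norm (p1 - p2) <= a" "norm (q1 - q2) <= b" for p1 p2 q1 q2 :: 'b and a b
   proof -
    have "(y0 + p1 - q1) - (y0 + p2 - q2) = (p1 - p2) - (q1 - q2)" by simp
    then have "norm ((y0 + p1 - q1) - (y0 + p2 - q2)) <= norm (p1 - p2) + norm (q1 - q2)" by (metis norm_triangle_ineq4)
    then show ?thesis using that by linarith
   qed
   from this[OF i[OF cl(1)[of t]] i[of 0]] show ?thesis
    using d unfolding Pa Q_def dist_norm by simp
  qed
  also have "\<dots> <= K * dist v w * (2 * d) + K * dist v w * d"
   using cl(1)[of t] K by (intro add_mono mult_left_mono) auto
  also have "\<dots> = 3 * (d * K) * dist v w" by (simp add: algebra_simps)
  also have "\<dots> <= 3/4 * dist v w"
  proof (rule mult_right_mono)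
   show "3 * (d * K) <= 3/4" using d(2) by argo
  qed simp
  finally show "dist (P v t) (P w t) <= (3/4) * dist v w" .
 qed
 have "\<exists>!x. x \<in> (UNIV :: (real \<Rightarrow>\<^sub>C 'b) set) & P x = x"
  using Banach_fix[of "UNIV :: (real \<Rightarrow>\<^sub>C 'b) set" "3/4" P] contr complete_UNIV by auto
 then obtain x where x: "P x = x" by auto
 let ?u = "apply_bcontfun x"
 have eq: "?u t = Q ?u (cl t)" for t using Pa[of x t] x by simp
 show ?thesis
 proof (rule that[of ?u])
  show "?u 0 = y0" using eq[of 0] d by (simp add: cl_def Q_def)
  fix t assume t: "t \<in> {-d..d}"
  show "(?u has_vector_derivative g t (?u t)) (at t within {-d..d})"
  proof (rule has_vector_derivative_transform[OF t _ Qd[OF _ t]])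
   show "?u s = Q ?u s" if "s \<in> {-d..d}" for s using eq[of s] cl(2)[OF that] by simp
   show "continuous_on {-d..d} ?u" by (rule continuous_on_apply_bcontfun)
  qed
 qed
qed

text \<open>Uniqueness; the interval may be closed, half-open or open.\<close>

lemma ode_unique_interval:
 fixes f :: "'a::euclidean_space => 'a"
 assumes W: "open W" and f: "Ck_on 1 W f"
  and u: "!!t. t \<in> {a..b} ==> u t \<in> W & (u has_vector_derivative f (u t)) (at t within {a..b})"
  and v: "!!t. t \<in> {a..b} ==> v t \<in> W & (v has_vector_derivative f (v t)) (at t within {a..b})"
  and t0: "t0 \<in> {a..b}" "u t0 = v t0" and t: "t \<in> {a..b}"
 shows "u t = v t"
proof -
 have uc: "continuous_on {a..b} u" "continuous_on {a..b} v"
  using u v has_vector_derivative_continuous_on[of "{a..b}" u "%t. f (u t)"]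
   has_vector_derivative_continuous_on[of "{a..b}" v "%t. f (v t)"] by auto
 have key: "\<exists>e>0. \<forall>r\<in>{a..b}. \<bar>r - s\<bar> < e --> u r = v r" if s: "s \<in> {a..b}" "u s = v s" for s
 proof -
  obtain R where R: "R > 0" "cball (u s) R \<subseteq> W" using W u[OF s(1)] open_contains_cball by blast
  obtain K where K: "K \<ge> 0" "!!x y. x \<in> cball (u s) R ==> y \<in> cball (u s) R ==> norm (f x - f y) <= K * norm (x - y)"
   using C1_lipschitz[OF f _ _ R(2)] by auto
  obtain e1 where e1: "e1 > 0" "!!r. r \<in> {a..b} ==> dist r s < e1 ==> dist (u r) (u s) < R"
   using uc(1) s(1) R(1) unfolding continuous_on_iff by metis
  obtain e2 where e2: "e2 > 0" "!!r. r \<in> {a..b} ==> dist r s < e2 ==> dist (v r) (v s) < R"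
   using uc(2) s(1) R(1) unfolding continuous_on_iff by metis
  define e where "e = min (min e1 e2) (1 / (4 * (K + 1)))"
  have e: "e > 0" "e <= e1" "e <= e2" "2 * e * K <= 1/2"
  proof -
   show "e > 0" "e <= e1" "e <= e2" using e1 e2 K by (auto simp: e_def)
   have "e * (4 * (K + 1)) <= 1" using K by (auto simp: e_def min_def field_simps)
   then show "2 * e * K <= 1/2" using \<open>e > 0\<close> by (simp add: algebra_simps)
  qed
  have "u r = v r" if r: "r \<in> {a..b}" "\<bar>r - s\<bar> < e" for r
  proof -
   let ?a = "min r s" and ?b = "max r s"
   have sub: "{?a..?b} \<subseteq> {a..b}" using r s by auto
   have near: "dist x s < e" if "x \<in> {?a..?b}" for x using that r by (auto simp: dist_real_def)
   have "norm (u r - v r) <= 2 * (norm (u s - v s) + 2 * e * 0)"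
   proof (rule short_time_gronwall[where a = ?a and b = ?b and z = "%x. u x - v x" and K = K
      and z' = "%x. f (u x) - f (v x)"])
    fix x assume x: "x \<in> {?a..?b}"
    then have xab: "x \<in> {a..b}" using sub by auto
    show "((%x. u x - v x) has_vector_derivative f (u x) - f (v x)) (at x within {?a..?b})"
     using u[OF xab] v[OF xab] has_vector_derivative_within_subset[OF _ sub] by (blast intro: has_vector_derivative_diff)
    have "u x \<in> cball (u s) R" "v x \<in> cball (u s) R"
     using e1(2)[OF xab] e2(2)[OF xab] near[OF x] e s(2) by (auto simp: dist_commute)
    then show "norm (f (u x) - f (v x)) <= K * norm (u x - v x) + 0" using K(2) by simp
   qed (use r e K in auto)
   then show ?thesis using s(2) by simp
  qed
  then show ?thesis using e(1) by blast
 qed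
 let ?A = "{s \<in> {a..b}. u s = v s}"
 have "openin (top_of_set {a..b}) ?A" unfolding openin_euclidean_subtopology_iff using key by (auto simp: dist_real_def)
 moreover have "closedin (top_of_set {a..b}) ?A"
 proof -
  have "?A = {s \<in> {a..b}. u s - v s = 0}" by auto
  moreover have "closedin (top_of_set {a..b}) {s \<in> {a..b}. u s - v s = 0}"
   using uc by (intro continuous_closedin_preimage_constant continuous_intros)
  ultimately show ?thesis by simp
 qed
 ultimately have "?A = {} \<or> ?A = {a..b}" using connected_Icc[of a b] unfolding connected_clopen by blast
 moreover have "t0 \<in> ?A" using t0 by blast
 ultimately have "t \<in> ?A" using t by blast
 then show ?thesis by blast
qed

text \<open>The local flow of a C2 field and its C1 dependence on the initial point.  The derivative of the flow
 is the solution \<open>V\<close> of the variational equation \<open>V' = Df(u) V\<close>; the Taylor remainder of \<open>f\<close> makes the error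
 of this linearization quadratic.\<close>

lemma local_flow_euclidean:
 fixes f :: "'a::euclidean_space => 'a"
 assumes W: "open W" "y0 \<in> W" and f: "Ck_on 2 W f"
 obtains d r \<phi> where "d > 0" "r > 0"
  "!!y. y \<in> ball y0 r ==> \<phi> 0 y = y"
  "!!y t. y \<in> ball y0 r ==> t \<in> {-d..d} ==> \<phi> t y \<in> W"
  "!!y t. y \<in> ball y0 r ==> t \<in> {-d..d} ==>
   ((%s. \<phi> s y) has_vector_derivative f (\<phi> t y)) (at t within {-d..d})"
  "!!t. t \<in> {-d..d} ==> Ck_on 1 (ball y0 r) (\<phi> t)"
proof -
 let ?D = "%x. frechet_derivative f (at x)"
 obtain R where R: "R > 0" "cball y0 (2*R) \<subseteq> W"
 proof -
  obtain e where "e > 0" "cball y0 e \<subseteq> W" using W open_contains_cball by blast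
  then show ?thesis using that[of "e/2"] by auto
 qed
 define C where "C = cball y0 (2*R)"
 have C: "compact C" "convex C" "C ~= {}" "closed C" "C \<subseteq> W" using R by (auto simp: C_def)
 have f1: "Ck_on 1 W f" using Ck_on_mono[of 1 W f] f by (simp add: numeral_2_eq_2)
 have Df1: "Ck_on 1 W (%x. ?D x v)" for v using f by (simp add: numeral_2_eq_2)
 have lin: "linear (?D x)" if "x \<in> C" for x using f1 that C by (auto intro: linear_frechet_derivative)
 have hd: "(f has_derivative ?D x) (at x)" if "x \<in> C" for x using C1_has_derivative[OF f1] that C by blast
 obtain K0 where K0: "K0 \<ge> 0" "!!x y. x \<in> C ==> y \<in> C ==> norm (f x - f y) <= K0 * norm (x - y)"
  using C1_lipschitz[OF f1 C(1,2,5)] by blast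
 obtain K1 where K1: "K1 \<ge> 0" "!!x v. x \<in> C ==> norm (?D x v) <= K1 * norm v"
  using C1_bounded_derivative[OF f1 C(1,5)] by blast
 have "\<forall>b. \<exists>K\<ge>0. \<forall>x\<in>C. \<forall>y\<in>C. norm (?D x b - ?D y b) <= K * norm (x - y)"
  using C1_lipschitz[OF Df1 C(1,2,5)] by (metis (no_types, lifting))
 then obtain Kb where Kb: "!!b. Kb b \<ge> 0" "!!b x y. x \<in> C ==> y \<in> C ==> norm (?D x b - ?D y b) <= Kb b * norm (x - y)"
  by metis
 define K2 where "K2 = (\<Sum>b\<in>Basis. Kb b)"
 have K2: "K2 \<ge> 0" by (auto simp: K2_def sum_nonneg Kb)
 have K2': "norm (?D x v - ?D y v) <= K2 * norm (x - y) * norm v" if "x \<in> C" "y \<in> C" for x y v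
 proof -
  have "norm (?D x v - ?D y v) <= (\<Sum>b\<in>Basis. norm (?D x b - ?D y b)) * norm v"
   using linear_norm_le_Basis[of "%v. ?D x v - ?D y v" v] lin[OF that(1)] lin[OF that(2)] by (simp add: linear_compose_sub)
  also have "\<dots> <= (\<Sum>b\<in>Basis. Kb b * norm (x - y)) * norm v"
   using Kb(2)[OF that] by (intro mult_right_mono sum_mono) auto
  finally show ?thesis by (simp add: K2_def sum_distrib_right)
 qed
 have taylor: "norm (f b - f a - ?D a (b - a)) <= K2 * norm (b - a) ^ 2" if ab: "a \<in> C" "b \<in> C" for a b
 proof -
  have seg: "closed_segment a b \<subseteq> C" using C(2) ab by (simp add: closed_segment_subset)
  have "norm ((f b - ?D a b) - (f a - ?D a a)) <= K2 * norm (b - a) * norm (b - a)"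
  proof (rule differentiable_bound[where S = "closed_segment a b" and f' = "%x v. ?D x v - ?D a v"])
   fix x assume x: "x \<in> closed_segment a b"
   have "(?D a has_derivative ?D a) (at x within closed_segment a b)"
    using lin[OF ab(1)] by (simp add: linear_imp_has_derivative)
   then show "((%x. f x - ?D a x) has_derivative (%v. ?D x v - ?D a v)) (at x within closed_segment a b)"
    using hd[of x] seg x by (auto intro!: derivative_intros intro: has_derivative_at_withinI)
   have "norm (x - a) <= norm (b - a)" using x segment_bound(1) by (metis norm_minus_commute)
   then have "K2 * norm (x - a) * norm v <= K2 * norm (b - a) * norm v" for v
    using K2 by (intro mult_right_mono mult_left_mono) auto
   then show "onorm (%v. ?D x v - ?D a v) <= K2 * norm (b - a)"
    using K2'[of x a] seg x ab by (intro onorm_le) (blast intro: order_trans)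
  qed auto
  then show ?thesis using lin[OF ab(1)] by (simp add: linear_diff power2_eq_square algebra_simps)
 qed
 have "bounded (f ` C)" using C compact_continuous_image[of C f] continuous_on_subset[OF Ck_on_continuous[OF f1]]
  by (metis compact_imp_bounded)
 then obtain B where B: "B > 0" "!!x. x \<in> C ==> norm (f x) <= B" by (auto simp: bounded_pos)
 define K where "K = K0 + K1"
 have K: "K \<ge> 0" "K0 <= K" "K1 <= K" using K0 K1 by (auto simp: K_def)
 define d where "d = min (R / (B + 1)) (1 / (4 * (K + 1)))"
 have d: "d > 0" "d * B <= R" "d * K <= 1/4"
 proof -
  show "d > 0" using R B K by (auto simp: d_def)
  have "d <= R / (B + 1)" "d <= 1 / (4 * (K + 1))" by (simp_all add: d_def)
  moreover have BK: "B + 1 > 0" "4 * (K + 1) > 0" using B K by auto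
  ultimately have "d * (B + 1) <= R" "d * (4 * (K + 1)) <= 1"
   unfolding pos_le_divide_eq[OF BK(1)] pos_le_divide_eq[OF BK(2)] by simp_all
  then show "d * B <= R" "d * K <= 1/4" using \<open>d > 0\<close> by (auto simp: algebra_simps)
 qed
 \<comment> \<open>The field is made globally Lipschitz by composing it with the projection to the ball \<open>C\<close>.\<close>
 define F where "F x = f (closest_point C x)" for x
 have clC: "closest_point C x \<in> C" for x using C by (simp add: closest_point_in_set)
 have Flip: "norm (F x - F y) <= K0 * norm (x - y)" for x y
 proof -
  have "norm (F x - F y) <= K0 * norm (closest_point C x - closest_point C y)" unfolding F_def using K0 clC by blast
  also have "\<dots> <= K0 * norm (x - y)"
   using closest_point_lipschitz[OF C(2,4,3), of x y] K0 by (intro mult_left_mono) (auto simp: dist_norm)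
  finally show ?thesis .
 qed
 have Fcont: "continuous_on UNIV F"
  by (rule lipschitz_on_continuous_on[of K0]) (use Flip K0 in \<open>auto simp: lipschitz_on_def dist_norm\<close>)
 have "\<exists>u. u 0 = y & (\<forall>t\<in>{-d..d}. (u has_vector_derivative F (u t)) (at t within {-d..d}))" for y
 proof (rule picard_existence[of d "%t. F" K y])
  show "continuous_on ({- d..d} \<times> UNIV) (%p. F (snd p))"
   by (rule continuous_on_compose2[OF Fcont continuous_on_snd[OF continuous_on_id]]) auto
  show "norm (F x - F y) <= K * norm (x - y)" for x y using Flip[of x y] mult_right_mono[OF K(2), of "norm (x - y)"] by simp
 qed (use d K in auto)
 then have "\<forall>y. \<exists>u. u 0 = y & (\<forall>t\<in>{-d..d}. (u has_vector_derivative F (u t)) (at t within {-d..d}))"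
  by blast
 then obtain \<psi> where \<psi>: "\<forall>y. \<psi> y 0 = y & (\<forall>t\<in>{-d..d}. (\<psi> y has_vector_derivative F (\<psi> y t)) (at t within {-d..d}))"
  by (rule exE[OF choice])
 define \<phi> where "\<phi> t y = \<psi> y t" for t y
 have \<phi>: "!!y. \<phi> 0 y = y"
   "!!y t. t \<in> {-d..d} ==> ((%s. \<phi> s y) has_vector_derivative F (\<phi> t y)) (at t within {-d..d})"
  unfolding \<phi>_def using \<psi> by auto
 have stay: "\<phi> t y \<in> C" if y: "y \<in> ball y0 R" and t: "t \<in> {-d..d}" for y t
 proof -
  have "norm (\<phi> t y - \<phi> 0 y) <= B * norm (t - 0)"
  proof (rule differentiable_bound[where S = "{-d..d}" and f' = "%t x. x *\<^sub>R F (\<phi> t y)"])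
   show "((%t. \<phi> t y) has_derivative (%x. x *\<^sub>R F (\<phi> s y))) (at s within {-d..d})" if "s \<in> {-d..d}" for s
    using \<phi>(2)[OF that] by (simp add: has_vector_derivative_def)
   show "onorm (%x. x *\<^sub>R F (\<phi> s y)) <= B" for s using B(2)[OF clC[of "\<phi> s y"]]
    by (intro onorm_le) (simp add: F_def mult.commute[of B] mult_left_mono)
  qed (use d t in auto)
  also have "\<dots> <= B * d" using t B by (intro mult_left_mono) auto
  finally have "norm (\<phi> t y - y) <= R" using d \<phi>(1)[of y] by (simp add: mult.commute)
  then have "dist y0 (\<phi> t y) <= 2 * R"
   using y dist_triangle[of y0 "\<phi> t y" y] by (auto simp: dist_norm norm_minus_commute)
  then show ?thesis by (simp add: C_def)
 qed
 have Ff: "F x = f x" if "x \<in> C" for x using that by (simp add: F_def closest_point_self)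
 have sol: "((%s. \<phi> s y) has_vector_derivative f (\<phi> t y)) (at t within {-d..d})"
  if "y \<in> ball y0 R" "t \<in> {-d..d}" for y t using \<phi>(2)[OF that(2), of y] Ff[OF stay[OF that]] by simp
 have lipphi: "norm (\<phi> t y - \<phi> t z) <= 2 * norm (y - z)"
  if y: "y \<in> ball y0 R" and z: "z \<in> ball y0 R" and t: "t \<in> {-d..d}" for y z t
 proof -
  have "norm (\<phi> t y - \<phi> t z) <= 2 * (norm (\<phi> 0 y - \<phi> 0 z) + 2 * d * 0)"
  proof (rule short_time_gronwall[where a = "-d" and b = d and K = K0 and t = t and z = "%t. \<phi> t y - \<phi> t z"])
   show "((%t. \<phi> t y - \<phi> t z) has_vector_derivative f (\<phi> s y) - f (\<phi> s z)) (at s within {-d..d})"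
    if "s \<in> {-d..d}" for s by (intro has_vector_derivative_diff sol that y z)
   show "norm (f (\<phi> s y) - f (\<phi> s z)) <= K0 * norm (\<phi> s y - \<phi> s z) + 0"
    if "s \<in> {-d..d}" for s using K0(2)[OF stay[OF y that] stay[OF z that]] by simp
   show "2 * d * K0 <= 1/2" using d K mult_left_mono[OF K(2), of d] by linarith
  qed (use d K0 t in auto)
  then show ?thesis using \<phi>(1) by simp
 qed
 \<comment> \<open>The variational equation is solved among bounded operators.\<close>
 define A where "A x = Blinfun (?D x)" for x
 have A: "blinfun_apply (A x) = ?D x" if "x \<in> C" for x
  unfolding A_def by (rule bounded_linear_Blinfun_apply) (use lin[OF that] linear_conv_bounded_linear in blast)
 have Anorm: "norm (A x) <= K1" if "x \<in> C" for x by (rule norm_blinfun_bound) (use K1 A[OF that] that in auto)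
 have Alip: "norm (A x - A y) <= K2 * norm (x - y)" if "x \<in> C" "y \<in> C" for x y
  by (rule norm_blinfun_bound) (use K2 K2'[OF that] A that in \<open>auto simp: blinfun.diff_left\<close>)
 have Acont: "continuous_on C A"
  by (rule lipschitz_on_continuous_on[of K2]) (use Alip K2 in \<open>auto simp: lipschitz_on_def dist_norm\<close>)
 have "\<exists>V. V 0 = id_blinfun & (\<forall>t\<in>{-d..d}. (V has_vector_derivative A (\<phi> t y) o\<^sub>L V t) (at t within {-d..d}))"
  if y: "y \<in> ball y0 R" for y
 proof (rule picard_existence[of d "%t. (o\<^sub>L) (A (\<phi> t y))" K "id_blinfun"])
  have "continuous_on {-d..d} (%t. \<phi> t y)" using sol[OF y] by (rule has_vector_derivative_continuous_on)
  then have "continuous_on {-d..d} (%t. A (\<phi> t y))"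
   using continuous_on_compose2[OF Acont, of "{-d..d}"] stay[OF y] by blast
  then have "continuous_on ({-d..d} \<times> (UNIV :: ('a \<Rightarrow>\<^sub>L 'a) set)) (%p. A (\<phi> (fst p) y))"
   by (rule continuous_on_compose2[OF _ continuous_on_fst[OF continuous_on_id]]) auto
  then show "continuous_on ({-d..d} \<times> (UNIV :: ('a \<Rightarrow>\<^sub>L 'a) set)) (%p. A (\<phi> (fst p) y) o\<^sub>L snd p)"
   by (rule bounded_bilinear.continuous_on[OF bounded_bilinear_blinfun_compose])
    (intro continuous_intros)
  show "norm ((A (\<phi> t y) o\<^sub>L U) - (A (\<phi> t y) o\<^sub>L V)) <= K * norm (U - V)" if t: "t \<in> {-d..d}" for t U V
  proof -
   have "(A (\<phi> t y) o\<^sub>L U) - (A (\<phi> t y) o\<^sub>L V) = A (\<phi> t y) o\<^sub>L (U - V)"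
    by (simp add: bounded_bilinear.diff_right[OF bounded_bilinear_blinfun_compose])
   then have "norm ((A (\<phi> t y) o\<^sub>L U) - (A (\<phi> t y) o\<^sub>L V)) <= norm (A (\<phi> t y)) * norm (U - V)"
    using norm_blinfun_compose by metis
   also have "\<dots> <= K * norm (U - V)" using Anorm[OF stay[OF y t]] K by (intro mult_right_mono) auto
   finally show ?thesis .
  qed
 qed (use d K in auto)
 then have "\<forall>y\<in>ball y0 R. \<exists>V. V 0 = id_blinfun & (\<forall>t\<in>{-d..d}. (V has_vector_derivative A (\<phi> t y) o\<^sub>L V t) (at t within {-d..d}))"
  by blast
 then obtain V where "\<forall>y\<in>ball y0 R. V y 0 = id_blinfun & (\<forall>t\<in>{-d..d}. (V y has_vector_derivative A (\<phi> t y) o\<^sub>L V y t) (at t within {-d..d}))"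
  by (rule exE[OF bchoice])
 then have V: "!!y. y \<in> ball y0 R ==> V y 0 = id_blinfun"
  "!!y t. y \<in> ball y0 R ==> t \<in> {-d..d} ==> (V y has_vector_derivative A (\<phi> t y) o\<^sub>L V y t) (at t within {-d..d})"
  by blast+
 have Vv: "((%t. V y t v) has_vector_derivative ?D (\<phi> t y) (V y t v)) (at t within {-d..d})"
  if y: "y \<in> ball y0 R" and t: "t \<in> {-d..d}" for y t v
 proof -
  have "((%t. blinfun_apply (V y t) v) has_vector_derivative blinfun_apply (A (\<phi> t y) o\<^sub>L V y t) v) (at t within {-d..d})"
   by (rule bounded_linear.has_vector_derivative[OF blinfun.bounded_linear_left V(2)[OF y t]])
  then show ?thesis using A[OF stay[OF y t]] by simp
 qed
 have Vbd: "norm (V y t v) <= 2 * norm v" if y: "y \<in> ball y0 R" and t: "t \<in> {-d..d}" for y t v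
 proof -
  have "norm (V y t v) <= 2 * (norm (V y 0 v) + 2 * d * 0)"
  proof (rule short_time_gronwall[where a = "-d" and b = d and K = K1 and t = t and z = "%t. V y t v"])
   show "2 * d * K1 <= 1/2" using d K mult_left_mono[OF K(3), of d] by linarith
   show "norm (?D (\<phi> s y) (V y s v)) <= K1 * norm (V y s v) + 0" if "s \<in> {-d..d}" for s
    using K1(2)[OF stay[OF y that]] by simp
  qed (use Vv[OF y] d K1 t in auto)
  then show ?thesis using V(1)[OF y] by simp
 qed
 have deriv: "(\<phi> t has_derivative V y t) (at y)" if y: "y \<in> ball y0 R" and t: "t \<in> {-d..d}" for y t
 proof -
  define c where "c = 16 * d * K2"
  have c: "c \<ge> 0" using d K2 by (auto simp: c_def)
  have quad: "norm (\<phi> t z - \<phi> t y - V y t (z - y)) <= c * norm (z - y) ^ 2" if z: "z \<in> ball y0 R" for z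
  proof -
   have "norm (\<phi> t z - \<phi> t y - V y t (z - y)) <= 2 * (norm (\<phi> 0 z - \<phi> 0 y - V y 0 (z - y)) + 2 * d * (K2 * (2 * norm (z - y))\<^sup>2))"
   proof (rule short_time_gronwall[where a = "-d" and b = d and K = K1 and t = t
      and z = "%t. \<phi> t z - \<phi> t y - V y t (z - y)"])
    fix s assume s: "s \<in> {-d..d}"
    show "((%t. \<phi> t z - \<phi> t y - V y t (z - y)) has_vector_derivative
      f (\<phi> s z) - f (\<phi> s y) - ?D (\<phi> s y) (V y s (z - y))) (at s within {-d..d})"
     by (intro has_vector_derivative_diff sol Vv s y z)
    let ?e = "\<phi> s z - \<phi> s y - V y s (z - y)"
    have "f (\<phi> s z) - f (\<phi> s y) - ?D (\<phi> s y) (V y s (z - y))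
     = ?D (\<phi> s y) ?e + (f (\<phi> s z) - f (\<phi> s y) - ?D (\<phi> s y) (\<phi> s z - \<phi> s y))"
     using lin[OF stay[OF y s]] by (simp add: linear_diff)
    moreover have "norm (?D (\<phi> s y) ?e) <= K1 * norm ?e" using K1(2)[OF stay[OF y s]] .
    moreover have "norm (f (\<phi> s z) - f (\<phi> s y) - ?D (\<phi> s y) (\<phi> s z - \<phi> s y)) <= K2 * (2 * norm (z - y))\<^sup>2"
    proof -
     have "K2 * (norm (\<phi> s z - \<phi> s y))\<^sup>2 <= K2 * (2 * norm (z - y))\<^sup>2"
      using lipphi[OF z y s] K2 by (intro mult_left_mono power_mono) auto
     then show ?thesis using taylor[OF stay[OF y s] stay[OF z s]] by linarith
    qed
    ultimately show "norm (f (\<phi> s z) - f (\<phi> s y) - ?D (\<phi> s y) (V y s (z - y))) <= K1 * norm ?e + K2 * (2 * norm (z - y))\<^sup>2"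
     using norm_add_le by metis
   next
    show "2 * d * K1 <= 1/2" using d K mult_left_mono[OF K(3), of d] by linarith
   qed (use d K1 K2 t in auto)
   also have "\<dots> = c * norm (z - y) ^ 2" using V(1)[OF y] \<phi>(1) by (simp add: c_def power_mult_distrib)
   finally show ?thesis .
  qed
  show ?thesis unfolding has_derivative_at_alt
  proof (intro conjI allI impI)
   show "bounded_linear (blinfun_apply (V y t))" by (rule blinfun.bounded_linear_right)
   fix e :: real assume e: "e > 0"
   obtain r where r: "r > 0" "ball y r \<subseteq> ball y0 R" using y open_ball open_contains_ball by blast
   define s where "s = min r (e / (c + 1))"
   have "norm (\<phi> t z - \<phi> t y - V y t (z - y)) <= e * norm (z - y)" if z: "norm (z - y) < s" for z
   proof -
    have "z \<in> ball y0 R" using r z by (auto simp: s_def dist_norm norm_minus_commute subset_iff)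
    then have "norm (\<phi> t z - \<phi> t y - V y t (z - y)) <= c * norm (z - y) * norm (z - y)"
     using quad[of z] by (simp add: power2_eq_square mult.assoc)
    also have "\<dots> <= e * norm (z - y)"
    proof (rule mult_right_mono)
     have "norm (z - y) <= e / (c + 1)" using z by (simp add: s_def)
     then have "norm (z - y) * (c + 1) <= e" using c by (simp add: field_simps)
     then show "c * norm (z - y) <= e" using norm_ge_zero[of "z - y"] by (simp add: algebra_simps del: norm_ge_zero)
    qed simp
    finally show ?thesis .
   qed
   moreover have "s > 0" using r e c by (auto simp: s_def)
   ultimately show "\<exists>d>0. \<forall>z. norm (z - y) < d --> norm (\<phi> t z - \<phi> t y - V y t (z - y)) <= e * norm (z - y)" by blast
  qed
 qed
 have Vcont: "continuous_on (ball y0 R) (%y. V y t v)" if t: "t \<in> {-d..d}" for t v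
 proof (rule lipschitz_on_continuous_on[of "4 * d * (4 * K2 * norm v)"])
  have "norm (V y t v - V z t v) <= 2 * (norm (V y 0 v - V z 0 v) + 2 * d * (K2 * (2 * norm (y - z)) * (2 * norm v)))"
   if y: "y \<in> ball y0 R" and z: "z \<in> ball y0 R" for y z
  proof (rule short_time_gronwall[where a = "-d" and b = d and K = K1 and t = t and z = "%t. V y t v - V z t v"])
   fix s assume s: "s \<in> {-d..d}"
   show "((%t. V y t v - V z t v) has_vector_derivative ?D (\<phi> s y) (V y s v) - ?D (\<phi> s z) (V z s v)) (at s within {-d..d})"
    by (intro has_vector_derivative_diff Vv y z s)
   have "?D (\<phi> s y) (V y s v) - ?D (\<phi> s z) (V z s v)
     = ?D (\<phi> s y) (V y s v - V z s v) + (?D (\<phi> s y) (V z s v) - ?D (\<phi> s z) (V z s v))"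
    using lin[OF stay[OF y s]] by (simp add: linear_diff)
   moreover have "norm (?D (\<phi> s y) (V z s v) - ?D (\<phi> s z) (V z s v)) <= K2 * (2 * norm (y - z)) * (2 * norm v)"
   proof -
    have "norm (?D (\<phi> s y) (V z s v) - ?D (\<phi> s z) (V z s v)) <= K2 * norm (\<phi> s y - \<phi> s z) * norm (V z s v)"
     by (rule K2'[OF stay[OF y s] stay[OF z s]])
    also have "\<dots> <= K2 * (2 * norm (y - z)) * (2 * norm v)"
     using lipphi[OF y z s] Vbd[OF z s] K2 by (intro mult_mono) auto
    finally show ?thesis .
   qed
   ultimately show "norm (?D (\<phi> s y) (V y s v) - ?D (\<phi> s z) (V z s v)) <= K1 * norm (V y s v - V z s v) + K2 * (2 * norm (y - z)) * (2 * norm v)"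
    using K1(2)[OF stay[OF y s], of "V y s v - V z s v"] norm_add_le by metis
  next
   show "2 * d * K1 <= 1/2" using d K mult_left_mono[OF K(3), of d] by linarith
  qed (use d K1 K2 t in auto)
  then show "(4 * d * (4 * K2 * norm v))-lipschitz_on (ball y0 R) (%y. V y t v)"
   using V(1) d K2 by (auto simp: lipschitz_on_def dist_norm algebra_simps)
 qed
 show ?thesis
 proof (rule that[of d R \<phi>])
  show "Ck_on 1 (ball y0 R) (\<phi> t)" if "t \<in> {-d..d}" for t
   using deriv Vcont that by (intro Ck_on_1I[where f' = "%y. V y t"]) auto
  show "\<phi> t y \<in> W" if "y \<in> ball y0 R" "t \<in> {-d..d}" for t y using stay[OF that] C(5) by blast
 qed (use d R \<phi> sol in auto)
qed

lemma Ck_on_2_imp_1: "Ck_on 2 S f ==> Ck_on 1 S f" using Ck_on_mono[of 1 S f] unfolding numeral_2_eq_2 One_nat_def .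

section \<open>Charts\<close>

lemma is_chartD:
 assumes "is_chart M c"
 shows "openin M (fst c)" "open (snd c ` fst c)" "fst c \<subseteq> topspace M"
  "continuous_map (subtopology M (fst c)) euclidean (snd c)" "inj_on (snd c) (fst c)"
  "open_map (subtopology M (fst c)) (top_of_set (snd c ` fst c)) (snd c)"
proof -
 have 1: "openin M (fst c)" "open (snd c ` fst c)"
  "homeomorphic_map (subtopology M (fst c)) (top_of_set (snd c ` fst c)) (snd c)"
  using assms by (auto simp: is_chart_def)
 then show "openin M (fst c)" "open (snd c ` fst c)" by auto
 show sub: "fst c \<subseteq> topspace M" using 1(1) openin_subset by blast
 show "continuous_map (subtopology M (fst c)) euclidean (snd c)"
  using homeomorphic_imp_continuous_map[OF 1(3)] continuous_map_in_subtopology by blast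
 show "inj_on (snd c) (fst c)" using homeomorphic_imp_injective_map[OF 1(3)] sub by (simp add: Int_absorb1)
 show "open_map (subtopology M (fst c)) (top_of_set (snd c ` fst c)) (snd c)" using 1(3) by (rule homeomorphic_imp_open_map)
qed

lemma chart_inv_left [simp]: "is_chart M c ==> x \<in> fst c ==> chart_inv c (snd c x) = x"
 unfolding chart_inv_def by (intro inv_into_f_f is_chartD)

lemma chart_inv_right:
 "y \<in> snd c ` fst c ==> snd c (chart_inv c y) = y" "y \<in> snd c ` fst c ==> chart_inv c y \<in> fst c"
 unfolding chart_inv_def by (auto intro: f_inv_into_f inv_into_into)

lemma chart_image_open:
 assumes c: "is_chart M c" and V: "openin M V" "V \<subseteq> fst c"
 shows "open (snd c ` V)"
proof -
 have "openin (subtopology M (fst c)) V" using V by (meson openin_subset_topspace_eq openin_subtopology_alt subset_openin_subtopology)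
 then have "openin (top_of_set (snd c ` fst c)) (snd c ` V)" using is_chartD(6)[OF c] by (auto simp: open_map_def)
 then show ?thesis using is_chartD(2)[OF c] openin_open_eq by blast
qed

lemma chart_preimage_open:
 assumes V: "openin M V" and f: "continuous_map (subtopology M V) euclidean f" and W: "open W"
 shows "openin M {x \<in> V. f x \<in> W}"
proof -
 have "openin (subtopology M V) {x \<in> topspace (subtopology M V). f x \<in> W}"
  by (rule openin_continuous_map_preimage[OF f]) (use W in simp)
 moreover have "{x \<in> topspace (subtopology M V). f x \<in> W} = {x \<in> V. f x \<in> W}"
  using openin_subset[OF V] by auto
 ultimately show ?thesis using V openin_trans_full by metis
qed

lemma chart_inv_continuous:
 assumes c: "is_chart M c"
 shows "continuous_map (top_of_set (snd c ` fst c)) M (chart_inv c)" unfolding continuous_map_def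
proof (intro conjI allI impI)
 show "chart_inv c \<in> topspace (top_of_set (snd c ` fst c)) \<rightarrow> topspace M"
  using chart_inv_right(2)[of _ c] is_chartD(3)[OF c] by (intro Pi_I) auto
 fix U assume U: "openin M U"
 have "{x \<in> topspace (top_of_set (snd c ` fst c)). chart_inv c x \<in> U} = snd c ` (U \<inter> fst c)"
  using c chart_inv_right[of _ c] by (auto simp: image_iff)
 moreover have "open (snd c ` (U \<inter> fst c))" using U is_chartD(1)[OF c] by (intro chart_image_open[OF c]) auto
 ultimately show "openin (top_of_set (snd c ` fst c)) {x \<in> topspace (top_of_set (snd c ` fst c)). chart_inv c x \<in> U}"
  by (auto simp: image_mono intro!: open_openin_trans is_chartD(2)[OF c])
qed

text \<open>Invariance of domain, on a space with an atlas: a continuous injection into \<open>real^3\<close> is a chart.\<close>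

lemma injective_continuous_open_image:
 fixes f :: "'a => real^3"
 assumes charts: "!!x. x \<in> V ==> \<exists>c. is_chart M c & x \<in> fst c"
  and V: "openin M V" and f: "continuous_map (subtopology M V) euclidean f" "inj_on f V"
 shows "open (f ` V)" unfolding open_subopen[of "f ` V"]
proof
 fix y assume "y \<in> f ` V"
 then obtain x where x: "x \<in> V" "y = f x" by blast
 obtain c where c: "is_chart M c" "x \<in> fst c" using charts x by blast
 let ?W = "snd c ` (V \<inter> fst c)"
 have W: "open ?W" using V is_chartD(1)[OF c(1)] by (intro chart_image_open[OF c(1)]) auto
 have inv: "chart_inv c w \<in> V \<inter> fst c" if "w \<in> ?W" for w using that c(1) by auto
 have "continuous_map (top_of_set ?W) (subtopology M V) (chart_inv c)"
 proof (rule continuous_map_into_subtopology)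
  show "continuous_map (top_of_set ?W) M (chart_inv c)"
   by (rule continuous_map_from_subtopology_mono[OF chart_inv_continuous[OF c(1)]]) auto
 qed (use inv in auto)
 from continuous_map_compose[OF this f(1)] have "continuous_on ?W (f \<circ> chart_inv c)"
  by simp
 note cont = this
 have inj: "inj_on (f \<circ> chart_inv c) ?W"
 proof (rule inj_onI)
  fix a b assume ab: "a \<in> ?W" "b \<in> ?W" "(f \<circ> chart_inv c) a = (f \<circ> chart_inv c) b"
  have "f (chart_inv c a) = f (chart_inv c b)" using ab(3) by simp
  then have eq: "chart_inv c a = chart_inv c b" by (rule inj_onD[OF f(2)]) (use inv[OF ab(1)] inv[OF ab(2)] in simp_all)
  have "snd c (chart_inv c a) = a" "snd c (chart_inv c b) = b" using ab(1,2) chart_inv_right(1)[of _ c] by blast+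
  then show "a = b" using eq by metis
 qed
 have "open ((f \<circ> chart_inv c) ` ?W)" by (rule invariance_of_domain[OF cont W inj])
 moreover have "y \<in> (f \<circ> chart_inv c) ` ?W" by (rule image_eqI[of _ _ "snd c x"]) (use x c in simp_all)
 moreover have "(f \<circ> chart_inv c) ` ?W \<subseteq> f ` V"
 proof
  fix z assume "z \<in> (f \<circ> chart_inv c) ` ?W"
  then obtain w where "w \<in> ?W" "z = f (chart_inv c w)" by auto
  then show "z \<in> f ` V" using inv[of w] by blast
 qed
 ultimately show "\<exists>T. open T & y \<in> T & T \<subseteq> f ` V" by blast
qed

lemma is_chart_invariance:
 fixes f :: "'a => real^3"
 assumes charts: "!!x. x \<in> V ==> \<exists>c. is_chart M c & x \<in> fst c"
  and V: "openin M V" and f: "continuous_map (subtopology M V) euclidean f" "inj_on f V"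
 shows "is_chart M (V, f)"
proof -
 have VM: "V \<subseteq> topspace M" using V openin_subset by blast
 have op: "open (f ` W)" if W: "openin M W" "W \<subseteq> V" for W using W charts f
  by (intro injective_continuous_open_image[of W M])
   (auto intro: inj_on_subset continuous_map_from_subtopology_mono)
 have "homeomorphic_map (subtopology M V) (top_of_set (f ` V)) f"
 proof (rule bijective_open_imp_homeomorphic_map)
  show "continuous_map (subtopology M V) (top_of_set (f ` V)) f" using f(1) by (auto simp: continuous_map_in_subtopology)
  show "open_map (subtopology M V) (top_of_set (f ` V)) f" unfolding open_map_def
  proof (intro allI impI)
   fix W assume "openin (subtopology M V) W"
   then have "openin M W" "W \<subseteq> V" using V by (auto simp: openin_open_subtopology)
   then show "openin (top_of_set (f ` V)) (f ` W)" using op by (metis image_mono open_subset)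
  qed
  show "f ` topspace (subtopology M V) = topspace (top_of_set (f ` V))" using VM by (simp add: Int_absorb1)
  show "inj_on f (topspace (subtopology M V))" using f(2) by (auto intro: inj_on_subset)
 qed
 then show ?thesis using V op[OF V] by (simp add: is_chart_def)
qed

lemma Ck_on_1_local:
 assumes "!!x. x \<in> S ==> \<exists>T. open T & x \<in> T & Ck_on 1 T f"
 shows "Ck_on 1 S f"
proof (rule Ck_on_1I)
 fix x assume "x \<in> S"
 from assms[OF this] obtain T where T: "x \<in> T" "Ck_on 1 T f" by (elim exE conjE)
 show "(f has_derivative frechet_derivative f (at x)) (at x)" by (rule C1_has_derivative[OF T(2,1)])
next
 fix v
 have "continuous (at x within S) (%x. frechet_derivative f (at x) v)" if "x \<in> S" for x
 proof -
  from assms[OF that] obtain T where T: "open T" "x \<in> T" "Ck_on 1 T f" by (elim exE conjE)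
  have "continuous (at x) (%x. frechet_derivative f (at x) v)"
   using Ck_on_1_cont[OF T(3), of v] T(2) unfolding continuous_on_eq_continuous_at[OF T(1)] by (rule bspec)
  then show ?thesis by (rule continuous_at_imp_continuous_at_within)
 qed
 then show "continuous_on S (%x. frechet_derivative f (at x) v)" by (simp add: continuous_on_eq_continuous_within)
qed

section \<open>A manifold with a vector field\<close>

locale vector_field_manifold =
 fixes M :: "'a topology" and A :: "'a chart set" and X :: "'a vfield"
 assumes manifold: "smooth_3manifold M A" and field: "smooth_vector_field A X"
begin

abbreviation "C1chart \<equiv> C1_coordinates M A"

lemma atlas_chart: "c \<in> A ==> is_chart M c" using manifold by (auto simp: smooth_3manifold_def)

lemma Hausdorff: "Hausdorff_space M" using manifold by (auto simp: smooth_3manifold_def)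

lemma atlas_covers: "x \<in> topspace M ==> \<exists>c\<in>A. x \<in> fst c"
 using manifold by (auto simp: smooth_3manifold_def)

lemma ex_chart: "x \<in> topspace M ==> \<exists>c. is_chart M c & x \<in> fst c" using atlas_covers atlas_chart by blast

lemma atlas_C1chart: assumes c: "c \<in> A" shows "C1chart c" unfolding C1_coordinates_def
proof (intro conjI ballI)
 show "is_chart M c" by (rule atlas_chart[OF c])
 have sm: "\<forall>c\<in>A. \<forall>d\<in>A. smooth_on (snd c ` (fst c \<inter> fst d)) (transition c d)"
  using manifold unfolding smooth_3manifold_def by (elim conjE)
 fix b assume b: "b \<in> A"
 show "Ck_on 1 (snd b ` (fst b \<inter> fst c)) (transition b c)"
  using sm[rule_format, OF b c] unfolding smooth_on_def by (rule spec)
 show "Ck_on 1 (snd c ` (fst b \<inter> fst c)) (transition c b)"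
  using sm[rule_format, OF c b] unfolding smooth_on_def Int_commute[of "fst b"] by (rule spec)
qed

lemma C1chart_is_chart: "C1chart d ==> is_chart M d" by (simp add: C1_coordinates_def)


lemma transition_apply:
 assumes "is_chart M c" "x \<in> fst c" shows "transition c d (snd c x) = snd d x"
 using assms by (simp add: transition_def)

lemma chart_overlap_open:
 assumes "is_chart M c" "is_chart M d"
 shows "open (snd c ` (fst c \<inter> fst d))" using assms by (intro chart_image_open) (auto intro: is_chartD)

text \<open>Transitions between any two C1 charts are C1, by passing through the atlas.\<close>

lemma C1chart_transition:
 assumes d: "C1chart d" and e: "C1chart e"
 shows "Ck_on 1 (snd d ` (fst d \<inter> fst e)) (transition d e)"
proof (rule Ck_on_1_local)
 fix y assume "y \<in> snd d ` (fst d \<inter> fst e)"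
 then obtain x where x: "x \<in> fst d" "x \<in> fst e" "y = snd d x" by blast
 note dc = C1chart_is_chart[OF d] and ec = C1chart_is_chart[OF e]
 obtain c where c: "c \<in> A" "x \<in> fst c" using atlas_covers x(1) is_chartD(3)[OF dc] by blast
 note cc = atlas_chart[OF c(1)]
 let ?V = "fst c \<inter> fst d \<inter> fst e"
 let ?T = "snd d ` ?V"
 have V: "openin M ?V" using is_chartD(1)[OF cc] is_chartD(1)[OF dc] is_chartD(1)[OF ec] by auto
 have T: "open ?T" by (rule chart_image_open[OF dc V]) auto
 have "Ck_on 1 ?T (transition c e \<circ> transition d c)"
 proof (rule C1_compose)
  show "Ck_on 1 ?T (transition d c)"
   by (rule Ck_on_subset[of 1 "snd d ` (fst c \<inter> fst d)"]) (use d c in \<open>auto simp: C1_coordinates_def\<close>)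
  show "Ck_on 1 (snd c ` (fst c \<inter> fst e)) (transition c e)" using e c by (auto simp: C1_coordinates_def)
  show "open (snd c ` (fst c \<inter> fst e))" by (rule chart_overlap_open[OF cc ec])
  show "transition d c ` ?T \<subseteq> snd c ` (fst c \<inter> fst e)"
  proof clarify
   fix z assume "z \<in> fst c" "z \<in> fst d" "z \<in> fst e"
   then show "transition d c (snd d z) \<in> snd c ` (fst c \<inter> fst e)" by (subst transition_apply[OF dc]) auto
  qed
 qed
 then have "Ck_on 1 ?T (transition d e)"
 proof (rule Ck_on_1_cong[OF _ T])
  fix z assume "z \<in> ?T"
  then show "(transition c e \<circ> transition d c) z = transition d e z" using dc cc by (auto simp: transition_def)
 qed
 moreover have "y \<in> ?T" using x c by auto
 ultimately show "\<exists>T. open T & y \<in> T & Ck_on 1 T (transition d e)" using T by blast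
qed

abbreviation "dtrans c d x \<equiv> frechet_derivative (transition c d) (at (snd c x))"

lemma dtrans_has_derivative:
 assumes "C1chart d" "C1chart e" "x \<in> fst d" "x \<in> fst e"
 shows "(transition d e has_derivative dtrans d e x) (at (snd d x))"
 using C1_has_derivative[OF C1chart_transition[OF assms(1,2)]] assms(3,4) by auto

lemma dtrans_linear:
 assumes "C1chart d" "C1chart e" "x \<in> fst d" "x \<in> fst e"
 shows "linear (dtrans d e x)" using dtrans_has_derivative[OF assms] has_derivative_linear by blast

lemma dtrans_chain:
 assumes c: "C1chart c" "x \<in> fst c" and d: "C1chart d" "x \<in> fst d" and e: "C1chart e" "x \<in> fst e"
 shows "dtrans d e x (dtrans c d x v) = dtrans c e x v"
proof -
 note cc = C1chart_is_chart[OF c(1)] and dc = C1chart_is_chart[OF d(1)] and ec = C1chart_is_chart[OF e(1)]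
 let ?V = "fst c \<inter> fst d \<inter> fst e"
 have V: "openin M ?V" using is_chartD(1)[OF cc] is_chartD(1)[OF dc] is_chartD(1)[OF ec] by auto
 have T: "open (snd c ` ?V)" by (rule chart_image_open[OF cc V]) auto
 have "(transition d e has_derivative dtrans d e x) (at (transition c d (snd c x)))"
  using dtrans_has_derivative[OF d(1) e(1) d(2) e(2)] transition_apply[OF cc c(2)] by simp
 then have "((transition d e \<circ> transition c d) has_derivative dtrans d e x \<circ> dtrans c d x) (at (snd c x))"
  by (rule diff_chain_at[OF dtrans_has_derivative[OF c(1) d(1) c(2) d(2)]])
 then have "(transition c e has_derivative dtrans d e x \<circ> dtrans c d x) (at (snd c x))"
  by (rule has_derivative_transform_within_open[OF _ T])
   (use c d e cc dc in \<open>auto simp: transition_def\<close>)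
 then have "dtrans c e x = dtrans d e x \<circ> dtrans c d x" using frechet_derivative_at by metis
 then show ?thesis by simp
qed

lemma dtrans_self:
 assumes c: "C1chart c" "x \<in> fst c"
 shows "dtrans c c x v = v"
proof -
 note cc = C1chart_is_chart[OF c(1)]
 have "(transition c c has_derivative (%v. v)) (at (snd c x))"
  by (rule has_derivative_transform_within_open[OF has_derivative_ident is_chartD(2)[OF cc]])
   (use c cc in \<open>auto simp: transition_def\<close>)
 then show ?thesis using frechet_derivative_at by metis
qed

lemma dtrans_inverse:
 assumes "C1chart c" "x \<in> fst c" "C1chart d" "x \<in> fst d"
 shows "dtrans d c x (dtrans c d x v) = v" using dtrans_chain[OF assms assms(1,2)] dtrans_self[OF assms(1,2)] by simp

text \<open>A family of charts patches together to a chart as soon as the common coordinate map is injective.\<close>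

lemma C1chart_local:
 assumes V: "openin M V" and inj: "inj_on f V"
  and loc: "!!x. x \<in> V ==> \<exists>e. C1chart e & x \<in> fst e & fst e \<subseteq> V & (\<forall>z\<in>fst e. f z = snd e z)"
 shows "C1chart (V, f)"
proof -
 have VM: "V \<subseteq> topspace M" using V openin_subset by blast
 have "continuous_map (subtopology M V) euclidean f" unfolding continuous_map_def
 proof (intro conjI allI impI)
  fix U :: "(real^3) set" assume U: "openin euclidean U"
  have "openin M {x \<in> V. f x \<in> U}" unfolding openin_subopen[of M "{x \<in> V. f x \<in> U}"]
  proof
   fix x assume x: "x \<in> {x \<in> V. f x \<in> U}"
   then obtain e where e: "C1chart e" "x \<in> fst e" "fst e \<subseteq> V" "\<forall>z\<in>fst e. f z = snd e z"
    using loc by blast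
   let ?O = "{z \<in> fst e. snd e z \<in> U}"
   have "openin M ?O" using U is_chartD[OF C1chart_is_chart[OF e(1)]] by (intro chart_preimage_open) auto
   then show "\<exists>T. openin M T & x \<in> T & T \<subseteq> {x \<in> V. f x \<in> U}"
    using x e by (intro exI[of _ ?O]) auto
  qed
  then show "openin (subtopology M V) {x \<in> topspace (subtopology M V). f x \<in> U}"
   using VM V by (auto simp: openin_open_subtopology Int_absorb1 intro: openin_subset)
 qed auto
 then have ch: "is_chart M (V, f)" using V inj ex_chart VM by (intro is_chart_invariance) auto
 show ?thesis unfolding C1_coordinates_def
 proof (intro conjI ballI ch)
  fix c assume c: "c \<in> A"
  note cc = atlas_chart[OF c] and c1 = atlas_C1chart[OF c]
  show "Ck_on 1 (snd c ` (fst c \<inter> fst (V, f))) (transition c (V, f))"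
  proof (rule Ck_on_1_local)
   fix y assume "y \<in> snd c ` (fst c \<inter> fst (V, f))"
   then obtain x where x: "x \<in> V" "x \<in> fst c" "y = snd c x" by auto
   obtain e where e: "C1chart e" "x \<in> fst e" "fst e \<subseteq> V" "\<forall>z\<in>fst e. f z = snd e z"
    using loc[OF x(1)] by blast
   let ?T = "snd c ` (fst c \<inter> fst e)"
   have T: "open ?T" by (rule chart_overlap_open[OF cc C1chart_is_chart[OF e(1)]])
   have "Ck_on 1 ?T (transition c (V, f))" by (rule Ck_on_1_cong[OF C1chart_transition[OF c1 e(1)] T])
     (use e cc in \<open>auto simp: transition_def\<close>)
   then show "\<exists>T. open T & y \<in> T & Ck_on 1 T (transition c (V, f))" using T x e by blast
  qed
  show "Ck_on 1 (snd (V, f) ` (fst c \<inter> fst (V, f))) (transition (V, f) c)"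
  proof (rule Ck_on_1_local)
   fix y assume "y \<in> snd (V, f) ` (fst c \<inter> fst (V, f))"
   then obtain x where x: "x \<in> V" "x \<in> fst c" "y = f x" by auto
   obtain e where e: "C1chart e" "x \<in> fst e" "fst e \<subseteq> V" "\<forall>z\<in>fst e. f z = snd e z"
    using loc[OF x(1)] by blast
   note ec = C1chart_is_chart[OF e(1)]
   let ?T = "snd e ` (fst e \<inter> fst c)"
   have T: "open ?T" by (rule chart_overlap_open[OF ec cc])
   have "chart_inv (V, f) (snd e z) = z" if "z \<in> fst e" for z using chart_inv_left[OF ch, of z] e that by auto
   then have "Ck_on 1 ?T (transition (V, f) c)" by (intro Ck_on_1_cong[OF C1chart_transition[OF e(1) c1] T])
     (use ec in \<open>auto simp: transition_def\<close>)
   moreover have "y \<in> ?T" using x e by auto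
   ultimately show "\<exists>T. open T & y \<in> T & Ck_on 1 T (transition (V, f) c)" using T by blast
  qed
 qed
qed

lemma C1chart_restrict:
 assumes e: "C1chart e" and V: "openin M V" "V \<subseteq> fst e"
 shows "C1chart (V, snd e)"
proof -
 note ec = C1chart_is_chart[OF e]
 have ch: "is_chart M (V, snd e)" using V is_chartD[OF ec] ex_chart
  by (intro is_chart_invariance) (auto intro: inj_on_subset continuous_map_from_subtopology_mono)
 have inv: "chart_inv (V, snd e) (snd e z) = chart_inv e (snd e z)" if "z \<in> V" for z
  using chart_inv_left[OF ch, of z] chart_inv_left[OF ec, of z] V that by auto
 show ?thesis unfolding C1_coordinates_def
 proof (intro conjI ballI ch)
  fix c assume c: "c \<in> A"
  note cc = atlas_chart[OF c] and c1 = atlas_C1chart[OF c]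
  have "transition c (V, snd e) = transition c e" by (simp add: transition_def)
  then show "Ck_on 1 (snd c ` (fst c \<inter> fst (V, snd e))) (transition c (V, snd e))"
   using V Ck_on_subset[OF C1chart_transition[OF c1 e], of "snd c ` (fst c \<inter> V)"] by auto
  have "Ck_on 1 (snd e ` (fst c \<inter> V)) (transition e c)"
   by (rule Ck_on_subset[OF C1chart_transition[OF e c1]]) (use V in auto)
  moreover have "open (snd e ` (fst c \<inter> V))" using V is_chartD(1)[OF cc] by (intro chart_image_open[OF ec]) auto
  ultimately have "Ck_on 1 (snd e ` (fst c \<inter> V)) (transition (V, snd e) c)"
   by (rule Ck_on_1_cong) (use inv in \<open>auto simp: transition_def\<close>)
  then show "Ck_on 1 (snd (V, snd e) ` (fst c \<inter> fst (V, snd e))) (transition (V, snd e) c)" by simp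
 qed
qed

section \<open>Integral curves in charts\<close>

abbreviation "icurve I \<gamma> \<equiv> integral_curve M A X (topspace M) I \<gamma>"

lemma icurve_subset: "icurve I \<gamma> ==> is_interval J ==> J \<subseteq> I ==> icurve J \<gamma>"
 unfolding integral_curve_def by (auto intro: has_vector_derivative_within_subset continuous_map_from_subtopology_mono)

lemma icurve_in_space: "icurve I \<gamma> ==> t \<in> I ==> \<gamma> t \<in> topspace M"
 unfolding integral_curve_def continuous_map_def by auto

lemma icurve_near:
 assumes g: "icurve I \<gamma>" and V: "openin M V" and s: "s \<in> I" "\<gamma> s \<in> V"
 obtains e where "e > 0" "!!t. t \<in> I ==> \<bar>t - s\<bar> < e ==> \<gamma> t \<in> V"
proof -
 have "continuous_map (top_of_set I) M \<gamma>" using g by (auto simp: integral_curve_def)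
 from openin_continuous_map_preimage[OF this V] have "openin (top_of_set I) {t \<in> I. \<gamma> t \<in> V}"
  by simp
 then obtain e where "e > 0" "\<forall>t\<in>I. dist t s < e --> t \<in> {t \<in> I. \<gamma> t \<in> V}"
  using s unfolding openin_euclidean_subtopology_iff by blast
 then show ?thesis using that by (auto simp: dist_real_def)
qed

text \<open>\<open>F\<close> is the vector field read in the C1 chart \<open>d\<close>.\<close>

definition field_in :: "'a chart => (real^3 => real^3) => bool" where
 "field_in d F \<longleftrightarrow> C1chart d & (\<forall>c\<in>A. \<forall>x\<in>fst c \<inter> fst d. dtrans c d x (X c x) = F (snd d x))"

lemma field_in_atlas: "c \<in> A ==> field_in c (X c \<circ> chart_inv c)" unfolding field_in_def
proof (intro conjI ballI)
 assume c: "c \<in> A"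
 then show "C1chart c" by (rule atlas_C1chart)
 fix b x assume b: "b \<in> A" and x: "x \<in> fst b \<inter> fst c"
 have "\<forall>c\<in>A. \<forall>d\<in>A. \<forall>x \<in> fst c \<inter> fst d. X d x = dtrans c d x (X c x)"
  using field unfolding smooth_vector_field_def by (rule conjunct1)
 from this[rule_format, OF b c x] have "X c x = dtrans b c x (X b x)" .
 then show "dtrans b c x (X b x) = (X c \<circ> chart_inv c) (snd c x)" using x atlas_chart[OF c] by simp
qed

lemma field_in_inverse:
 assumes "field_in d F" "c \<in> A" "x \<in> fst c" "x \<in> fst d"
 shows "dtrans d c x (F (snd d x)) = X c x"
proof -
 have 1: "C1chart d" "dtrans c d x (X c x) = F (snd d x)" using assms by (auto simp: field_in_def)
 show ?thesis using dtrans_inverse[OF atlas_C1chart[OF assms(2)] assms(3) 1(1) assms(4), of "X c x"] 1(2) by simp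
qed

lemma icurve_in_chart:
 assumes d: "field_in d F" and g: "icurve I \<gamma>" and t: "t \<in> I" "\<gamma> t \<in> fst d"
 shows "((snd d \<circ> \<gamma>) has_vector_derivative F (snd d (\<gamma> t))) (at t within I)"
proof -
 have d1: "C1chart d" using d by (simp add: field_in_def)
 note dc = C1chart_is_chart[OF d1]
 obtain c where c: "c \<in> A" "\<gamma> t \<in> fst c" using icurve_in_space[OF g t(1)] atlas_covers by blast
 note cc = atlas_chart[OF c(1)] and c1 = atlas_C1chart[OF c(1)]
 have "((snd c \<circ> \<gamma>) has_vector_derivative X c (\<gamma> t)) (at t within I)"
  using g t c by (auto simp: integral_curve_def)
 moreover have "(transition c d has_derivative dtrans c d (\<gamma> t)) (at ((snd c \<circ> \<gamma>) t) within (snd c \<circ> \<gamma>) ` I)"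
  using has_derivative_at_withinI[OF dtrans_has_derivative[OF c1 d1 c(2) t(2)]] by simp
 ultimately have "((transition c d \<circ> (snd c \<circ> \<gamma>)) has_derivative
   (dtrans c d (\<gamma> t) \<circ> (%x. x *\<^sub>R X c (\<gamma> t)))) (at t within I)"
  unfolding has_vector_derivative_def by (rule diff_chain_within)
 moreover have "dtrans c d (\<gamma> t) \<circ> (%x. x *\<^sub>R X c (\<gamma> t)) = (%x. x *\<^sub>R F (snd d (\<gamma> t)))"
  using d c t linear_scale[OF dtrans_linear[OF c1 d1 c(2) t(2)]] by (auto simp: field_in_def)
 ultimately have 1: "((transition c d \<circ> (snd c \<circ> \<gamma>)) has_vector_derivative F (snd d (\<gamma> t))) (at t within I)"
  by (simp add: has_vector_derivative_def)
 obtain e where e: "e > 0" "!!s. s \<in> I ==> \<bar>s - t\<bar> < e ==> \<gamma> s \<in> fst c"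
  using icurve_near[OF g is_chartD(1)[OF cc] t(1) c(2)] by blast
 show ?thesis by (rule has_vector_derivative_transform_within[OF 1 e(1) t(1)])
   (use e cc in \<open>auto simp: transition_def dist_real_def\<close>)
qed

lemma icurveI_chart:
 assumes d: "field_in d F" and I: "is_interval I"
  and u: "!!t. t \<in> I ==> u t \<in> snd d ` fst d & (u has_vector_derivative F (u t)) (at t within I)"
 shows "icurve I (%t. chart_inv d (u t))" unfolding integral_curve_def
proof (intro conjI ballI impI I)
 have d1: "C1chart d" using d by (simp add: field_in_def)
 note dc = C1chart_is_chart[OF d1]
 have "continuous_on I u" using u has_vector_derivative_continuous_on[of I u "%t. F (u t)"] by blast
 then have "continuous_map (top_of_set I) (top_of_set (snd d ` fst d)) u" using u by auto
 then have "continuous_map (top_of_set I) M (chart_inv d \<circ> u)"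
  using chart_inv_continuous[OF dc] by (rule continuous_map_compose)
 then show "continuous_map (top_of_set I) (subtopology M (topspace M)) (%t. chart_inv d (u t))" by (simp add: o_def)
 fix t c assume t: "t \<in> I" and c: "c \<in> A" "chart_inv d (u t) \<in> fst c"
 note c1 = atlas_C1chart[OF c(1)]
 let ?x = "chart_inv d (u t)"
 have x: "?x \<in> fst d" "snd d ?x = u t" using u[OF t] chart_inv_right[of "u t" d] by auto
 have 1: "(transition d c has_derivative dtrans d c ?x) (at (u t))"
  using dtrans_has_derivative[OF d1 c1 x(1) c(2)] x(2) by simp
 have 2: "(u has_derivative (%s. s *\<^sub>R F (u t))) (at t within I)"
  using u[OF t] unfolding has_vector_derivative_def by (rule conjunct2)
 have "((transition d c \<circ> u) has_derivative dtrans d c ?x \<circ> (%s. s *\<^sub>R F (u t))) (at t within I)"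
  by (rule diff_chain_within[OF 2 has_derivative_at_withinI[OF 1]])
 moreover have "dtrans d c ?x \<circ> (%s. s *\<^sub>R F (u t)) = (%s. s *\<^sub>R X c ?x)"
  using field_in_inverse[OF d c x(1)] x(2) linear_scale[OF dtrans_linear[OF d1 c1 x(1) c(2)]] by auto
 ultimately show "((snd c \<circ> (%t. chart_inv d (u t))) has_vector_derivative X c ?x) (at t within I)"
  by (simp add: has_vector_derivative_def transition_def o_def)
qed

lemma atlas_field_C2:
 assumes "c \<in> A" shows "Ck_on 2 (snd c ` fst c) (X c \<circ> chart_inv c)"
proof -
 have "\<forall>c\<in>A. smooth_on (snd c ` fst c) (X c \<circ> chart_inv c)"
  using field unfolding smooth_vector_field_def by (rule conjunct2)
 from bspec[OF this assms] show ?thesis unfolding smooth_on_def by (rule spec)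
qed

lemma icurve_unique:
 assumes g: "icurve I \<gamma>" and d: "icurve I dl" and t0: "t0 \<in> I" "\<gamma> t0 = dl t0" and t: "t \<in> I"
 shows "\<gamma> t = dl t"
proof -
 let ?J = "{min t t0..max t t0}"
 have int: "is_interval I" using g by (simp add: integral_curve_def)
 have JI: "?J \<subseteq> I"
 proof
  fix x assume x: "x \<in> ?J"
  have 1: "c \<in> I" if "a \<in> I" "b \<in> I" "a <= c" "c <= b" for a b c using int[unfolded is_interval_1] that by blast
  show "x \<in> I"
  proof (cases "t <= t0")
   case True
   then show ?thesis using 1[OF t t0(1)] x by simp
  next
   case False
   then show ?thesis using 1[OF t0(1) t] x by simp
  qed
 qed
 let ?A = "{s \<in> ?J. \<gamma> s = dl s}"
 have near: "\<exists>e>0. \<forall>r\<in>?J. \<bar>r - s\<bar> < e --> \<gamma> r = dl r" if s: "s \<in> ?J" "\<gamma> s = dl s" for s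
 proof -
  have sI: "s \<in> I" using s JI by auto
  obtain c where c: "c \<in> A" "\<gamma> s \<in> fst c" using icurve_in_space[OF g sI] atlas_covers by blast
  note cc = atlas_chart[OF c(1)]
  obtain e1 where e1: "e1 > 0" "!!r. r \<in> I ==> \<bar>r - s\<bar> < e1 ==> \<gamma> r \<in> fst c"
   using icurve_near[OF g is_chartD(1)[OF cc] sI c(2)] by blast
  obtain e2 where e2: "e2 > 0" "!!r. r \<in> I ==> \<bar>r - s\<bar> < e2 ==> dl r \<in> fst c"
   using icurve_near[OF d is_chartD(1)[OF cc] sI] c(2) s(2) by auto
  have "\<gamma> r = dl r" if r: "r \<in> ?J" "\<bar>r - s\<bar> < min e1 e2" for r
  proof -
   let ?a = "min r s" and ?b = "max r s"
   have sub: "{?a..?b} \<subseteq> ?J" using r s by auto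
   have sol: "(snd c \<circ> \<eta>) x \<in> snd c ` fst c &
     ((snd c \<circ> \<eta>) has_vector_derivative (X c \<circ> chart_inv c) ((snd c \<circ> \<eta>) x)) (at x within {?a..?b})"
    if \<eta>: "icurve I \<eta>" "!!r. r \<in> I ==> \<bar>r - s\<bar> < min e1 e2 ==> \<eta> r \<in> fst c" and x: "x \<in> {?a..?b}" for \<eta> x
   proof -
    have xI: "x \<in> I" "\<bar>x - s\<bar> < min e1 e2" using x sub JI r by (auto simp: min_def max_def split: if_splits)
    have "{?a..?b} \<subseteq> I" using sub JI by blast
    then have "icurve {?a..?b} \<eta>" using \<eta>(1) icurve_subset is_interval_cc by blast
    from icurve_in_chart[OF field_in_atlas[OF c(1)] this x] \<eta>(2)[OF xI] show ?thesis by (auto simp: o_def)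
   qed
   have "(snd c \<circ> \<gamma>) r = (snd c \<circ> dl) r"
   proof (rule ode_unique_interval[where f = "X c \<circ> chart_inv c" and a = ?a and b = ?b and ?t0.0 = s])
    show "open (snd c ` fst c)" by (rule is_chartD(2)[OF cc])
    show "Ck_on 1 (snd c ` fst c) (X c \<circ> chart_inv c)" by (rule Ck_on_2_imp_1[OF atlas_field_C2[OF c(1)]])
    show "(snd c \<circ> \<gamma>) x \<in> snd c ` fst c &
     ((snd c \<circ> \<gamma>) has_vector_derivative (X c \<circ> chart_inv c) ((snd c \<circ> \<gamma>) x)) (at x within {?a..?b})"
     if "x \<in> {?a..?b}" for x by (rule sol[OF g _ that]) (use e1(2) in simp)
    show "(snd c \<circ> dl) x \<in> snd c ` fst c &
     ((snd c \<circ> dl) has_vector_derivative (X c \<circ> chart_inv c) ((snd c \<circ> dl) x)) (at x within {?a..?b})"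
     if "x \<in> {?a..?b}" for x by (rule sol[OF d _ that]) (use e2(2) in simp)
    show "s \<in> {?a..?b}" "r \<in> {?a..?b}" by simp_all
    show "(snd c \<circ> \<gamma>) s = (snd c \<circ> dl) s" using s(2) by simp
   qed
   then have 1: "snd c (\<gamma> r) = snd c (dl r)" by simp
   have "r \<in> I" using r(1) JI by blast
   then have "\<gamma> r \<in> fst c" "dl r \<in> fst c" using e1(2) e2(2) r(2) by simp_all
   then show ?thesis by (rule inj_onD[OF is_chartD(5)[OF cc] 1])
  qed
  then show ?thesis using e1(1) e2(1) by (intro exI[of _ "min e1 e2"]) auto
 qed
 have "openin (top_of_set ?J) ?A" unfolding openin_euclidean_subtopology_iff using near by (auto simp: dist_real_def)
 moreover have "openin (top_of_set ?J) (?J - ?A)" unfolding openin_euclidean_subtopology_iff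
 proof (intro conjI ballI)
  fix s assume s: "s \<in> ?J - ?A"
  then have sI: "s \<in> I" "\<gamma> s ~= dl s" using JI by auto
  then obtain U V where UV: "openin M U" "openin M V" "\<gamma> s \<in> U" "dl s \<in> V" "disjnt U V"
   using Hausdorff icurve_in_space[OF g sI(1)] icurve_in_space[OF d sI(1)] unfolding Hausdorff_space_def by metis
  obtain e1 where e1: "e1 > 0" "!!r. r \<in> I ==> \<bar>r - s\<bar> < e1 ==> \<gamma> r \<in> U"
   using icurve_near[OF g UV(1) sI(1) UV(3)] by blast
  obtain e2 where e2: "e2 > 0" "!!r. r \<in> I ==> \<bar>r - s\<bar> < e2 ==> dl r \<in> V"
   using icurve_near[OF d UV(2) sI(1) UV(4)] by blast
  have "r \<in> ?J - ?A" if "r \<in> ?J" "dist r s < min e1 e2" for r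
  proof -
   have "\<gamma> r \<in> U" "dl r \<in> V" using e1(2)[of r] e2(2)[of r] that JI by (auto simp: dist_real_def)
   then have "\<gamma> r ~= dl r" using UV(5) by (auto simp: disjnt_iff)
   then show ?thesis using that by auto
  qed
  then show "\<exists>e>0. \<forall>r\<in>?J. dist r s < e --> r \<in> ?J - ?A"
   using e1(1) e2(1) by (intro exI[of _ "min e1 e2"]) auto
 qed auto
 then have "closedin (top_of_set ?J) ?A" by (subst closedin_def) (auto intro!: Collect_restrict)
 ultimately have "?A = {} \<or> ?A = ?J" using connected_Icc[of "min t t0" "max t t0"] unfolding connected_clopen by blast
 moreover have "t0 \<in> ?A" using t0(2) by simp
 moreover have "t \<in> ?J" by simp
 ultimately have "t \<in> ?A" by blast
 then show ?thesis by blast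
qed

lemma icurve_shift:
 assumes g: "icurve I \<gamma>" and J: "is_interval J" "!!t. t \<in> J ==> t + s \<in> I"
 shows "icurve J (%t. \<gamma> (t + s))" unfolding integral_curve_def
proof (intro conjI ballI impI J(1))
 have 1: "continuous_map (top_of_set J) (top_of_set I) (%t. t + s)" using J(2) by (auto intro!: continuous_intros)
 have 2: "continuous_map (top_of_set I) (subtopology M (topspace M)) \<gamma>" using g by (simp add: integral_curve_def)
 from continuous_map_compose[OF 1 2]
 show "continuous_map (top_of_set J) (subtopology M (topspace M)) (%t. \<gamma> (t + s))" by (simp add: o_def)
 fix t c assume t: "t \<in> J" and c: "c \<in> A" "\<gamma> (t + s) \<in> fst c"
 have "((snd c \<circ> \<gamma>) has_vector_derivative X c (\<gamma> (t + s))) (at (t + s) within (%t. t + s) ` J)"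
  using g c J(2)[OF t] has_vector_derivative_within_subset[of "snd c \<circ> \<gamma>" _ "t + s" I "(%t. t + s) ` J"] J(2)
  by (auto simp: integral_curve_def)
 moreover have "((%t. t + s) has_vector_derivative 1) (at t within J)" by (auto intro!: derivative_eq_intros)
 ultimately show "((snd c \<circ> (%t. \<gamma> (t + s))) has_vector_derivative X c (\<gamma> (t + s))) (at t within J)"
  using vector_diff_chain_within[of "%t. t + s" 1 t J "snd c \<circ> \<gamma>" "X c (\<gamma> (t + s))"] by (simp add: o_def)
qed

lemma icurve_concat:
 assumes g: "icurve {a..b} \<gamma>" and d: "is_interval J" "J \<subseteq> {b..}" "b \<in> J" "icurve J dl"
  and eq: "\<gamma> b = dl b" and ab: "a <= b"
 shows "icurve ({a..b} \<union> J) (%t. if t \<in> {a..b} then \<gamma> t else dl t)" unfolding integral_curve_def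
proof (intro conjI ballI impI)
 let ?h = "%t. if t \<in> {a..b} then \<gamma> t else dl t"
 have overlap: "t = b" if "t \<in> {a..b}" "t \<in> J" for t using that d(2) by force
 show "is_interval ({a..b} \<union> J)" unfolding is_interval_1
 proof (intro ballI allI impI)
  fix x y z assume x: "x \<in> {a..b} \<union> J" and y: "y \<in> {a..b} \<union> J" and z: "x <= z & z <= y"
  show "z \<in> {a..b} \<union> J"
  proof (cases "z <= b")
   case True
   then show ?thesis using x z ab d(2) by force
  next
   case False
   then have "y \<in> J" using y z by auto
   then show ?thesis using d(1,3) False z unfolding is_interval_1 by (meson UnI2 linear)
  qed
 qed
 let ?S = "{a..b} \<union> J"
 have cl: "closure {a..b} \<inter> closure J \<subseteq> {b}"
 proof -
  have "closure J \<subseteq> {b..}" using d(2) by (simp add: closure_minimal)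
  then show ?thesis by force
 qed
 have near: "\<exists>e>0. \<forall>r\<in>?S. \<bar>r - s\<bar> < e --> ?h r \<in> U" if U: "openin M U" and s: "s \<in> ?S" "?h s \<in> U" for U s
 proof -
  have "\<exists>e>0. \<forall>r\<in>{a..b}. \<bar>r - s\<bar> < e --> \<gamma> r \<in> U"
  proof (cases "s \<in> {a..b}")
   case True
   then show ?thesis using icurve_near[OF g U True] s by metis
  next
   case False
   then have "s > b" using s d(2) ab by force
   then show ?thesis by (intro exI[of _ "s - b"]) auto
  qed
  moreover have "\<exists>e>0. \<forall>r\<in>J. \<bar>r - s\<bar> < e --> dl r \<in> U"
  proof (cases "s \<in> J")
   case True
   have "dl s \<in> U"
   proof (cases "s \<in> {a..b}")
    case ab: True
    then have "s = b" by (rule overlap[OF _ True])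
    then show ?thesis using s(2) ab eq by simp
   next
    case False
    then show ?thesis using s(2) by (auto split: if_splits)
   qed
   then show ?thesis using icurve_near[OF d(4) U True] by metis
  next
   case False
   then have "s < b" using s d(3) by (cases "s = b") auto
   then show ?thesis using d(2) by (intro exI[of _ "b - s"]) force
  qed
  ultimately obtain e1 e2 where e: "e1 > 0" "\<forall>r\<in>{a..b}. \<bar>r - s\<bar> < e1 --> \<gamma> r \<in> U"
   "e2 > 0" "\<forall>r\<in>J. \<bar>r - s\<bar> < e2 --> dl r \<in> U" by blast
  have "?h r \<in> U" if "r \<in> ?S" "\<bar>r - s\<bar> < min e1 e2" for r using e that by auto
  then show ?thesis using e(1,3) by (intro exI[of _ "min e1 e2"]) auto
 qed
 have "continuous_map (top_of_set ?S) M ?h" unfolding continuous_map_def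
 proof (intro conjI allI impI)
  show "?h \<in> topspace (top_of_set ?S) \<rightarrow> topspace M"
  proof (rule Pi_I)
   fix s assume "s \<in> topspace (top_of_set ?S)"
   then show "?h s \<in> topspace M"
    using icurve_in_space[OF g, of s] icurve_in_space[OF d(4), of s] by (cases "s \<in> {a..b}") auto
  qed
  fix U assume U: "openin M U"
  show "openin (top_of_set ?S) {x \<in> topspace (top_of_set ?S). ?h x \<in> U}"
   unfolding openin_euclidean_subtopology_iff dist_real_def
  proof (intro conjI ballI)
   fix s assume "s \<in> {x \<in> topspace (top_of_set ?S). ?h x \<in> U}"
   then have s: "s \<in> ?S" "?h s \<in> U" by simp_all
   from near[OF U s] obtain e where "e > 0" "\<forall>r\<in>?S. \<bar>r - s\<bar> < e --> ?h r \<in> U"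
    by (elim exE conjE)
   then show "\<exists>e>0. \<forall>r\<in>?S. \<bar>r - s\<bar> < e --> r \<in> {x \<in> topspace (top_of_set ?S). ?h x \<in> U}"
    by (intro exI[of _ e]) simp
  qed (auto split: if_splits)
 qed
 then show "continuous_map (top_of_set ?S) (subtopology M (topspace M)) ?h" by simp
 fix t c assume t: "t \<in> ?S" and c: "c \<in> A" "?h t \<in> fst c"
 have f1: "((%t. if t \<in> {a..b} then (snd c \<circ> \<gamma>) t else (snd c \<circ> dl) t) has_vector_derivative
  (if t \<in> {a..b} then X c (\<gamma> t) else X c (dl t))) (at t within ?S)"
 proof (rule has_vector_derivative_If_within_closures[OF t refl])
  have 1: "{a..b} \<union> (closure {a..b} \<inter> closure J) = {a..b}" "J \<union> (closure {a..b} \<inter> closure J) = J"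
   using cl ab d(3) by auto
  show "((snd c \<circ> \<gamma>) has_vector_derivative X c (\<gamma> t)) (at t within {a..b} \<union> (closure {a..b} \<inter> closure J))"
   if "t \<in> {a..b} \<union> (closure {a..b} \<inter> closure J)"
   using that g c unfolding 1 by (auto simp: integral_curve_def)
  show "((snd c \<circ> dl) has_vector_derivative X c (dl t)) (at t within J \<union> (closure {a..b} \<inter> closure J))"
   if "t \<in> J \<union> (closure {a..b} \<inter> closure J)"
  proof -
   have tJ: "t \<in> J" using that unfolding 1 .
   have "dl t \<in> fst c"
   proof (cases "t \<in> {a..b}")
    case ab: True
    then have "t = b" by (rule overlap[OF _ tJ])
    then show ?thesis using c(2) ab eq by simp
   next
    case False
    then show ?thesis using c(2) by (auto split: if_splits)
   qed
   then show ?thesis using d(4) tJ c unfolding 1 by (auto simp: integral_curve_def)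
  qed
  show "(snd c \<circ> \<gamma>) t = (snd c \<circ> dl) t" "X c (\<gamma> t) = X c (dl t)"
   if "t \<in> closure {a..b}" "t \<in> closure J" using that cl eq by auto
 qed
 have f2: "(%t. if t \<in> {a..b} then (snd c \<circ> \<gamma>) t else (snd c \<circ> dl) t) = snd c \<circ> ?h"
  by (rule ext) simp
 have f3: "(if t \<in> {a..b} then X c (\<gamma> t) else X c (dl t)) = X c (?h t)" by simp
 from f1 show "((snd c \<circ> ?h) has_vector_derivative X c (?h t)) (at t within ?S)" unfolding f2 f3 .
qed

end

section \<open>The local flow and its charts\<close>

context vector_field_manifold
begin

lemma euclidean_flow_inverse:
 fixes f :: "real^3 => real^3"
 assumes W: "open W" and f: "Ck_on 1 W f" and t: "t \<in> {-d..d}" and d: "d <= d1"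
  and u: "!!s. s \<in> {-d..d} ==> u s \<in> W & (u has_vector_derivative f (u s)) (at s within {-d..d})"
  and v: "!!s. s \<in> {-d1..d1} ==> v s \<in> W & (v has_vector_derivative f (v s)) (at s within {-d1..d1})"
  and eq: "v 0 = u t"
 shows "v (- t) = u 0"
proof -
 let ?a = "min (-t) 0" and ?b = "max (-t) 0"
 have "(%s. u (s + t)) (-t) = v (-t)"
 proof (rule ode_unique_interval[OF W f, where a = ?a and b = ?b and ?t0.0 = 0])
  fix s assume s: "s \<in> {?a..?b}"
  have st: "s + t \<in> {-d..d}" using s t by (auto simp: min_def max_def split: if_splits)
  have sub: "(%s. s + t) ` {?a..?b} \<subseteq> {-d..d}" using t by (auto simp: min_def max_def split: if_splits)
  have "((%s. s + t) has_vector_derivative 1) (at s within {?a..?b})" by (auto intro!: derivative_eq_intros)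
  from vector_diff_chain_within[OF this has_vector_derivative_within_subset[OF conjunct2[OF u[OF st]] sub]]
  have "((%s. u (s + t)) has_vector_derivative f (u (s + t))) (at s within {?a..?b})" by (simp add: o_def)
  then show "u (s + t) \<in> W & ((%s. u (s + t)) has_vector_derivative f (u (s + t))) (at s within {?a..?b})"
   using u[OF st] by blast
  have sub2: "{?a..?b} \<subseteq> {-d1..d1}" using t d by (auto simp: min_def max_def split: if_splits)
  then have "s \<in> {-d1..d1}" using s by blast
  from v[OF this] show "v s \<in> W & (v has_vector_derivative f (v s)) (at s within {?a..?b})"
   using has_vector_derivative_within_subset[OF _ sub2] by blast
 qed (use eq in auto)
 then show ?thesis by simp
qed

text \<open>The time-\<open>t\<close> map of the flow is, for small \<open>t\<close>, a local C1 diffeomorphism.  This is recorded by saying that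
 it pulls C1 charts back to C1 charts.\<close>

lemma local_flow:
 assumes N: "openin M N" "m0 \<in> N"
 obtains d O' \<Phi> where "d > 0" "openin M O'" "m0 \<in> O'" "O' \<subseteq> N"
  "!!m. m \<in> O' ==> \<Phi> 0 m = m"
  "!!m. m \<in> O' ==> icurve {-d..d} (%t. \<Phi> t m)"
  "!!m t. m \<in> O' ==> t \<in> {-d..d} ==> \<Phi> t m \<in> N"
  "!!e t Q. C1chart e ==> t \<in> {-d..d} ==> openin M Q ==>
   C1chart ({m \<in> O' \<inter> Q. \<Phi> t m \<in> fst e}, %m. snd e (\<Phi> t m))"
proof -
 have "m0 \<in> topspace M" using N openin_subset by blast
 then obtain c where c: "c \<in> A" "m0 \<in> fst c" using atlas_covers by blast
 note cc = atlas_chart[OF c(1)] and c1 = atlas_C1chart[OF c(1)]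
 define y0 where "y0 = snd c m0"
 define f where "f = X c \<circ> chart_inv c"
 have fc: "field_in c f" unfolding f_def by (rule field_in_atlas[OF c(1)])
 define W0 where "W0 = snd c ` (N \<inter> fst c)"
 have W0: "open W0" "y0 \<in> W0" "W0 \<subseteq> snd c ` fst c"
  using N c is_chartD(1)[OF cc] by (auto simp: W0_def y0_def intro!: chart_image_open[OF cc])
 have W0N: "chart_inv c y \<in> N \<inter> fst c" "snd c (chart_inv c y) = y" if "y \<in> W0" for y
 proof -
  from that obtain m where m: "m \<in> N" "m \<in> fst c" "y = snd c m" by (auto simp: W0_def)
  then show "chart_inv c y \<in> N \<inter> fst c" "snd c (chart_inv c y) = y" using cc by simp_all
 qed
 have f2: "Ck_on 2 W0 f" unfolding f_def by (rule Ck_on_subset[OF atlas_field_C2[OF c(1)] W0(3)])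
 have f1: "Ck_on 1 W0 f" by (rule Ck_on_2_imp_1[OF f2])
 obtain d1 r1 \<phi> where d1: "d1 > 0" "r1 > 0" and
  \<phi>0: "!!y. y \<in> ball y0 r1 ==> \<phi> 0 y = y" and
  \<phi>W: "!!y t. y \<in> ball y0 r1 ==> t \<in> {-d1..d1} ==> \<phi> t y \<in> W0" and
  \<phi>d: "!!y t. y \<in> ball y0 r1 ==> t \<in> {-d1..d1} ==>
   ((%s. \<phi> s y) has_vector_derivative f (\<phi> t y)) (at t within {-d1..d1})" and
  \<phi>C: "!!t. t \<in> {-d1..d1} ==> Ck_on 1 (ball y0 r1) (\<phi> t)"
  by (rule local_flow_euclidean[OF W0(1,2) f2]) (rule that)
 have r1W: "ball y0 r1 \<subseteq> W0"
 proof
  fix y assume y: "y \<in> ball y0 r1"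
  then show "y \<in> W0" using \<phi>W[OF y, of 0] \<phi>0[OF y] d1 by simp
 qed
 have y0b: "y0 \<in> ball y0 r1" using d1 by simp
 \<comment> \<open>A second flow, with values in the domain of the first, so that the two are inverse to each other.\<close>
 obtain d2 r2 \<psi> where d2: "d2 > 0" "r2 > 0" and
  \<psi>0: "!!y. y \<in> ball y0 r2 ==> \<psi> 0 y = y" and
  \<psi>W: "!!y t. y \<in> ball y0 r2 ==> t \<in> {-d2..d2} ==> \<psi> t y \<in> ball y0 r1" and
  \<psi>d: "!!y t. y \<in> ball y0 r2 ==> t \<in> {-d2..d2} ==>
   ((%s. \<psi> s y) has_vector_derivative f (\<psi> t y)) (at t within {-d2..d2})" and
  \<psi>C: "!!t. t \<in> {-d2..d2} ==> Ck_on 1 (ball y0 r2) (\<psi> t)"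
  by (rule local_flow_euclidean[OF open_ball y0b Ck_on_subset[OF f2 r1W]]) (rule that)
 define d where "d = min d1 d2"
 have d: "d > 0" "d <= d1" "d <= d2" using d1 d2 by (auto simp: d_def)
 have dsub: "{-d..d} \<subseteq> {-d2..d2}" using d by auto
 have \<psi>sol: "\<psi> s y \<in> W0 & ((%s. \<psi> s y) has_vector_derivative f (\<psi> s y)) (at s within {-d..d})"
  if "y \<in> ball y0 r2" "s \<in> {-d..d}" for y s
  using \<psi>W[OF that(1), of s] \<psi>d[OF that(1), of s] that(2) dsub r1W
   has_vector_derivative_within_subset[OF _ dsub] by blast
 have \<psi>ball: "\<psi> t y \<in> ball y0 r1" if "y \<in> ball y0 r2" "t \<in> {-d..d}" for y t
  using \<psi>W[OF that(1), of t] that(2) dsub by blast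
 have inv: "\<phi> (- t) (\<psi> t y) = y" if y: "y \<in> ball y0 r2" and t: "t \<in> {-d..d}" for y t
 proof -
  have "(%s. \<phi> s (\<psi> t y)) (- t) = (%s. \<psi> s y) 0"
  proof (rule euclidean_flow_inverse[OF W0(1) f1 t d(2)])
   show "\<phi> s (\<psi> t y) \<in> W0 & ((%s. \<phi> s (\<psi> t y)) has_vector_derivative f (\<phi> s (\<psi> t y))) (at s within {-d1..d1})"
    if "s \<in> {-d1..d1}" for s using \<phi>W[OF \<psi>ball[OF y t] that] \<phi>d[OF \<psi>ball[OF y t] that] by blast
   show "\<phi> 0 (\<psi> t y) = \<psi> t y" by (rule \<phi>0[OF \<psi>ball[OF y t]])
  qed (rule \<psi>sol[OF y])
  then show ?thesis using \<psi>0[OF y] by simp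
 qed
 define O' where "O' = {m \<in> N \<inter> fst c. snd c m \<in> ball y0 r2}"
 define \<Phi> where "\<Phi> t m = chart_inv c (\<psi> t (snd c m))" for t m
 have NcO: "openin M (N \<inter> fst c)" using N is_chartD(1)[OF cc] by blast
 have ccont: "continuous_map (subtopology M V) euclidean (snd c)" if "V \<subseteq> fst c" for V
  using continuous_map_from_subtopology_mono[OF is_chartD(4)[OF cc] that] .
 have O': "openin M O'" unfolding O'_def by (rule chart_preimage_open[OF NcO ccont]) auto
 have \<Phi>c: "snd c (\<Phi> t m) = \<psi> t (snd c m)" "\<Phi> t m \<in> N \<inter> fst c" if "m \<in> O'" "t \<in> {-d..d}" for t m
  using W0N[of "\<psi> t (snd c m)"] \<psi>sol[of "snd c m" t] that by (auto simp: O'_def \<Phi>_def)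
 show ?thesis
 proof (rule that[of d O' \<Phi>])
  show "m0 \<in> O'" using N c d2 by (simp add: O'_def y0_def)
  show "O' \<subseteq> N" by (auto simp: O'_def)
  fix m assume m: "m \<in> O'"
  have mb: "snd c m \<in> ball y0 r2" "m \<in> fst c" using m by (auto simp: O'_def)
  show "\<Phi> 0 m = m" using \<psi>0[OF mb(1)] cc mb(2) by (simp add: \<Phi>_def)
  show "icurve {-d..d} (%t. \<Phi> t m)" unfolding \<Phi>_def
  proof (rule icurveI_chart[OF fc is_interval_cc])
   show "\<psi> t (snd c m) \<in> snd c ` fst c & ((%t. \<psi> t (snd c m)) has_vector_derivative f (\<psi> t (snd c m))) (at t within {-d..d})"
    if "t \<in> {-d..d}" for t using \<psi>sol[OF mb(1) that] W0(3) by blast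
  qed
  show "\<Phi> t m \<in> N" if "t \<in> {-d..d}" for t using \<Phi>c(2)[OF m that] by blast
 next
  fix e t Q
  assume e: "C1chart e" and t: "t \<in> {-d..d}" and Q: "openin M Q"
  note ec = C1chart_is_chart[OF e]
  let ?V = "{m \<in> O' \<inter> Q. \<Phi> t m \<in> fst e}" and ?f = "%m. snd e (\<Phi> t m)"
  let ?T = "{y \<in> ball y0 r2. \<psi> t y \<in> snd c ` (fst c \<inter> fst e)}"
  have td: "t \<in> {-d2..d2}" "- t \<in> {-d1..d1}" using t d by auto
  have ovl: "open (snd c ` (fst c \<inter> fst e))" by (rule chart_overlap_open[OF cc ec])
  have "?T = ball y0 r2 \<inter> \<psi> t -` (snd c ` (fst c \<inter> fst e))" by auto
  then have T: "open ?T" using continuous_open_preimage[OF Ck_on_continuous[OF \<psi>C[OF td(1)]] open_ball ovl] by simp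
  have VT: "m \<in> ?V \<longleftrightarrow> m \<in> O' \<inter> Q & snd c m \<in> ?T" for m
  proof
   assume m: "m \<in> ?V"
   then have "m \<in> O'" by simp
   then have "\<psi> t (snd c m) = snd c (\<Phi> t m)" "\<Phi> t m \<in> fst c" "snd c m \<in> ball y0 r2"
    using \<Phi>c[OF _ t, of m] by (auto simp: O'_def)
   then show "m \<in> O' \<inter> Q & snd c m \<in> ?T" using m by auto
  next
   assume m: "m \<in> O' \<inter> Q & snd c m \<in> ?T"
   then obtain x where x: "x \<in> fst c" "x \<in> fst e" "\<psi> t (snd c m) = snd c x" by auto
   then have "\<Phi> t m = x" using cc by (simp add: \<Phi>_def)
   then show "m \<in> ?V" using m x by simp
  qed
  have "?V = {m \<in> O' \<inter> Q. snd c m \<in> ?T}" using VT by blast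
  moreover have "openin M {m \<in> O' \<inter> Q. snd c m \<in> ?T}"
   by (rule chart_preimage_open[OF openin_Int[OF O' Q] ccont T]) (auto simp: O'_def)
  ultimately have V: "openin M ?V" by simp
  define g where "g = transition c e \<circ> \<psi> t"
  have gC: "Ck_on 1 ?T g" unfolding g_def
  proof (rule C1_compose)
   show "Ck_on 1 ?T (\<psi> t)" by (rule Ck_on_subset[OF \<psi>C[OF td(1)]]) auto
   show "Ck_on 1 (snd c ` (fst c \<inter> fst e)) (transition c e)" by (rule C1chart_transition[OF c1 e])
  qed (use ovl in auto)
  have gf: "?f m = g (snd c m)" if "m \<in> ?V" for m by (simp add: g_def transition_def \<Phi>_def)
  have Vc: "?V \<subseteq> fst c" "?V \<subseteq> O'" by (auto simp: O'_def)
  have inj: "inj_on ?f ?V"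
  proof (rule inj_onI)
   fix m m' assume m: "m \<in> ?V" "m' \<in> ?V" and eq: "?f m = ?f m'"
   have "\<Phi> t m = \<Phi> t m'" by (rule inj_onD[OF is_chartD(5)[OF ec] eq]) (use m in auto)
   then have "\<psi> t (snd c m) = \<psi> t (snd c m')" using \<Phi>c(1)[OF _ t] m Vc by (metis (no_types, lifting) subsetD)
   then have "snd c m = snd c m'" using inv[OF _ t] m VT by (metis (no_types, lifting) mem_Collect_eq)
   then show "m = m'" by (rule inj_onD[OF is_chartD(5)[OF cc]]) (use m Vc in auto)
  qed
  have cont: "continuous_map (subtopology M ?V) euclidean ?f"
  proof (rule continuous_map_eq)
   have "continuous_map (subtopology M ?V) (top_of_set ?T) (snd c)"
    by (rule continuous_map_into_subtopology[OF ccont[OF Vc(1)]]) (use VT in auto)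
   moreover have "continuous_map (top_of_set ?T) euclidean g" using Ck_on_continuous[OF gC] by simp
   ultimately show "continuous_map (subtopology M ?V) euclidean (g \<circ> snd c)" by (rule continuous_map_compose)
   show "(g \<circ> snd c) m = ?f m" if "m \<in> topspace (subtopology M ?V)" for m using gf[of m] that by simp
  qed
  have ch: "is_chart M (?V, ?f)"
  proof (rule is_chart_invariance[OF _ V cont inj])
   show "\<exists>c. is_chart M c & x \<in> fst c" if "x \<in> ?V" for x using that Vc cc by blast
  qed
  have chi: "chart_inv (?V, ?f) (?f m) = m" if "m \<in> ?V" for m using chart_inv_left[OF ch, of m] that by simp
  show "C1chart (?V, ?f)" unfolding C1_coordinates_def
  proof (intro conjI ballI ch)
   fix b assume b: "b \<in> A"
   note bc = atlas_chart[OF b] and b1 = atlas_C1chart[OF b]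
   let ?S = "snd b ` (fst b \<inter> ?V)"
   have S: "open ?S" using V is_chartD(1)[OF bc] by (intro chart_image_open[OF bc]) auto
   have "Ck_on 1 ?S (g \<circ> transition b c)"
   proof (rule C1_compose[OF _ gC T])
    show "Ck_on 1 ?S (transition b c)" by (rule Ck_on_subset[OF C1chart_transition[OF b1 c1]]) (use Vc in auto)
    show "transition b c ` ?S \<subseteq> ?T"
    proof
     fix z assume "z \<in> transition b c ` ?S"
     then obtain m where m: "m \<in> fst b" "m \<in> ?V" "z = transition b c (snd b m)" by auto
     have "z = snd c m" using m(3) transition_apply[OF bc m(1)] by simp
     then show "z \<in> ?T" using VT[of m] m(2) by blast
    qed
   qed
   then have "Ck_on 1 ?S (transition b (?V, ?f))"
   proof (rule Ck_on_1_cong[OF _ S])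
    fix z assume "z \<in> ?S"
    then obtain m where m: "m \<in> fst b" "m \<in> ?V" "z = snd b m" by auto
    have "transition b c z = snd c m" "chart_inv b z = m" using m transition_apply[OF bc m(1)] bc by simp_all
    then show "(g \<circ> transition b c) z = transition b (?V, ?f) z" using gf[OF m(2)] by (simp add: transition_def)
   qed
   then show "Ck_on 1 (snd b ` (fst b \<inter> fst (?V, ?f))) (transition b (?V, ?f))" by simp
   let ?R = "?f ` (fst b \<inter> ?V)"
   have "open (snd (?V, ?f) ` (fst b \<inter> ?V))" using V is_chartD(1)[OF bc] by (intro chart_image_open[OF ch]) auto
   then have R: "open ?R" by simp
   have ec2: "transition e c (?f m) = \<psi> t (snd c m)" if "m \<in> ?V" for m
    using transition_apply[OF ec, of "\<Phi> t m" c] \<Phi>c(1)[OF _ t, of m] that by auto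
   have 1: "Ck_on 1 ?R (\<phi> (- t) \<circ> transition e c)"
   proof (rule C1_compose[OF _ \<phi>C[OF td(2)] open_ball])
    show "Ck_on 1 ?R (transition e c)"
     by (rule Ck_on_subset[OF C1chart_transition[OF e c1]]) (use \<Phi>c(2)[OF _ t] in auto)
    show "transition e c ` ?R \<subseteq> ball y0 r1" using ec2 \<psi>ball[OF _ t] by (auto simp: O'_def)
   qed
   have 2: "(\<phi> (- t) \<circ> transition e c) (?f m) = snd c m" if "m \<in> ?V" for m
    using ec2[OF that] inv[OF _ t] that VT[of m] by auto
   have "Ck_on 1 ?R (transition c b \<circ> (\<phi> (- t) \<circ> transition e c))"
   proof (rule C1_compose[OF 1 C1chart_transition[OF c1 b1]])
    show "open (snd c ` (fst c \<inter> fst b))" by (rule chart_overlap_open[OF cc bc])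
    show "(\<phi> (- t) \<circ> transition e c) ` ?R \<subseteq> snd c ` (fst c \<inter> fst b)"
    proof
     fix z assume "z \<in> (\<phi> (- t) \<circ> transition e c) ` ?R"
     then obtain m where m: "m \<in> fst b" "m \<in> ?V" "z = (\<phi> (- t) \<circ> transition e c) (?f m)" by blast
     have "z = snd c m" unfolding m(3) by (rule 2[OF m(2)])
     then show "z \<in> snd c ` (fst c \<inter> fst b)" using m Vc by blast
    qed
   qed
   then have "Ck_on 1 ?R (transition (?V, ?f) b)"
   proof (rule Ck_on_1_cong[OF _ R])
    fix z assume "z \<in> ?R"
    then obtain m where m: "m \<in> fst b" "m \<in> ?V" "z = ?f m" by blast
    have mc: "m \<in> fst c" using m Vc by blast
    have "(transition c b \<circ> (\<phi> (- t) \<circ> transition e c)) z = transition c b (snd c m)"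
     unfolding m(3) comp_apply[of "transition c b"] using 2[OF m(2)] by simp
    also have "\<dots> = snd b m" by (rule transition_apply[OF cc mc])
    also have "\<dots> = transition (?V, ?f) b z" using chi[OF m(2)] m(3) by (simp add: transition_def)
    finally show "(transition c b \<circ> (\<phi> (- t) \<circ> transition e c)) z = transition (?V, ?f) b z" .
   qed
   then show "Ck_on 1 (snd (?V, ?f) ` (fst b \<inter> fst (?V, ?f))) (transition (?V, ?f) b)" by simp
  qed
 qed (use d O' in auto)
qed

text \<open>Following the flow along a whole integral curve pulls charts at its end back to charts at its
 beginning; nearby curves stay in \<open>N\<close> from time \<open>T\<close> on, as the given one does.\<close>

lemma flow_chart:
 assumes g: "icurve {a..b} \<gamma>" and ab: "a <= b" and N: "openin M N" "!!t. t \<in> {a..b} ==> T <= t ==> \<gamma> t \<in> N"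
  and e: "C1chart e" "\<gamma> b \<in> fst e" and Q: "openin M Q" "\<gamma> a \<in> Q"
 shows "\<exists>e'. C1chart e' & \<gamma> a \<in> fst e' & fst e' \<subseteq> Q &
  (\<forall>m\<in>fst e'. \<exists>dl. icurve {a..b} dl & dl a = m & dl b \<in> fst e & snd e' m = snd e (dl b) &
   (\<forall>t\<in>{a..b}. T <= t --> dl t \<in> N))"
proof -
 define G where "G x y e Q e' \<longleftrightarrow> C1chart e' & \<gamma> x \<in> fst e' & fst e' \<subseteq> Q &
  (\<forall>m\<in>fst e'. \<exists>dl. icurve {x..y} dl & dl x = m & dl y \<in> fst e & snd e' m = snd e (dl y) &
   (\<forall>t\<in>{x..y}. T <= t --> dl t \<in> N))" for x y e Q e'
 define P where "P x y \<longleftrightarrow> (a <= x --> x <= y --> y <= b -->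
  (\<forall>e Q. C1chart e --> \<gamma> y \<in> fst e --> openin M Q --> \<gamma> x \<in> Q --> (\<exists>e'. G x y e Q e')))" for x y
 have "P a b" using ab
 proof (induction rule: Bolzano)
  case (trans x y z)
  show ?case unfolding P_def
  proof (intro impI allI)
   fix e Q assume xz: "a <= x" "x <= z" "z <= b" and e: "C1chart e" "\<gamma> z \<in> fst e" and Q: "openin M Q" "\<gamma> x \<in> Q"
   have "y \<in> {a..b}" using trans(3,4) xz by simp
   then have ytop: "\<gamma> y \<in> topspace M" by (rule icurve_in_space[OF g])
   obtain e2 where e2: "G y z e (topspace M) e2"
    using trans(2)[unfolded P_def, rule_format, of e "topspace M"] e ytop trans(3,4) xz by auto
   have e2': "C1chart e2" "\<gamma> y \<in> fst e2" using e2 unfolding G_def by blast+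
   obtain e1 where e1: "G x y e2 Q e1" using trans(1)[unfolded P_def, rule_format, of e2 Q] e2' Q trans(3,4) xz by auto
   have "G x z e Q e1" unfolding G_def
   proof (intro conjI ballI)
    fix m assume m: "m \<in> fst e1"
    obtain dl1 where dl1: "icurve {x..y} dl1" "dl1 x = m" "dl1 y \<in> fst e2" "snd e1 m = snd e2 (dl1 y)"
      "\<forall>t\<in>{x..y}. T <= t --> dl1 t \<in> N" using e1 m unfolding G_def by blast
    obtain dl2 where dl2: "icurve {y..z} dl2" "dl2 y = dl1 y" "dl2 z \<in> fst e" "snd e2 (dl1 y) = snd e (dl2 z)"
      "\<forall>t\<in>{y..z}. T <= t --> dl2 t \<in> N" using e2 dl1(3) unfolding G_def by blast
    let ?dl = "%t. if t \<in> {x..y} then dl1 t else dl2 t"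
    have "icurve ({x..y} \<union> {y..z}) ?dl"
     by (rule icurve_concat[OF dl1(1) is_interval_cc _ _ dl2(1)]) (use trans(3,4) dl2(2) in auto)
    moreover have "{x..y} \<union> {y..z} = {x..z}" using trans(3,4) by auto
    ultimately have 1: "icurve {x..z} ?dl" by simp
    have 2: "?dl t = dl2 t" if "y <= t" for t using that dl2(2) by (cases "t = y") auto
    have 3: "?dl z = dl2 z" by (rule 2[OF trans(4)])
    have 4: "?dl x = m" using dl1(2) trans(3) by simp
    have 5: "?dl t \<in> N" if "t \<in> {x..z}" "T <= t" for t using that dl1(5) dl2(5) 2[of t] by (cases "t <= y") auto
    show "\<exists>dl. icurve {x..z} dl & dl x = m & dl z \<in> fst e & snd e1 m = snd e (dl z) &
      (\<forall>t\<in>{x..z}. T <= t --> dl t \<in> N)"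
    proof (intro exI[of _ ?dl] conjI ballI impI)
     show "?dl z \<in> fst e" unfolding 3 by (rule dl2(3))
     show "snd e1 m = snd e (?dl z)" unfolding 3 dl1(4) by (rule dl2(4))
     show "icurve {x..z} ?dl" by (rule 1)
     show "?dl x = m" by (rule 4)
     show "?dl t \<in> N" if "t \<in> {x..z}" "T <= t" for t by (rule 5[OF that])
    qed
   qed (use e1 in \<open>auto simp: G_def\<close>)
   then show "\<exists>e'. G x z e Q e'" by blast
  qed
 next
  case (local x)
  have xab: "x \<in> {a..b}" using local by simp
  define Nx where "Nx = (if T <= x then N else topspace M)"
  have Nx: "openin M Nx" "\<gamma> x \<in> Nx" using N xab icurve_in_space[OF g xab] by (auto simp: Nx_def)
  obtain d Ox \<Phi> where d: "d > 0" and Ox: "openin M Ox" "\<gamma> x \<in> Ox" "Ox \<subseteq> Nx" and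
   \<Phi>0: "!!m. m \<in> Ox ==> \<Phi> 0 m = m" and
   \<Phi>i: "!!m. m \<in> Ox ==> icurve {-d..d} (%t. \<Phi> t m)" and
   \<Phi>N: "!!m t. m \<in> Ox ==> t \<in> {-d..d} ==> \<Phi> t m \<in> Nx" and
   \<Phi>e: "!!e t Q. C1chart e ==> t \<in> {-d..d} ==> openin M Q ==>
   C1chart ({m \<in> Ox \<inter> Q. \<Phi> t m \<in> fst e}, %m. snd e (\<Phi> t m))"
   by (rule local_flow[OF Nx]) (rule that)
  obtain e1 where e1: "e1 > 0" "!!t. t \<in> {a..b} ==> \<bar>t - x\<bar> < e1 ==> \<gamma> t \<in> Ox"
   using icurve_near[OF g Ox(1) xab Ox(2)] by blast
  define d' where "d' = min (min d e1) (if T <= x then 1 else T - x)"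
  have d': "d' > 0" "d' <= d" "d' <= e1" "\<not> T <= x ==> d' <= T - x" using d e1 by (auto simp: d'_def)
  have "P a' b'" if ab': "a' <= x" "x <= b'" "b' - a' < d'" for a' b' unfolding P_def
  proof (intro impI allI)
   fix e Q assume xz: "a <= a'" "a' <= b'" "b' <= b" and e: "C1chart e" "\<gamma> b' \<in> fst e" and Q: "openin M Q" "\<gamma> a' \<in> Q"
   let ?h = "b' - a'"
   let ?e' = "({m \<in> Ox \<inter> Q. \<Phi> ?h m \<in> fst e}, %m. snd e (\<Phi> ?h m))"
   have h: "?h \<in> {-d..d}" using ab' d' xz by auto
   have a'O: "\<gamma> a' \<in> Ox" using e1(2)[of a'] ab' d' xz xab by auto
   have cur: "icurve {a'..b'} (%t. \<Phi> (t - a') m)" if m: "m \<in> Ox" for m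
    using icurve_shift[OF \<Phi>i[OF m] is_interval_cc[of a' b'], of "- a'"] h by auto
   have "icurve {a'..b'} \<gamma>" by (rule icurve_subset[OF g is_interval_cc]) (use xz in auto)
   then have \<gamma>b: "\<gamma> b' = \<Phi> ?h (\<gamma> a')"
    using icurve_unique[OF _ cur[OF a'O], of \<gamma> a' b'] \<Phi>0[OF a'O] xz by simp
   have "G a' b' e Q ?e'" unfolding G_def
   proof (intro conjI ballI)
    show "C1chart ?e'" by (rule \<Phi>e[OF e(1) h Q(1)])
    show "\<gamma> a' \<in> fst ?e'" using \<gamma>b a'O Q(2) e(2) by simp
    show "fst ?e' \<subseteq> Q" by auto
    fix m assume "m \<in> fst ?e'"
    then have m: "m \<in> Ox" "\<Phi> ?h m \<in> fst e" by auto
    have "\<Phi> (t - a') m \<in> N" if t: "t \<in> {a'..b'}" "T <= t" for t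
    proof -
     have "T <= x"
     proof (rule ccontr)
      assume "\<not> T <= x"
      then have "b' < T" using d'(4) ab' by linarith
      then show False using t by simp
     qed
     then have "Nx = N" by (simp add: Nx_def)
     moreover have "t - a' \<in> {-d..d}" using t h by auto
     ultimately show ?thesis using \<Phi>N[OF m(1)] by blast
    qed
    then show "\<exists>dl. icurve {a'..b'} dl & dl a' = m & dl b' \<in> fst e & snd ?e' m = snd e (dl b') &
      (\<forall>t\<in>{a'..b'}. T <= t --> dl t \<in> N)"
     using cur[OF m(1)] m(2) \<Phi>0[OF m(1)] by (intro exI[of _ "%t. \<Phi> (t - a') m"]) simp
   qed
   then show "\<exists>e'. G a' b' e Q e'" by blast
  qed
  then show ?case using d'(1) by blast
 qed
 then show ?thesis using e Q ab unfolding P_def G_def by simp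
qed

text \<open>The chart \<open>d\<close> composed with the time-\<open>S\<close> map of the flow, on its full domain of definition.\<close>

definition time_map :: "real => 'a => 'a" where
 "time_map S m = (THE x. \<exists>dl. icurve {0..S} dl & dl 0 = m & dl S = x)"

definition pull_chart :: "real => 'a chart => 'a chart" where
 "pull_chart S d = ({m. \<exists>dl. icurve {0..S} dl & dl 0 = m & dl S \<in> fst d}, %m. snd d (time_map S m))"

lemma time_map_eq:
 assumes "icurve {0..S} dl" "dl 0 = m" "0 <= S"
 shows "time_map S m = dl S" unfolding time_map_def
proof (rule the_equality)
 show "\<exists>dl'. icurve {0..S} dl' & dl' 0 = m & dl' S = dl S" using assms by blast
 fix x assume "\<exists>dl. icurve {0..S} dl & dl 0 = m & dl S = x"
 then obtain dl' where d': "icurve {0..S} dl'" "dl' 0 = m" "dl' S = x" by blast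
 have "dl' S = dl S" by (rule icurve_unique[OF d'(1) assms(1), of 0]) (use assms d' in auto)
 then show "x = dl S" using d'(3) by simp
qed

lemma pull_chart_apply:
 assumes "icurve {0..S} dl" "dl 0 = m" "0 <= S" "dl S \<in> fst d"
 shows "m \<in> fst (pull_chart S d)" "snd (pull_chart S d) m = snd d (dl S)"
 using assms time_map_eq[OF assms(1-3)] by (auto simp: pull_chart_def)

lemma pull_chartE:
 assumes "m \<in> fst (pull_chart S d)" "0 <= S"
 obtains dl where "icurve {0..S} dl" "dl 0 = m" "dl S \<in> fst d" "snd (pull_chart S d) m = snd d (dl S)"
proof -
 obtain dl where d: "icurve {0..S} dl" "dl 0 = m" "dl S \<in> fst d" using assms by (auto simp: pull_chart_def)
 show ?thesis by (rule that[OF d pull_chart_apply(2)[OF d(1,2) assms(2) d(3)]])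
qed

lemma C1chart_pull:
 assumes d: "C1chart d" and S: "0 <= S"
 shows "C1chart (pull_chart S d)"
proof -
 note dc = C1chart_is_chart[OF d]
 let ?V = "fst (pull_chart S d)" and ?f = "snd (pull_chart S d)"
 have loc: "\<exists>e. C1chart e & m \<in> fst e & fst e \<subseteq> ?V & (\<forall>z\<in>fst e. ?f z = snd e z)" if m: "m \<in> ?V" for m
 proof -
  obtain dl where dl: "icurve {0..S} dl" "dl 0 = m" "dl S \<in> fst d" by (rule pull_chartE[OF m S])
  have top: "dl t \<in> topspace M" if "t \<in> {0..S}" "0 <= t" for t by (rule icurve_in_space[OF dl(1) that(1)])
  have top0: "dl 0 \<in> topspace M" using top[of 0] S by simp
  have "\<exists>e'. C1chart e' & dl 0 \<in> fst e' & fst e' \<subseteq> topspace M &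
   (\<forall>m\<in>fst e'. \<exists>dl. icurve {0..S} dl & dl 0 = m & dl S \<in> fst d & snd e' m = snd d (dl S) &
    (\<forall>t\<in>{0..S}. 0 <= t --> dl t \<in> topspace M))"
   by (rule flow_chart[OF dl(1) S openin_topspace _ d dl(3) openin_topspace top0]) (rule top)
  then obtain e where e: "C1chart e" "dl 0 \<in> fst e"
   "\<forall>m\<in>fst e. \<exists>dl. icurve {0..S} dl & dl 0 = m & dl S \<in> fst d & snd e m = snd d (dl S) &
    (\<forall>t\<in>{0..S}. 0 <= t --> dl t \<in> topspace M)"
   by (elim exE conjE)
  have "z \<in> ?V & ?f z = snd e z" if z: "z \<in> fst e" for z
  proof -
   obtain dl' where d': "icurve {0..S} dl'" "dl' 0 = z" "dl' S \<in> fst d" "snd e z = snd d (dl' S)" using e(3) z by blast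
   show ?thesis using pull_chart_apply[OF d'(1,2) S d'(3)] d'(4) by simp
  qed
  then show ?thesis using e(1,2) dl(2) by blast
 qed
 have V: "openin M ?V" unfolding openin_subopen[of M ?V]
 proof
  fix m assume "m \<in> ?V"
  then obtain e where e: "C1chart e" "m \<in> fst e" "fst e \<subseteq> ?V" using loc by blast
  then show "\<exists>T. openin M T & m \<in> T & T \<subseteq> ?V" using is_chartD(1)[OF C1chart_is_chart] by blast
 qed
 have inj: "inj_on ?f ?V"
 proof (rule inj_onI)
  fix m m' assume m: "m \<in> ?V" "m' \<in> ?V" and eq: "?f m = ?f m'"
  obtain dl where dl: "icurve {0..S} dl" "dl 0 = m" "dl S \<in> fst d" "?f m = snd d (dl S)" by (rule pull_chartE[OF m(1) S])
  obtain dl' where dl': "icurve {0..S} dl'" "dl' 0 = m'" "dl' S \<in> fst d" "?f m' = snd d (dl' S)"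
   by (rule pull_chartE[OF m(2) S])
  have "dl S = dl' S" by (rule inj_onD[OF is_chartD(5)[OF dc]]) (use eq dl dl' in simp_all)
  then have "dl 0 = dl' 0" using icurve_unique[OF dl(1) dl'(1), of S 0] S by simp
  then show "m = m'" using dl(2) dl'(2) by simp
 qed
 have "C1chart (?V, ?f)" by (rule C1chart_local[OF V inj loc])
 then show ?thesis by simp
qed

lemma field_in_pull:
 assumes d: "field_in d F" and S: "0 <= S"
 shows "field_in (pull_chart S d) F" unfolding field_in_def
proof (intro conjI ballI)
 let ?p = "pull_chart S d"
 have d1: "C1chart d" using d by (simp add: field_in_def)
 show p1: "C1chart ?p" by (rule C1chart_pull[OF d1 S])
 fix c x assume c: "c \<in> A" and x: "x \<in> fst c \<inter> fst ?p"
 note c1 = atlas_C1chart[OF c]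
 obtain dl where dl: "icurve {0..S} dl" "dl 0 = x" "dl S \<in> fst d" "snd ?p x = snd d (dl S)"
  using pull_chartE[OF _ S, of x d] x by blast
 obtain h O' \<Phi> where h: "h > 0" and O'': "openin M O'" and O': "dl S \<in> O'" and "O' \<subseteq> fst d" and
   \<Phi>0: "!!m. m \<in> O' ==> \<Phi> 0 m = m" and
   \<Phi>i: "!!m. m \<in> O' ==> icurve {-h..h} (%t. \<Phi> t m)" and
   \<Phi>N: "!!m t. m \<in> O' ==> t \<in> {-h..h} ==> \<Phi> t m \<in> fst d" and
   "!!e t Q. C1chart e ==> t \<in> {-h..h} ==> openin M Q ==>
   C1chart ({m \<in> O' \<inter> Q. \<Phi> t m \<in> fst e}, %m. snd e (\<Phi> t m))"
  by (rule local_flow[OF is_chartD(1)[OF C1chart_is_chart[OF d1]] dl(3)]) (rule that)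
 define \<zeta> where "\<zeta> = (%t. if t \<in> {0..S} then dl t else \<Phi> (t - S) (dl S))"
 have "icurve {S..S+h} (%t. \<Phi> (t + (- S)) (dl S))" by (rule icurve_shift[OF \<Phi>i[OF O'] is_interval_cc]) auto
 then have "icurve ({0..S} \<union> {S..S+h}) \<zeta>"
  unfolding \<zeta>_def using h S \<Phi>0[OF O'] by (intro icurve_concat[OF dl(1) is_interval_cc]) auto
 moreover have "{0..S} \<union> {S..S+h} = {0..S+h}" using S h by auto
 ultimately have \<zeta>: "icurve {0..S+h} \<zeta>" by simp
 have \<zeta>S: "\<zeta> (t + S) = \<Phi> t (dl S)" if "t \<in> {0..h}" for t
  using that S \<Phi>0[OF O'] by (cases "t = 0") (auto simp: \<zeta>_def)
 have pz: "\<zeta> t \<in> fst ?p & snd ?p (\<zeta> t) = snd d (\<zeta> (t + S))" if t: "t \<in> {0..h}" for t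
 proof -
  have "icurve {0..S} (%s. \<zeta> (s + t))" by (rule icurve_shift[OF \<zeta> is_interval_cc]) (use t in auto)
  moreover have "\<zeta> (S + t) \<in> fst d" using \<zeta>S[OF t] \<Phi>N[OF O'] t h by (simp add: add.commute)
  ultimately show ?thesis using pull_chart_apply[of S "%s. \<zeta> (s + t)" "\<zeta> t" d] S by (simp add: add.commute)
 qed
 have zin: "\<zeta> 0 = x" using dl(2) S by (simp add: \<zeta>_def)
 have int0: "{0..h} \<subseteq> {0..S+h}" using S by auto
 have "\<forall>t\<in>{0..h}. \<forall>c\<in>A. \<zeta> t \<in> fst c --> ((snd c \<circ> \<zeta>) has_vector_derivative X c (\<zeta> t)) (at t within {0..h})"
  using icurve_subset[OF \<zeta> is_interval_cc int0] unfolding integral_curve_def by (elim conjE)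
 from this[rule_format, of 0 c]
 have "((snd c \<circ> \<zeta>) has_vector_derivative X c (\<zeta> 0)) (at 0 within {0..h})" using c x zin h by simp
 then have "((transition c ?p \<circ> (snd c \<circ> \<zeta>)) has_derivative dtrans c ?p x \<circ> (%t. t *\<^sub>R X c x)) (at 0 within {0..h})"
  unfolding has_vector_derivative_def zin
 proof (rule diff_chain_within)
  show "(transition c ?p has_derivative dtrans c ?p x) (at ((snd c \<circ> \<zeta>) 0) within (snd c \<circ> \<zeta>) ` {0..h})"
   using has_derivative_at_withinI[OF dtrans_has_derivative[OF c1 p1, of x]] x zin by simp
 qed
 moreover have "dtrans c ?p x \<circ> (%t. t *\<^sub>R X c x) = (%t. t *\<^sub>R dtrans c ?p x (X c x))"
  using linear_scale[OF dtrans_linear[OF c1 p1, of x]] x by auto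
 ultimately have 1: "((transition c ?p \<circ> (snd c \<circ> \<zeta>)) has_vector_derivative dtrans c ?p x (X c x)) (at 0 within {0..h})"
  by (simp add: has_vector_derivative_def)
 obtain e where e: "e > 0" "!!t. t \<in> {0..S+h} ==> \<bar>t - 0\<bar> < e ==> \<zeta> t \<in> fst c"
  using icurve_near[OF \<zeta> is_chartD(1)[OF atlas_chart[OF c]], of 0] x zin S h by auto
 have 2: "((%t. snd d (\<zeta> (t + S))) has_vector_derivative dtrans c ?p x (X c x)) (at 0 within {0..h})"
 proof (rule has_vector_derivative_transform_within[OF 1 e(1)])
  fix t assume t: "t \<in> {0..h}" "dist t 0 < e"
  have "\<zeta> t \<in> fst c" by (rule e(2)) (use t int0 in auto)
  then have "(transition c ?p \<circ> (snd c \<circ> \<zeta>)) t = snd ?p (\<zeta> t)"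
   using transition_apply[OF atlas_chart[OF c]] by simp
  then show "(transition c ?p \<circ> (snd c \<circ> \<zeta>)) t = snd d (\<zeta> (t + S))" using pz[OF t(1)] by simp
 qed (use h in simp)
 have "icurve {0..h} (%t. \<zeta> (t + S))" by (rule icurve_shift[OF \<zeta> is_interval_cc]) (use S in auto)
 from icurve_in_chart[OF d this, of 0] \<zeta>S[of 0] \<Phi>0[OF O'] dl(3) h
 have 3: "((%t. snd d (\<zeta> (t + S))) has_vector_derivative F (snd d (dl S))) (at 0 within {0..h})" by (simp add: o_def)
 have "dtrans c ?p x (X c x) = F (snd d (dl S))"
 proof (rule vector_derivative_unique_within[OF _ 2 3])
  show "at 0 within {0..h} ~= bot" using at_within_Icc_at_right[OF h] trivial_limit_at_right_real by simp
 qed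
 then show "dtrans c ?p x (X c x) = F (snd ?p x)" using dl(4) by simp
qed

text \<open>Linear changes of coordinates.\<close>

lemma C1chart_linear:
 assumes d: "C1chart d" and B: "linear B" "linear B'" "!!x. B' (B x) = x" "!!x. B (B' x) = x"
 shows "C1chart (fst d, %x. B (snd d x))"
  and "x \<in> fst d ==> x \<in> fst c ==> C1chart c ==> dtrans c (fst d, %x. B (snd d x)) x v = B (dtrans c d x v)"
proof -
 note dc = C1chart_is_chart[OF d]
 let ?d = "(fst d, %x. B (snd d x))"
 have lin1: "Ck_on 1 UNIV L" if "linear L" for L :: "real^3 => real^3"
  by (rule Ck_on_1I[where f' = "%x. L"]) (use that in \<open>auto simp: linear_imp_has_derivative\<close>)
 have cB: "continuous_map euclidean euclidean B" using B(1) by (simp add: linear_continuous_on linear_linear)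
 have ch: "is_chart M ?d"
 proof (rule is_chart_invariance)
  show "continuous_map (subtopology M (fst d)) euclidean (%x. B (snd d x))"
   using continuous_map_compose[OF is_chartD(4)[OF dc] cB] by (simp add: o_def)
  show "inj_on (%x. B (snd d x)) (fst d)"
  proof (rule inj_onI)
   fix x y assume xy: "x \<in> fst d" "y \<in> fst d" "B (snd d x) = B (snd d y)"
   then have "snd d x = snd d y" using B(3) by metis
   then show "x = y" by (rule inj_onD[OF is_chartD(5)[OF dc]]) (use xy in auto)
  qed
 qed (use is_chartD[OF dc] ex_chart in auto)
 have inv: "chart_inv ?d (B (snd d x)) = x" if "x \<in> fst d" for x using chart_inv_left[OF ch, of x] that by simp
 show C: "C1chart ?d" unfolding C1_coordinates_def
 proof (intro conjI ballI ch)
  fix c assume c: "c \<in> A"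
  note cc = atlas_chart[OF c] and c1 = atlas_C1chart[OF c]
  have "transition c ?d = B \<circ> transition c d" by (rule ext) (simp add: transition_def)
  then show "Ck_on 1 (snd c ` (fst c \<inter> fst ?d)) (transition c ?d)"
   using C1_compose[OF C1chart_transition[OF c1 d] lin1[OF B(1)]] by simp
  let ?S = "(%x. B (snd d x)) ` (fst c \<inter> fst d)"
  have "Ck_on 1 ?S (transition d c \<circ> B')"
  proof (rule C1_compose[OF _ C1chart_transition[OF d c1]])
   show "Ck_on 1 ?S B'" by (rule Ck_on_subset[OF lin1[OF B(2)]]) simp
   show "open (snd d ` (fst d \<inter> fst c))" by (rule chart_overlap_open[OF dc cc])
   show "B' ` ?S \<subseteq> snd d ` (fst d \<inter> fst c)" using B(3) by auto
  qed
  moreover have "open (snd ?d ` (fst c \<inter> fst d))"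
   using is_chartD(1)[OF cc] is_chartD(1)[OF dc] by (intro chart_image_open[OF ch]) auto
  ultimately have "Ck_on 1 ?S (transition ?d c)"
  proof (elim Ck_on_1_cong)
   fix z assume "z \<in> ?S"
   then obtain x where x: "x \<in> fst d" "z = B (snd d x)" by auto
   then show "(transition d c \<circ> B') z = transition ?d c z" using inv[OF x(1)] B(3) dc by (simp add: transition_def)
  qed simp
  then show "Ck_on 1 (snd ?d ` (fst c \<inter> fst ?d)) (transition ?d c)" by simp
 qed
 show "dtrans c ?d x v = B (dtrans c d x v)" if x: "x \<in> fst d" "x \<in> fst c" and c: "C1chart c"
 proof -
  have e: "transition c ?d = B \<circ> transition c d" by (rule ext) (simp add: transition_def)
  have "((B \<circ> transition c d) has_derivative B \<circ> dtrans c d x) (at (snd c x))"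
   by (rule diff_chain_at[OF dtrans_has_derivative[OF c d x(2,1)] linear_imp_has_derivative[OF B(1)]])
  then have "B \<circ> dtrans c d x = dtrans c ?d x" unfolding e[symmetric] by (rule frechet_derivative_at)
  then show ?thesis by (metis comp_apply)
 qed
qed

lemma field_in_linear_change:
 assumes d: "field_in d F" and B: "linear B" "linear B'" "!!x. B' (B x) = x" "!!x. B (B' x) = x"
 shows "field_in (fst d, %x. B (snd d x)) (%y. B (F (B' y)))" unfolding field_in_def
proof (intro conjI ballI)
 have d1: "C1chart d" using d by (simp add: field_in_def)
 show "C1chart (fst d, %x. B (snd d x))" by (rule C1chart_linear(1)[OF d1 B])
 fix c x assume c: "c \<in> A" and x: "x \<in> fst c \<inter> fst (fst d, %x. B (snd d x))"
 have "dtrans c (fst d, %x. B (snd d x)) x (X c x) = B (dtrans c d x (X c x))"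
  using x by (intro C1chart_linear(2)[OF d1 B]) (auto intro: atlas_C1chart[OF c])
 also have "\<dots> = B (F (snd d x))" using d c x by (auto simp: field_in_def)
 finally show "dtrans c (fst d, %x. B (snd d x)) x (X c x) = B (F (B' (snd (fst d, %x. B (snd d x)) x)))" using B(3) by simp
qed

end

section \<open>Linear flows\<close>

definition linear_flow :: "(real^3 => real^3) => real => real^3 => real^3" where
 "linear_flow L t x = (\<chi> i. \<Sum>n. ((L ^^ n) x $ i / fact n) * t ^ n)"

lemma linear_components:
 fixes L :: "real^3 => real^3"
 assumes "linear L"
 shows "L y $ i = (\<Sum>j\<in>UNIV. y $ j * L (axis j 1) $ i)"
proof -
 have "L y = L (\<Sum>j\<in>UNIV. y $ j *s axis j 1)" by (simp add: basis_expansion)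
 also have "\<dots> = (\<Sum>j\<in>UNIV. y $ j *s L (axis j 1))"
  using assms by (simp add: linear_sum linear_scale scalar_mult_eq_scaleR)
 finally have "L y $ i = (\<Sum>j\<in>UNIV. y $ j *s L (axis j 1)) $ i" by (rule arg_cong)
 then show ?thesis by (simp add: sum_component)
qed

lemma has_vector_derivative_vec3:
 fixes u :: "real => real^3"
 shows "(u has_vector_derivative v) (at t within S) \<longleftrightarrow>
  (\<forall>i. ((%t. u t $ i) has_real_derivative v $ i) (at t within S))"
proof -
 have "(u has_vector_derivative v) (at t within S) \<longleftrightarrow>
  (\<forall>b\<in>Basis. ((%t. u t \<bullet> b) has_derivative (%x. (x *\<^sub>R v) \<bullet> b)) (at t within S))"
  unfolding has_vector_derivative_def by (rule has_derivative_componentwise_within)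
 also have "\<dots> \<longleftrightarrow> (\<forall>i. ((%t. u t $ i) has_derivative (%x. x * v $ i)) (at t within S))"
  by (simp add: Basis_vec_def inner_axis)
 also have "\<dots> \<longleftrightarrow> (\<forall>i. ((%t. u t $ i) has_real_derivative v $ i) (at t within S))"
 proof -
  have "(%x. x * v $ i) = (*) (v $ i)" for i by (rule ext) (simp add: mult.commute)
  then show ?thesis by (simp add: has_field_derivative_def)
 qed
 finally show ?thesis .
qed

context
 fixes L :: "real^3 => real^3"
 assumes lin: "linear L"
begin

lemma linear_flow_summable: "summable (%n. ((L ^^ n) x $ i / fact n) * t ^ n)"
proof -
 obtain K where K: "K > 0" "!!y. norm (L y) <= K * norm y" using linear_bounded_pos[OF lin] by blast
 have pow: "norm ((L ^^ n) x) <= K ^ n * norm x" for n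
 proof (induction n)
  case (Suc n)
  have "norm ((L ^^ Suc n) x) <= K * norm ((L ^^ n) x)" using K(2) by simp
  also have "\<dots> <= K * (K ^ n * norm x)" using Suc K(1) by (intro mult_left_mono) auto
  finally show ?case by (simp add: mult.assoc)
 qed simp
 show ?thesis
 proof (rule summable_comparison_test')
  show "summable (%n. norm x * (inverse (fact n) * (K * \<bar>t\<bar>) ^ n))" by (intro summable_mult summable_exp)
  fix n :: nat
  have "\<bar>(L ^^ n) x $ i\<bar> <= K ^ n * norm x" using component_le_norm_cart pow order_trans by blast
  then have "\<bar>(L ^^ n) x $ i\<bar> / fact n * \<bar>t\<bar> ^ n <= K ^ n * norm x / fact n * \<bar>t\<bar> ^ n"
   by (intro mult_right_mono divide_right_mono) auto
  then show "norm (((L ^^ n) x $ i / fact n) * t ^ n) <= norm x * (inverse (fact n) * (K * \<bar>t\<bar>) ^ n)"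
   by (simp add: abs_mult power_abs power_mult_distrib field_simps)
 qed
qed

lemma linear_flow_commute: "linear_flow L t (L x) = L (linear_flow L t x)"
proof -
 have "linear_flow L t (L x) $ i = L (linear_flow L t x) $ i" for i
 proof -
  have "(L ^^ n) (L x) $ i = (\<Sum>j\<in>UNIV. (L ^^ n) x $ j * L (axis j 1) $ i)" for n
   using linear_components[OF lin, of "(L ^^ n) x" i] by (simp add: funpow_swap1)
  then have "linear_flow L t (L x) $ i
    = (\<Sum>n. \<Sum>j\<in>UNIV. L (axis j 1) $ i * ((L ^^ n) x $ j / fact n * t ^ n))"
   by (simp add: linear_flow_def sum_divide_distrib sum_distrib_left field_simps)
  also have "\<dots> = (\<Sum>j\<in>UNIV. \<Sum>n. L (axis j 1) $ i * ((L ^^ n) x $ j / fact n * t ^ n))"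
   by (rule suminf_sum) (intro summable_mult linear_flow_summable)
  also have "\<dots> = (\<Sum>j\<in>UNIV. L (axis j 1) $ i * linear_flow L t x $ j)"
  proof (rule sum.cong[OF refl])
   fix j
   have "linear_flow L t x $ j = (\<Sum>n. (L ^^ n) x $ j / fact n * t ^ n)" by (simp add: linear_flow_def)
   then show "(\<Sum>n. L (axis j 1) $ i * ((L ^^ n) x $ j / fact n * t ^ n)) = L (axis j 1) $ i * linear_flow L t x $ j"
    using suminf_mult[OF linear_flow_summable] by metis
  qed
  finally show ?thesis using linear_components[OF lin, of "linear_flow L t x" i] by (simp add: mult.commute)
 qed
 then show ?thesis by (simp add: vec_eq_iff)
qed

lemma linear_flow_derivative:
 "((%t. linear_flow L t x) has_vector_derivative L (linear_flow L t x)) (at t within S)"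
 unfolding has_vector_derivative_vec3
proof
 fix i
 let ?c = "%n. (L ^^ n) x $ i / fact n"
 have "((%t. \<Sum>n. ?c n * t ^ n) has_field_derivative (\<Sum>n. diffs ?c n * t ^ n)) (at t)"
  by (rule termdiffs_strong_converges_everywhere) (rule linear_flow_summable)
 moreover have "diffs ?c n = (L ^^ n) (L x) $ i / fact n" for n
 proof -
  have "(L ^^ Suc n) x = (L ^^ n) (L x)" by (simp add: funpow_swap1)
  then have "diffs ?c n = of_nat (Suc n) * ((L ^^ n) (L x) $ i / fact (Suc n))" unfolding diffs_def by simp
  also have "\<dots> = (L ^^ n) (L x) $ i / fact n" by (simp add: field_simps del: of_nat_Suc)
  finally show ?thesis .
 qed
 ultimately have "((%t. \<Sum>n. ?c n * t ^ n) has_field_derivative linear_flow L t (L x) $ i) (at t)"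
  by (simp add: linear_flow_def)
 then have "((%t. linear_flow L t x $ i) has_real_derivative L (linear_flow L t x) $ i) (at t)"
  unfolding linear_flow_commute by (simp add: linear_flow_def)
 then show "((%t. linear_flow L t x $ i) has_real_derivative L (linear_flow L t x) $ i) (at t within S)"
  by (rule has_field_derivative_at_within)
qed

lemma linear_flow_0: "linear_flow L 0 x = x"
proof -
 have "(\<Sum>n. ((L ^^ n) x $ i / fact n) * 0 ^ n) = x $ i" for i
  using suminf_finite[of "{0}" "%n. ((L ^^ n) x $ i / fact n) * 0 ^ n"] by simp
 then show ?thesis by (simp add: linear_flow_def vec_eq_iff)
qed

lemma linear_C1: "Ck_on 1 UNIV L" by (rule Ck_on_1I[where f' = "%x. L"]) (auto simp: linear_imp_has_derivative lin)

lemma linear_flow_unique: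
 assumes u: "!!t. t \<in> {a..b} ==> (u has_vector_derivative L (u t)) (at t within {a..b})"
  and s: "s \<in> {a..b}" and t: "t \<in> {a..b}"
 shows "u t = linear_flow L (t - s) (u s)"
proof (rule ode_unique_interval[OF open_UNIV linear_C1 _ _ s _ t])
 fix r assume r: "r \<in> {a..b}"
 show "u r \<in> UNIV & (u has_vector_derivative L (u r)) (at r within {a..b})" using u[OF r] by simp
 have "((%r. r - s) has_vector_derivative 1) (at r within {a..b})" by (auto intro!: derivative_eq_intros)
 from vector_diff_chain_within[OF this linear_flow_derivative]
 have "((%r. linear_flow L (r - s) (u s)) has_vector_derivative L (linear_flow L (r - s) (u s))) (at r within {a..b})"
  by (simp add: o_def)
 then show "linear_flow L (r - s) (u s) \<in> UNIV &
  ((%r. linear_flow L (r - s) (u s)) has_vector_derivative L (linear_flow L (r - s) (u s))) (at r within {a..b})" by simp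
qed (simp add: linear_flow_0)

lemma linear_flow_linear: "linear (linear_flow L t)"
proof (rule linearI)
 have *: "t \<in> {-\<bar>t\<bar>..\<bar>t\<bar>}" "0 \<in> {-\<bar>t\<bar>..\<bar>t\<bar>}" by auto
 fix x y
 have "linear_flow L t x + linear_flow L t y = linear_flow L (t - 0) (linear_flow L 0 x + linear_flow L 0 y)"
  by (rule linear_flow_unique[OF _ *(2,1)])
   (auto intro!: derivative_eq_intros linear_flow_derivative simp: linear_add[OF lin])
 then show "linear_flow L t (x + y) = linear_flow L t x + linear_flow L t y" by (simp add: linear_flow_0)
next
 have *: "t \<in> {-\<bar>t\<bar>..\<bar>t\<bar>}" "0 \<in> {-\<bar>t\<bar>..\<bar>t\<bar>}" by auto
 fix r x
 have "r *\<^sub>R linear_flow L t x = linear_flow L (t - 0) (r *\<^sub>R linear_flow L 0 x)"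
 proof (rule linear_flow_unique[OF _ *(2,1)])
  fix s
  show "((%s. r *\<^sub>R linear_flow L s x) has_vector_derivative L (r *\<^sub>R linear_flow L s x)) (at s within {-\<bar>t\<bar>..\<bar>t\<bar>})"
   unfolding linear_scale[OF lin]
   by (rule bounded_linear.has_vector_derivative[OF bounded_linear_scaleR_right linear_flow_derivative])
 qed
 then show "linear_flow L t (r *\<^sub>R x) = r *\<^sub>R linear_flow L t x" by (simp add: linear_flow_0)
qed

lemma linear_flow_add: "linear_flow L (s + t) x = linear_flow L s (linear_flow L t x)"
proof -
 let ?I = "{-(\<bar>s\<bar>+\<bar>t\<bar>)..\<bar>s\<bar>+\<bar>t\<bar>}"
 have "linear_flow L (s + t) x = linear_flow L (s + t - t) (linear_flow L t x)"
  by (rule linear_flow_unique[of "-(\<bar>s\<bar>+\<bar>t\<bar>)" "\<bar>s\<bar>+\<bar>t\<bar>"]) (auto intro!: linear_flow_derivative)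
 then show ?thesis by simp
qed

lemma linear_flow_cancel: "linear_flow L (- t) (linear_flow L t x) = x" "linear_flow L t (linear_flow L (- t) x) = x"
 using linear_flow_add[of "-t" t x] linear_flow_add[of t "-t" x] by (simp_all add: linear_flow_0)

lemma linear_flow_continuous: "continuous_on S (linear_flow L t)"
 using linear_flow_linear linear_continuous_on linear_linear by blast

lemma linear_flow_continuous_time: "continuous_on S (%t. linear_flow L t x)"
 using linear_flow_derivative by (rule has_vector_derivative_continuous_on)

end

section \<open>Saddles with a stable plane and an expanding axis\<close>

text \<open>Every saddle is brought to this form, up to a reversal of time; the strict inequality on the plane
 makes Euclidean circles in the plane transverse to the flow.\<close>

locale saddle_form =
 fixes L :: "real^3 => real^3" and \<mu> \<alpha> :: real
 assumes lin: "linear L" and \<mu>: "\<mu> > 0" and \<alpha>: "\<alpha> > 0"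
  and L1: "L y $ 1 = \<mu> * y $ 1"
  and Laxis: "L (axis 1 1) = \<mu> *\<^sub>R axis 1 1"
  and Lplane: "y $ 1 = 0 ==> y \<bullet> L y <= - \<alpha> * (y \<bullet> y)"
begin

abbreviation "E \<equiv> linear_flow L"

lemma E1: "E t y $ 1 = exp (\<mu> * t) * y $ 1"
proof -
 have "((%t. exp (- \<mu> * t) * (E t y $ 1)) has_real_derivative 0) (at t)" for t
 proof -
  have "((%t. E t y $ 1) has_real_derivative \<mu> * E t y $ 1) (at t)"
   using iffD1[OF has_vector_derivative_vec3 linear_flow_derivative[OF lin, of y t UNIV], rule_format, of 1] unfolding L1 .
  then show ?thesis by (auto intro!: derivative_eq_intros simp: algebra_simps)
 qed
 then have "exp (- \<mu> * t) * (E t y $ 1) = exp (- \<mu> * 0) * (E 0 y $ 1)" by (intro DERIV_isconst_all) auto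
 then have "exp (- \<mu> * t) * (E t y $ 1) = y $ 1" by (simp add: linear_flow_0[OF lin])
 then have "exp (\<mu> * t) * y $ 1 = (exp (\<mu> * t) * exp (- \<mu> * t)) * (E t y $ 1)" by simp
 also have "exp (\<mu> * t) * exp (- \<mu> * t) = 1" by (simp add: exp_minus)
 finally show ?thesis by simp
qed

lemma E_axis: "E t (axis 1 1) = exp (\<mu> * t) *\<^sub>R axis 1 1"
proof -
 have *: "t \<in> {-\<bar>t\<bar>..\<bar>t\<bar>}" "0 \<in> {-\<bar>t\<bar>..\<bar>t\<bar>}" by auto
 have "exp (\<mu> * t) *\<^sub>R axis 1 1 = E (t - 0) (exp (\<mu> * 0) *\<^sub>R axis 1 1)"
 proof (rule linear_flow_unique[OF lin _ *(2,1)])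
  fix s
  have "((%s. exp (\<mu> * s)) has_real_derivative exp (\<mu> * s) * \<mu>) (at s within {-\<bar>t\<bar>..\<bar>t\<bar>})"
   by (auto intro!: derivative_eq_intros)
  then have "((%s. exp (\<mu> * s) *\<^sub>R axis 1 1) has_vector_derivative (exp (\<mu> * s) * \<mu>) *\<^sub>R axis 1 1) (at s within {-\<bar>t\<bar>..\<bar>t\<bar>})"
   unfolding has_real_derivative_iff_has_vector_derivative
   by (rule bounded_linear.has_vector_derivative[OF bounded_linear_scaleR_left])
  then show "((%s. exp (\<mu> * s) *\<^sub>R axis 1 1) has_vector_derivative L (exp (\<mu> * s) *\<^sub>R axis 1 1)) (at s within {-\<bar>t\<bar>..\<bar>t\<bar>})"
   by (simp add: linear_scale[OF lin] Laxis)
 qed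
 then show ?thesis by simp
qed

definition plane :: "real^3 => real^3" where "plane y = y - (y $ 1) *\<^sub>R axis 1 1"

lemma plane_linear: "linear plane" unfolding plane_def by (rule linearI) (auto simp: algebra_simps)

lemma plane_continuous: "continuous_on S plane" using plane_linear linear_continuous_on linear_linear by blast

lemma plane_simps [simp]: "plane y $ 1 = 0" "y $ 1 = 0 ==> plane y = y" "plane (plane y) = plane y"
 by (auto simp: plane_def axis_def)

lemma plane_decomp: "y = (y $ 1) *\<^sub>R axis 1 1 + plane y" by (simp add: plane_def)

lemma E_plane: "plane (E t y) = E t (plane y)"
proof -
 have "E t y = E t ((y $ 1) *\<^sub>R axis 1 1 + plane y)" using plane_decomp by metis
 also have "\<dots> = (y $ 1) *\<^sub>R E t (axis 1 1) + E t (plane y)"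
  by (simp add: linear_add[OF linear_flow_linear[OF lin]] linear_scale[OF linear_flow_linear[OF lin]])
 finally show ?thesis unfolding plane_def by (simp add: E_axis E1 plane_def[symmetric] mult.commute)
qed

lemma E_plane0: "y $ 1 = 0 ==> E t y $ 1 = 0" by (simp add: E1)

lemma E_decay:
 assumes y: "y $ 1 = 0" and t: "0 <= t"
 shows "norm (E t y) <= exp (- \<alpha> * t) * norm y"
proof -
 let ?f = "%s. exp (2 * \<alpha> * s) * (E s y \<bullet> E s y)"
 have "\<exists>d. (?f has_real_derivative d) (at s) & d <= 0" for s
 proof -
  have "((%s. E s y \<bullet> E s y) has_real_derivative E s y \<bullet> L (E s y) + L (E s y) \<bullet> E s y) (at s)"
   unfolding has_real_derivative_iff_has_vector_derivative
   by (rule bounded_bilinear.has_vector_derivative[OF bounded_bilinear_inner])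
    (rule linear_flow_derivative[OF lin])+
  then have 1: "(?f has_real_derivative exp (2 * \<alpha> * s) * (2 * \<alpha>) * (E s y \<bullet> E s y) + (E s y \<bullet> L (E s y) + L (E s y) \<bullet> E s y) * exp (2 * \<alpha> * s)) (at s)"
   by (auto intro!: derivative_eq_intros)
  have 2: "exp (2 * \<alpha> * s) * (2 * \<alpha>) * (E s y \<bullet> E s y) + (E s y \<bullet> L (E s y) + L (E s y) \<bullet> E s y) * exp (2 * \<alpha> * s)
   = exp (2 * \<alpha> * s) * (2 * (\<alpha> * (E s y \<bullet> E s y) + E s y \<bullet> L (E s y)))"
   by (simp add: algebra_simps inner_commute)
  have "\<alpha> * (E s y \<bullet> E s y) + E s y \<bullet> L (E s y) <= 0" using Lplane[OF E_plane0[OF y, of s]] by simp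
  then have "exp (2 * \<alpha> * s) * (2 * (\<alpha> * (E s y \<bullet> E s y) + E s y \<bullet> L (E s y))) <= 0"
   by (intro mult_nonneg_nonpos) auto
  then show ?thesis using 1 unfolding 2 by blast
 qed
 then have "?f t <= ?f 0" using t by (intro DERIV_nonpos_imp_nonincreasing[of 0 t ?f]) auto
 then have "exp (2 * \<alpha> * t) * (norm (E t y))\<^sup>2 <= (norm y)\<^sup>2"
  by (simp add: linear_flow_0[OF lin] power2_norm_eq_inner)
 then have "(exp (\<alpha> * t) * norm (E t y))\<^sup>2 <= (norm y)\<^sup>2"
  by (simp add: power_mult_distrib flip: exp_double) (simp add: mult.assoc)
 then have "exp (\<alpha> * t) * norm (E t y) <= norm y" by (rule power2_le_imp_le) simp
 then show ?thesis by (simp add: exp_minus field_simps)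
qed

lemma E_growth:
 assumes y: "y $ 1 = 0" and t: "0 <= t"
 shows "norm (E (- t) y) \<ge> exp (\<alpha> * t) * norm y"
proof -
 have "norm (E t (E (- t) y)) <= exp (- \<alpha> * t) * norm (E (- t) y)" by (rule E_decay[OF E_plane0[OF y] t])
 then show ?thesis by (simp add: linear_flow_cancel[OF lin] exp_minus field_simps)
qed

lemma E_strict_decay:
 assumes y: "y $ 1 = 0" "y ~= 0" and st: "s < t"
 shows "norm (E t y) < norm (E s y)"
proof -
 have "E s y ~= 0" using linear_flow_cancel(1)[OF lin, of s y] linear_0[OF linear_flow_linear[OF lin]] y(2) by metis
 have "norm (E ((t - s) + s) y) <= exp (- \<alpha> * (t - s)) * norm (E s y)"
  unfolding linear_flow_add[OF lin] using st by (intro E_decay E_plane0 y) auto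
 also have "\<dots> < 1 * norm (E s y)" using \<alpha> st \<open>E s y ~= 0\<close> by (intro mult_strict_right_mono) auto
 finally show ?thesis by simp
qed

text \<open>The time at which the orbit of \<open>y\<close> in the stable plane crosses the unit circle.\<close>

definition cross :: "real^3 => real" where "cross y = (THE t. norm (E t (plane y)) = 1)"

lemma cross_unique:
 assumes y: "plane y ~= 0" and t: "norm (E t (plane y)) = 1"
 shows "cross y = t" unfolding cross_def
proof (rule the_equality)
 show "norm (E t (plane y)) = 1" by (rule t)
 fix s assume "norm (E s (plane y)) = 1"
 then show "s = t" using E_strict_decay[of "plane y" s t] E_strict_decay[of "plane y" t s] y t
  by (metis linorder_neqE_linordered_idom order_less_irrefl plane_simps(1))
qed

lemma cross_exists:
 assumes y: "plane y ~= 0"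
 shows "\<exists>t. norm (E t (plane y)) = 1"
proof -
 let ?n = "norm (plane y)"
 have n: "?n > 0" using y by simp
 define T where "T = (\<bar>ln ?n\<bar> + 1) / \<alpha>"
 have T: "T \<ge> 0" "\<alpha> * T = \<bar>ln ?n\<bar> + 1" using \<alpha> by (auto simp: T_def)
 have e: "exp (\<alpha> * T) \<ge> ?n" "exp (\<alpha> * T) * ?n \<ge> 1"
 proof -
  have "?n = exp (ln ?n)" using n by simp
  also have "\<dots> <= exp (\<alpha> * T)" unfolding T(2) by simp
  finally show "exp (\<alpha> * T) \<ge> ?n" .
  have "exp (\<alpha> * T) * ?n = exp (\<alpha> * T + ln ?n)" using n by (simp add: exp_add)
  also have "\<dots> \<ge> 1" unfolding T(2) by simp
  finally show "exp (\<alpha> * T) * ?n \<ge> 1" .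
 qed
 have "norm (E T (plane y)) <= exp (- \<alpha> * T) * ?n" by (rule E_decay[OF _ T(1)]) simp
 also have "\<dots> <= 1" using e(1) by (simp add: exp_minus field_simps)
 finally have hi: "norm (E T (plane y)) <= 1" .
 have lo: "1 <= norm (E (- T) (plane y))" using E_growth[of "plane y" T] T(1) e(2) by simp
 have "continuous_on {-T..T} (%t. norm (E t (plane y)))" by (intro continuous_on_norm linear_flow_continuous_time[OF lin])
 then show ?thesis using IVT2'[of "%t. norm (E t (plane y))" T 1 "-T"] hi lo T(1) by auto
qed

lemma cross_norm: "plane y ~= 0 ==> norm (E (cross y) (plane y)) = 1" using cross_exists cross_unique by metis

lemma cross_less:
 assumes y: "plane y ~= 0"
 shows "cross y < b \<longleftrightarrow> norm (E b (plane y)) < 1"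
proof -
 note s = E_strict_decay[of "plane y", OF plane_simps(1) y]
 show ?thesis using s[of "cross y" b] s[of b "cross y"] cross_norm[OF y]
  by (metis linorder_neqE_linordered_idom order_less_asym order_less_irrefl)
qed

lemma cross_greater:
 assumes y: "plane y ~= 0"
 shows "b < cross y \<longleftrightarrow> norm (E b (plane y)) > 1"
proof -
 note s = E_strict_decay[of "plane y", OF plane_simps(1) y]
 show ?thesis using s[of "cross y" b] s[of b "cross y"] cross_norm[OF y]
  by (metis linorder_neqE_linordered_idom order_less_asym order_less_irrefl)
qed

lemma plane_E_nonzero: "plane y ~= 0 ==> plane (E t y) ~= 0"
 using linear_flow_cancel(1)[OF lin, of t "plane y"] linear_0[OF linear_flow_linear[OF lin]] unfolding E_plane by metis

lemma cross_E:
 assumes y: "plane y ~= 0"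
 shows "cross (E t y) = cross y - t"
proof (rule cross_unique[OF plane_E_nonzero[OF y]])
 have "E (cross y - t) (E t (plane y)) = E (cross y) (plane y)"
  using linear_flow_add[OF lin, of "cross y - t" t "plane y"] by simp
 then show "norm (E (cross y - t) (plane (E t y))) = 1" unfolding E_plane using cross_norm[OF y] by simp
qed

lemma cross_continuous: "continuous_on {y. plane y ~= 0} cross"
proof -
 have op: "open {y. plane y ~= 0}"
 proof -
  have "{y. plane y ~= 0} = plane -` (- {0})" by auto
  then show ?thesis using open_vimage[OF _ plane_continuous, of "- {0}"] by auto
 qed
 have c: "continuous_on UNIV (%y. norm (E b (plane y)))" for b
  by (intro continuous_on_norm continuous_on_compose2[OF linear_flow_continuous[OF lin] plane_continuous]) auto
 show ?thesis unfolding continuous_on_eq_continuous_at[OF op]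
 proof
  fix y assume y: "y \<in> {y. plane y ~= 0}"
  show "isCont cross y" unfolding isCont_def
  proof (rule order_tendstoI)
   have evn: "\<forall>\<^sub>F z in at y. plane z ~= 0" using eventually_at_in_open'[OF op y] by (rule eventually_mono) simp
   fix a assume "a < cross y"
   then have "norm (E a (plane y)) > 1" using cross_greater y by simp
   moreover have "((%y. norm (E a (plane y))) \<longlongrightarrow> norm (E a (plane y))) (at y)"
    using c[of a] by (simp add: continuous_on_eq_continuous_at isCont_def)
   ultimately have "\<forall>\<^sub>F z in at y. norm (E a (plane z)) > 1" by (rule order_tendstoD(1)[rotated])
   then show "\<forall>\<^sub>F z in at y. a < cross z" using evn by eventually_elim (simp add: cross_greater)
  next
   have evn: "\<forall>\<^sub>F z in at y. plane z ~= 0" using eventually_at_in_open'[OF op y] by (rule eventually_mono) simp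
   fix a assume "a > cross y"
   then have "norm (E a (plane y)) < 1" using cross_less y by simp
   moreover have "((%y. norm (E a (plane y))) \<longlongrightarrow> norm (E a (plane y))) (at y)"
    using c[of a] by (simp add: continuous_on_eq_continuous_at isCont_def)
   ultimately have "\<forall>\<^sub>F z in at y. norm (E a (plane z)) < 1" by (rule order_tendstoD(2)[rotated])
   then show "\<forall>\<^sub>F z in at y. cross z < a" using evn by eventually_elim (simp add: cross_less)
  qed
 qed
qed

text \<open>Signed power: conjugates multiplication by \<open>exp (\<mu> t)\<close> to multiplication by \<open>exp t\<close>.\<close>

definition hat :: "real => real" where "hat x = sgn x * \<bar>x\<bar> powr (1/\<mu>)"

lemma hat_0 [simp]: "hat 0 = 0" by (simp add: hat_def)

lemma hat_scale: "hat (exp (\<mu> * t) * x) = exp t * hat x"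
 using \<mu> by (simp add: hat_def abs_mult powr_mult sgn_mult exp_powr_real)

lemma hat_strict_mono: "x < y ==> hat x < hat y"
proof -
 assume xy: "x < y"
 consider "0 <= x" | "x < 0" "0 < y" | "y <= 0" using xy by linarith
 then show "hat x < hat y"
 proof cases
  case 1
  then have "\<bar>x\<bar> powr (1/\<mu>) < \<bar>y\<bar> powr (1/\<mu>)" using xy \<mu> by (intro powr_less_mono2) auto
  then show ?thesis using 1 xy by (cases "x = 0") (auto simp: hat_def)
 next
  case 2
  then show ?thesis by (simp add: hat_def) (smt (verit) powr_gt_zero)
 next
  case 3
  then have "\<bar>y\<bar> powr (1/\<mu>) < \<bar>x\<bar> powr (1/\<mu>)" using xy \<mu> by (intro powr_less_mono2) auto
  then show ?thesis using 3 xy by (cases "y = 0") (auto simp: hat_def)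
 qed
qed

lemma hat_inject: "hat x = hat y \<longleftrightarrow> x = y"
 using hat_strict_mono by (metis linorder_neqE_linordered_idom order_less_irrefl)

lemma hat_eq_0 [simp]: "hat x = 0 \<longleftrightarrow> x = 0" using hat_inject[of x 0] by simp

lemma hat_continuous: "continuous_on S hat"
proof -
 have "hat = (%x. (if x <= 0 then - ((- x) powr (1/\<mu>)) else x powr (1/\<mu>)))" by (rule ext) (auto simp: hat_def sgn_if)
 moreover have "continuous_on (UNIV :: real set) (%x. (if x <= 0 then - ((- x) powr (1/\<mu>)) else x powr (1/\<mu>)))"
 proof -
  have "continuous_on ({..0} \<union> {0..}) (%x::real. (if x <= 0 then - ((- x) powr (1/\<mu>)) else x powr (1/\<mu>)))"
  proof (rule continuous_on_cases)
   show "continuous_on {..0} (%x::real. - ((- x) powr (1/\<mu>)))"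
    using \<mu> by (intro continuous_on_minus continuous_on_powr' continuous_intros) auto
   show "continuous_on {0..} (%x::real. x powr (1/\<mu>))" using \<mu> by (intro continuous_on_powr' continuous_intros) auto
  qed auto
  moreover have "{..0} \<union> {0..} = (UNIV :: real set)" by auto
  ultimately show ?thesis by simp
 qed
 ultimately show ?thesis using continuous_on_subset by (metis subset_UNIV)
qed

text \<open>A homeomorphism onto its image conjugating the linear flow to the one with all rates equal to one.\<close>

definition unit_form :: "real^3 => real^3" where
 "unit_form y = hat (y $ 1) *\<^sub>R axis 1 1 +
  (if plane y = 0 then 0 else exp (cross y) *\<^sub>R E (cross y) (plane y))"

lemma unit_form_1 [simp]: "unit_form y $ 1 = hat (y $ 1)" by (auto simp: unit_form_def axis_def E_plane0)

lemma plane_unit_form: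
 "plane (unit_form y) = (if plane y = 0 then 0 else exp (cross y) *\<^sub>R E (cross y) (plane y))"
 unfolding plane_def[of "unit_form y"] unit_form_1 by (simp add: unit_form_def)

lemma norm_plane_unit_form:
 "norm (plane (unit_form y)) = (if plane y = 0 then 0 else exp (cross y))"
 by (simp add: plane_unit_form cross_norm)

lemma unit_form_inj: "unit_form y = unit_form z ==> y = z"
proof -
 assume eq: "unit_form y = unit_form z"
 then have 1: "y $ 1 = z $ 1" using unit_form_1 hat_inject by metis
 have n: "(if plane y = 0 then 0 else exp (cross y)) = (if plane z = 0 then 0 else exp (cross z))"
  using norm_plane_unit_form[of y] norm_plane_unit_form[of z] eq by simp
 have "plane y = plane z"
 proof (cases "plane y = 0")
  case True
  then show ?thesis using n by (auto split: if_splits)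
 next
  case False
  then have z: "plane z ~= 0" and c: "cross y = cross z" using n by (auto split: if_splits)
  have "exp (cross y) *\<^sub>R E (cross y) (plane y) = exp (cross z) *\<^sub>R E (cross z) (plane z)"
   using plane_unit_form[of y] plane_unit_form[of z] eq False z by simp
  then have "E (cross y) (plane y) = E (cross y) (plane z)" using c by simp
  then show ?thesis using linear_flow_cancel(1)[OF lin] by metis
 qed
 then show "y = z" using 1 plane_decomp by metis
qed

lemma unit_form_flow:
 "unit_form (E t y) $ 1 = exp t * unit_form y $ 1"
 "plane (unit_form (E t y)) = exp (- t) *\<^sub>R plane (unit_form y)"
proof -
 show "unit_form (E t y) $ 1 = exp t * unit_form y $ 1" using hat_scale[of t "y $ 1"] by (simp add: E1)
 show "plane (unit_form (E t y)) = exp (- t) *\<^sub>R plane (unit_form y)"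
 proof (cases "plane y = 0")
  case True
  then have "plane (E t y) = 0" by (simp add: E_plane linear_0[OF linear_flow_linear[OF lin]])
  then show ?thesis using True by (simp add: plane_unit_form)
 next
  case False
  have "E (cross y - t) (E t (plane y)) = E (cross y) (plane y)"
   using linear_flow_add[OF lin, of "cross y - t" t "plane y"] by simp
  moreover have "exp (cross y - t) = exp (- t) * exp (cross y)" by (simp flip: exp_add)
  ultimately show ?thesis using False plane_E_nonzero[OF False] by (simp add: plane_unit_form cross_E E_plane)
 qed
qed

lemma E_joint_continuous:
 assumes "(s \<longlongrightarrow> s0) F" "(v \<longlongrightarrow> v0) F"
 shows "((%x. E (s x) (v x)) \<longlongrightarrow> E s0 v0) F"
proof -
 have rep: "E t w = (\<Sum>j\<in>UNIV. (w $ j) *\<^sub>R E t (axis j 1))" for t w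
 proof -
  have "E t w = E t (\<Sum>j\<in>UNIV. (w $ j) *\<^sub>R axis j 1)"
   using basis_expansion[of w] by (simp add: scalar_mult_eq_scaleR)
  then show ?thesis by (simp add: linear_sum[OF linear_flow_linear[OF lin]] linear_scale[OF linear_flow_linear[OF lin]])
 qed
 have "((%x. \<Sum>j\<in>UNIV. (v x $ j) *\<^sub>R E (s x) (axis j 1)) \<longlongrightarrow> (\<Sum>j\<in>UNIV. (v0 $ j) *\<^sub>R E s0 (axis j 1))) F"
 proof (intro tendsto_sum tendsto_scaleR tendsto_vec_nth assms(2))
  fix j
  have "isCont (%t. E t (axis j 1)) s0"
   using linear_flow_continuous_time[OF lin, of UNIV] by (simp add: continuous_on_eq_continuous_at)
  then show "((%x. E (s x) (axis j 1)) \<longlongrightarrow> E s0 (axis j 1)) F"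
   using assms(1) by (rule isCont_tendsto_compose)
 qed
 then show ?thesis by (simp flip: rep)
qed

lemma unit_form_continuous: "continuous_on UNIV unit_form"
proof -
 let ?g = "%y. if plane y = 0 then 0 else exp (cross y) *\<^sub>R E (cross y) (plane y)"
 have op: "open {y. plane y ~= 0}"
 proof -
  have "{y. plane y ~= 0} = plane -` (- {0})" by auto
  then show ?thesis using open_vimage[OF _ plane_continuous, of "- {0}"] by auto
 qed
 have "isCont ?g y" for y
 proof (cases "plane y = 0")
  case False
  then have y: "y \<in> {y. plane y ~= 0}" by simp
  have cc: "(cross \<longlongrightarrow> cross y) (at y)"
   using cross_continuous y unfolding continuous_on_eq_continuous_at[OF op] isCont_def by blast
  have pc: "(plane \<longlongrightarrow> plane y) (at y)"
   using plane_continuous[of UNIV] by (simp add: continuous_on_eq_continuous_at isCont_def)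
  have "((%y. exp (cross y) *\<^sub>R E (cross y) (plane y)) \<longlongrightarrow> exp (cross y) *\<^sub>R E (cross y) (plane y)) (at y)"
   by (intro tendsto_scaleR tendsto_exp cc E_joint_continuous pc)
  moreover have "\<forall>\<^sub>F z in at y. exp (cross z) *\<^sub>R E (cross z) (plane z) = ?g z"
   using eventually_at_in_open'[OF op y] by (rule eventually_mono) simp
  ultimately show ?thesis unfolding isCont_def using False by (auto elim: Lim_transform_eventually)
 next
  case True
  have nb: "\<exists>d>0. \<forall>z. dist z y < d --> norm (?g z) < e" if e: "e > 0" for e
  proof -
   have "continuous_on UNIV (%z. norm (E (ln e) (plane z)))"
    by (intro continuous_on_norm continuous_on_compose2[OF linear_flow_continuous[OF lin] plane_continuous]) auto
   then have "((%z. norm (E (ln e) (plane z))) \<longlongrightarrow> norm (E (ln e) (plane y))) (at y)"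
    by (simp add: continuous_on_eq_continuous_at isCont_def)
   then have "\<forall>\<^sub>F z in at y. norm (E (ln e) (plane z)) < 1"
    by (rule order_tendstoD(2)) (simp add: True linear_0[OF linear_flow_linear[OF lin]])
   then obtain d where d: "d > 0" "!!z. z ~= y ==> dist z y < d ==> norm (E (ln e) (plane z)) < 1"
    unfolding eventually_at by auto
   have "norm (?g z) < e" if z: "dist z y < d" for z
   proof (cases "plane z = 0")
    case False
    then have "z ~= y" using True by auto
    then have "cross z < ln e" using d(2) z cross_less[OF False] by blast
    then have "exp (cross z) < e" using e by (metis exp_less_mono exp_ln)
    then show ?thesis using False by (simp add: cross_norm)
   qed (use e in simp)
   then show ?thesis using d(1) by blast
  qed
  show ?thesis unfolding isCont_def LIM_eq
  proof (intro allI impI)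
   fix e :: real assume "0 < e"
   then obtain d where d: "d > 0" "!!z. dist z y < d ==> norm (?g z) < e" using nb by blast
   have "?g y = 0" using True by simp
   then have "norm (?g z - ?g y) < e" if "norm (z - y) < d" for z
    using d(2)[of z] that by (simp only: dist_norm diff_0_right)
   then show "\<exists>s>0. \<forall>z. z ~= y & norm (z - y) < s --> norm (?g z - ?g y) < e" using d(1) by blast
  qed
 qed
 then have 1: "continuous_on UNIV ?g" by (simp add: continuous_on_eq_continuous_at)
 have 2: "continuous_on UNIV (%y. hat (y $ 1) *\<^sub>R axis 1 1 :: real^3)"
  by (intro continuous_intros continuous_on_compose2[OF hat_continuous[of UNIV]]) auto
 show ?thesis using continuous_on_add[OF 2 1] by (simp add: unit_form_def)
qed

lemma unit_form_axis2: "unit_form (axis 2 1) = axis 2 1"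
proof -
 have p: "plane (axis 2 1 :: real^3) = axis 2 1" by (auto simp: plane_def axis_def)
 have "norm (E 0 (plane (axis 2 1))) = 1" using p by (simp add: linear_flow_0[OF lin])
 then have "cross (axis 2 1) = 0" using cross_unique[of "axis 2 1" 0] p by (simp add: axis_eq_0_iff)
 then show ?thesis unfolding unit_form_def p by (simp add: linear_flow_0[OF lin] axis_def vec_eq_iff)
qed

lemma unit_form_0: "unit_form 0 = 0" by (simp add: unit_form_def linear_0[OF plane_linear])

text \<open>The crossing time is locally Lipschitz.\<close>

lemma cross_lipschitz:
 assumes y: "plane y ~= 0" and z: "plane z ~= 0" and le: "cross y <= cross z"
 shows "\<alpha> * (cross z - cross y) <= norm (E (cross y) (plane z - plane y))"
proof -
 let ?c = "cross y" and ?h = "cross z - cross y"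
 have h: "?h \<ge> 0" using le by simp
 have "1 = norm (E ?h (E ?c (plane z)))" using cross_norm[OF z] linear_flow_add[OF lin, of ?h ?c "plane z"] by simp
 also have "\<dots> <= exp (- \<alpha> * ?h) * norm (E ?c (plane z))" by (rule E_decay[OF E_plane0 h]) simp
 finally have "1 <= exp (- (\<alpha> * ?h)) * norm (E ?c (plane z))" by simp
 then have "exp (\<alpha> * ?h) * 1 <= exp (\<alpha> * ?h) * (exp (- (\<alpha> * ?h)) * norm (E ?c (plane z)))"
  by (rule mult_left_mono) simp
 also have "\<dots> = norm (E ?c (plane z))" unfolding mult.assoc[symmetric] exp_add[symmetric] by simp
 finally have "exp (\<alpha> * ?h) <= norm (E ?c (plane z))" by simp
 moreover have "1 + \<alpha> * ?h <= exp (\<alpha> * ?h)" by (rule exp_ge_add_one_self)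
 moreover have "norm (E ?c (plane z)) <= norm (E ?c (plane y)) + norm (E ?c (plane z) - E ?c (plane y))"
  using norm_triangle_sub by blast
 moreover have "E ?c (plane z) - E ?c (plane y) = E ?c (plane z - plane y)"
  by (simp add: linear_diff[OF linear_flow_linear[OF lin]])
 ultimately have "1 + \<alpha> * ?h <= norm (E ?c (plane y)) + norm (E ?c (plane z - plane y))" by (metis order_trans)
 then show ?thesis unfolding cross_norm[OF y] by (rule add_le_imp_le_left)
qed

end

section \<open>Normal form of a linear saddle\<close>

definition indep3 :: "real^3 => real^3 => real^3 => bool" where
 "indep3 e f g \<longleftrightarrow> (\<forall>x y z. x *\<^sub>R e + y *\<^sub>R f + z *\<^sub>R g = 0 --> x = 0 & y = 0 & z = 0)"

definition frame :: "real^3 => real^3 => real^3 => real^3 => real^3" where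
 "frame e f g v = (v $ 1) *\<^sub>R e + (v $ 2) *\<^sub>R f + (v $ 3) *\<^sub>R g"

lemma frame_linear: "linear (frame e f g)" unfolding frame_def by (rule linearI) (auto simp: algebra_simps)

lemma indep3_inverse:
 assumes "indep3 e f g"
 obtains P where "linear P" "!!v. P (frame e f g v) = v" "!!v. frame e f g (P v) = v"
proof -
 have "inj (frame e f g)" unfolding linear_injective_0[OF frame_linear]
 proof (intro allI impI)
  fix v :: "real^3" assume "frame e f g v = 0"
  then have "v $ 1 = 0 & v $ 2 = 0 & v $ 3 = 0" using assms unfolding indep3_def frame_def by blast
  then show "v = 0" by (simp only: vec_eq_iff forall_3 zero_index)
 qed
 then show ?thesis using linear_injective_isomorphism[OF frame_linear] that by blast
qed

lemma indep3_expand: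
 assumes "indep3 e f g"
 obtains x y z where "v = x *\<^sub>R e + y *\<^sub>R f + z *\<^sub>R g"
proof -
 obtain P where "frame e f g (P v) = v" using indep3_inverse[OF assms] by metis
 then show ?thesis using that unfolding frame_def by metis
qed

lemma saddle_form_of_frame:
 fixes T :: "real^3 => real^3"
 assumes T: "linear T" and ind: "indep3 e f g" and e: "T e = \<kappa> *\<^sub>R e" "\<kappa> > 0"
  and f: "T f = a *\<^sub>R f + b *\<^sub>R g" and g: "T g = c *\<^sub>R f + d *\<^sub>R g"
  and neg: "m > 0" "!!s t. a * s\<^sup>2 + (b + c) * (s * t) + d * t\<^sup>2 <= - m * (s\<^sup>2 + t\<^sup>2)"
 shows "\<exists>P P'. linear P & linear P' & (\<forall>v. P (P' v) = v) & (\<forall>v. P' (P v) = v) &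
  saddle_form (%v. P (T (P' v))) \<kappa> m"
proof -
 let ?F = "frame e f g"
 obtain P where P: "linear P" "!!v. P (?F v) = v" "!!v. ?F (P v) = v" using indep3_inverse[OF ind] by blast
 let ?L = "%v. P (T (?F v))"
 define w :: "real^3 => real^3" where "w v = (\<kappa> * v $ 1) *\<^sub>R axis 1 1 + (a * v $ 2 + c * v $ 3) *\<^sub>R axis 2 1
  + (b * v $ 2 + d * v $ 3) *\<^sub>R axis 3 1" for v
 have w: "w v $ 1 = \<kappa> * v $ 1" "w v $ 2 = a * v $ 2 + c * v $ 3" "w v $ 3 = b * v $ 2 + d * v $ 3" for v
  by (simp_all add: w_def axis_def)
 have L: "?L v = w v" for v
 proof -
  have "T (?F v) = (v $ 1) *\<^sub>R T e + (v $ 2) *\<^sub>R T f + (v $ 3) *\<^sub>R T g"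
   by (simp add: frame_def linear_add[OF T] linear_scale[OF T])
  also have "\<dots> = ?F (w v)" unfolding frame_def w e f g by (simp add: algebra_simps)
  finally show ?thesis using P(2) by simp
 qed
 have "saddle_form ?L \<kappa> m"
 proof (rule saddle_form.intro)
  show "linear ?L" using linear_compose[OF linear_compose[OF frame_linear T] P(1)] by (simp add: o_def)
  show "?L y $ 1 = \<kappa> * y $ 1" for y unfolding L w ..
  show "?L (axis 1 1) = \<kappa> *\<^sub>R axis 1 1" unfolding L by (simp add: vec_eq_iff forall_3 w axis_def)
  show "y \<bullet> ?L y <= - m * (y \<bullet> y)" if "y $ 1 = 0" for y using neg(2)[of "y $ 2" "y $ 3"] that unfolding L
   by (simp add: inner_vec_def sum_3 w power2_eq_square algebra_simps)
 qed (use e neg in auto)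
 then show ?thesis using P frame_linear by blast
qed

lemma saddle_form_plane:
 fixes T :: "real^3 => real^3"
 assumes T: "linear T" and e: "T e = \<kappa> *\<^sub>R e" "\<kappa> > 0" "e ~= 0"
  and a: "T a = \<alpha> *\<^sub>R a - \<beta> *\<^sub>R b" and b: "T b = \<beta> *\<^sub>R a + \<alpha> *\<^sub>R b" and ab: "\<alpha> < 0" "\<beta> ~= 0"
  and ind: "!!s t. s *\<^sub>R a + t *\<^sub>R b = 0 ==> s = 0 & t = 0"
 shows "\<exists>P P'. linear P & linear P' & (\<forall>v. P (P' v) = v) & (\<forall>v. P' (P v) = v) &
  saddle_form (%v. P (T (P' v))) \<kappa> (- \<alpha>)"
proof (rule saddle_form_of_frame[OF T _ e(1,2)])
 show "T a = \<alpha> *\<^sub>R a + (- \<beta>) *\<^sub>R b" "T b = \<beta> *\<^sub>R a + \<alpha> *\<^sub>R b" using a b by auto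
 show "indep3 e a b" unfolding indep3_def
 proof (intro allI impI)
  fix x y z assume eq: "x *\<^sub>R e + y *\<^sub>R a + z *\<^sub>R b = 0"
  have "x = 0"
  proof (rule ccontr)
   assume x: "x ~= 0"
   have e': "x *\<^sub>R e = (- y) *\<^sub>R a + (- z) *\<^sub>R b" using eq by (simp add: eq_neg_iff_add_eq_0 algebra_simps)
   have "T (x *\<^sub>R e) = \<kappa> *\<^sub>R (x *\<^sub>R e)" by (simp add: linear_scale[OF T] e)
   then have "T ((- y) *\<^sub>R a + (- z) *\<^sub>R b) = \<kappa> *\<^sub>R ((- y) *\<^sub>R a + (- z) *\<^sub>R b)" unfolding e' .
   then have "(- y) *\<^sub>R (\<alpha> *\<^sub>R a - \<beta> *\<^sub>R b) + (- z) *\<^sub>R (\<beta> *\<^sub>R a + \<alpha> *\<^sub>R b) = \<kappa> *\<^sub>R ((- y) *\<^sub>R a + (- z) *\<^sub>R b)"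
    by (simp only: linear_add[OF T] linear_scale[OF T] a b)
   then have "(\<kappa> * y - \<alpha> * y - \<beta> * z) *\<^sub>R a + (\<kappa> * z - \<alpha> * z + \<beta> * y) *\<^sub>R b = 0"
    by (simp add: algebra_simps)
   then have yz: "\<kappa> * y - \<alpha> * y - \<beta> * z = 0" "\<kappa> * z - \<alpha> * z + \<beta> * y = 0" using ind by blast+
   have "\<beta> * (y\<^sup>2 + z\<^sup>2) = y * (\<kappa> * z - \<alpha> * z + \<beta> * y) - z * (\<kappa> * y - \<alpha> * y - \<beta> * z)"
    by (simp add: power2_eq_square algebra_simps)
   also have "\<dots> = 0" using yz by simp
   finally have "y\<^sup>2 + z\<^sup>2 = 0" using ab by simp
   then have "y = 0" "z = 0" by (simp_all add: sum_power2_eq_zero_iff)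
   then show False using e' x e(3) by simp
  qed
  then show "x = 0 & y = 0 & z = 0" using eq ind[of y z] by simp
 qed
 show "\<alpha> * s\<^sup>2 + (- \<beta> + \<beta>) * (s * t) + \<alpha> * t\<^sup>2 <= - (- \<alpha>) * (s\<^sup>2 + t\<^sup>2)" for s t
  by (simp add: algebra_simps)
qed (use ab in auto)

lemma saddle_form_real:
 fixes T :: "real^3 => real^3"
 assumes T: "linear T" and v1: "T v1 = l1 *\<^sub>R v1" "l1 < 0" and v2: "T v2 = l2 *\<^sub>R v2" "l2 > 0"
  and ind: "indep3 v3 v1 v2" and v3: "T v3 = m *\<^sub>R v3 + p *\<^sub>R v1 + q *\<^sub>R v2" "m < 0"
 shows "\<exists>P P' \<mu> \<alpha>. linear P & linear P' & (\<forall>v. P (P' v) = v) & (\<forall>v. P' (P v) = v) &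
  saddle_form (%v. P (T (P' v))) \<mu> \<alpha>"
proof -
 \<comment> \<open>A multiple of \<open>v2\<close> decouples \<open>v3\<close> from \<open>v2\<close>; a small factor makes the coupling to \<open>v1\<close> negligible.\<close>
 define c where "c = q / (m - l2)"
 define k where "k = min (- l1) (- m)"
 define \<epsilon> where "\<epsilon> = k / (\<bar>p\<bar> + 1)"
 have k: "k > 0" "l1 <= - k" "m <= - k" using v1 v3 by (auto simp: k_def)
 have \<epsilon>: "\<epsilon> > 0" "\<bar>\<epsilon> * p\<bar> <= k"
 proof -
  show "\<epsilon> > 0" using k by (simp add: \<epsilon>_def)
  have "\<epsilon> * (\<bar>p\<bar> + 1) = k" by (simp add: \<epsilon>_def)
  then have "\<epsilon> * \<bar>p\<bar> <= k" using \<open>\<epsilon> > 0\<close> by (simp add: algebra_simps)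
  then show "\<bar>\<epsilon> * p\<bar> <= k" using \<open>\<epsilon> > 0\<close> by (simp add: abs_mult)
 qed
 let ?g = "\<epsilon> *\<^sub>R (v3 + c *\<^sub>R v2)"
 have c: "q + c * l2 = m * c" using v2 v3 by (simp add: c_def field_simps)
 have "T ?g = \<epsilon> *\<^sub>R (m *\<^sub>R v3 + p *\<^sub>R v1 + q *\<^sub>R v2 + (c * l2) *\<^sub>R v2)"
  by (simp add: linear_add[OF T] linear_scale[OF T] v2 v3)
 also have "\<dots> = \<epsilon> *\<^sub>R (m *\<^sub>R v3 + p *\<^sub>R v1 + (q + c * l2) *\<^sub>R v2)" by (simp add: algebra_simps)
 also have "\<dots> = (\<epsilon> * p) *\<^sub>R v1 + m *\<^sub>R ?g" unfolding c by (simp add: algebra_simps)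
 finally have g: "T ?g = (\<epsilon> * p) *\<^sub>R v1 + m *\<^sub>R ?g" .
 have i: "indep3 v2 v1 ?g" unfolding indep3_def
 proof (intro allI impI)
  fix x y z assume "x *\<^sub>R v2 + y *\<^sub>R v1 + z *\<^sub>R ?g = 0"
  then have "(z * \<epsilon>) *\<^sub>R v3 + y *\<^sub>R v1 + (x + z * \<epsilon> * c) *\<^sub>R v2 = 0" by (simp add: algebra_simps)
  then have "z * \<epsilon> = 0" "y = 0" "x + z * \<epsilon> * c = 0" using ind unfolding indep3_def by blast+
  then show "x = 0 & y = 0 & z = 0" using \<epsilon> by auto
 qed
 have "\<exists>P P'. linear P & linear P' & (\<forall>v. P (P' v) = v) & (\<forall>v. P' (P v) = v) &
  saddle_form (%v. P (T (P' v))) l2 (k / 2)"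
 proof (rule saddle_form_of_frame[OF T i v2(1,2) _ g])
  show "T v1 = l1 *\<^sub>R v1 + 0 *\<^sub>R ?g" using v1 by simp
  fix s t :: real
  have "\<bar>s * t\<bar> <= (s\<^sup>2 + t\<^sup>2) / 2"
   using sum_squares_bound[of "\<bar>s\<bar>" "\<bar>t\<bar>"] by (simp add: abs_mult)
  then have "\<bar>\<epsilon> * p\<bar> * \<bar>s * t\<bar> <= k * ((s\<^sup>2 + t\<^sup>2) / 2)" using \<epsilon> k by (intro mult_mono) auto
  then have 1: "(0 + \<epsilon> * p) * (s * t) <= k * ((s\<^sup>2 + t\<^sup>2) / 2)" by (metis abs_le_D1 abs_mult add_0)
  have 2: "l1 * s\<^sup>2 <= - k * s\<^sup>2" "m * t\<^sup>2 <= - k * t\<^sup>2"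
   using mult_right_mono[OF k(2) zero_le_power2[of s]] mult_right_mono[OF k(3) zero_le_power2[of t]] by auto
  have "l1 * s\<^sup>2 + (0 + \<epsilon> * p) * (s * t) + m * t\<^sup>2 <= - k * s\<^sup>2 + k * ((s\<^sup>2 + t\<^sup>2) / 2) + - k * t\<^sup>2"
   using 1 2 by (intro add_mono)
  also have "\<dots> = - (k / 2) * (s\<^sup>2 + t\<^sup>2)" by (simp add: field_simps)
  finally show "l1 * s\<^sup>2 + (0 + \<epsilon> * p) * (s * t) + m * t\<^sup>2 <= - (k / 2) * (s\<^sup>2 + t\<^sup>2)" .
 qed (use k in auto)
 then show ?thesis by blast
qed

lemma complex_eigenvalue_real_parts:
 assumes "complex_eigenvalue B l"
 obtains a b where "a ~= 0 \<or> b ~= 0" "B *v a = Re l *\<^sub>R a - Im l *\<^sub>R b" "B *v b = Im l *\<^sub>R a + Re l *\<^sub>R b"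
proof -
 obtain v :: "complex^3" where v: "v ~= 0" "(\<chi> i j. complex_of_real (B $ i $ j)) *v v = l *s v"
  using assms by (auto simp: complex_eigenvalue_def)
 have i: "(\<Sum>j\<in>UNIV. complex_of_real (B $ i $ j) * v $ j) = l * v $ i" for i
  using arg_cong[OF v(2), of "%w. w $ i"] by (simp add: matrix_vector_mult_def)
 let ?a = "\<chi> i. Re (v $ i)" and ?b = "\<chi> i. Im (v $ i)"
 show ?thesis
 proof (rule that[of ?a ?b])
  show "?a ~= 0 \<or> ?b ~= 0" using v(1) by (auto simp: vec_eq_iff complex_eq_iff)
  show "B *v ?a = Re l *\<^sub>R ?a - Im l *\<^sub>R ?b"
  proof -
   have "(\<Sum>j\<in>UNIV. B $ i $ j * Re (v $ j)) = Re l * Re (v $ i) - Im l * Im (v $ i)" for i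
    using arg_cong[OF i[of i], of Re] by simp
   then show ?thesis by (simp add: vec_eq_iff matrix_vector_mult_def)
  qed
  show "B *v ?b = Im l *\<^sub>R ?a + Re l *\<^sub>R ?b"
  proof -
   have "(\<Sum>j\<in>UNIV. B $ i $ j * Im (v $ j)) = Im l * Re (v $ i) + Re l * Im (v $ i)" for i
    using arg_cong[OF i[of i], of Im] by simp
   then show ?thesis by (simp add: vec_eq_iff matrix_vector_mult_def)
  qed
 qed
qed

lemma complex_eigenvalue_zero:
 assumes "B *v w = 0" "w ~= (0 :: real^3)"
 shows "complex_eigenvalue B 0" unfolding complex_eigenvalue_def
proof (intro exI conjI)
 let ?v = "(\<chi> i. complex_of_real (w $ i)) :: complex^3"
 show "?v ~= 0" using assms(2) by (auto simp: vec_eq_iff)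
 have "(\<Sum>j\<in>UNIV. complex_of_real (B $ i $ j) * complex_of_real (w $ j)) = 0" for i
 proof -
  have "(\<Sum>j\<in>UNIV. B $ i $ j * w $ j) = 0"
   using arg_cong[OF assms(1), of "%w. w $ i"] by (simp add: matrix_vector_mult_def)
  then show ?thesis by (metis (no_types, lifting) of_real_0 of_real_mult of_real_sum sum.cong)
 qed
 then show "(\<chi> i j. complex_of_real (B $ i $ j)) *v ?v = 0 *s ?v" by (simp add: vec_eq_iff matrix_vector_mult_def)
qed

lemma rotation_independent:
 fixes T :: "real^3 => real^3"
 assumes T: "linear T" and a: "T a = \<alpha> *\<^sub>R a - \<beta> *\<^sub>R b" and b: "T b = \<beta> *\<^sub>R a + \<alpha> *\<^sub>R b"
  and \<beta>: "\<beta> ~= 0" and ab: "a ~= 0 \<or> b ~= 0" and eq: "s *\<^sub>R a + t *\<^sub>R b = 0"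
 shows "s = 0 & t = 0"
proof -
 have "T (s *\<^sub>R a + t *\<^sub>R b) = 0" unfolding eq by (rule linear_0[OF T])
 then have "\<alpha> *\<^sub>R (s *\<^sub>R a + t *\<^sub>R b) + \<beta> *\<^sub>R (t *\<^sub>R a - s *\<^sub>R b) = 0"
  by (simp add: linear_add[OF T] linear_scale[OF T] a b algebra_simps)
 then have ts: "t *\<^sub>R a = s *\<^sub>R b" unfolding eq using \<beta> by simp
 have "(s\<^sup>2 + t\<^sup>2) *\<^sub>R a = s *\<^sub>R (s *\<^sub>R a) + t *\<^sub>R (t *\<^sub>R a)" by (simp add: power2_eq_square algebra_simps)
 also have "\<dots> = s *\<^sub>R (s *\<^sub>R a + t *\<^sub>R b)" unfolding ts by (simp add: algebra_simps)
 finally have 1: "(s\<^sup>2 + t\<^sup>2) *\<^sub>R a = 0" unfolding eq by simp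
 have "(s\<^sup>2 + t\<^sup>2) *\<^sub>R b = s *\<^sub>R (s *\<^sub>R b) + t *\<^sub>R (t *\<^sub>R b)" by (simp add: power2_eq_square algebra_simps)
 also have "\<dots> = t *\<^sub>R (s *\<^sub>R a + t *\<^sub>R b)" unfolding ts[symmetric] by (simp add: algebra_simps)
 finally have 2: "(s\<^sup>2 + t\<^sup>2) *\<^sub>R b = 0" unfolding eq by simp
 have "s\<^sup>2 + t\<^sup>2 = 0" using 1 2 ab by auto
 then show ?thesis by (simp add: sum_power2_eq_zero_iff)
qed

lemma rotation_square:
 fixes T :: "real^3 => real^3"
 assumes T: "linear T" and a: "T a = \<alpha> *\<^sub>R a - \<beta> *\<^sub>R b" and b: "T b = \<beta> *\<^sub>R a + \<alpha> *\<^sub>R b"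
 shows "T (T a) = (2 * \<alpha>) *\<^sub>R T a - (\<alpha>\<^sup>2 + \<beta>\<^sup>2) *\<^sub>R a" "T (T b) = (2 * \<alpha>) *\<^sub>R T b - (\<alpha>\<^sup>2 + \<beta>\<^sup>2) *\<^sub>R b"
 by (simp_all add: a b linear_add[OF T] linear_diff[OF T] linear_scale[OF T] vec_eq_iff algebra_simps power2_eq_square)

text \<open>In dimension three there is no room for two pairs of complex eigenvalues.\<close>

lemma one_rotation_plane:
 fixes T :: "real^3 => real^3"
 assumes T: "linear T" and a: "T a = \<alpha> *\<^sub>R a - \<beta> *\<^sub>R b" and b: "T b = \<beta> *\<^sub>R a + \<alpha> *\<^sub>R b"
  and \<beta>: "\<beta> ~= 0" and ab: "a ~= 0 \<or> b ~= 0"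
  and a': "T a' = \<alpha>' *\<^sub>R a' - \<beta>' *\<^sub>R b'" and b': "T b' = \<beta>' *\<^sub>R a' + \<alpha>' *\<^sub>R b'"
  and \<beta>': "\<beta>' ~= 0" and ab': "a' ~= 0 \<or> b' ~= 0"
 shows "\<alpha> = \<alpha>'"
proof (rule ccontr)
 assume ne: "\<alpha> ~= \<alpha>'"
 note ind = rotation_independent[OF T a b \<beta> ab]
 note ind' = rotation_independent[OF T a' b' \<beta>' ab']
 have in_plane: "\<exists>s t. w = s *\<^sub>R a + t *\<^sub>R b" if sq: "T (T w) = (2 * \<alpha>') *\<^sub>R T w - (\<alpha>'\<^sup>2 + \<beta>'\<^sup>2) *\<^sub>R w" for w
 proof (rule ccontr)
  assume out: "\<not> (\<exists>s t. w = s *\<^sub>R a + t *\<^sub>R b)"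
  have i: "indep3 w a b" unfolding indep3_def
  proof (intro allI impI)
   fix x y z assume eq: "x *\<^sub>R w + y *\<^sub>R a + z *\<^sub>R b = 0"
   have "x = 0"
   proof (rule ccontr)
    assume x: "x ~= 0"
    have "x *\<^sub>R w = (- y) *\<^sub>R a + (- z) *\<^sub>R b" using eq by (simp add: eq_neg_iff_add_eq_0 algebra_simps)
    then have "(1 / x) *\<^sub>R (x *\<^sub>R w) = (1 / x) *\<^sub>R ((- y) *\<^sub>R a + (- z) *\<^sub>R b)" by simp
    then have "w = (- y / x) *\<^sub>R a + (- z / x) *\<^sub>R b" using x by (simp add: algebra_simps)
    then show False using out by blast
   qed
   then show "x = 0 & y = 0 & z = 0" using eq ind[of y z] by simp
  qed
  obtain m s t where w: "T w = m *\<^sub>R w + s *\<^sub>R a + t *\<^sub>R b" using indep3_expand[OF i] by blast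
  have "T (T w) - (2 * \<alpha>') *\<^sub>R T w + (\<alpha>'\<^sup>2 + \<beta>'\<^sup>2) *\<^sub>R w = 0" using sq by simp
  moreover have "T (T w) = m *\<^sub>R (m *\<^sub>R w + s *\<^sub>R a + t *\<^sub>R b) + s *\<^sub>R (\<alpha> *\<^sub>R a - \<beta> *\<^sub>R b) + t *\<^sub>R (\<beta> *\<^sub>R a + \<alpha> *\<^sub>R b)"
   by (subst w) (simp only: linear_add[OF T] linear_scale[OF T] w a b)
  ultimately have "m *\<^sub>R (m *\<^sub>R w + s *\<^sub>R a + t *\<^sub>R b) + s *\<^sub>R (\<alpha> *\<^sub>R a - \<beta> *\<^sub>R b) + t *\<^sub>R (\<beta> *\<^sub>R a + \<alpha> *\<^sub>R b)
   - (2 * \<alpha>') *\<^sub>R (m *\<^sub>R w + s *\<^sub>R a + t *\<^sub>R b) + (\<alpha>'\<^sup>2 + \<beta>'\<^sup>2) *\<^sub>R w = 0" unfolding w by simp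
  then have "((m - \<alpha>')\<^sup>2 + \<beta>'\<^sup>2) *\<^sub>R w + (m * s + s * \<alpha> + t * \<beta> - 2 * \<alpha>' * s) *\<^sub>R a
    + (m * t - s * \<beta> + t * \<alpha> - 2 * \<alpha>' * t) *\<^sub>R b = 0"
   by (simp add: algebra_simps power2_eq_square)
  then have "(m - \<alpha>')\<^sup>2 + \<beta>'\<^sup>2 = 0" using i unfolding indep3_def by blast
  then show False using \<beta>' by (simp add: sum_power2_eq_zero_iff)
 qed
 have key: "T w = (((\<alpha>\<^sup>2 + \<beta>\<^sup>2) - (\<alpha>'\<^sup>2 + \<beta>'\<^sup>2)) / (2 * (\<alpha> - \<alpha>'))) *\<^sub>R w"
  if sq: "T (T w) = (2 * \<alpha>') *\<^sub>R T w - (\<alpha>'\<^sup>2 + \<beta>'\<^sup>2) *\<^sub>R w" for w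
 proof -
  obtain s t where w: "w = s *\<^sub>R a + t *\<^sub>R b" using in_plane[OF sq] by blast
  have "T (T w) = s *\<^sub>R T (T a) + t *\<^sub>R T (T b)" unfolding w by (simp add: linear_add[OF T] linear_scale[OF T])
  also have "\<dots> = (2 * \<alpha>) *\<^sub>R T w - (\<alpha>\<^sup>2 + \<beta>\<^sup>2) *\<^sub>R w"
   unfolding rotation_square[OF T a b] w by (simp add: linear_add[OF T] linear_scale[OF T] algebra_simps)
  finally have "(2 * \<alpha>) *\<^sub>R T w - (\<alpha>\<^sup>2 + \<beta>\<^sup>2) *\<^sub>R w = (2 * \<alpha>') *\<^sub>R T w - (\<alpha>'\<^sup>2 + \<beta>'\<^sup>2) *\<^sub>R w"
   using sq by simp
  then have "(2 * (\<alpha> - \<alpha>')) *\<^sub>R T w = ((\<alpha>\<^sup>2 + \<beta>\<^sup>2) - (\<alpha>'\<^sup>2 + \<beta>'\<^sup>2)) *\<^sub>R w"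
   by (simp add: algebra_simps)
  then have "(1 / (2 * (\<alpha> - \<alpha>'))) *\<^sub>R ((2 * (\<alpha> - \<alpha>')) *\<^sub>R T w) = (1 / (2 * (\<alpha> - \<alpha>'))) *\<^sub>R (((\<alpha>\<^sup>2 + \<beta>\<^sup>2) - (\<alpha>'\<^sup>2 + \<beta>'\<^sup>2)) *\<^sub>R w)" by simp
  then show ?thesis using ne by simp
 qed
 let ?k = "((\<alpha>\<^sup>2 + \<beta>\<^sup>2) - (\<alpha>'\<^sup>2 + \<beta>'\<^sup>2)) / (2 * (\<alpha> - \<alpha>'))"
 have "\<alpha>' *\<^sub>R a' - \<beta>' *\<^sub>R b' = ?k *\<^sub>R a'" using key[OF rotation_square(1)[OF T a' b']] a' by simp
 then have "(\<alpha>' - ?k) *\<^sub>R a' + (- \<beta>') *\<^sub>R b' = 0" by (simp add: algebra_simps)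
 then show False using ind' \<beta>' by fastforce
qed

theorem saddle_normal_form:
 assumes hyp: "!!l. complex_eigenvalue B l ==> Re l ~= 0"
  and l1: "complex_eigenvalue B l1" "Re l1 < 0" and l2: "complex_eigenvalue B l2" "Re l2 > 0"
 shows "\<exists>P P' \<mu> \<alpha>. linear P & linear P' & (\<forall>v. P (P' v) = v) & (\<forall>v. P' (P v) = v) &
  (saddle_form (%v. P (B *v P' v)) \<mu> \<alpha> \<or> saddle_form (%v. P (- (B *v P' v))) \<mu> \<alpha>)"
proof -
 let ?T = "(*v) B" and ?N = "%v. - (B *v v)"
 have T: "linear ?T" by simp
 have N: "linear ?N" by (rule linear_compose_neg[OF T])
 obtain a b where ab: "a ~= 0 \<or> b ~= 0" "B *v a = Re l1 *\<^sub>R a - Im l1 *\<^sub>R b" "B *v b = Im l1 *\<^sub>R a + Re l1 *\<^sub>R b"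
  by (rule complex_eigenvalue_real_parts[OF l1(1)])
 obtain a' b' where ab': "a' ~= 0 \<or> b' ~= 0" "B *v a' = Re l2 *\<^sub>R a' - Im l2 *\<^sub>R b'" "B *v b' = Im l2 *\<^sub>R a' + Re l2 *\<^sub>R b'"
  by (rule complex_eigenvalue_real_parts[OF l2(1)])
 show ?thesis
 proof (cases "Im l1 = 0"; cases "Im l2 = 0")
  assume "Im l1 = 0" "Im l2 = 0"
  define v1 where "v1 = (if a ~= 0 then a else b)"
  define v2 where "v2 = (if a' ~= 0 then a' else b')"
  have v1: "B *v v1 = Re l1 *\<^sub>R v1" "v1 ~= 0" using ab \<open>Im l1 = 0\<close> by (auto simp: v1_def)
  have v2: "B *v v2 = Re l2 *\<^sub>R v2" "v2 ~= 0" using ab' \<open>Im l2 = 0\<close> by (auto simp: v2_def)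
  have "dim (span {v1, v2}) <= card {v1, v2}" by (simp add: dim_le_card')
  also have "\<dots> < 3" using card_insert_le_m1[of 2 "{v2}" v1] by (simp add: card_insert_if)
  finally have d3: "dim (span {v1, v2}) < 3" .
  have "span {v1, v2} ~= (UNIV :: (real^3) set)"
  proof
   assume eq: "span {v1, v2} = UNIV"
   show False using d3 unfolding eq by (simp add: dim_UNIV)
  qed
  then obtain v3 where v3: "v3 \<notin> span {v1, v2}" by blast
  have comb: "s *\<^sub>R v1 + t *\<^sub>R v2 \<in> span {v1, v2}" for s t by (intro span_add span_scale span_base) auto
  have ind: "indep3 v3 v1 v2" unfolding indep3_def
  proof (intro allI impI)
   fix x y z assume eq: "x *\<^sub>R v3 + y *\<^sub>R v1 + z *\<^sub>R v2 = 0"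
   have x: "x = 0"
   proof (rule ccontr)
    assume x: "x ~= 0"
    have "x *\<^sub>R v3 = (- y) *\<^sub>R v1 + (- z) *\<^sub>R v2" using eq by (simp add: eq_neg_iff_add_eq_0 algebra_simps)
    then have "(1/x) *\<^sub>R (x *\<^sub>R v3) \<in> span {v1, v2}" using comb by (metis span_scale)
    then show False using v3 x by simp
   qed
   then have eq': "y *\<^sub>R v1 + z *\<^sub>R v2 = 0" using eq by simp
   have "B *v (y *\<^sub>R v1 + z *\<^sub>R v2) = Re l1 *\<^sub>R (y *\<^sub>R v1) + Re l2 *\<^sub>R (z *\<^sub>R v2)"
    by (simp add: linear_add[OF T] linear_scale[OF T] v1 v2 mult.commute)
   then have "Re l1 *\<^sub>R (y *\<^sub>R v1) + Re l2 *\<^sub>R (z *\<^sub>R v2) = 0" unfolding eq' by simp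
   moreover have "z *\<^sub>R v2 = - (y *\<^sub>R v1)" using eq' by (simp add: eq_neg_iff_add_eq_0 add.commute)
   ultimately have "((Re l1 - Re l2) * y) *\<^sub>R v1 = 0" by (simp add: algebra_simps)
   then have "y = 0" using v1(2) l1 l2 by simp
   then show "x = 0 & y = 0 & z = 0" using x eq' v2(2) by simp
  qed
  obtain m p q where m: "B *v v3 = m *\<^sub>R v3 + p *\<^sub>R v1 + q *\<^sub>R v2" using indep3_expand[OF ind] by blast
  have "m ~= 0"
  proof
   assume m0: "m = 0"
   let ?w = "v3 - (p / Re l1) *\<^sub>R v1 - (q / Re l2) *\<^sub>R v2"
   have "B *v ?w = 0" using l1 l2 m m0 by (simp add: linear_diff[OF T] linear_scale[OF T] v1 v2)
   moreover have "?w ~= 0"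
   proof
    assume "?w = 0"
    then have "v3 = (p / Re l1) *\<^sub>R v1 + (q / Re l2) *\<^sub>R v2" by (simp add: algebra_simps)
    then show False using v3 comb by metis
   qed
   ultimately show False using complex_eigenvalue_zero hyp by fastforce
  qed
  then consider "m < 0" | "m > 0" by linarith
  then show ?thesis
  proof cases
   case 1
   show ?thesis using saddle_form_real[OF T v1(1) l1(2) v2(1) l2(2) ind m 1] by blast
  next
   case 2
   have ind2: "indep3 v3 v2 v1" unfolding indep3_def
   proof (intro allI impI)
    fix x y z assume "x *\<^sub>R v3 + y *\<^sub>R v2 + z *\<^sub>R v1 = 0"
    then have "x *\<^sub>R v3 + z *\<^sub>R v1 + y *\<^sub>R v2 = 0" by (simp add: algebra_simps)
    then show "x = 0 & y = 0 & z = 0" using ind unfolding indep3_def by blast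
   qed
   have "\<exists>P P' \<mu> \<alpha>. linear P & linear P' & (\<forall>v. P (P' v) = v) & (\<forall>v. P' (P v) = v) &
    saddle_form (%v. P (?N (P' v))) \<mu> \<alpha>"
   proof (rule saddle_form_real[OF N _ _ _ _ ind2])
    show "?N v2 = (- Re l2) *\<^sub>R v2" "?N v1 = (- Re l1) *\<^sub>R v1" using v1 v2 by simp_all
    show "?N v3 = (- m) *\<^sub>R v3 + (- q) *\<^sub>R v2 + (- p) *\<^sub>R v1" unfolding m by simp
   qed (use l1 l2 2 in auto)
   then show ?thesis by blast
  qed
 next
  assume "Im l1 = 0" and im: "Im l2 ~= 0"
  define v1 where "v1 = (if a ~= 0 then a else b)"
  have v1: "B *v v1 = Re l1 *\<^sub>R v1" "v1 ~= 0" using ab \<open>Im l1 = 0\<close> by (auto simp: v1_def)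
  have "\<exists>P P'. linear P & linear P' & (\<forall>v. P (P' v) = v) & (\<forall>v. P' (P v) = v) &
   saddle_form (%v. P (?N (P' v))) (- Re l1) (- (- Re l2))"
  proof (rule saddle_form_plane[OF N])
   show "?N v1 = (- Re l1) *\<^sub>R v1" using v1 by simp
   show "?N a' = (- Re l2) *\<^sub>R a' - (- Im l2) *\<^sub>R b'" "?N b' = (- Im l2) *\<^sub>R a' + (- Re l2) *\<^sub>R b'"
    unfolding ab' by simp_all
   show "s = 0 & t = 0" if "s *\<^sub>R a' + t *\<^sub>R b' = 0" for s t
    by (rule rotation_independent[OF T ab'(2,3) im ab'(1) that])
  qed (use v1 l1 l2 im in auto)
  then show ?thesis by blast
 next
  assume im: "Im l1 ~= 0" and "Im l2 = 0"
  define v2 where "v2 = (if a' ~= 0 then a' else b')"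
  have v2: "B *v v2 = Re l2 *\<^sub>R v2" "v2 ~= 0" using ab' \<open>Im l2 = 0\<close> by (auto simp: v2_def)
  have "\<exists>P P'. linear P & linear P' & (\<forall>v. P (P' v) = v) & (\<forall>v. P' (P v) = v) &
   saddle_form (%v. P (?T (P' v))) (Re l2) (- Re l1)"
   by (rule saddle_form_plane[OF T v2(1) l2(2) v2(2) ab(2,3) l1(2) im rotation_independent[OF T ab(2,3) im ab(1)]])
  then show ?thesis by blast
 next
  assume im: "Im l1 ~= 0" "Im l2 ~= 0"
  have "Re l1 = Re l2" by (rule one_rotation_plane[OF T ab(2,3) im(1) ab(1) ab'(2,3) im(2) ab'(1)])
  then show ?thesis using l1 l2 by simp
 qed
qed

section \<open>Linear charts at a saddle\<close>

lemma linear_flow_uminus: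
 assumes lin: "linear L"
 shows "linear_flow (%v. - L v) t y = linear_flow L (- t) y"
proof -
 have N: "linear (%v. - L v)" by (rule linear_compose_neg[OF lin])
 have "linear_flow L (- t) y = linear_flow (%v. - L v) (t - 0) (linear_flow L (- 0) y)"
 proof (rule linear_flow_unique[OF N, of "- \<bar>t\<bar>" "\<bar>t\<bar>"])
  fix s
  have "((%s::real. - s) has_vector_derivative - 1) (at s within {- \<bar>t\<bar>..\<bar>t\<bar>})"
   by (auto intro!: derivative_eq_intros)
  from vector_diff_chain_within[OF this linear_flow_derivative[OF lin]]
  show "((%s. linear_flow L (- s) y) has_vector_derivative - L (linear_flow L (- s) y)) (at s within {- \<bar>t\<bar>..\<bar>t\<bar>})"
   by (simp add: o_def)
 qed auto
 then show ?thesis by (simp add: linear_flow_0[OF lin])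
qed

lemma quotient_limit:
 fixes g :: "real^3 => real^3"
 assumes "(g has_derivative g') (at y0)"
 shows "((%s. (1/s) *\<^sub>R (g (y0 + s *\<^sub>R v) - g y0)) \<longlongrightarrow> g' v) (at (0::real))"
proof (rule vec_tendstoI)
 fix i
 have "((%s::real. y0 + s *\<^sub>R v) has_derivative (%s. s *\<^sub>R v)) (at 0)" by (auto intro!: derivative_eq_intros)
 moreover have "(g has_derivative g') (at (y0 + (0::real) *\<^sub>R v))" using assms by simp
 ultimately have "(g \<circ> (%s::real. y0 + s *\<^sub>R v) has_derivative g' \<circ> (%s. s *\<^sub>R v)) (at 0)"
  by (rule diff_chain_at)
 moreover have "g' \<circ> (%s. s *\<^sub>R v) = (%s. s *\<^sub>R g' v)"
  using assms has_derivative_linear linear_scale by fastforce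
 ultimately have "((%s::real. g (y0 + s *\<^sub>R v)) has_vector_derivative g' v) (at 0)"
  by (simp add: has_vector_derivative_def o_def)
 then have "((%s::real. g (y0 + s *\<^sub>R v) $ i) has_real_derivative g' v $ i) (at 0)"
  by (simp add: has_vector_derivative_vec3)
 then have "((%s::real. (g (y0 + (0 + s) *\<^sub>R v) $ i - g (y0 + 0 *\<^sub>R v) $ i) / s) \<longlongrightarrow> g' v $ i) (at 0)"
  by (simp only: DERIV_def)
 then show "((%s. ((1/s) *\<^sub>R (g (y0 + s *\<^sub>R v) - g y0)) $ i) \<longlongrightarrow> g' v $ i) (at (0::real))"
  by simp
qed

context vector_field_manifold
begin

lemma C1_linearizable_field_in:
 assumes "C1_linearizable M A X p"
 obtains d L where "field_in d L" "linear L" "p \<in> fst d" "snd d p = 0"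
 using assms unfolding C1_linearizable_def field_in_def by blast

text \<open>The linear part in a linearizing chart is conjugate to the Jacobian in the charts of the atlas.\<close>

lemma jacobian_conjugate:
 assumes d: "field_in d L" "linear L" "p \<in> fst d" "snd d p = 0"
  and c: "c \<in> A" "p \<in> fst c" and X0: "X c p = 0"
 shows "dtrans c d p (jacobian (X c \<circ> chart_inv c) (at (snd c p)) *v v) = L (dtrans c d p v)"
proof -
 define f where "f = X c \<circ> chart_inv c"
 define y0 where "y0 = snd c p"
 let ?J = "dtrans c d p" and ?S = "snd c ` (fst c \<inter> fst d)"
 note cc = atlas_chart[OF c(1)] and c1 = atlas_C1chart[OF c(1)]
 have d1: "C1chart d" using d(1) by (simp add: field_in_def)
 note dc = C1chart_is_chart[OF d1]
 have S: "open ?S" "y0 \<in> ?S" using chart_overlap_open[OF cc dc] c d by (auto simp: y0_def)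
 have f0: "f y0 = 0" using X0 cc c by (simp add: f_def y0_def)
 have "f differentiable (at y0)" using C1_has_derivative[OF Ck_on_2_imp_1[OF atlas_field_C2[OF c(1)]], of y0] c
  unfolding f_def y0_def differentiable_def by blast
 then have fd: "(f has_derivative (%h. jacobian f (at y0) *v h)) (at y0)" by (simp add: jacobian_works)
 define y where "y s = y0 + s *\<^sub>R v" for s :: real
 have yl: "(y \<longlongrightarrow> y0) (at 0)"
 proof -
  have "(y \<longlongrightarrow> y 0) (at 0)" unfolding y_def by (intro tendsto_intros)
  then show ?thesis by (simp add: y_def)
 qed
 have "((%s. (1/s) *\<^sub>R f (y s)) \<longlongrightarrow> jacobian f (at y0) *v v) (at 0)"
  using quotient_limit[OF fd, of v] by (simp add: f0 y_def)
 then have 1: "((%s. frechet_derivative (transition c d) (at (y s)) ((1/s) *\<^sub>R f (y s))) \<longlongrightarrow>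
   frechet_derivative (transition c d) (at y0) (jacobian f (at y0) *v v)) (at 0)"
  by (rule C1_tendsto[OF C1chart_transition[OF c1 d1] S yl])
 have kd: "(transition c d has_derivative ?J) (at y0)" unfolding y0_def by (rule dtrans_has_derivative[OF c1 d1 c(2) d(3)])
 have k0: "transition c d y0 = 0" using transition_apply[OF cc c(2), of d] d by (simp add: y0_def)
 have "((L \<circ> transition c d) has_derivative L \<circ> ?J) (at y0)"
  by (rule diff_chain_at[OF kd linear_imp_has_derivative[OF d(2)]])
 from quotient_limit[OF this, of v]
 have 2: "((%s. (1/s) *\<^sub>R L (transition c d (y s))) \<longlongrightarrow> L (?J v)) (at 0)"
  by (simp add: k0 linear_0[OF d(2)] y_def)
 have "\<forall>\<^sub>F s in at 0. y s \<in> ?S" using yl S by (rule topological_tendstoD)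
 then have "\<forall>\<^sub>F s in at 0. frechet_derivative (transition c d) (at (y s)) ((1/s) *\<^sub>R f (y s)) = (1/s) *\<^sub>R L (transition c d (y s))"
 proof (rule eventually_mono)
  fix s assume "y s \<in> ?S"
  then obtain x where x: "x \<in> fst c" "x \<in> fst d" "y s = snd c x" by auto
  have "dtrans c d x (X c x) = L (snd d x)" using d(1) c x by (auto simp: field_in_def)
  moreover have "f (y s) = X c x" "transition c d (y s) = snd d x" using x cc by (simp_all add: f_def transition_def)
  ultimately show "frechet_derivative (transition c d) (at (y s)) ((1/s) *\<^sub>R f (y s)) = (1/s) *\<^sub>R L (transition c d (y s))"
   unfolding x(3) using linear_scale[OF dtrans_linear[OF c1 d1 x(1,2)]] by simp
 qed
 from tendsto_cong[OF this] 1
 have "((%s. (1/s) *\<^sub>R L (transition c d (y s))) \<longlongrightarrow>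
   frechet_derivative (transition c d) (at y0) (jacobian f (at y0) *v v)) (at 0)" by simp
 from tendsto_unique[OF _ this 2] show ?thesis by (simp add: f_def y0_def)
qed

lemma saddle_chart:
 assumes hyp: "hyperbolic_saddle M A X p" and lin: "C1_linearizable M A X p"
 obtains d L \<mu> \<alpha> where "field_in d L" "linear L" "p \<in> fst d" "snd d p = 0"
  "saddle_form L \<mu> \<alpha> \<or> saddle_form (%v. - L v) \<mu> \<alpha>"
proof -
 obtain d L where d: "field_in d L" "linear L" "p \<in> fst d" "snd d p = 0" by (rule C1_linearizable_field_in[OF lin])
 have d1: "C1chart d" using d(1) by (simp add: field_in_def)
 have "p \<in> topspace M" using hyp by (simp add: hyperbolic_saddle_def)
 then obtain c where c: "c \<in> A" "p \<in> fst c" using atlas_covers by blast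
 note c1 = atlas_C1chart[OF c(1)]
 define B where "B = jacobian (X c \<circ> chart_inv c) (at (snd c p))"
 have h: "X c p = 0" "!!l. complex_eigenvalue B l ==> Re l ~= 0"
  "\<exists>l. complex_eigenvalue B l & Re l < 0" "\<exists>l. complex_eigenvalue B l & Re l > 0"
  using hyp c unfolding hyperbolic_saddle_def B_def Let_def by blast+
 obtain P P' \<mu> \<alpha> where P: "linear P" "linear P'" "!!v. P (P' v) = v" "!!v. P' (P v) = v"
  "saddle_form (%v. P (B *v P' v)) \<mu> \<alpha> \<or> saddle_form (%v. P (- (B *v P' v))) \<mu> \<alpha>"
  using saddle_normal_form[of B] h by blast
 let ?J = "dtrans c d p" and ?J' = "dtrans d c p"
 have J: "linear ?J" "linear ?J'" "!!v. ?J' (?J v) = v" "!!v. ?J (?J' v) = v"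
  using dtrans_linear[OF c1 d1 c(2) d(3)] dtrans_linear[OF d1 c1 d(3) c(2)]
   dtrans_inverse[OF c1 c(2) d1 d(3)] dtrans_inverse[OF d1 d(3) c1 c(2)] by auto
 define Q where "Q = P \<circ> ?J'"
 define Q' where "Q' = ?J \<circ> P'"
 have Q: "linear Q" "linear Q'" "!!v. Q' (Q v) = v" "!!v. Q (Q' v) = v"
  unfolding Q_def Q'_def using linear_compose[OF J(2) P(1)] linear_compose[OF P(2) J(1)] J P by simp_all
 have JB: "?J (B *v v) = L (?J v)" for v unfolding B_def by (rule jacobian_conjugate[OF d c h(1)])
 have conj: "Q (L (Q' v)) = P (B *v P' v)" for v using JB[of "P' v"] J(3) by (simp add: Q_def Q'_def flip: JB)
 show ?thesis
 proof (rule that[of "(fst d, %x. Q (snd d x))" "%v. Q (L (Q' v))" \<mu> \<alpha>])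
  show "field_in (fst d, %x. Q (snd d x)) (%v. Q (L (Q' v)))" by (rule field_in_linear_change[OF d(1) Q])
  show "linear (%v. Q (L (Q' v)))" using linear_compose[OF linear_compose[OF Q(2) d(2)] Q(1)] by (simp add: o_def)
  show "saddle_form (%v. Q (L (Q' v))) \<mu> \<alpha> \<or> saddle_form (%v. - Q (L (Q' v))) \<mu> \<alpha>"
   using P(5) unfolding conj by (simp add: linear_neg[OF P(1)])
 qed (use d Q linear_0 in auto)
qed

text \<open>Curves inside the domain of a linear chart.\<close>

lemma icurve_linear_chart:
 assumes d: "field_in d L" "linear L" and g: "icurve I \<gamma>"
  and st: "!!r. r \<in> {s..t} ==> r \<in> I & \<gamma> r \<in> fst d" and le: "s <= t"
 shows "snd d (\<gamma> t) = linear_flow L (t - s) (snd d (\<gamma> s))"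
proof -
 have g': "icurve {s..t} \<gamma>" by (rule icurve_subset[OF g is_interval_cc]) (use st in blast)
 have "(snd d \<circ> \<gamma>) t = linear_flow L (t - s) ((snd d \<circ> \<gamma>) s)"
 proof (rule linear_flow_unique[OF d(2), of s t])
  fix r assume r: "r \<in> {s..t}"
  show "((snd d \<circ> \<gamma>) has_vector_derivative L ((snd d \<circ> \<gamma>) r)) (at r within {s..t})"
   using icurve_in_chart[OF d(1) g' r] st[OF r] by simp
 qed (use le in auto)
 then show ?thesis by simp
qed

lemma linear_chart_icurve:
 assumes d: "field_in d L" "linear L" and I: "is_interval I"
  and v: "!!t. t \<in> I ==> linear_flow L (t - s) v \<in> snd d ` fst d"
 shows "icurve I (%t. chart_inv d (linear_flow L (t - s) v))"
proof (rule icurveI_chart[OF d(1) I])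
 fix t assume t: "t \<in> I"
 have "((%r. r - s) has_vector_derivative 1) (at t within I)" by (auto intro!: derivative_eq_intros)
 from vector_diff_chain_within[OF this linear_flow_derivative[OF d(2)]]
 show "linear_flow L (t - s) v \<in> snd d ` fst d &
  ((%t. linear_flow L (t - s) v) has_vector_derivative L (linear_flow L (t - s) v)) (at t within I)"
  using v[OF t] by (simp add: o_def)
qed

lemma limit_enters_ball:
 assumes d: "C1chart d" "q \<in> fst d" "snd d q = 0" and g: "limitin M \<gamma> q at_top" and r: "r > 0"
 shows "\<forall>\<^sub>F t in at_top. \<gamma> t \<in> fst d & norm (snd d (\<gamma> t)) < r"
proof -
 note dc = C1chart_is_chart[OF d(1)]
 let ?U = "{x \<in> fst d. snd d x \<in> ball 0 r}"
 have "openin M ?U" by (rule chart_preimage_open[OF is_chartD(1,4)[OF dc]]) simp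
 moreover have "q \<in> ?U" using d r by simp
 ultimately have "\<forall>\<^sub>F t in at_top. \<gamma> t \<in> ?U" using g unfolding limitin_def by blast
 then show ?thesis by (rule eventually_mono) simp
qed

lemma ball_in_chart:
 assumes d: "C1chart d" "q \<in> fst d" "snd d q = 0" and N: "openin M N" "q \<in> N"
 obtains r where "r > 0" "ball 0 r \<subseteq> snd d ` (N \<inter> fst d)"
proof -
 note dc = C1chart_is_chart[OF d(1)]
 have "open (snd d ` (N \<inter> fst d))" using N is_chartD(1)[OF dc] by (intro chart_image_open[OF dc]) auto
 moreover have "0 \<in> snd d ` (N \<inter> fst d)" using d N by (metis IntI image_eqI)
 ultimately show ?thesis using that open_contains_ball by blast
qed

end

section \<open>The stable manifold near a saddle with a stable plane\<close>

locale sink_saddle = vector_field_manifold M A X + saddle_form L \<mu> \<alpha>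
 for M :: "'a topology" and A :: "'a chart set" and X :: "'a vfield"
  and L :: "real^3 => real^3" and \<mu> \<alpha> :: real +
 fixes d :: "'a chart" and q :: 'a
 assumes chart: "field_in d L" and q: "q \<in> fst d" "snd d q = 0"
begin

lemma d1: "C1chart d" using chart by (simp add: field_in_def)

lemma E_0 [simp]: "E t 0 = 0" by (rule linear_0[OF linear_flow_linear[OF lin]])

lemma decay_le: "v $ 1 = 0 ==> 0 <= t ==> norm (E t v) <= norm v"
proof -
 assume v: "v $ 1 = 0" and t: "0 <= t"
 have "norm (E t v) <= exp (- \<alpha> * t) * norm v" by (rule E_decay[OF v t])
 also have "\<dots> <= 1 * norm v" using \<alpha> t by (intro mult_right_mono) auto
 finally show ?thesis by simp
qed

text \<open>A curve staying near \<open>q\<close> lies in the stable plane, since the first coordinate grows.\<close>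

lemma staying_curve_in_plane:
 assumes g: "icurve I \<gamma>" and I: "{S..} \<subseteq> I" and stay: "!!t. S <= t ==> \<gamma> t \<in> fst d & norm (snd d (\<gamma> t)) < r"
 shows "snd d (\<gamma> S) $ 1 = 0"
proof (rule ccontr)
 let ?y = "snd d (\<gamma> S)"
 assume y: "?y $ 1 ~= 0"
 define t where "t = r / (\<mu> * \<bar>?y $ 1\<bar>)"
 have r: "r > 0" using stay[of S] norm_ge_zero[of ?y] by (meson le_less_trans order_refl)
 have t: "t \<ge> 0" "\<mu> * t * \<bar>?y $ 1\<bar> = r" using y \<mu> r by (auto simp: t_def)
 have lin': "snd d (\<gamma> (S + t)) = linear_flow L (S + t - S) ?y"
  by (rule icurve_linear_chart[OF chart lin g]) (use I stay t in auto)
 have "r = \<mu> * t * \<bar>?y $ 1\<bar>" using t by simp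
 also have "\<dots> <= exp (\<mu> * t) * \<bar>?y $ 1\<bar>"
 proof (rule mult_right_mono)
  show "\<mu> * t <= exp (\<mu> * t)" using exp_ge_add_one_self[of "\<mu> * t"] by linarith
 qed simp
 also have "\<dots> = \<bar>snd d (\<gamma> (S + t)) $ 1\<bar>" unfolding lin' E1 by (simp add: abs_mult)
 also have "\<dots> <= norm (snd d (\<gamma> (S + t)))" by (rule component_le_norm_cart)
 also have "\<dots> < r" using stay[of "S + t"] t by simp
 finally show False by simp
qed

text \<open>Points of the plane near \<open>q\<close> converge to \<open>q\<close>, staying in a prescribed neighbourhood.\<close>

lemma plane_point_converges:
 fixes s :: real
 assumes N: "openin M N" and r: "ball 0 r \<subseteq> snd d ` (N \<inter> fst d)" and v: "v $ 1 = 0" "norm v < r"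
  and \<zeta>_def: "\<zeta> = (%t. chart_inv d (E (t - s) v))"
 shows "icurve {s..} \<zeta>" "limitin M \<zeta> q at_top" "!!t. s <= t ==> \<zeta> t \<in> N \<inter> fst d" "snd d (\<zeta> s) = v"
proof -
 note dc = C1chart_is_chart[OF d1]
 have inb: "E (t - s) v \<in> snd d ` (N \<inter> fst d)" if "s <= t" for t
  using r decay_le[OF v(1), of "t - s"] v(2) that by (auto simp: subset_iff)
 show "icurve {s..} \<zeta>"
  unfolding \<zeta>_def by (rule linear_chart_icurve[OF chart lin is_interval_ci]) (use inb in auto)
 show NN: "\<zeta> t \<in> N \<inter> fst d" if st: "s <= t" for t
 proof -
  obtain x where x: "x \<in> N" "x \<in> fst d" "E (t - s) v = snd d x" using inb[OF st] by auto
  then show ?thesis using dc by (simp add: \<zeta>_def)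
 qed
 have "v \<in> snd d ` fst d" using inb[of s] by (auto simp: linear_flow_0[OF lin])
 then show "snd d (\<zeta> s) = v" by (simp add: \<zeta>_def linear_flow_0[OF lin] chart_inv_right)
 show "limitin M \<zeta> q at_top" unfolding limitin_def
 proof (intro conjI allI impI)
  show "q \<in> topspace M" using q is_chartD(3)[OF dc] by blast
  fix U assume U: "openin M U & q \<in> U"
  obtain r' where r': "r' > 0" "ball 0 r' \<subseteq> snd d ` (U \<inter> fst d)" using ball_in_chart[OF d1 q] U by blast
  have "\<forall>\<^sub>F t in at_top. exp (- \<alpha> * (t - s)) * norm v < r'"
   using eventually_ge_at_top[of "s + norm v / (\<alpha> * r')"]
  proof (rule eventually_mono)
   fix t assume t: "s + norm v / (\<alpha> * r') <= t"
   have "norm v = \<alpha> * (norm v / (\<alpha> * r')) * r'" using \<alpha> r'(1) by simp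
   also have "\<dots> <= \<alpha> * (t - s) * r'" using t \<alpha> r'(1) by (intro mult_right_mono mult_left_mono) auto
   also have "\<dots> < exp (\<alpha> * (t - s)) * r'"
   proof (rule mult_strict_right_mono[OF _ r'(1)])
    show "\<alpha> * (t - s) < exp (\<alpha> * (t - s))" using exp_ge_add_one_self[of "\<alpha> * (t - s)"] by linarith
   qed
   finally have "norm v < exp (\<alpha> * (t - s)) * r'" .
   then have "exp (- (\<alpha> * (t - s))) * norm v < exp (- (\<alpha> * (t - s))) * (exp (\<alpha> * (t - s)) * r')"
    by (rule mult_strict_left_mono) simp
   also have "\<dots> = r'" unfolding mult.assoc[symmetric] exp_add[symmetric] by simp
   finally show "exp (- \<alpha> * (t - s)) * norm v < r'" by simp
  qed
  then show "\<forall>\<^sub>F t in at_top. \<zeta> t \<in> U" using eventually_ge_at_top[of s]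
  proof eventually_elim
   case (elim t)
   have "norm (E (t - s) v) < r'" using E_decay[OF v(1), of "t - s"] elim by simp
   then have "E (t - s) v \<in> snd d ` (U \<inter> fst d)" using r'(2) by (auto simp: subset_iff)
   then obtain x where "x \<in> U" "x \<in> fst d" "E (t - s) v = snd d x" by auto
   then show ?case using dc by (simp add: \<zeta>_def)
  qed
 qed
qed

text \<open>The plane, pulled back along a curve that converges to \<open>q\<close>, lies in the pieces of the stable manifold
 used to define its tangent spaces.\<close>

lemma plane_in_stable_piece:
 assumes S: "0 <= S" and g: "icurve {0..} \<gamma>" "limitin M \<gamma> q at_top"
  and box: "!!t. S <= t ==> \<gamma> t \<in> fst d"
  and N: "openin M N" "q \<in> N" "0 <= T" "!!t. T <= t ==> \<gamma> t \<in> N"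
 obtains Q where "openin M Q" "\<gamma> 0 \<in> Q" "Q \<subseteq> fst (pull_chart S d)"
  "!!m. m \<in> Q ==> snd (pull_chart S d) m $ 1 = 0 ==> m \<in> stable_piece M A X q N T"
proof -
 note dc = C1chart_is_chart[OF d1]
 let ?p = "pull_chart S d"
 obtain r where r: "r > 0" "ball 0 r \<subseteq> snd d ` (N \<inter> fst d)" by (rule ball_in_chart[OF d1 q N(1,2)])
 from limit_enters_ball[OF d1 q g(2) r(1)]
 obtain S0 where S0: "!!t. S0 <= t ==> \<gamma> t \<in> fst d & norm (snd d (\<gamma> t)) < r"
  unfolding eventually_at_top_linorder by blast
 define S' where "S' = max S0 (max S T)"
 have S': "S0 <= S'" "S <= S'" "T <= S'" "0 <= S'" using S by (auto simp: S'_def)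
 have gS': "icurve {0..S'} \<gamma>" by (rule icurve_subset[OF g(1) is_interval_cc]) auto
 have gS: "icurve {0..S} \<gamma>" by (rule icurve_subset[OF g(1) is_interval_cc]) auto
 have g0: "\<gamma> 0 \<in> fst ?p" using pull_chart_apply(1)[OF gS refl S box[OF order_refl]] .
 have p1: "openin M (fst ?p)" by (rule is_chartD(1)[OF C1chart_is_chart[OF C1chart_pull[OF d1 S]]])
 let ?V = "{x \<in> fst d. snd d x \<in> ball 0 r}"
 have V: "openin M ?V" by (rule chart_preimage_open[OF is_chartD(1,4)[OF dc]]) simp
 have e: "C1chart (?V, snd d)" by (rule C1chart_restrict[OF d1 V]) auto
 have eS: "\<gamma> S' \<in> fst (?V, snd d)" using S0[OF S'(1)] by simp
 have "\<exists>e'. C1chart e' & \<gamma> 0 \<in> fst e' & fst e' \<subseteq> fst ?p &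
  (\<forall>m\<in>fst e'. \<exists>dl. icurve {0..S'} dl & dl 0 = m & dl S' \<in> fst (?V, snd d) & snd e' m = snd (?V, snd d) (dl S') &
   (\<forall>t\<in>{0..S'}. S <= t --> dl t \<in> fst d))"
  by (rule flow_chart[OF gS' S'(4) is_chartD(1)[OF dc] _ e eS p1 g0]) (use box in auto)
 then obtain e1 where e1': "C1chart e1" "\<gamma> 0 \<in> fst e1" "fst e1 \<subseteq> fst ?p"
  "\<forall>m\<in>fst e1. \<exists>dl. icurve {0..S'} dl & dl 0 = m & dl S' \<in> fst (?V, snd d) & snd e1 m = snd (?V, snd d) (dl S') &
   (\<forall>t\<in>{0..S'}. S <= t --> dl t \<in> fst d)" by blast
 note e1 = e1'(1-3)
 have e1m: "\<exists>dl. icurve {0..S'} dl & dl 0 = m & dl S' \<in> ?V & (\<forall>t\<in>{0..S'}. S <= t --> dl t \<in> fst d)" if "m \<in> fst e1" for m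
  using bspec[OF e1'(4) that] unfolding fst_conv by blast
 have "\<exists>e'. C1chart e' & \<gamma> 0 \<in> fst e' & fst e' \<subseteq> fst e1 &
  (\<forall>m\<in>fst e'. \<exists>dl. icurve {0..S'} dl & dl 0 = m & dl S' \<in> fst (?V, snd d) & snd e' m = snd (?V, snd d) (dl S') &
   (\<forall>t\<in>{0..S'}. T <= t --> dl t \<in> N))"
  by (rule flow_chart[OF gS' S'(4) N(1) _ e eS is_chartD(1)[OF C1chart_is_chart[OF e1(1)]] e1(2)]) (use N(4) in auto)
 then obtain e2 where e2': "C1chart e2" "\<gamma> 0 \<in> fst e2" "fst e2 \<subseteq> fst e1"
  "\<forall>m\<in>fst e2. \<exists>dl. icurve {0..S'} dl & dl 0 = m & dl S' \<in> fst (?V, snd d) & snd e2 m = snd (?V, snd d) (dl S') &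
   (\<forall>t\<in>{0..S'}. T <= t --> dl t \<in> N)" by blast
 note e2 = e2'(1-3)
 have e2m: "\<exists>dl. icurve {0..S'} dl & dl 0 = m & (\<forall>t\<in>{0..S'}. T <= t --> dl t \<in> N)" if "m \<in> fst e2" for m
  using bspec[OF e2'(4) that] by blast
 show ?thesis
 proof (rule that[of "fst e2"])
  show "openin M (fst e2)" by (rule is_chartD(1)[OF C1chart_is_chart[OF e2(1)]])
  show "\<gamma> 0 \<in> fst e2" by (rule e2(2))
  show "fst e2 \<subseteq> fst ?p" using e2(3) e1(3) by blast
  fix m assume m: "m \<in> fst e2" and m1: "snd ?p m $ 1 = 0"
  obtain dl where dl: "icurve {0..S'} dl" "dl 0 = m" "dl S' \<in> ?V" "\<forall>t\<in>{0..S'}. S <= t --> dl t \<in> fst d"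
   using e1m[of m] e2(3) m by blast
  obtain dl' where dl': "icurve {0..S'} dl'" "dl' 0 = m" "\<forall>t\<in>{0..S'}. T <= t --> dl' t \<in> N"
   using e2m[OF m] by blast
  have same: "dl' t = dl t" if "t \<in> {0..S'}" for t
   by (rule icurve_unique[OF dl'(1) dl(1), of 0]) (use that S' dl dl' in auto)
  have dS: "icurve {0..S} dl" by (rule icurve_subset[OF dl(1) is_interval_cc]) (use S' in auto)
  have "dl S \<in> fst d" using dl(4) S S' by auto
  then have "snd ?p m = snd d (dl S)" by (rule pull_chart_apply(2)[OF dS dl(2) S])
  then have "snd d (dl S) $ 1 = 0" using m1 by simp
  moreover have "snd d (dl S') = E (S' - S) (snd d (dl S))"
   by (rule icurve_linear_chart[OF chart lin dl(1) _ S'(2)]) (use dl(4) S in auto)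
  ultimately have v1: "snd d (dl S') $ 1 = 0" by (simp add: E1)
  have v2: "norm (snd d (dl S')) < r" using dl(3) by simp
  define \<zeta> where "\<zeta> = (%t. chart_inv d (E (t - S') (snd d (dl S'))))"
  note \<zeta> = plane_point_converges[OF N(1) r(2) v1 v2 \<zeta>_def]
  have zS: "\<zeta> S' = dl S'"
  proof (rule inj_onD[OF is_chartD(5)[OF dc] \<zeta>(4)])
   show "\<zeta> S' \<in> fst d" using \<zeta>(3)[of S'] by simp
   show "dl S' \<in> fst d" using dl(3) by simp
  qed
  define \<eta> where "\<eta> = (%t. if t \<in> {0..S'} then dl t else \<zeta> t)"
  have "icurve ({0..S'} \<union> {S'..}) \<eta>"
   unfolding \<eta>_def by (rule icurve_concat[OF dl(1) is_interval_ci _ _ \<zeta>(1)]) (use zS S' in auto)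
  moreover have "{0..S'} \<union> {S'..} = {0..}" using S' by auto
  ultimately have \<eta>: "icurve {0..} \<eta>" by simp
  have \<eta>\<zeta>: "\<eta> t = \<zeta> t" if "S' <= t" for t using that zS by (cases "t = S'") (auto simp: \<eta>_def)
  have "limitin M \<eta> q at_top"
  proof -
   have "\<forall>\<^sub>F t in at_top. \<zeta> t = \<eta> t"
    using eventually_ge_at_top[of S'] by (rule eventually_mono) (simp add: \<eta>\<zeta>)
   then show ?thesis using \<zeta>(2) by (simp add: limitin_transform_eventually)
  qed
  moreover have "\<eta> ` {T..} \<subseteq> N"
  proof clarify
   fix t assume t: "T <= t"
   show "\<eta> t \<in> N"
   proof (cases "t <= S'")
    case True
    then have tt: "t \<in> {0..S'}" using t N(3) by simp
    then show ?thesis using bspec[OF dl'(3) tt] t same[OF tt] tt by (simp add: \<eta>_def)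
   next
    case False
    then show ?thesis using \<eta>\<zeta>[of t] \<zeta>(3)[of t] by simp
   qed
  qed
  moreover have "\<eta> 0 = m" using dl(2) S' by (simp add: \<eta>_def)
  ultimately show "m \<in> stable_piece M A X q N T" using \<eta> unfolding stable_piece_def by blast
 qed
qed

text \<open>Conversely, every point of the stable manifold enters the plane after an integer time, so the stable
 manifold is a countable union of C1 images of subsets of the plane.\<close>

lemma stable_set_pull_charts:
 assumes "m \<in> stable_set M A X q"
 obtains n :: nat where "m \<in> fst (pull_chart (real n) d)" "snd (pull_chart (real n) d) m $ 1 = 0"
proof -
 obtain \<gamma> where g: "icurve {0..} \<gamma>" "\<gamma> 0 = m" "limitin M \<gamma> q at_top"
  using assms by (auto simp: stable_set_def)
 from limit_enters_ball[OF d1 q g(3) zero_less_one]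
 obtain S0 where S0: "!!t. S0 <= t ==> \<gamma> t \<in> fst d & norm (snd d (\<gamma> t)) < 1"
  unfolding eventually_at_top_linorder by blast
 obtain n :: nat where n: "S0 <= real n" using real_arch_simple by blast
 have "icurve {0..real n} \<gamma>" by (rule icurve_subset[OF g(1) is_interval_cc]) auto
 note p = pull_chart_apply[OF this g(2), of d]
 have "snd d (\<gamma> (real n)) $ 1 = 0" by (rule staying_curve_in_plane[OF g(1), of _ 1]) (use S0 n in auto)
 then show ?thesis using that p S0[OF n] by simp
qed

lemma stable_set_no_interior:
 assumes U: "openin M U" "U \<subseteq> stable_set M A X q" "x \<in> U" and e: "C1chart e" "x \<in> fst e"
 shows False
proof -
 note ec = C1chart_is_chart[OF e(1)]
 let ?p = "%n::nat. pull_chart (real n) d"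
 have p1: "C1chart (?p n)" for n by (rule C1chart_pull[OF d1]) simp
 let ?R = "%n. {y \<in> snd (?p n) ` (fst (?p n) \<inter> fst e). y $ 1 = 0}"
 have neg: "negligible (transition (?p n) e ` ?R n)" for n
 proof (rule negligible_differentiable_image_negligible)
  show "negligible (?R n)" by (rule negligible_subset[OF negligible_standard_hyperplane_cart[of 1]]) auto
  show "transition (?p n) e differentiable_on ?R n"
  proof (rule differentiable_at_imp_differentiable_on)
   fix y assume "y \<in> ?R n"
   then show "transition (?p n) e differentiable at y"
    using C1_has_derivative[OF C1chart_transition[OF p1 e(1)]] unfolding differentiable_def by blast
  qed
 qed simp
 have "snd e ` (U \<inter> fst e) \<subseteq> (\<Union>n. transition (?p n) e ` ?R n)"
 proof
  fix y assume "y \<in> snd e ` (U \<inter> fst e)"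
  then obtain m where m: "m \<in> U" "m \<in> fst e" "y = snd e m" by blast
  obtain n where n: "m \<in> fst (?p n)" "snd (?p n) m $ 1 = 0" using stable_set_pull_charts[of m] U(2) m(1) by blast
  have "snd (?p n) m \<in> ?R n" using n m(2) by blast
  moreover have "transition (?p n) e (snd (?p n) m) = y" using transition_apply[OF C1chart_is_chart[OF p1] n(1)] m(3) by simp
  ultimately show "y \<in> (\<Union>n. transition (?p n) e ` ?R n)" by blast
 qed
 from negligible_subset[OF negligible_Union_nat[OF neg] this]
 have "negligible (snd e ` (U \<inter> fst e))" .
 moreover have "open (snd e ` (U \<inter> fst e))" using U is_chartD(1)[OF ec] by (intro chart_image_open[OF ec]) auto
 ultimately show False using open_not_negligible U(3) e(2) by blast
qed

lemma stable_piece_subset: "stable_piece M A X q N T \<subseteq> stable_set M A X q"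
 by (auto simp: stable_piece_def stable_set_def)

text \<open>Hence the stable tangent space at a point of the stable manifold is the plane, read in a pulled back
 chart: it contains the plane and is not the whole space.\<close>

lemma stable_tangent_eq_plane:
 assumes S: "0 <= S" and g: "icurve {0..} \<gamma>" "limitin M \<gamma> q at_top"
  and box: "!!t. S <= t ==> \<gamma> t \<in> fst d"
  and c: "c \<in> A" "\<gamma> 0 \<in> fst c" and V: "stable_tangent M A X q (\<gamma> 0) c V"
 shows "V = {v. dtrans c (pull_chart S d) (\<gamma> 0) v $ 1 = 0}"
proof -
 let ?p = "pull_chart S d" and ?x = "\<gamma> 0"
 note c1 = atlas_C1chart[OF c(1)]
 obtain N T where N: "openin M N" "q \<in> N" "0 <= T"
  and ts: "has_tangent_space M A (stable_piece M A X q N T) ?x c V"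
  using V by (auto simp: stable_tangent_def)
 let ?P = "stable_piece M A X q N T"
 have xP: "?x \<in> ?P" using ts by (simp add: has_tangent_space_def)
 obtain e F where e: "C1chart e" "?x \<in> fst e" "subspace F"
   "snd e ` (?P \<inter> fst e) = snd e ` fst e \<inter> F" "V = {v. dtrans c e ?x v \<in> F}"
  using ts unfolding has_tangent_space_def by blast
 note ec = C1chart_is_chart[OF e(1)]
 obtain \<gamma>' where g': "icurve {0..} \<gamma>'" "\<gamma>' 0 = ?x" "\<gamma>' ` {T..} \<subseteq> N"
  using xP by (auto simp: stable_piece_def)
 have gN: "\<gamma> t \<in> N" if "T <= t" for t
 proof -
  have "\<gamma>' t = \<gamma> t" by (rule icurve_unique[OF g'(1) g(1), of 0]) (use g' that N(3) in auto)
  then show ?thesis using g'(3) that by auto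
 qed
 have p1: "C1chart ?p" by (rule C1chart_pull[OF d1 S])
 note pc = C1chart_is_chart[OF p1]
 have gS: "icurve {0..S} \<gamma>" by (rule icurve_subset[OF g(1) is_interval_cc]) auto
 have xp: "?x \<in> fst ?p" "snd ?p ?x = snd d (\<gamma> S)" using pull_chart_apply[OF gS refl S box[OF order_refl]] by auto
 obtain S0 where S0: "!!t. S0 <= t ==> \<gamma> t \<in> fst d & norm (snd d (\<gamma> t)) < 1"
  using limit_enters_ball[OF d1 q g(2) zero_less_one] unfolding eventually_at_top_linorder by blast
 have x1: "snd ?p ?x $ 1 = 0"
 proof -
  let ?S1 = "max S S0"
  have "snd d (\<gamma> ?S1) $ 1 = 0" by (rule staying_curve_in_plane[OF g(1), of _ 1]) (use S0 S in auto)
  moreover have "snd d (\<gamma> ?S1) = E (?S1 - S) (snd d (\<gamma> S))"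
   by (rule icurve_linear_chart[OF chart lin g(1)]) (use box S in auto)
  ultimately show ?thesis using xp(2) by (simp add: E1)
 qed
 obtain Q where Q: "openin M Q" "?x \<in> Q" "Q \<subseteq> fst ?p" "!!m. m \<in> Q ==> snd ?p m $ 1 = 0 ==> m \<in> ?P"
  by (rule plane_in_stable_piece[OF S g box N gN]) (assumption | rule that)+
 have sub: "v \<in> V" if v: "dtrans c ?p ?x v $ 1 = 0" for v
 proof -
  let ?w = "dtrans c ?p ?x v" and ?y0 = "snd ?p ?x"
  let ?O = "snd ?p ` (Q \<inter> fst e)"
  have O': "open ?O" using Q is_chartD(1)[OF ec] by (intro chart_image_open[OF pc]) auto
  have y0O: "?y0 \<in> ?O" using Q(2) e(2) by blast
  have F: "transition ?p e y \<in> F" if y: "y \<in> ?O" "y $ 1 = 0" for y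
  proof -
   obtain m where m: "m \<in> Q" "m \<in> fst e" "y = snd ?p m" using y(1) by blast
   then have "m \<in> ?P" using Q(4) y(2) by simp
   then have "snd e m \<in> F" using e(4) m(2) by blast
   then show ?thesis using transition_apply[OF pc, of m e] m Q(3) by auto
  qed
  have lim: "((%s. (1/s) *\<^sub>R (transition ?p e (?y0 + s *\<^sub>R ?w) - transition ?p e ?y0)) \<longlongrightarrow> dtrans ?p e ?x ?w) (at (0::real))"
   by (rule quotient_limit[OF dtrans_has_derivative[OF p1 e(1) xp(1) e(2)]])
  have "((%s::real. ?y0 + s *\<^sub>R ?w) \<longlongrightarrow> ?y0 + 0 *\<^sub>R ?w) (at 0)" by (intro tendsto_intros)
  then have "\<forall>\<^sub>F s in at (0::real). ?y0 + s *\<^sub>R ?w \<in> ?O"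
   using O' y0O by (intro topological_tendstoD[where l = ?y0]) simp_all
  then have "\<forall>\<^sub>F s in at (0::real). (1/s) *\<^sub>R (transition ?p e (?y0 + s *\<^sub>R ?w) - transition ?p e ?y0) \<in> F"
  proof (rule eventually_mono)
   fix s :: real assume s: "?y0 + s *\<^sub>R ?w \<in> ?O"
   have "transition ?p e (?y0 + s *\<^sub>R ?w) \<in> F" by (rule F[OF s]) (simp add: x1 v)
   moreover have "transition ?p e ?y0 \<in> F" by (rule F[OF y0O x1])
   ultimately show "(1/s) *\<^sub>R (transition ?p e (?y0 + s *\<^sub>R ?w) - transition ?p e ?y0) \<in> F"
    using e(3) by (intro subspace_scale subspace_diff)
  qed
  from Lim_in_closed_set[OF closed_subspace[OF e(3)] this _ lim]
  have "dtrans ?p e ?x ?w \<in> F" by simp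
  then show ?thesis unfolding e(5) using dtrans_chain[OF c1 c(2) p1 xp(1) e(1,2)] by simp
 qed
 have FU: "F ~= UNIV"
 proof
  assume "F = UNIV"
  then have im: "snd e ` (?P \<inter> fst e) = snd e ` fst e" using e(4) by simp
  have "fst e \<subseteq> ?P"
  proof
   fix m assume m: "m \<in> fst e"
   then have "snd e m \<in> snd e ` (?P \<inter> fst e)" using im by blast
   then obtain m' where m': "m' \<in> ?P" "m' \<in> fst e" "snd e m = snd e m'" by blast
   have "m = m'" by (rule inj_onD[OF is_chartD(5)[OF ec] m'(3) m m'(2)])
   then show "m \<in> ?P" using m' by simp
  qed
  then have "fst e \<subseteq> stable_set M A X q" using stable_piece_subset by blast
  then show False using stable_set_no_interior[OF is_chartD(1)[OF ec] _ e(2) e(1,2)] by blast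
 qed
 let ?J = "dtrans c e ?x" and ?K = "dtrans c ?p ?x"
 have J: "linear ?J" by (rule dtrans_linear[OF c1 e(1) c(2) e(2)])
 have K: "linear ?K" by (rule dtrans_linear[OF c1 p1 c(2) xp(1)])
 have "?K v $ 1 = 0" if v: "v \<in> V" for v
 proof (rule ccontr)
  assume k: "?K v $ 1 ~= 0"
  have "w \<in> V" for w
  proof -
   let ?s = "?K w $ 1 / ?K v $ 1"
   have "?K (w - ?s *\<^sub>R v) $ 1 = 0" using k by (simp add: linear_diff[OF K] linear_scale[OF K])
   then have "?J (w - ?s *\<^sub>R v) \<in> F" using sub e(5) by blast
   moreover have "?J v \<in> F" using v e(5) by blast
   ultimately have "?J (w - ?s *\<^sub>R v) + ?s *\<^sub>R ?J v \<in> F" using e(3) by (intro subspace_add subspace_scale)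
   then show "w \<in> V" unfolding e(5) by (simp add: linear_diff[OF J] linear_scale[OF J])
  qed
  then have "?J (dtrans e c ?x u) \<in> F" for u unfolding e(5) by blast
  then have "F = UNIV" using dtrans_inverse[OF e(1,2) c1 c(2)] by auto
  then show False using FU by simp
 qed
 then show ?thesis using sub by blast
qed

end

text \<open>The opposite type: if the stable directions form the axis, the stable manifold is a countable union of
 C1 images of subsets of a line, and so is not of dimension two.\<close>

lemma (in vector_field_manifold) stable_axis_dim:
 assumes d: "field_in d L" "linear L" and q: "q \<in> fst d" "snd d q = 0"
  and sf: "saddle_form (%v. - L v) \<mu> \<alpha>" and dim: "stable_dim M A X q 2"
 shows False
proof -
 interpret R: saddle_form "%v. - L v" \<mu> \<alpha> by (rule sf)
 have d1: "C1chart d" using d(1) by (simp add: field_in_def)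
 note dc = C1chart_is_chart[OF d1]
 have rev: "linear_flow L t y = linear_flow (%v. - L v) (- t) y" for t y by (simp add: linear_flow_uminus[OF d(2)])
 have on_axis: "R.plane (snd d (\<gamma> S)) = 0"
  if g: "icurve I \<gamma>" and I: "{S..} \<subseteq> I" and stay: "!!t. S <= t ==> \<gamma> t \<in> fst d & norm (snd d (\<gamma> t)) < 1" for I \<gamma> S
 proof (rule ccontr)
  let ?y = "snd d (\<gamma> S)"
  assume y: "R.plane ?y ~= 0"
  define t where "t = 2 / (\<alpha> * norm (R.plane ?y))"
  have t: "t \<ge> 0" "\<alpha> * t * norm (R.plane ?y) = 2" using y R.\<alpha> by (auto simp: t_def)
  have lin': "snd d (\<gamma> (S + t)) = linear_flow L (S + t - S) ?y"
   by (rule icurve_linear_chart[OF d g]) (use I stay t in auto)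
  have pn: "norm (R.plane z) <= norm z" for z :: "real^3"
  proof -
   have "(norm (R.plane z))\<^sup>2 <= (norm z)\<^sup>2"
    unfolding power2_norm_eq_inner by (simp add: R.plane_def inner_vec_def sum_3 axis_def)
   then show ?thesis by (rule power2_le_imp_le) simp
  qed
  have "2 = \<alpha> * t * norm (R.plane ?y)" using t by simp
  also have "\<dots> <= exp (\<alpha> * t) * norm (R.plane ?y)"
  proof (rule mult_right_mono)
   show "\<alpha> * t <= exp (\<alpha> * t)" using exp_ge_add_one_self[of "\<alpha> * t"] by linarith
  qed simp
  also have "\<dots> <= norm (R.E (- t) (R.plane ?y))" by (rule R.E_growth[OF _ t(1)]) simp
  also have "\<dots> = norm (R.plane (snd d (\<gamma> (S + t))))" unfolding lin' rev R.E_plane by simp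
  also have "\<dots> <= norm (snd d (\<gamma> (S + t)))" by (rule pn)
  also have "\<dots> < 1" using stay[of "S + t"] t by simp
  finally show False by simp
 qed
 have qtop: "q \<in> topspace M" using q is_chartD(3)[OF dc] by blast
 obtain c where c: "c \<in> A" "q \<in> fst c" using atlas_covers qtop by blast
 note c1 = atlas_C1chart[OF c(1)]
 have "icurve {0..} (%t. chart_inv d (linear_flow L (t - 0) 0))" by (rule linear_chart_icurve[OF d is_interval_ci])
   (use q linear_0[OF linear_flow_linear[OF d(2)]] in \<open>auto intro: image_eqI[of _ _ q]\<close>)
 moreover have "chart_inv d (linear_flow L (t - 0) 0) = q" for t
  using chart_inv_left[OF dc q(1)] q(2) linear_0[OF linear_flow_linear[OF d(2)]] by simp
 ultimately have "icurve {0..} (%t. q)" by simp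
 then have qs: "q \<in> stable_set M A X q" using qtop unfolding stable_set_def by (auto intro!: exI[of _ "%t. q"])
 obtain V where V: "stable_tangent M A X q q c V" "dim V = 2" using dim qs c unfolding stable_dim_def by blast
 obtain N T where ts: "has_tangent_space M A (stable_piece M A X q N T) q c V" using V(1) by (auto simp: stable_tangent_def)
 let ?P = "stable_piece M A X q N T"
 obtain e F where e: "C1chart e" "q \<in> fst e" "subspace F"
   "snd e ` (?P \<inter> fst e) = snd e ` fst e \<inter> F" "V = {v. dtrans c e q v \<in> F}"
  using ts unfolding has_tangent_space_def by blast
 have qP: "q \<in> ?P" using ts by (simp add: has_tangent_space_def)
 note ec = C1chart_is_chart[OF e(1)]
 have FV: "F = dtrans c e q ` V"
 proof
  show "F \<subseteq> dtrans c e q ` V"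
  proof
   fix w assume w: "w \<in> F"
   have "dtrans c e q (dtrans e c q w) = w" by (rule dtrans_inverse[OF e(1,2) c1 c(2)])
   then show "w \<in> dtrans c e q ` V" using w e(5) by (intro image_eqI[of _ _ "dtrans e c q w"]) auto
  qed
 qed (use e(5) in auto)
 have "inj_on (dtrans c e q) (span V)" using dtrans_inverse[OF c1 c(2) e(1,2)] by (metis inj_onI)
 then have dF: "dim F = 2" unfolding FV using dim_image_eq[OF dtrans_linear[OF c1 e(1) c(2) e(2)]] V(2) by metis
 have "dim F = dim (UNIV :: (real^2) set)" using dF by (simp add: dim_UNIV)
 then obtain f where f: "linear f" "f ` F = (UNIV :: (real^2) set)" "inj_on f F"
  using subspace_isomorphism[OF e(3) subspace_UNIV] by blast
 obtain g where g: "linear g" "!!x. x \<in> F ==> g (f x) = x"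
  using linear_exists_left_inverse_on[OF f(1) e(3) f(3)] by blast
 let ?p = "%n::nat. pull_chart (real n) d"
 have p1: "C1chart (?p n)" for n by (rule C1chart_pull[OF d1]) simp
 let ?R = "%n. {s::real. s *\<^sub>R axis 1 1 \<in> snd (?p n) ` (fst (?p n) \<inter> fst e)}"
 let ?h = "%n s. f (transition (?p n) e (s *\<^sub>R axis 1 1))"
 have neg: "negligible (?h n ` ?R n)" for n
 proof (rule negligible_differentiable_image_lowdim)
  show "DIM(real) < DIM(real^2)" by simp
  show "?h n differentiable_on ?R n"
  proof (rule differentiable_at_imp_differentiable_on)
   fix s assume "s \<in> ?R n"
   then have "(transition (?p n) e has_derivative frechet_derivative (transition (?p n) e) (at (s *\<^sub>R axis 1 1))) (at (s *\<^sub>R axis 1 1))"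
    using C1_has_derivative[OF C1chart_transition[OF p1 e(1)]] by simp
   then have "transition (?p n) e differentiable at (s *\<^sub>R axis 1 1)" unfolding differentiable_def by blast
   then have "(transition (?p n) e \<circ> (%s. s *\<^sub>R axis 1 1)) differentiable at s"
    by (intro differentiable_chain_at) auto
   from differentiable_chain_at[OF this linear_imp_differentiable[OF f(1)]]
   have "(f \<circ> (transition (?p n) e \<circ> (%s. s *\<^sub>R axis 1 1))) differentiable at s" .
   then show "?h n differentiable at s" by (simp add: o_def)
  qed
 qed
 let ?U = "snd e ` fst e"
 have "g -` ?U \<subseteq> (\<Union>n. ?h n ` ?R n)"
 proof
  fix z assume z: "z \<in> g -` ?U"
  obtain x where x: "x \<in> F" "z = f x" using f(2) by blast
  then have "x \<in> ?U \<inter> F" using z g(2) by simp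
  then obtain m where m: "m \<in> ?P" "m \<in> fst e" "x = snd e m" using e(4) by blast
  obtain \<gamma> where gm: "icurve {0..} \<gamma>" "\<gamma> 0 = m" "limitin M \<gamma> q at_top"
   using m(1) by (auto simp: stable_piece_def)
  from limit_enters_ball[OF d1 q gm(3) zero_less_one]
  obtain S0 where S0: "!!t. S0 <= t ==> \<gamma> t \<in> fst d & norm (snd d (\<gamma> t)) < 1"
   unfolding eventually_at_top_linorder by blast
  obtain n :: nat where n: "S0 <= real n" using real_arch_simple by blast
  have "icurve {0..real n} \<gamma>" by (rule icurve_subset[OF gm(1) is_interval_cc]) auto
  note p = pull_chart_apply[OF this gm(2), of d]
  have mp: "m \<in> fst (?p n)" "snd (?p n) m = snd d (\<gamma> (real n))" using p S0[OF n] by auto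
  have "R.plane (snd d (\<gamma> (real n))) = 0" by (rule on_axis[OF gm(1)]) (use S0 n in auto)
  then have ax: "snd (?p n) m = (snd (?p n) m $ 1) *\<^sub>R axis 1 1" using R.plane_decomp[of "snd (?p n) m"] mp(2) by simp
  have "snd (?p n) m $ 1 \<in> ?R n" using mp(1) m(2) by (simp flip: ax)
  moreover have "?h n (snd (?p n) m $ 1) = z"
   using transition_apply[OF C1chart_is_chart[OF p1] mp(1), of e] m(3) x(2) by (simp flip: ax)
  ultimately show "z \<in> (\<Union>n. ?h n ` ?R n)" by blast
 qed
 from negligible_subset[OF negligible_Union_nat[OF neg] this]
 have "negligible (g -` ?U)" .
 moreover have "open (g -` ?U)"
  using is_chartD(2)[OF ec] g(1) by (intro open_vimage) (auto intro: linear_continuous_on simp: linear_linear)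
 moreover have "f (snd e q) \<in> g -` ?U"
 proof -
  have "snd e q \<in> F" using e(4) qP e(2) by blast
  then show ?thesis using g(2) e(2) by simp
 qed
 ultimately show False using open_not_negligible by blast
qed

section \<open>Extending conjugacies in the unit linear flow\<close>

definition vec3 :: "real => real => real => real^3" where
 "vec3 x y z = x *\<^sub>R axis 1 1 + y *\<^sub>R axis 2 1 + z *\<^sub>R axis 3 1"

lemma vec3_nth [simp]: "vec3 x y z $ 1 = x" "vec3 x y z $ 2 = y" "vec3 x y z $ 3 = z" by (simp_all add: vec3_def axis_def)

lemma vec3_eq_iff: "v = w \<longleftrightarrow> v $ 1 = w $ 1 & v $ 2 = w $ 2 & v $ 3 = (w :: real^3) $ 3"
 by (simp add: vec_eq_iff forall_3)

lemma vec3_eta [simp]: "vec3 (v $ 1) (v $ 2) (v $ 3) = v" by (simp add: vec3_eq_iff)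

lemma axis2_vec3: "axis 2 1 = vec3 0 1 0" by (simp add: vec3_eq_iff axis_def)

lemma continuous_on_vec3 [continuous_intros]:
 "continuous_on S f ==> continuous_on S g ==> continuous_on S h ==> continuous_on S (%x. vec3 (f x) (g x) (h x))"
 unfolding vec3_def by (intro continuous_intros)

lemma isCont_vec3:
 "isCont f x ==> isCont g x ==> isCont h x ==> isCont (%x. vec3 (f x) (g x) (h x)) x"
 unfolding vec3_def by (intro continuous_intros)

definition unit_flow :: "real => real^3 => real^3" where
 "unit_flow t v = vec3 (exp t * v $ 1) (exp (- t) * v $ 2) (exp (- t) * v $ 3)"

lemma unit_flow_nth [simp]:
 "unit_flow t v $ 1 = exp t * v $ 1" "unit_flow t v $ 2 = exp (- t) * v $ 2" "unit_flow t v $ 3 = exp (- t) * v $ 3"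
 by (simp_all add: unit_flow_def)

lemma unit_flow_invariant: "unit_flow t v $ 1 * unit_flow t v $ 2 = v $ 1 * v $ 2" by (simp add: exp_minus field_simps)

definition cube :: "real => (real^3) set" where
 "cube \<rho> = {v. \<bar>v $ 1\<bar> < \<rho> & \<bar>v $ 2 - 1\<bar> < \<rho> & \<bar>v $ 3\<bar> < \<rho>}"

lemma open_cube: "open (cube \<rho>)"
proof -
 have "cube \<rho> = {v. \<bar>v $ 1\<bar> < \<rho>} \<inter> {v. \<bar>v $ 2 - 1\<bar> < \<rho>} \<inter> {v. \<bar>v $ 3\<bar> < \<rho>}"
  by (auto simp: cube_def)
 moreover have "open {v :: real^3. \<bar>v $ 1\<bar> < \<rho>}" "open {v :: real^3. \<bar>v $ 2 - 1\<bar> < \<rho>}" "open {v :: real^3. \<bar>v $ 3\<bar> < \<rho>}"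
  by (auto intro!: open_Collect_less continuous_intros)
 ultimately show ?thesis by auto
qed

lemma cube_in_open:
 assumes "open W" "axis 2 1 \<in> W"
 obtains \<rho> where "0 < \<rho>" "\<rho> <= 1/2" "cube \<rho> \<subseteq> W"
proof -
 obtain e where e: "e > 0" "ball (axis 2 1) e \<subseteq> W" using assms open_contains_ball by blast
 define \<rho> where "\<rho> = min (1/2) (e / 3)"
 have \<rho>: "0 < \<rho>" "\<rho> <= 1/2" "3 * \<rho> <= e" using e by (auto simp: \<rho>_def)
 have "v \<in> W" if v: "v \<in> cube \<rho>" for v
 proof -
  have "norm (v - axis 2 1) <= (\<Sum>i\<in>UNIV. \<bar>(v - axis 2 1) $ i\<bar>)" by (rule norm_le_l1_cart)
  also have "\<dots> < 3 * \<rho>" using v by (simp add: sum_3 axis_def cube_def)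
  finally have "v \<in> ball (axis 2 1) e" using \<rho>(3) by (simp add: dist_norm norm_minus_commute)
  then show ?thesis using e(2) by blast
 qed
 then show ?thesis using that \<rho> by blast
qed

text \<open>A function on the cube that is homogeneous along the flow is determined by its values on the
 section \<open>v $ 2 = 1\<close>.\<close>

lemma section_value:
 assumes equi: "!!v t. (!!r. r \<in> closed_segment 0 t ==> unit_flow r v \<in> cube \<rho>) ==> Z (unit_flow t v) = exp (- t) * Z v"
  and v: "\<bar>v $ 2 - 1\<bar> < \<rho>" "\<rho> <= 1/2" and c: "\<bar>v $ 1 * v $ 2\<bar> < \<rho> / 2" and s: "\<bar>v $ 3 / v $ 2\<bar> < \<rho> / 2"
 shows "Z v = v $ 2 * Z (vec3 (v $ 1 * v $ 2) 1 (v $ 3 / v $ 2))"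
proof -
 have y: "1/2 < v $ 2" "v $ 2 < 3/2" using v by argo+
 let ?w = "vec3 (v $ 1 * v $ 2) 1 (v $ 3 / v $ 2)" and ?t = "- ln (v $ 2)"
 have e: "exp (- ?t) = v $ 2" "exp ?t = 1 / v $ 2" using y by (simp_all add: exp_minus inverse_eq_divide)
 have "unit_flow ?t ?w = v" using y by (simp add: vec3_eq_iff e)
 moreover have "unit_flow r ?w \<in> cube \<rho>" if r: "r \<in> closed_segment 0 ?t" for r
 proof -
  have r': "(0 <= r & r <= ?t) \<or> (?t <= r & r <= 0)" using r by (auto simp: closed_segment_eq_real_ivl split: if_splits)
  have gen: "\<bar>a - 1\<bar> < \<rho> & a <= 2 & 1/2 <= a"
   if "(1 <= a & a <= b) \<or> (b <= a & a <= 1)" "\<bar>b - 1\<bar> < \<rho>" for a b :: real using that v(2) by auto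
  have "(exp 0 <= exp (- r) & exp (- r) <= exp (- ?t)) \<or> (exp (- ?t) <= exp (- r) & exp (- r) <= exp 0)" using r' by auto
  from gen[OF this[unfolded e exp_zero] v(1)]
  have er: "\<bar>exp (- r) - 1\<bar> < \<rho>" "exp (- r) <= 2" "exp (- r) \<ge> 1/2" by blast+
  have "exp r * exp (- r) = 1" by (simp add: exp_minus)
  have "exp r <= 2"
  proof (rule ccontr)
   assume "\<not> exp r <= 2"
   then have "2 * (1/2) < exp r * exp (- r)" using er(3) by (intro mult_less_le_imp_less) auto
   then show False using \<open>exp r * exp (- r) = 1\<close> by simp
  qed
  then have "exp r * \<bar>v $ 1 * v $ 2\<bar> <= 2 * \<bar>v $ 1 * v $ 2\<bar>" by (intro mult_right_mono) auto
  moreover have "exp (- r) * \<bar>v $ 3 / v $ 2\<bar> <= 2 * \<bar>v $ 3 / v $ 2\<bar>" using er by (intro mult_right_mono) auto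
  moreover have "2 * \<bar>v $ 1 * v $ 2\<bar> < \<rho>" "2 * \<bar>v $ 3 / v $ 2\<bar> < \<rho>" using c s by argo+
  ultimately have "exp r * \<bar>v $ 1 * v $ 2\<bar> < \<rho>" "exp (- r) * \<bar>v $ 3 / v $ 2\<bar> < \<rho>" by linarith+
  then show ?thesis using er by (simp add: cube_def abs_mult)
 qed
 ultimately have "Z v = exp (- ?t) * Z ?w" using equi[of ?t ?w] by simp
 then show ?thesis unfolding e .
qed

lemma strict_mono_of_inj:
 fixes b :: "real => real"
 assumes c: "continuous_on {-dl..dl} b" and inj: "inj_on b {-dl..dl}" and lt: "b (- dl) < b dl"
  and xy: "- dl <= x" "x < y" "y <= dl"
 shows "b x < b y"
proof -
 have left: "b x < b dl" if "- dl <= x" "x < dl" for x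
 proof (cases "x = - dl")
  case False
  then show ?thesis using continuous_inj_imp_mono[of "- dl" x dl b] that c inj lt by auto
 qed (use lt in simp)
 show ?thesis
 proof (cases "y = dl")
  case True
  then show ?thesis using left xy by simp
 next
  case False
  have "continuous_on {x..dl} b" "inj_on b {x..dl}" using c inj xy by (auto intro: continuous_on_subset inj_on_subset)
  then show ?thesis using continuous_inj_imp_mono[of x y dl b] left[of x] xy False by auto
 qed
qed

definition clip :: "real => real => real" where "clip dl s = max (- dl) (min dl s)"

lemma clip_props:
 assumes "0 <= dl"
 shows "clip dl s \<in> {-dl..dl}" "\<bar>s\<bar> <= dl ==> clip dl s = s" "s <= t ==> clip dl s <= clip dl t"
  "dl <= s ==> clip dl s = dl" "s <= - dl ==> clip dl s = - dl"
 using assms by (auto simp: clip_def)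

lemma continuous_on_clip [continuous_intros]: "continuous_on S f ==> continuous_on S (%x. clip dl (f x))"
 unfolding clip_def by (intro continuous_intros)

text \<open>Extension of a third coordinate \<open>Z\<close> from a neighbourhood of the point \<open>(0,1,0)\<close>.  Orbits in
 \<open>v $ 2 > 0\<close> are labelled by \<open>c = v $ 1 * v $ 2\<close> and the slope \<open>s = v $ 3 / v $ 2\<close>.  For fixed \<open>c\<close> the new slope
 is an increasing function of the old one near \<open>s = 0\<close>, continued piecewise linearly to the identity on
 \<open>\<bar>s\<bar> \<ge> 1\<close>; so the map is the identity outside the sector \<open>\<bar>v $ 3\<bar> <= v $ 2\<close> and extends to the saddle.\<close>

lemma extend_third_increasing:
 fixes Z :: "real^3 => real"
 assumes \<rho>: "0 < \<rho>" "\<rho> <= 1/2" and Zc: "continuous_on (cube \<rho>) Z" and Z0: "Z (axis 2 1) = 0"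
  and equi: "!!v t. (!!r. r \<in> closed_segment 0 t ==> unit_flow r v \<in> cube \<rho>) ==> Z (unit_flow t v) = exp (- t) * Z v"
  and inj: "!!v w. v \<in> cube \<rho> ==> w \<in> cube \<rho> ==> v $ 1 = w $ 1 ==> v $ 2 = w $ 2 ==> Z v = Z w ==> v = w"
  and incr: "!!s. 0 < s ==> s < \<rho> ==> Z (vec3 0 1 (- s)) < Z (vec3 0 1 s)"
 obtains F \<epsilon> W where "\<epsilon> > 0" "open W" "axis 2 1 \<in> W" "W \<subseteq> cube \<rho>" "W \<subseteq> {v. \<bar>v $ 1 * v $ 2\<bar> < \<epsilon>}"
  "continuous_on {v. \<bar>v $ 1 * v $ 2\<bar> < \<epsilon>} F" "inj_on F {v. \<bar>v $ 1 * v $ 2\<bar> < \<epsilon>}"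
  "!!v. v \<in> W ==> F v = vec3 (v $ 1) (v $ 2) (Z v)"
  "!!v t. F (unit_flow t v) = unit_flow t (F v)" "F 0 = 0"
proof -
 define b where "b c s = Z (vec3 c 1 s)" for c s
 have inbox: "vec3 c 1 s \<in> cube \<rho>" if "\<bar>c\<bar> < \<rho>" "\<bar>s\<bar> < \<rho>" for c s using that \<rho> by (simp add: cube_def)
 have bc: "continuous_on {p. \<bar>fst p\<bar> < \<rho> & \<bar>snd p\<bar> < \<rho>} (%p. b (fst p) (snd p))"
  unfolding b_def by (rule continuous_on_compose2[OF Zc]) (auto intro!: continuous_intros inbox)
 have bcomp: "continuous_on S (%x. b (f x) (g x))"
  if f: "continuous_on S f" and g: "continuous_on S g" and bd: "!!x. x \<in> S ==> \<bar>f x\<bar> < \<rho>" "!!x. x \<in> S ==> \<bar>g x\<bar> < \<rho>"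
  for S :: "'x::topological_space set" and f g
 proof -
  have "(%x. (f x, g x)) ` S \<subseteq> {p. \<bar>fst p\<bar> < \<rho> & \<bar>snd p\<bar> < \<rho>}" using bd by auto
  from continuous_on_compose2[OF bc continuous_on_Pair[OF f g] this] show ?thesis by simp
 qed
 have b0: "b 0 0 = 0" using Z0 by (simp add: b_def axis2_vec3)
 have "open {p :: real \<times> real. \<bar>fst p\<bar> < \<rho> & \<bar>snd p\<bar> < \<rho>}"
  by (intro open_Collect_conj open_Collect_less continuous_intros)
 then have "isCont (%p. b (fst p) (snd p)) (0, 0)" using bc \<rho> by (simp add: continuous_on_eq_continuous_at)
 then have "\<forall>\<^sub>F p in at (0, 0). \<bar>b (fst p) (snd p)\<bar> < 1"
  unfolding isCont_def using tendsto_rabs[of "%p. b (fst p) (snd p)" "b 0 0" "at (0,0)"] b0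
  by (auto intro!: order_tendstoD(2)[of "%p. \<bar>b (fst p) (snd p)\<bar>" 0])
 then obtain \<eta> where \<eta>: "\<eta> > 0" "!!p. p ~= (0, 0) ==> dist p (0, 0) < \<eta> ==> \<bar>b (fst p) (snd p)\<bar> < 1"
  unfolding eventually_at by auto
 define dl where "dl = min (\<rho> / 4) (\<eta> / 4)"
 have dl: "0 < dl" "dl < \<rho> / 2" "dl < \<rho>" "dl < 1" "2 * dl < \<eta>" using \<rho> \<eta> by (auto simp: dl_def min_def)
 have b1: "\<bar>b c s\<bar> < 1" if "\<bar>c\<bar> <= dl" "\<bar>s\<bar> <= dl" for c s
 proof (cases "c = 0 & s = 0")
  case False
  have "dist (c, s) (0, 0) = norm (c, s)" by (simp add: dist_norm)
  also have "\<dots> <= norm c + norm s" by (rule norm_Pair_le)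
  also have "\<dots> < \<eta>" using that dl by simp
  finally show ?thesis using \<eta>(2)[of "(c, s)"] False by auto
 qed (simp add: b0)
 have mono: "b c s < b c t" if c: "\<bar>c\<bar> <= dl" and st: "- dl <= s" "s < t" "t <= dl" for c s t
 proof (rule strict_mono_of_inj[OF _ _ _ st])
  have cc: "continuous_on {-dl..dl} (b c')" if "\<bar>c'\<bar> <= dl" for c'
   by (rule bcomp[of _ "%s. c'" "%s. s"]) (use that dl in auto)
  have ii: "inj_on (b c') {-dl..dl}" if "\<bar>c'\<bar> <= dl" for c'
  proof (rule inj_onI)
   fix s t assume st: "s \<in> {-dl..dl}" "t \<in> {-dl..dl}" "b c' s = b c' t"
   have "vec3 c' 1 s = vec3 c' 1 t" by (rule inj) (use st that dl in \<open>auto simp: b_def intro!: inbox\<close>)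
   then show "s = t" by (simp add: vec3_eq_iff)
  qed
  show "continuous_on {-dl..dl} (b c)" "inj_on (b c) {-dl..dl}" using cc[OF c] ii[OF c] by auto
  let ?g = "%c. b c dl - b c (- dl)"
  have gc: "continuous_on {-dl..dl} ?g"
   by (intro continuous_on_diff bcomp continuous_on_const continuous_on_id) (use dl in auto)
  have g0: "?g 0 > 0" using incr[of dl] dl by (simp add: b_def)
  have gne: "?g c' ~= 0" if "\<bar>c'\<bar> <= dl" for c' using inj_onD[OF ii[OF that], of dl "- dl"] dl by auto
  have "?g c > 0"
  proof (rule ccontr)
   assume "\<not> ?g c > 0"
   then have neg: "?g c < 0" using gne[OF c] by simp
   have con: "connected (?g ` {-dl..dl})" by (rule connected_continuous_image[OF gc connected_Icc])
   have "0 \<in> ?g ` {-dl..dl}"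
   proof (rule connectedD_interval[OF con])
    show "?g c \<in> ?g ` {-dl..dl}" by (rule imageI) (use c in auto)
    show "?g 0 \<in> ?g ` {-dl..dl}" by (rule imageI) (use dl in auto)
   qed (use g0 neg in auto)
   then show False using gne by auto
  qed
  then show "b c (- dl) < b c dl" by simp
 qed
 \<comment> \<open>the new slope on \<open>\<bar>s\<bar> <= 1\<close>, and the difference \<open>H\<close> to the old one\<close>
 define T where "T c s = b c (clip dl s) + max 0 (s - dl) / (1 - dl) * (1 - b c dl)
   + min 0 (s + dl) / (1 - dl) * (1 + b c (- dl))" for c s
 define H where "H c s = T (clip dl c) (clip 1 s) - clip 1 s" for c s
 have Tmono: "T c s < T c t" if c: "\<bar>c\<bar> <= dl" and st: "s < t" for c s t
 proof -
  have bb: "1 - b c dl > 0" "1 + b c (- dl) > 0" using b1[OF c, of dl] b1[OF c, of "- dl"] dl by auto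
  have 1: "b c (clip dl s) <= b c (clip dl t)" using mono[OF c, of "clip dl s" "clip dl t"] clip_props[of dl] dl st
   by (metis atLeastAtMost_iff less_eq_real_def)
  have 2: "max 0 (s - dl) / (1 - dl) * (1 - b c dl) <= max 0 (t - dl) / (1 - dl) * (1 - b c dl)"
   using bb dl st by (intro mult_right_mono divide_right_mono) auto
  have 3: "min 0 (s + dl) / (1 - dl) * (1 + b c (- dl)) <= min 0 (t + dl) / (1 - dl) * (1 + b c (- dl))"
   using bb dl st by (intro mult_right_mono divide_right_mono) auto
  consider "s < dl" "- dl < t" | "dl <= s" | "t <= - dl" by linarith
  then show ?thesis
  proof cases
   case 1
   then have "clip dl s < clip dl t" using st dl by (auto simp: clip_def min_def max_def)
   then have "b c (clip dl s) < b c (clip dl t)" using mono[OF c, of "clip dl s" "clip dl t"] clip_props(1)[of dl] dl by auto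
   then show ?thesis unfolding T_def using 2 3 by linarith
  next
   case 2
   have "max 0 (s - dl) / (1 - dl) * (1 - b c dl) < max 0 (t - dl) / (1 - dl) * (1 - b c dl)"
    using bb dl st 2 by (intro mult_strict_right_mono divide_strict_right_mono) auto
   then show ?thesis unfolding T_def using 1 3 by linarith
  next
   case t: 3
   have "min 0 (s + dl) / (1 - dl) * (1 + b c (- dl)) < min 0 (t + dl) / (1 - dl) * (1 + b c (- dl))"
    using bb dl st t by (intro mult_strict_right_mono divide_strict_right_mono) auto
   then show ?thesis unfolding T_def using 1 2 by linarith
  qed
 qed
 have T1: "T c 1 = 1" "T c (- 1) = - 1" for c
 proof -
  have r: "(1 - dl) / (1 - dl) = 1" "(- 1 + dl) / (1 - dl) = - 1" using dl by (simp_all add: field_simps)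
  have c: "clip dl 1 = dl" "clip dl (- 1) = - dl" using clip_props(4,5)[of dl] dl by auto
  have m: "max 0 (1 - dl) = 1 - dl" "min 0 (1 + dl) = 0" "max 0 (- 1 - dl) = 0" "min 0 (- 1 + dl) = - 1 + dl"
   using dl by auto
  show "T c 1 = 1" "T c (- 1) = - 1" unfolding T_def c m r by simp_all
 qed
 have Tle: "\<bar>T c s\<bar> <= 1" if c: "\<bar>c\<bar> <= dl" and s: "\<bar>s\<bar> <= 1" for c s
 proof -
  have s': "- 1 <= s" "s <= 1" using s by auto
  have "T c s <= T c 1" using Tmono[OF c, of s 1] s'(2) by (metis less_eq_real_def)
  moreover have "T c (-1) <= T c s" using Tmono[OF c, of "-1" s] s'(1) by (metis less_eq_real_def)
  ultimately show ?thesis using T1 by simp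
 qed
 have cldl: "\<bar>clip dl s\<bar> < \<rho>" for s using clip_props(1)[of dl s] dl by auto
 have Tc: "continuous_on ({-dl..dl} \<times> UNIV) (%p. T (fst p) (snd p))"
  unfolding T_def using dl by (intro continuous_intros bcomp) (use cldl in auto)
 have Hc: "continuous_on UNIV (%p. H (fst p) (snd p))"
 proof -
  have "continuous_on UNIV (%p :: real \<times> real. (clip dl (fst p), clip 1 (snd p)))" by (intro continuous_intros)
  moreover have "range (%p :: real \<times> real. (clip dl (fst p), clip 1 (snd p))) \<subseteq> {-dl..dl} \<times> UNIV"
   using clip_props(1)[of dl] dl by auto
  ultimately have "continuous_on UNIV (%p :: real \<times> real. T (fst (clip dl (fst p), clip 1 (snd p))) (snd (clip dl (fst p), clip 1 (snd p))))"
   by (rule continuous_on_compose2[OF Tc])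
  then have "continuous_on UNIV (%p :: real \<times> real. T (clip dl (fst p)) (clip 1 (snd p)))" by simp
  then show ?thesis unfolding H_def by (intro continuous_intros)
 qed
 have Hle: "\<bar>H c s\<bar> <= 2" for c s
 proof -
  have "\<bar>clip dl c\<bar> <= dl" "\<bar>clip 1 s\<bar> <= 1" using clip_props(1)[of dl c] clip_props(1)[of 1 s] dl by auto
  then show ?thesis using Tle[of "clip dl c" "clip 1 s"] by (simp add: H_def)
 qed
 have Hmono: "s + H c s < t + H c t" if st: "s < t" for c s t
 proof -
  have cd: "\<bar>clip dl c\<bar> <= dl" using clip_props(1)[of dl c] dl by auto
  show ?thesis
  proof (cases "clip 1 s < clip 1 t")
   case True
   then have "T (clip dl c) (clip 1 s) < T (clip dl c) (clip 1 t)" by (rule Tmono[OF cd])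
   moreover have "s - clip 1 s <= t - clip 1 t" using st by (auto simp: clip_def min_def max_def)
   ultimately show ?thesis unfolding H_def by linarith
  next
   case False
   then have "clip 1 s = clip 1 t" using clip_props(3)[of 1 s t] st by simp
   then show ?thesis using st by (simp add: H_def)
  qed
 qed
 define F where "F v = vec3 (v $ 1) (v $ 2) (v $ 3 + max 0 (v $ 2) * H (v $ 1 * v $ 2) (v $ 3 / v $ 2))" for v :: "real^3"
 have Fcont: "isCont F v" for v
 proof -
  let ?h = "%v :: real^3. max 0 (v $ 2) * H (v $ 1 * v $ 2) (v $ 3 / v $ 2)"
  have nth: "isCont (%v :: real^3. v $ i) v" for i by (intro continuous_intros)
  have "isCont ?h v"
  proof (cases "v $ 2 = 0")
   case False
   have "isCont (%p. H (fst p) (snd p)) p" for p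
    using Hc unfolding continuous_on_eq_continuous_at[OF open_UNIV] by (rule bspec) simp
   moreover have "isCont (%v :: real^3. (v $ 1 * v $ 2, v $ 3 / v $ 2)) v" using False by (intro continuous_intros nth) auto
   ultimately have "isCont (%v :: real^3. H (v $ 1 * v $ 2) (v $ 3 / v $ 2)) v"
    using isCont_o2[of v "%v :: real^3. (v $ 1 * v $ 2, v $ 3 / v $ 2)" "%p. H (fst p) (snd p)"] by simp
   then show ?thesis by (intro continuous_intros nth)
  next
   case True
   have "((%v :: real^3. \<bar>v $ 2\<bar> * 2) \<longlongrightarrow> \<bar>v $ 2\<bar> * 2) (at v)" by (intro tendsto_intros)
   then have "((%v :: real^3. \<bar>v $ 2\<bar> * 2) \<longlongrightarrow> 0) (at v)" using True by simp
   moreover have "\<forall>\<^sub>F w in at v. norm (?h w) <= \<bar>w $ 2\<bar> * 2"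
   proof (rule always_eventually, rule allI)
    fix w :: "real^3"
    have "\<bar>max 0 (w $ 2)\<bar> * \<bar>H (w $ 1 * w $ 2) (w $ 3 / w $ 2)\<bar> <= \<bar>w $ 2\<bar> * 2"
     using Hle by (intro mult_mono) auto
    then show "norm (?h w) <= \<bar>w $ 2\<bar> * 2" by (simp add: abs_mult)
   qed
   ultimately have "(?h \<longlongrightarrow> 0) (at v)" by (rule Lim_null_comparison[rotated])
   then show ?thesis using True by (simp add: isCont_def)
  qed
  from isCont_add[OF nth this, of 3] show ?thesis unfolding F_def by (intro isCont_vec3 nth)
 qed
 have Finj: "inj F"
 proof (rule injI)
  fix v w assume eq: "F v = F w"
  then have 12: "v $ 1 = w $ 1" "v $ 2 = w $ 2" by (simp_all add: F_def vec3_eq_iff)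
  have 3: "v $ 3 + max 0 (v $ 2) * H (v $ 1 * v $ 2) (v $ 3 / v $ 2) = w $ 3 + max 0 (v $ 2) * H (v $ 1 * v $ 2) (w $ 3 / v $ 2)"
   using eq 12 by (simp add: F_def vec3_eq_iff)
  have "v $ 3 = w $ 3"
  proof (cases "v $ 2 > 0")
   case True
   let ?y = "v $ 2" and ?c = "v $ 1 * v $ 2"
   have "?y * (v $ 3 / ?y + H ?c (v $ 3 / ?y)) = ?y * (w $ 3 / ?y + H ?c (w $ 3 / ?y))"
    using 3 True by (simp add: distrib_left)
   then have "v $ 3 / ?y + H ?c (v $ 3 / ?y) = w $ 3 / ?y + H ?c (w $ 3 / ?y)" using True by simp
   then have "v $ 3 / ?y = w $ 3 / ?y" using Hmono by (metis linorder_neqE_linordered_idom order_less_irrefl)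
   then show ?thesis using True by simp
  qed (use 3 in simp)
  then show "v = w" using 12 by (simp add: vec3_eq_iff)
 qed
 let ?W = "{v. \<bar>v $ 2 - 1\<bar> < \<rho>} \<inter> {v. \<bar>v $ 1 * v $ 2\<bar> < dl} \<inter> {v. \<bar>v $ 3\<bar> < dl * v $ 2} \<inter> cube \<rho>"
 show ?thesis
 proof (rule that[of dl ?W F])
  show "open ?W" by (intro open_Int open_Collect_less open_cube continuous_intros)
  show "axis 2 1 \<in> ?W" using dl \<rho> by (simp add: axis2_vec3 cube_def)
  show "continuous_on {v. \<bar>v $ 1 * v $ 2\<bar> < dl} F" by (rule continuous_at_imp_continuous_on) (use Fcont in blast)
  show "inj_on F {v. \<bar>v $ 1 * v $ 2\<bar> < dl}" using Finj by (rule inj_on_subset) simp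
  show "F (unit_flow t v) = unit_flow t (F v)" for v t
  proof -
   have mx: "max 0 (unit_flow t v $ 2) = exp (- t) * max 0 (v $ 2)" by (auto simp: max_def mult_le_0_iff zero_le_mult_iff)
   have i: "unit_flow t v $ 3 / unit_flow t v $ 2 = v $ 3 / v $ 2" by simp
   have "F (unit_flow t v) $ 3 = exp (- t) * F v $ 3"
    unfolding F_def vec3_nth unit_flow_invariant i mx by (simp add: distrib_left)
   then show ?thesis unfolding vec3_eq_iff unit_flow_nth by (simp add: F_def)
  qed
  show "F 0 = 0" by (simp add: F_def vec3_eq_iff)
  fix v assume v: "v \<in> ?W"
  have y: "v $ 2 > 0" using v \<rho> by (auto simp: cube_def)
  have s: "\<bar>v $ 3 / v $ 2\<bar> < dl" using v y by (simp add: abs_divide field_simps)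
  have v1: "\<bar>v $ 2 - 1\<bar> < \<rho>" and c1: "\<bar>v $ 1 * v $ 2\<bar> < dl" using v by auto
  note c2 = less_trans[OF c1 dl(2)]
  have cl: "clip dl (v $ 1 * v $ 2) = v $ 1 * v $ 2" "clip 1 (v $ 3 / v $ 2) = v $ 3 / v $ 2"
   "clip dl (v $ 3 / v $ 2) = v $ 3 / v $ 2"
   using v s dl by (auto intro!: clip_props(2))
  have xm: "max 0 (x - dl) = 0" "min 0 (x + dl) = 0" if "\<bar>x\<bar> < dl" for x using that by auto
  have "T (v $ 1 * v $ 2) (v $ 3 / v $ 2) = b (v $ 1 * v $ 2) (v $ 3 / v $ 2)" unfolding T_def cl xm[OF s] by simp
  then have "v $ 3 + max 0 (v $ 2) * H (v $ 1 * v $ 2) (v $ 3 / v $ 2) = v $ 2 * b (v $ 1 * v $ 2) (v $ 3 / v $ 2)"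
   using y by (simp add: H_def cl algebra_simps)
  also have "\<dots> = Z v"
   unfolding b_def by (rule section_value[OF equi v1 \<rho>(2) c2 less_trans[OF s dl(2)], symmetric]) auto
  finally show "F v = vec3 (v $ 1) (v $ 2) (Z v)" by (simp add: F_def)
 qed (use dl in auto)
qed

lemma extend_third:
 fixes Z :: "real^3 => real"
 assumes \<rho>: "0 < \<rho>" "\<rho> <= 1/2" and Zc: "continuous_on (cube \<rho>) Z" and Z0: "Z (axis 2 1) = 0"
  and equi: "!!v t. (!!r. r \<in> closed_segment 0 t ==> unit_flow r v \<in> cube \<rho>) ==> Z (unit_flow t v) = exp (- t) * Z v"
  and inj: "!!v w. v \<in> cube \<rho> ==> w \<in> cube \<rho> ==> v $ 1 = w $ 1 ==> v $ 2 = w $ 2 ==> Z v = Z w ==> v = w"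
 obtains F \<epsilon> W where "\<epsilon> > 0" "open W" "axis 2 1 \<in> W" "W \<subseteq> cube \<rho>" "W \<subseteq> {v. \<bar>v $ 1 * v $ 2\<bar> < \<epsilon>}"
  "continuous_on {v. \<bar>v $ 1 * v $ 2\<bar> < \<epsilon>} F" "inj_on F {v. \<bar>v $ 1 * v $ 2\<bar> < \<epsilon>}"
  "!!v. v \<in> W ==> F v = vec3 (v $ 1) (v $ 2) (Z v)"
  "!!v t. F (unit_flow t v) = unit_flow t (F v)" "F 0 = 0"
proof -
 \<comment> \<open>On the section, \<open>Z\<close> is monotone in the slope; if it decreases, reflect the third coordinate first.\<close>
 define b where "b s = Z (vec3 0 1 s)" for s
 have bc: "continuous_on {-s..s} b" if "s < \<rho>" for s
  unfolding b_def by (rule continuous_on_compose2[OF Zc]) (use that \<rho> in \<open>auto intro!: continuous_intros simp: cube_def\<close>)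
 have bi: "inj_on b {-s..s}" if "s < \<rho>" for s
 proof (rule inj_onI)
  fix x y assume xy: "x \<in> {-s..s}" "y \<in> {-s..s}" "b x = b y"
  have "vec3 0 1 x = vec3 0 1 y" by (rule inj) (use xy that \<rho> in \<open>auto simp: b_def cube_def\<close>)
  then show "x = y" by (simp add: vec3_eq_iff)
 qed
 have b0: "b 0 = 0" using Z0 by (simp add: b_def axis2_vec3)
 have opp: "b (- s) < 0 & 0 < b s \<or> b s < 0 & 0 < b (- s)" if "0 < s" "s < \<rho>" for s
  using continuous_inj_imp_mono[of "- s" 0 s b] that bc[of s] bi[of s] b0 by auto
 define s0 where "s0 = \<rho> / 2"
 have s0: "0 < s0" "s0 < \<rho>" using \<rho> by (auto simp: s0_def)
 have same: "0 < b s" if "0 < b s0" "0 < s" "s < \<rho>" for s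
 proof (rule ccontr)
  assume "\<not> 0 < b s"
  then have neg: "b s < 0" using opp[of s] that by auto
  let ?m = "max s s0"
  have con: "connected (b ` {min s s0..?m})"
   by (rule connected_continuous_image[OF continuous_on_subset[OF bc[of ?m]] connected_Icc]) (use that s0 in auto)
  have "0 \<in> b ` {min s s0..?m}" by (rule connectedD_interval[OF con, of "b s" "b s0"]) (use neg that in auto)
  then obtain x where "x \<in> {min s s0..?m}" "b x = b 0" using b0 by auto
  then have "x = 0" using inj_onD[OF bi[of ?m], of x 0] that s0 by (auto simp: min_def split: if_splits)
  then show False using \<open>x \<in> {min s s0..?m}\<close> that s0 by (auto simp: min_def split: if_splits)
 qed
 have same': "b s < 0" if "b s0 < 0" "0 < s" "s < \<rho>" for s
 proof (rule ccontr)
  assume "\<not> b s < 0"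
  then have neg: "0 < b s" using opp[of s] that by auto
  let ?m = "max s s0"
  have con: "connected (b ` {min s s0..?m})"
   by (rule connected_continuous_image[OF continuous_on_subset[OF bc[of ?m]] connected_Icc]) (use that s0 in auto)
  have "0 \<in> b ` {min s s0..?m}" by (rule connectedD_interval[OF con, of "b s0" "b s"]) (use neg that in auto)
  then obtain x where "x \<in> {min s s0..?m}" "b x = b 0" using b0 by auto
  then have "x = 0" using inj_onD[OF bi[of ?m], of x 0] that s0 by (auto simp: min_def split: if_splits)
  then show False using \<open>x \<in> {min s s0..?m}\<close> that s0 by (auto simp: min_def split: if_splits)
 qed
 show ?thesis
 proof (cases "0 < b s0")
  case True
  have incr: "Z (vec3 0 1 (- s)) < Z (vec3 0 1 s)" if "0 < s" "s < \<rho>" for s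
   using opp[OF that] same[OF True that] unfolding b_def by linarith
  show ?thesis by (rule extend_third_increasing[OF \<rho> Zc Z0 equi inj incr]) (assumption | rule that)+
 next
  case False
  then have neg: "b s0 < 0" using opp[OF s0] by auto
  define R where "R v = vec3 (v $ 1) (v $ 2) (- v $ 3)" for v :: "real^3"
  have R: "R (R v) = v" "R v \<in> cube \<rho> \<longleftrightarrow> v \<in> cube \<rho>" "R (unit_flow t v) = unit_flow t (R v)"
   "R v $ 1 = v $ 1" "R v $ 2 = v $ 2" "R v $ 3 = - v $ 3" for v t
   by (simp_all add: R_def vec3_eq_iff cube_def)
  have Rc: "continuous_on S R" for S unfolding R_def by (intro continuous_intros)
  have Rinj: "v = w" if "R v = R w" for v w using R(1) that by metis
  let ?Z = "%v. Z (R v)"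
  have c: "continuous_on (cube \<rho>) ?Z" by (rule continuous_on_compose2[OF Zc Rc]) (auto simp: R)
  have z: "?Z (axis 2 1) = 0"
  proof -
   have "R (axis 2 1) = axis 2 1" by (simp add: R_def axis2_vec3)
   then show ?thesis using Z0 by simp
  qed
  have e: "?Z (unit_flow t v) = exp (- t) * ?Z v" if "!!r. r \<in> closed_segment 0 t ==> unit_flow r v \<in> cube \<rho>" for v t
  proof -
   have "unit_flow r (R v) \<in> cube \<rho>" if r: "r \<in> closed_segment 0 t" for r
    using \<open>!!r. r \<in> closed_segment 0 t ==> unit_flow r v \<in> cube \<rho>\<close>[OF r] R(2)[of "unit_flow r v"] R(3) by metis
   then show ?thesis using equi[of t "R v"] R(3) by simp
  qed
  have i: "v = w" if "v \<in> cube \<rho>" "w \<in> cube \<rho>" "v $ 1 = w $ 1" "v $ 2 = w $ 2" "?Z v = ?Z w" for v w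
  proof (rule Rinj)
   show "R v = R w" by (rule inj) (use that in \<open>simp_all add: R(2,4,5)\<close>)
  qed
  have incr: "?Z (vec3 0 1 (- s)) < ?Z (vec3 0 1 s)" if "0 < s" "s < \<rho>" for s
   using opp[OF that] same'[OF neg that] unfolding b_def by (simp add: R_def)
  obtain F \<epsilon> W where F: "\<epsilon> > 0" "open W" "axis 2 1 \<in> W" "W \<subseteq> cube \<rho>" "W \<subseteq> {v. \<bar>v $ 1 * v $ 2\<bar> < \<epsilon>}"
   "continuous_on {v. \<bar>v $ 1 * v $ 2\<bar> < \<epsilon>} F" "inj_on F {v. \<bar>v $ 1 * v $ 2\<bar> < \<epsilon>}"
   "!!v. v \<in> W ==> F v = vec3 (v $ 1) (v $ 2) (?Z v)"
   "!!v t. F (unit_flow t v) = unit_flow t (F v)" "F 0 = 0"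
   by (rule extend_third_increasing[OF \<rho> c z e i incr]) (assumption | rule that)+
  show ?thesis
  proof (rule that[of \<epsilon> "R -` W" "%v. F (R v)"])
   show "open (R -` W)" by (rule open_vimage[OF F(2) Rc])
   show "axis 2 1 \<in> R -` W" using F(3) by (simp add: R_def axis2_vec3)
   show "R -` W \<subseteq> cube \<rho>" using F(4) R(2) by blast
   show "R -` W \<subseteq> {v. \<bar>v $ 1 * v $ 2\<bar> < \<epsilon>}" using F(5) R(4,5) by fastforce
   show "continuous_on {v. \<bar>v $ 1 * v $ 2\<bar> < \<epsilon>} (%v. F (R v))"
    by (rule continuous_on_compose2[OF F(6) Rc]) (auto simp: R)
   show "inj_on (%v. F (R v)) {v. \<bar>v $ 1 * v $ 2\<bar> < \<epsilon>}"
   proof (rule inj_onI)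
    fix v w assume vw: "v \<in> {v. \<bar>v $ 1 * v $ 2\<bar> < \<epsilon>}" "w \<in> {v. \<bar>v $ 1 * v $ 2\<bar> < \<epsilon>}" "F (R v) = F (R w)"
    have "R v = R w" by (rule inj_onD[OF F(7) vw(3)]) (use vw R in auto)
    then show "v = w" by (rule Rinj)
   qed
   show "F (R v) = vec3 (v $ 1) (v $ 2) (Z v)" if "v \<in> R -` W" for v using F(8)[of "R v"] that R by simp
   show "F (R (unit_flow t v)) = unit_flow t (F (R v))" for v t using F(9) R(3) by simp
   have "R 0 = 0" by (simp add: R_def vec3_eq_iff)
   then show "F (R 0) = 0" using F(10) by simp
  qed (use F in auto)
 qed
qed

text \<open>Extension of a second coordinate \<open>Y\<close>: points are rescaled in the plane by a factor depending only on the
 orbit label \<open>(c, s)\<close>.  The factor is interpolated geometrically to \<open>1\<close> as the slope leaves a neighbourhood of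
 \<open>0\<close>; a weighted mean of increasing functions of \<open>c\<close> is increasing, which keeps the map injective.\<close>

lemma extend_second:
 fixes Y :: "real^3 => real"
 assumes \<rho>: "0 < \<rho>" "\<rho> <= 1/2" and Yc: "continuous_on (cube \<rho>) Y" and Y0: "Y (axis 2 1) = 1"
  and pos: "!!v. v \<in> cube \<rho> ==> Y v > 0"
  and equi: "!!v t. (!!r. r \<in> closed_segment 0 t ==> unit_flow r v \<in> cube \<rho>) ==> Y (unit_flow t v) = exp (- t) * Y v"
  and mono: "!!c c' s. \<bar>c\<bar> < \<rho> ==> \<bar>c'\<bar> < \<rho> ==> \<bar>s\<bar> < \<rho> ==> \<bar>c\<bar> < \<bar>c'\<bar> ==> c * c' > 0 ==>
    \<bar>c\<bar> * Y (vec3 c 1 s) < \<bar>c'\<bar> * Y (vec3 c' 1 s)"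
 obtains F \<epsilon> W where "\<epsilon> > 0" "open W" "axis 2 1 \<in> W" "W \<subseteq> cube \<rho>" "W \<subseteq> {v. \<bar>v $ 1 * v $ 2\<bar> < \<epsilon>}"
  "continuous_on {v. \<bar>v $ 1 * v $ 2\<bar> < \<epsilon>} F" "inj_on F {v. \<bar>v $ 1 * v $ 2\<bar> < \<epsilon>}"
  "!!v. v \<in> W ==> F v = vec3 (v $ 1) (Y v) (v $ 3 / v $ 2 * Y v)"
  "!!v t. F (unit_flow t v) = unit_flow t (F v)" "F 0 = 0"
proof -
 define dl where "dl = \<rho> / 4"
 have dl: "0 < dl" "dl < \<rho>" "2 * dl = \<rho> / 2" using \<rho> by (auto simp: dl_def)
 define a where "a c s = ln (Y (vec3 (clip dl c) 1 (clip dl s)))" for c s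
 define cut where "cut s = max 0 (min 1 (2 - 2 * \<bar>s\<bar> / dl))" for s
 have inbox: "vec3 c 1 s \<in> cube \<rho>" if "\<bar>c\<bar> < \<rho>" "\<bar>s\<bar> < \<rho>" for c s using that \<rho> by (simp add: cube_def)
 have cl: "\<bar>clip dl c\<bar> <= dl" for c using clip_props(1)[of dl c] dl by auto
 have clb: "vec3 (clip dl c) 1 (clip dl s) \<in> cube \<rho>" for c s using cl[of c] cl[of s] dl by (intro inbox) auto
 have "continuous_on UNIV (%p. Y (vec3 (clip dl (fst p)) 1 (clip dl (snd p))))"
  by (rule continuous_on_compose2[OF Yc]) (use clb in \<open>auto intro!: continuous_intros\<close>)
 moreover have "\<forall>p\<in>UNIV. Y (vec3 (clip dl (fst p)) 1 (clip dl (snd p))) ~= 0"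
  using pos[OF clb] by (metis less_irrefl)
 ultimately have ac: "continuous_on UNIV (%p. a (fst p) (snd p))" unfolding a_def by (rule continuous_on_ln)
 have cutc: "continuous_on UNIV cut" unfolding cut_def using dl by (intro continuous_intros) auto
 have cut: "0 <= cut s" "cut s <= 1" "dl <= \<bar>s\<bar> ==> cut s = 0" "2 * \<bar>s\<bar> <= dl ==> cut s = 1" for s
  using dl by (auto simp: cut_def field_simps)
 define m where "m v = (if v $ 2 > 0 then exp (cut (v $ 3 / v $ 2) * a (v $ 1 * v $ 2) (v $ 3 / v $ 2)) else 1)" for v :: "real^3"
 have "compact ({-dl..dl} \<times> {-dl..dl})" by (intro compact_Times compact_Icc)
 then have "bounded ((%p. a (fst p) (snd p)) ` ({-dl..dl} \<times> {-dl..dl}))"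
  using compact_continuous_image[OF continuous_on_subset[OF ac subset_UNIV]] compact_imp_bounded by blast
 then obtain B0 where B: "\<forall>x\<in>(%p. a (fst p) (snd p)) ` ({-dl..dl} \<times> {-dl..dl}). norm x <= B0"
  unfolding bounded_iff by blast
 have B0: "\<bar>a (fst p) (snd p)\<bar> <= B0" if "p \<in> {-dl..dl} \<times> {-dl..dl}" for p
  using bspec[OF B imageI[OF that]] by simp
 have aB: "\<bar>a c s\<bar> <= B0" for c s
 proof -
  have "a c s = a (clip dl c) (clip dl s)"
   using clip_props(2)[of dl "clip dl c"] clip_props(2)[of dl "clip dl s"] cl dl by (simp add: a_def)
  then show ?thesis using B0[of "(clip dl c, clip dl s)"] clip_props(1)[of dl] dl by simp
 qed
 have B0pos: "0 <= B0" using aB[of 0 0] by linarith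
 have mpos: "m v > 0" for v by (simp add: m_def)
 have mB: "m v <= exp B0" for v
 proof (cases "v $ 2 > 0")
  case True
  have "cut (v $ 3 / v $ 2) * a (v $ 1 * v $ 2) (v $ 3 / v $ 2) <= 1 * B0"
   using cut(1,2)[of "v $ 3 / v $ 2"] aB[of "v $ 1 * v $ 2" "v $ 3 / v $ 2"] B0pos
   by (meson abs_le_D1 mult_left_mono mult_right_mono order_trans)
  then show ?thesis using True by (simp add: m_def)
 qed (use B0pos in \<open>simp add: m_def\<close>)
 define F where "F v = vec3 (v $ 1) (v $ 2 * m v) (v $ 3 * m v)" for v
 have mcont: "isCont m v" if v: "v $ 2 ~= 0 \<or> v $ 3 ~= 0" for v
 proof -
  have nth: "isCont (%v :: real^3. v $ i) v" for i by (intro continuous_intros)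
  have lt: "v $ 2 < \<bar>v $ 3\<bar> / dl" if "v $ 2 <= 0"
  proof (cases "v $ 2 = 0")
   case True
   then show ?thesis using v dl by simp
  next
   case False
   moreover have "0 <= \<bar>v $ 3\<bar> / dl" using dl by simp
   ultimately show ?thesis using that by linarith
  qed
  consider "v $ 2 > 0" | "v $ 2 <= 0" "v $ 2 < \<bar>v $ 3\<bar> / dl"
   using lt by (meson not_less)
  then show ?thesis
  proof cases
   case 1
   have ai: "isCont (%p. a (fst p) (snd p)) p" for p
    using ac unfolding continuous_on_eq_continuous_at[OF open_UNIV] by (rule bspec) simp
   have cuti: "isCont cut s" for s using cutc by (simp add: continuous_on_eq_continuous_at)
   have si: "isCont (%v :: real^3. v $ 3 / v $ 2) v" using 1 by (intro continuous_intros nth) auto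
   have "isCont (%v :: real^3. (v $ 1 * v $ 2, v $ 3 / v $ 2)) v" by (intro continuous_intros nth si)
   then have "isCont (%v :: real^3. a (v $ 1 * v $ 2) (v $ 3 / v $ 2)) v"
    using isCont_o2[of v "%v :: real^3. (v $ 1 * v $ 2, v $ 3 / v $ 2)" "%p. a (fst p) (snd p)"] ai by simp
   moreover have "isCont (%v :: real^3. cut (v $ 3 / v $ 2)) v" by (rule isCont_o2[OF si cuti])
   ultimately have c: "isCont (%v :: real^3. exp (cut (v $ 3 / v $ 2) * a (v $ 1 * v $ 2) (v $ 3 / v $ 2))) v"
    by (intro continuous_intros)
   have "\<forall>\<^sub>F w in nhds v. w $ 2 > 0"
    using 1 by (intro eventually_nhds_in_open[of "{w :: real^3. w $ 2 > 0}", simplified]) (auto intro!: open_Collect_less continuous_intros)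
   then have ev: "\<forall>\<^sub>F w in nhds v. m w = exp (cut (w $ 3 / w $ 2) * a (w $ 1 * w $ 2) (w $ 3 / w $ 2))"
    by (rule eventually_mono) (simp add: m_def)
   show ?thesis by (rule iffD2[OF isCont_cong[OF ev] c])
  next
   case 2
   have "\<forall>\<^sub>F w in nhds v. w $ 2 < \<bar>w $ 3\<bar> / dl"
    using 2 dl by (intro eventually_nhds_in_open[of "{w :: real^3. w $ 2 < \<bar>w $ 3\<bar> / dl}", simplified]) (auto intro!: open_Collect_less continuous_intros)
   then have "\<forall>\<^sub>F w in nhds v. m w = 1"
   proof (rule eventually_mono)
    fix w :: "real^3" assume w: "w $ 2 < \<bar>w $ 3\<bar> / dl"
    show "m w = 1"
    proof (cases "w $ 2 > 0")
     case True
     then have "dl <= \<bar>w $ 3 / w $ 2\<bar>" using w dl by (simp add: abs_divide field_simps)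
     then show ?thesis using cut(3) by (simp add: m_def)
    qed (simp add: m_def)
   qed
   then show ?thesis using isCont_cong[of m "%w. 1" v] by simp
  qed
 qed
 have Fcont: "isCont F v" for v
 proof -
  have nth: "isCont (%v :: real^3. v $ i) v" for i by (intro continuous_intros)
  have prod: "isCont (%v. v $ i * m v) v" if i: "i = 2 \<or> i = 3" for i
  proof (cases "v $ 2 ~= 0 \<or> v $ 3 ~= 0")
   case True
   then show ?thesis by (intro continuous_intros nth mcont)
  next
   case False
   then have vi: "v $ i = 0" using i by auto
   have "((%v :: real^3. \<bar>v $ i\<bar> * exp B0) \<longlongrightarrow> \<bar>v $ i\<bar> * exp B0) (at v)" by (intro tendsto_intros)
   then have "((%v :: real^3. \<bar>v $ i\<bar> * exp B0) \<longlongrightarrow> 0) (at v)" using vi by simp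
   moreover have "\<forall>\<^sub>F w in at v. norm (w $ i * m w) <= \<bar>w $ i\<bar> * exp B0"
    using mpos mB by (intro always_eventually allI) (auto simp: abs_mult less_imp_le intro!: mult_left_mono)
   ultimately have "((%v. v $ i * m v) \<longlongrightarrow> 0) (at v)" by (rule Lim_null_comparison[rotated])
   then show ?thesis using vi by (simp add: isCont_def)
  qed
  show ?thesis unfolding F_def by (intro isCont_vec3 nth prod) auto
 qed
 have Finj: "inj_on F {v. \<bar>v $ 1 * v $ 2\<bar> < dl}"
 proof (rule inj_onI)
  fix v w assume v: "v \<in> {v. \<bar>v $ 1 * v $ 2\<bar> < dl}" and w: "w \<in> {v. \<bar>v $ 1 * v $ 2\<bar> < dl}" and eq: "F v = F w"
  have 1: "v $ 1 = w $ 1" and 2: "v $ 2 * m v = w $ 2 * m w" and 3: "v $ 3 * m v = w $ 3 * m w"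
   using eq by (simp_all add: F_def vec3_eq_iff)
  have sg: "v $ 2 > 0 \<longleftrightarrow> w $ 2 > 0"
   using 2 mpos[of v] mpos[of w] by (metis zero_less_mult_pos2 mult_pos_pos)
  have "m v = m w"
  proof (cases "v $ 2 > 0")
   case True
   then have w2: "w $ 2 > 0" using sg by simp
   have s: "v $ 3 / v $ 2 = w $ 3 / w $ 2"
   proof -
    have "v $ 3 / v $ 2 = (v $ 3 * m v) / (v $ 2 * m v)" using mpos[of v] by simp
    also have "\<dots> = w $ 3 / w $ 2" unfolding 2 3 using mpos[of w] by simp
    finally show ?thesis .
   qed
   let ?s = "v $ 3 / v $ 2" and ?x = "v $ 1"
   have mv: "m v = exp (cut ?s * a (?x * v $ 2) ?s)" "m w = exp (cut ?s * a (?x * w $ 2) ?s)"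
    using True w2 1 s by (simp_all add: m_def)
   show ?thesis
   proof (cases "?x = 0 \<or> cut ?s = 0")
    case True
    then show ?thesis unfolding mv by auto
   next
    case False
    then have sd: "\<bar>?s\<bar> < dl" using cut(3)[of ?s] by linarith
    have less: False if ab: "0 < p" "p < r" "\<bar>?x * p\<bar> < dl" "\<bar>?x * r\<bar> < dl"
     and e: "p * exp (cut ?s * a (?x * p) ?s) = r * exp (cut ?s * a (?x * r) ?s)" for p r
    proof -
     have cp: "clip dl (?x * p) = ?x * p" "clip dl (?x * r) = ?x * r" "clip dl ?s = ?s"
      using ab sd dl by (auto intro!: clip_props(2))
     have Yp: "Y (vec3 (?x * p) 1 ?s) > 0" "Y (vec3 (?x * r) 1 ?s) > 0"
      by (rule pos[OF inbox[OF less_trans[OF ab(3) dl(2)] less_trans[OF sd dl(2)]]],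
        rule pos[OF inbox[OF less_trans[OF ab(4) dl(2)] less_trans[OF sd dl(2)]]])
     have r0: "r > 0" using ab by simp
     have "\<bar>?x * p\<bar> < \<bar>?x * r\<bar>" using ab False by (simp add: abs_mult)
     moreover have "(?x * p) * (?x * r) > 0"
     proof -
      have "?x * ?x > 0" using False not_real_square_gt_zero[of ?x] by blast
      then have "(?x * ?x) * (p * r) > 0" using ab(1) r0 by simp
      then show ?thesis by (simp only: mult_ac)
     qed
     ultimately have "\<bar>?x * p\<bar> * Y (vec3 (?x * p) 1 ?s) < \<bar>?x * r\<bar> * Y (vec3 (?x * r) 1 ?s)"
      by (rule mono[OF less_trans[OF ab(3) dl(2)] less_trans[OF ab(4) dl(2)] less_trans[OF sd dl(2)]])
     then have "\<bar>?x\<bar> * (p * Y (vec3 (?x * p) 1 ?s)) < \<bar>?x\<bar> * (r * Y (vec3 (?x * r) 1 ?s))"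
      using ab r0 by (simp add: abs_mult mult.assoc)
     then have "p * Y (vec3 (?x * p) 1 ?s) < r * Y (vec3 (?x * r) 1 ?s)" using False by simp
     then have "ln (p * Y (vec3 (?x * p) 1 ?s)) < ln (r * Y (vec3 (?x * r) 1 ?s))" using ab Yp by simp
     then have l1: "ln p + a (?x * p) ?s < ln r + a (?x * r) ?s" using ab r0 Yp by (simp add: ln_mult a_def cp)
     have l2: "ln p < ln r" using ab by simp
     have "ln (p * exp (cut ?s * a (?x * p) ?s)) = ln (r * exp (cut ?s * a (?x * r) ?s))" using e by simp
     then have l3: "ln p + cut ?s * a (?x * p) ?s = ln r + cut ?s * a (?x * r) ?s" using ab r0 by (simp add: ln_mult)
     have "cut ?s * (ln p + a (?x * p) ?s) < cut ?s * (ln r + a (?x * r) ?s)"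
      using l1 False cut(1)[of ?s] by (intro mult_strict_left_mono) auto
     moreover have "(1 - cut ?s) * ln p <= (1 - cut ?s) * ln r" using l2 cut(2)[of ?s] by (intro mult_left_mono) auto
     ultimately have "cut ?s * (ln p + a (?x * p) ?s) + (1 - cut ?s) * ln p < cut ?s * (ln r + a (?x * r) ?s) + (1 - cut ?s) * ln r"
      by (rule add_less_le_mono)
     then show False using l3 by (simp add: algebra_simps)
    qed
    have e: "v $ 2 * exp (cut ?s * a (?x * v $ 2) ?s) = w $ 2 * exp (cut ?s * a (?x * w $ 2) ?s)" using 2 unfolding mv .
    have "v $ 2 = w $ 2" using less[of "v $ 2" "w $ 2"] less[of "w $ 2" "v $ 2"] True w2 v w e 1
     by (metis (mono_tags, lifting) linorder_neqE_linordered_idom mem_Collect_eq)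
    then show ?thesis unfolding mv by simp
   qed
  next
   case False
   then show ?thesis using sg by (simp add: m_def)
  qed
  then show "v = w" using 1 2 3 mpos[of w] by (simp add: vec3_eq_iff)
 qed
 let ?W = "{v. \<bar>v $ 2 - 1\<bar> < \<rho>} \<inter> {v. \<bar>v $ 1 * v $ 2\<bar> < dl} \<inter> {v. 2 * \<bar>v $ 3\<bar> < dl * v $ 2} \<inter> cube \<rho>"
 show ?thesis
 proof (rule that[of dl ?W F])
  show "open ?W" by (intro open_Int open_Collect_less open_cube continuous_intros)
  show "axis 2 1 \<in> ?W" using dl \<rho> by (simp add: axis2_vec3 cube_def)
  show "continuous_on {v. \<bar>v $ 1 * v $ 2\<bar> < dl} F" by (rule continuous_at_imp_continuous_on) (use Fcont in blast)
  show "F (unit_flow t v) = unit_flow t (F v)" for v t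
  proof -
   have i: "unit_flow t v $ 3 / unit_flow t v $ 2 = v $ 3 / v $ 2" by simp
   have "m (unit_flow t v) = m v" unfolding m_def unit_flow_invariant i by (simp add: zero_less_mult_iff)
   then show ?thesis by (simp add: F_def vec3_eq_iff)
  qed
  show "F 0 = 0" by (simp add: F_def vec3_eq_iff)
  fix v assume v: "v \<in> ?W"
  have y: "v $ 2 > 0" using v \<rho> by (auto simp: cube_def)
  have s: "2 * \<bar>v $ 3 / v $ 2\<bar> <= dl" using v y by (simp add: abs_divide field_simps)
  have cl2: "clip dl (v $ 1 * v $ 2) = v $ 1 * v $ 2" "clip dl (v $ 3 / v $ 2) = v $ 3 / v $ 2"
   using v s dl by (auto intro!: clip_props(2))
  have "m v = Y (vec3 (v $ 1 * v $ 2) 1 (v $ 3 / v $ 2))"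
   using y cut(4)[OF s] pos[OF clb[of "v $ 1 * v $ 2" "v $ 3 / v $ 2"]] by (simp add: m_def a_def cl2)
  moreover have "Y v = v $ 2 * Y (vec3 (v $ 1 * v $ 2) 1 (v $ 3 / v $ 2))"
  proof -
   have v1: "\<bar>v $ 2 - 1\<bar> < \<rho>" and c1: "\<bar>v $ 1 * v $ 2\<bar> < dl" using v by auto
   have lt: "\<bar>v $ 1 * v $ 2\<bar> < \<rho> / 2" "\<bar>v $ 3 / v $ 2\<bar> < \<rho> / 2" using c1 s dl by linarith+
   show ?thesis by (rule section_value[OF equi v1 \<rho>(2) lt]) auto
  qed
  ultimately have h: "v $ 2 * m v = Y v" by simp
  have h': "v $ 3 / v $ 2 * Y v = v $ 3 * m v" unfolding h[symmetric] using y by simp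
  show "F v = vec3 (v $ 1) (Y v) (v $ 3 / v $ 2 * Y v)" by (simp only: F_def h h')
 qed (use dl Finj in auto)
qed

section \<open>Straightening coordinates at the ends of a connection\<close>

text \<open>Rescaling rays in the last two coordinates so that Euclidean circles become squares: on the side of
 the square through \<open>(0,1,0)\<close> the second coordinate is then the radius, which is constant on circles.\<close>

definition rad :: "real^3 => real" where "rad v = sqrt ((v $ 2)\<^sup>2 + (v $ 3)\<^sup>2)"

definition side :: "real^3 => real" where "side v = max \<bar>v $ 2\<bar> \<bar>v $ 3\<bar>"

definition square :: "real^3 => real^3" where
 "square v = vec3 (v $ 1) (rad v / side v * v $ 2) (rad v / side v * v $ 3)"

lemma square_nth [simp]:
 "square v $ 1 = v $ 1" "square v $ 2 = rad v / side v * v $ 2" "square v $ 3 = rad v / side v * v $ 3"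
 by (simp_all add: square_def)

lemma side_nonneg: "0 <= side v" by (simp add: side_def)

lemma rad_nonneg: "0 <= rad v" by (simp add: rad_def)

lemma side_eq_0: "side v = 0 \<longleftrightarrow> v $ 2 = 0 & v $ 3 = 0" by (auto simp: side_def max_def)

lemma rad_eq_0: "rad v = 0 \<longleftrightarrow> v $ 2 = 0 & v $ 3 = 0" by (simp add: rad_def add_nonneg_eq_0_iff)

lemma side_scale:
 assumes "v $ 2 = k * w $ 2" "v $ 3 = k * w $ 3" "0 <= k"
 shows "side v = k * side w" using assms by (simp add: side_def abs_mult max_mult_distrib_left)

lemma rad_scale:
 assumes "v $ 2 = k * w $ 2" "v $ 3 = k * w $ 3" "0 <= k"
 shows "rad v = k * rad w"
proof -
 have "(v $ 2)\<^sup>2 + (v $ 3)\<^sup>2 = k\<^sup>2 * ((w $ 2)\<^sup>2 + (w $ 3)\<^sup>2)"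
  unfolding assms by (simp add: power_mult_distrib algebra_simps)
 then show ?thesis unfolding rad_def using assms(3) by (simp add: real_sqrt_mult)
qed

lemma side_square: "side (square v) = rad v"
proof (cases "side v = 0")
 case True
 then have "v $ 2 = 0 & v $ 3 = 0" using side_eq_0 by blast
 then show ?thesis by (simp add: side_def rad_def)
next
 case False
 have "side (square v) = rad v / side v * side v" by (rule side_scale) (simp_all add: rad_nonneg side_nonneg)
 then show ?thesis using False by simp
qed

lemma square_inj: assumes eq: "square v = square w" shows "v = w"
proof -
 have 1: "v $ 1 = w $ 1" "rad v / side v * v $ 2 = rad w / side w * w $ 2"
  "rad v / side v * v $ 3 = rad w / side w * w $ 3"
  using arg_cong[OF eq, of "%u. u $ 1"] arg_cong[OF eq, of "%u. u $ 2"] arg_cong[OF eq, of "%u. u $ 3"] by simp_all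
 have r: "rad v = rad w" using arg_cong[OF eq, of side] by (simp add: side_square)
 show ?thesis
 proof (cases "rad v = 0")
  case True
  then show ?thesis using r rad_eq_0[of v] rad_eq_0[of w] 1 by (simp add: vec3_eq_iff)
 next
  case False
  have s: "side v > 0" "side w > 0"
   using False r side_nonneg[of v] side_nonneg[of w] side_eq_0[of v] side_eq_0[of w] rad_eq_0[of v] rad_eq_0[of w]
   by (auto simp: less_le)
  have "rad (square v) = rad v / side v * rad v" "rad (square w) = rad w / side w * rad w"
   by (rule rad_scale; simp add: rad_nonneg side_nonneg)+
  then have "rad v / side v * rad v = rad w / side w * rad w" using eq by simp
  then have k: "rad v / side v = rad w / side w" using False r by simp
  have "rad v / side v ~= 0" using False s by simp
  then have "v $ 2 = w $ 2" "v $ 3 = w $ 3" using 1 unfolding k by simp_all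
  then show ?thesis using 1 by (simp add: vec3_eq_iff)
 qed
qed

lemma square_continuous: "continuous_on S square"
proof (rule continuous_at_imp_continuous_on, rule ballI)
 fix v :: "real^3"
 have nth: "isCont (%v :: real^3. v $ i) v" for i by (intro continuous_intros)
 have rc: "isCont rad v" unfolding rad_def by (intro continuous_intros)
 have sc: "isCont side v" unfolding side_def by (intro continuous_intros)
 have c: "isCont (%v. rad v / side v * v $ i) v" if i: "i = 2 \<or> i = 3" for i
 proof (cases "side v = 0")
  case False
  then show ?thesis by (intro continuous_intros rc sc nth)
 next
  case True
  then have r0: "rad v = 0" using side_eq_0 rad_eq_0 by blast
  have "(rad \<longlongrightarrow> 0) (at v)" using rc r0 by (simp add: isCont_def)
  moreover have "\<forall>\<^sub>F w in at v. norm (rad w / side w * w $ i) <= rad w"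
  proof (intro always_eventually allI)
   fix w :: "real^3"
   have "\<bar>w $ i\<bar> <= side w" using i by (auto simp: side_def)
   then have "rad w / side w * \<bar>w $ i\<bar> <= rad w / side w * side w"
    by (rule mult_left_mono) (simp add: rad_nonneg side_nonneg)
   also have "\<dots> <= rad w" using rad_nonneg[of w] by simp
   finally show "norm (rad w / side w * w $ i) <= rad w" using rad_nonneg[of w] side_nonneg[of w] by (simp add: abs_mult)
  qed
  ultimately have "((%w. rad w / side w * w $ i) \<longlongrightarrow> 0) (at v)" by (rule Lim_null_comparison[rotated])
  then show ?thesis using r0 by (simp add: isCont_def)
 qed
 show "isCont square v" unfolding square_def using c[of 2] c[of 3] nth[of 1] by (intro isCont_vec3) simp_all
qed

lemma square_flow: "square (unit_flow t v) = unit_flow t (square v)"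
proof -
 have r: "rad (unit_flow t v) = exp (- t) * rad v" and s: "side (unit_flow t v) = exp (- t) * side v"
  by (rule rad_scale side_scale; simp)+
 have "rad (unit_flow t v) / side (unit_flow t v) = rad v / side v" unfolding r s by simp
 then show ?thesis by (simp add: vec3_eq_iff)
qed

lemma square_0: "square 0 = 0" by (simp add: vec3_eq_iff)

lemma square_axis2: "square (axis 2 1) = axis 2 1" by (simp add: axis2_vec3 vec3_eq_iff rad_def side_def)

lemma square_side:
 assumes "square v $ 2 > 0" "\<bar>square v $ 3\<bar> <= square v $ 2"
 shows "square v $ 2 = rad v"
proof -
 have gen: "max \<bar>a\<bar> \<bar>b\<bar> = a" if "0 < a" "\<bar>b\<bar> <= a" for a b :: real using that by auto
 have "side (square v) = square v $ 2" unfolding side_def by (rule gen[OF assms])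
 then show ?thesis by (simp only: side_square)
qed

context saddle_form
begin

lemma plane_nth [simp]: "plane v $ 2 = v $ 2" "plane v $ 3 = v $ 3" by (simp_all add: plane_def axis_def)

lemma norm_plane: "norm (plane v) = rad v" by (simp add: norm_vec_def L2_set_def sum_3 rad_def)

text \<open>Coordinates that conjugate the saddle to the unit flow, and whose second coordinate is, near
 \<open>(0,1,0)\<close>, the exponential of the crossing time.\<close>

definition flow_coords :: "real^3 => real^3" where "flow_coords y = square (unit_form y)"

lemma flow_coords_continuous: "continuous_on UNIV flow_coords" unfolding flow_coords_def
 by (rule continuous_on_compose2[OF square_continuous[of UNIV] unit_form_continuous]) simp

lemma flow_coords_inj: "flow_coords y = flow_coords z ==> y = z"
 unfolding flow_coords_def by (rule unit_form_inj[OF square_inj])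

lemma flow_coords_flow: "flow_coords (E t y) = unit_flow t (flow_coords y)"
proof -
 have "plane (unit_form (E t y)) $ i = (exp (- t) *\<^sub>R plane (unit_form y)) $ i" for i by (simp only: unit_form_flow(2))
 from this[of 2] this[of 3] have "unit_form (E t y) = unit_flow t (unit_form y)"
  using unit_form_flow(1)[of t y] by (simp add: vec3_eq_iff)
 then show ?thesis by (simp add: flow_coords_def square_flow)
qed

lemma flow_coords_1: "flow_coords y $ 1 = hat (y $ 1)" by (simp add: flow_coords_def)

lemma flow_coords_0: "flow_coords 0 = 0" by (simp add: flow_coords_def unit_form_0 square_0)

lemma flow_coords_axis2: "flow_coords (axis 2 1) = axis 2 1" by (simp add: flow_coords_def unit_form_axis2 square_axis2)

lemma flow_coords_2:
 assumes "flow_coords y $ 2 > 0" "\<bar>flow_coords y $ 3\<bar> <= flow_coords y $ 2"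
 shows "plane y ~= 0" "flow_coords y $ 2 = exp (cross y)"
proof -
 have r: "flow_coords y $ 2 = norm (plane (unit_form y))"
  using square_side assms unfolding flow_coords_def norm_plane by blast
 then show "plane y ~= 0" using assms(1) norm_plane_unit_form[of y] by (auto split: if_splits)
 then show "flow_coords y $ 2 = exp (cross y)" using r norm_plane_unit_form[of y] by simp
qed

text \<open>The last two coordinates determine the component in the plane, since they do not depend on the first one.\<close>

lemma flow_coords_plane:
 assumes "flow_coords y $ 2 = flow_coords z $ 2" "flow_coords y $ 3 = flow_coords z $ 3"
 shows "plane y = plane z"
proof -
 define z' where "z' = (y $ 1) *\<^sub>R axis 1 1 + plane z"
 have p: "plane z' = plane z" by (simp add: vec3_eq_iff z'_def axis_def)
 have 1: "z' $ 1 = y $ 1" by (simp add: z'_def axis_def)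
 have "cross z' = cross z" by (simp add: cross_def p)
 then have "plane (unit_form z') = plane (unit_form z)" by (simp only: plane_unit_form p)
 then have u: "unit_form z' $ 2 = unit_form z $ 2" "unit_form z' $ 3 = unit_form z $ 3" by (metis plane_nth)+
 then have "rad (unit_form z') = rad (unit_form z)" "side (unit_form z') = side (unit_form z)"
  by (simp_all add: rad_def side_def)
 then have "flow_coords z' $ 2 = flow_coords z $ 2" "flow_coords z' $ 3 = flow_coords z $ 3"
  using u by (simp_all add: flow_coords_def)
 moreover have "flow_coords z' $ 1 = flow_coords y $ 1" by (simp only: flow_coords_1 1)
 ultimately have "flow_coords z' = flow_coords y" using assms by (simp add: vec3_eq_iff)
 then have "z' = y" by (rule flow_coords_inj)
 then show ?thesis using p by simp
qed

end

lemma unit_flow_0 [simp]: "unit_flow 0 v = v" by (simp add: vec3_eq_iff)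

lemma unit_flow_zero [simp]: "unit_flow t 0 = 0" by (simp add: vec3_eq_iff)

text \<open>The changes of coordinates used on either half of a connection: embeddings of a flow-invariant neighbourhood of
 the saddle and of its contracting axis that commute with the unit flow.\<close>

definition flow_embedding :: "(real^3) set => (real^3 => real^3) => bool" where
 "flow_embedding N F \<longleftrightarrow> open N & continuous_on N F & inj_on F N & (\<forall>v t. v \<in> N --> unit_flow t v \<in> N) &
  (\<forall>v t. F (unit_flow t v) = unit_flow t (F v)) & 0 \<in> N & axis 2 1 \<in> N & F 0 = 0"

context vector_field_manifold
begin

lemma icurve_cong:
 assumes g: "icurve I \<gamma>" and eq: "!!t. t \<in> I ==> dl t = \<gamma> t"
 shows "icurve I dl" unfolding integral_curve_def
proof (intro conjI ballI impI)
 show "is_interval I" using g by (simp add: integral_curve_def)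
 have "continuous_map (top_of_set I) (subtopology M (topspace M)) \<gamma>" using g by (simp add: integral_curve_def)
 then show "continuous_map (top_of_set I) (subtopology M (topspace M)) dl" by (rule continuous_map_eq) (use eq in simp)
 fix t c assume t: "t \<in> I" and c: "c \<in> A" "dl t \<in> fst c"
 have "((snd c \<circ> \<gamma>) has_vector_derivative X c (\<gamma> t)) (at t within I)"
  using g t c eq[OF t] by (auto simp: integral_curve_def)
 then have "((snd c \<circ> dl) has_vector_derivative X c (\<gamma> t)) (at t within I)"
  by (rule has_vector_derivative_transform[OF t, rotated]) (use eq in simp)
 then show "((snd c \<circ> dl) has_vector_derivative X c (dl t)) (at t within I)" using eq[OF t] by simp
qed

lemma icurve_const:
 assumes d: "field_in d F" and q: "q \<in> fst d" and F0: "F (snd d q) = 0" and I: "is_interval I"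
 shows "icurve I (%t. q)"
proof -
 have dc: "is_chart M d" using d C1chart_is_chart by (simp add: field_in_def)
 have "icurve I (%t. chart_inv d (snd d q))" by (rule icurveI_chart[OF d I]) (use q F0 in auto)
 then show ?thesis using chart_inv_left[OF dc q] by simp
qed

lemma embedding_chart:
 assumes "openin M V" "continuous_map (subtopology M V) euclidean (f :: 'a => real^3)" "inj_on f V"
 shows "is_chart M (V, f)"
proof (rule is_chart_invariance[OF _ assms])
 fix x assume "x \<in> V"
 then have "x \<in> topspace M" using assms(1) openin_subset by blast
 then show "\<exists>c. is_chart M c & x \<in> fst c" by (rule ex_chart)
qed

end

text \<open>One half of a connection.  The sign \<open>\<sigma>\<close> is \<open>1\<close> at the end of the connection; at its beginning it is
 \<open>- 1\<close>, and \<open>L\<close> is the linear part of the reversed field.\<close>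

locale saddle_end = vector_field_manifold M A X + saddle_form L \<mu> \<alpha>
 for M :: "'a topology" and A :: "'a chart set" and X :: "'a vfield"
  and L :: "real^3 => real^3" and \<mu> \<alpha> :: real +
 fixes \<sigma> :: real and D :: "'a chart" and p :: 'a
 assumes sign: "\<sigma> = 1 \<or> \<sigma> = - 1"
  and chart: "field_in D (%v. \<sigma> *\<^sub>R L v)" and p: "p \<in> fst D" "snd D p = 0"
begin

lemma D1: "C1chart D" using chart by (simp add: field_in_def)

lemmas Dc = C1chart_is_chart[OF D1]

lemma signed_linear: "linear (%v. \<sigma> *\<^sub>R L v)" by (rule linear_compose_scale_right[OF lin])

lemma signed_flow: "linear_flow (%v. \<sigma> *\<^sub>R L v) t y = E (\<sigma> * t) y"
proof (cases "\<sigma> = 1")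
 case False
 then have "\<sigma> = - 1" using sign by simp
 then show ?thesis using linear_flow_uminus[OF lin, of t y] by simp
qed simp

lemma sign_mult [simp]: "\<sigma> * (\<sigma> * t) = t" using sign by auto

definition coords :: "'a => real^3" where "coords m = flow_coords (snd D m)"

lemma coords_continuous: "continuous_map (subtopology M (fst D)) euclidean coords"
proof -
 have "continuous_map euclidean euclidean flow_coords" using flow_coords_continuous by simp
 with is_chartD(4)[OF Dc] have "continuous_map (subtopology M (fst D)) euclidean (flow_coords \<circ> snd D)"
  by (rule continuous_map_compose)
 then show ?thesis by (simp add: o_def coords_def[abs_def])
qed

lemma coords_inj: "m \<in> fst D ==> m' \<in> fst D ==> coords m = coords m' ==> m = m'"
 unfolding coords_def using is_chartD(5)[OF Dc] flow_coords_inj by (metis inj_onD)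

lemma coords_p: "coords p = 0" by (simp add: coords_def p flow_coords_0)

lemma coords_evolve:
 assumes g: "icurve I dl" and I: "!!r. r \<in> I ==> dl r \<in> fst D" and s: "s \<in> I" and t: "t \<in> I"
 shows "coords (dl t) = unit_flow (\<sigma> * (t - s)) (coords (dl s))"
proof -
 let ?J = "{min s t..max s t}"
 have "min s t \<in> I" "max s t \<in> I" using s t by (simp_all add: min_def max_def)
 then have JI: "?J \<subseteq> I" using g unfolding integral_curve_def is_interval_1 by (meson atLeastAtMost_iff subsetI)
 have gJ: "icurve ?J dl" by (rule icurve_subset[OF g is_interval_cc JI])
 have "(snd D \<circ> dl) t = linear_flow (%v. \<sigma> *\<^sub>R L v) (t - s) ((snd D \<circ> dl) s)"
 proof (rule linear_flow_unique[OF signed_linear, of "min s t" "max s t"])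
  fix r assume r: "r \<in> ?J"
  show "((snd D \<circ> dl) has_vector_derivative \<sigma> *\<^sub>R L ((snd D \<circ> dl) r)) (at r within ?J)"
   using icurve_in_chart[OF chart gJ r] I[of r] JI r by auto
 qed auto
 then show ?thesis unfolding coords_def signed_flow by (simp add: flow_coords_flow)
qed

lemma coords_icurve:
 assumes I: "is_interval I" "0 \<in> I" and m: "!!r. r \<in> I ==> m r \<in> fst D"
  and flow: "!!r. r \<in> I ==> coords (m r) = unit_flow r (coords (m 0))"
 shows "icurve {t. \<sigma> * t \<in> I} (%t. m (\<sigma> * t))"
proof -
 let ?v = "snd D (m 0)"
 have Ev: "snd D (m r) = E r ?v" if "r \<in> I" for r
  using flow[OF that] unfolding coords_def flow_coords_flow[symmetric] by (rule flow_coords_inj)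
 have J: "is_interval {t. \<sigma> * t \<in> I}"
 proof (cases "\<sigma> = 1")
  case False
  then have "\<sigma> = - 1" using sign by simp
  then have "{t. \<sigma> * t \<in> I} = uminus ` I" by (auto intro: image_eqI[of _ _ "- x" for x])
  then show ?thesis using I(1) by simp
 qed (use I in simp)
 have "icurve {t. \<sigma> * t \<in> I} (%t. chart_inv D (linear_flow (%v. \<sigma> *\<^sub>R L v) (t - 0) ?v))"
  by (rule linear_chart_icurve[OF chart signed_linear J]) (use Ev m in \<open>auto simp: signed_flow simp flip: Ev\<close>)
 then show ?thesis
 proof (rule icurve_cong)
  fix t assume "t \<in> {t. \<sigma> * t \<in> I}"
  then have t: "\<sigma> * t \<in> I" by simp
  show "m (\<sigma> * t) = chart_inv D (linear_flow (%v. \<sigma> *\<^sub>R L v) (t - 0) ?v)"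
   unfolding signed_flow using Ev[OF t] chart_inv_left[OF Dc m[OF t]] by simp
 qed
qed

text \<open>A function that scales along integral curves scales along the unit flow when it is read in
 flow-equivariant coordinates.\<close>

lemma transported_scaling:
 assumes O': "O' \<subseteq> fst D" "coords ` O' \<subseteq> N" and G: "flow_embedding N G"
  and w: "!!I dl s t. icurve I dl ==> dl ` I \<subseteq> O' ==> s \<in> I ==> t \<in> I ==> w (dl t) = exp (- (\<sigma> * (t - s))) * w (dl s)"
  and v: "!!r. r \<in> closed_segment 0 t ==> unit_flow r v \<in> (%m. G (coords m)) ` O'"
 shows "w (inv_into O' (%m. G (coords m)) (unit_flow t v)) = exp (- t) * w (inv_into O' (%m. G (coords m)) v)"
proof -
 let ?f = "%m. G (coords m)" and ?I = "closed_segment 0 t"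
 define m where "m r = inv_into O' ?f (unit_flow r v)" for r
 have m: "m r \<in> O'" "?f (m r) = unit_flow r v" if "r \<in> ?I" for r
  unfolding m_def using inv_into_into[OF v[OF that]] f_inv_into_f[OF v[OF that]] by auto
 have 0: "0 \<in> ?I" by simp
 have flow: "coords (m r) = unit_flow r (coords (m 0))" if r: "r \<in> ?I" for r
 proof -
  have "inj_on G N" using G by (simp add: flow_embedding_def)
  moreover have "G (coords (m r)) = G (unit_flow r (coords (m 0)))"
   using m(2)[OF r] m(2)[OF 0] G by (simp add: flow_embedding_def)
  moreover have "coords (m r) \<in> N" "coords (m 0) \<in> N" using O'(2) m(1)[OF r] m(1)[OF 0] by auto
  moreover have "unit_flow r (coords (m 0)) \<in> N" using calculation(4) G by (simp add: flow_embedding_def)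
  ultimately show ?thesis by (meson inj_onD)
 qed
 have ii: "is_interval ?I" by (simp add: is_interval_convex_1)
 have c: "icurve {s. \<sigma> * s \<in> ?I} (%s. m (\<sigma> * s))"
  by (rule coords_icurve[OF ii 0 _ flow]) (use m(1) O' in blast)
 have "w (m (\<sigma> * (\<sigma> * t))) = exp (- (\<sigma> * (\<sigma> * t - 0))) * w (m (\<sigma> * 0))"
  by (rule w[OF c]) (use m(1) in auto)
 then show ?thesis by (simp add: m_def)
qed

text \<open>Puts a function that scales along integral curves into the form that the extension lemmas for the unit flow need.\<close>

lemma read_in_coordinates:
 assumes O': "openin M O'" "O' \<subseteq> fst D" "coords ` O' \<subseteq> N" and G: "flow_embedding N G"
  and m1: "m1 \<in> O'" "G (coords m1) = axis 2 1"
  and w: "continuous_map (subtopology M O') euclideanreal w"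
  and sc: "!!I dl s t. icurve I dl ==> dl ` I \<subseteq> O' ==> s \<in> I ==> t \<in> I ==> w (dl t) = exp (- (\<sigma> * (t - s))) * w (dl s)"
 obtains \<rho> where "0 < \<rho>" "\<rho> <= 1/2" "cube \<rho> \<subseteq> (%m. G (coords m)) ` O'"
  "continuous_on (cube \<rho>) (%v. w (inv_into O' (%m. G (coords m)) v))"
  "\<forall>v t. (\<forall>r\<in>closed_segment 0 t. unit_flow r v \<in> cube \<rho>) -->
   w (inv_into O' (%m. G (coords m)) (unit_flow t v)) = exp (- t) * w (inv_into O' (%m. G (coords m)) v)"
  "!!m. m \<in> O' ==> inv_into O' (%m. G (coords m)) (G (coords m)) = m"
  "continuous_map (subtopology M O') euclidean (%m. G (coords m))"
proof -
 let ?f = "%m. G (coords m)"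
 have cc: "continuous_map (subtopology M O') (top_of_set N) coords"
 proof (rule continuous_map_into_subtopology)
  show "continuous_map (subtopology M O') euclidean coords"
   using coords_continuous O'(2) by (rule continuous_map_from_subtopology_mono)
  show "coords \<in> topspace (subtopology M O') \<rightarrow> N" using O'(3) by auto
 qed
 have "continuous_map (top_of_set N) euclidean G" using G by (simp add: flow_embedding_def)
 with cc have "continuous_map (subtopology M O') euclidean (G \<circ> coords)" by (rule continuous_map_compose)
 then have fc: "continuous_map (subtopology M O') euclidean ?f" by (simp add: o_def)
 have fi: "inj_on ?f O'"
 proof (rule inj_onI)
  fix m m' assume m: "m \<in> O'" "m' \<in> O'" "?f m = ?f m'"
  have "inj_on G N" using G by (simp add: flow_embedding_def)
  from inj_onD[OF this m(3)] have "coords m = coords m'" using m O'(3) by blast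
  then show "m = m'" using coords_inj m O'(2) by blast
 qed
 have ch: "is_chart M (O', ?f)" by (rule embedding_chart[OF O'(1) fc fi])
 have op: "open (?f ` O')" using is_chartD(2)[OF ch] by simp
 have "axis 2 1 \<in> ?f ` O'" using m1 by (metis imageI)
 then obtain \<rho> where \<rho>: "0 < \<rho>" "\<rho> <= 1/2" "cube \<rho> \<subseteq> ?f ` O'" using cube_in_open[OF op] by blast
 have invc: "continuous_map (top_of_set (?f ` O')) M (inv_into O' ?f)"
  using chart_inv_continuous[OF ch] by (simp add: chart_inv_def)
 have "continuous_map (top_of_set (?f ` O')) (subtopology M O') (inv_into O' ?f)"
  by (rule continuous_map_into_subtopology[OF invc]) (auto intro: inv_into_into)
 from continuous_map_compose[OF this w]
 have "continuous_map (top_of_set (?f ` O')) euclideanreal (w \<circ> inv_into O' ?f)" .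
 then have "continuous_on (?f ` O') (w \<circ> inv_into O' ?f)" by simp
 from continuous_on_subset[OF this \<rho>(3)]
 have 1: "continuous_on (cube \<rho>) (%v. w (inv_into O' ?f v))" by (simp add: o_def)
 have 2: "\<forall>v t. (\<forall>r\<in>closed_segment 0 t. unit_flow r v \<in> cube \<rho>) -->
  w (inv_into O' ?f (unit_flow t v)) = exp (- t) * w (inv_into O' ?f v)"
 proof (intro allI impI)
  fix v t assume v: "\<forall>r\<in>closed_segment 0 t. unit_flow r v \<in> cube \<rho>"
  have v': "unit_flow r v \<in> ?f ` O'" if "r \<in> closed_segment 0 t" for r using bspec[OF v that] \<rho>(3) by blast
  show "w (inv_into O' ?f (unit_flow t v)) = exp (- t) * w (inv_into O' ?f v)"
   by (rule transported_scaling[OF O'(2,3) G sc v'])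
 qed
 show ?thesis by (rule that[OF \<rho> 1 2 _ fc]) (auto intro: inv_into_f_f[OF fi])
qed

lemma extend_third_at_end:
 assumes O': "openin M O'" "O' \<subseteq> fst D" "coords ` O' \<subseteq> N" and G: "flow_embedding N G"
  and m1: "m1 \<in> O'" "G (coords m1) = axis 2 1" "coords m1 = axis 2 1"
  and w: "continuous_map (subtopology M O') euclideanreal w" "w m1 = 0"
  and sc: "!!I dl s t. icurve I dl ==> dl ` I \<subseteq> O' ==> s \<in> I ==> t \<in> I ==> w (dl t) = exp (- (\<sigma> * (t - s))) * w (dl s)"
  and inj: "!!m m'. m \<in> O' ==> m' \<in> O' ==> G (coords m) $ 1 = G (coords m') $ 1 ==>
   G (coords m) $ 2 = G (coords m') $ 2 ==> w m = w m' ==> m = m'"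
 obtains N' F W where "flow_embedding N' F" "openin M W" "m1 \<in> W" "W \<subseteq> O'" "coords ` W \<subseteq> N'"
  "!!m. m \<in> W ==> F (coords m) = vec3 (G (coords m) $ 1) (G (coords m) $ 2) (w m)"
proof -
 let ?f = "%m. G (coords m)"
 obtain \<rho> where \<rho>: "0 < \<rho>" "\<rho> <= 1/2" and b: "cube \<rho> \<subseteq> ?f ` O'"
  and Zc: "continuous_on (cube \<rho>) (%v. w (inv_into O' ?f v))"
  and eq': "\<forall>v t. (\<forall>r\<in>closed_segment 0 t. unit_flow r v \<in> cube \<rho>) -->
   w (inv_into O' ?f (unit_flow t v)) = exp (- t) * w (inv_into O' ?f v)"
  and inv: "!!m. m \<in> O' ==> inv_into O' ?f (?f m) = m"
  and fc: "continuous_map (subtopology M O') euclidean ?f"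
  by (rule read_in_coordinates[OF O' G m1(1,2) w(1) sc]) (assumption | rule that)+
 have eq: "w (inv_into O' ?f (unit_flow t v)) = exp (- t) * w (inv_into O' ?f v)"
  if "!!r. r \<in> closed_segment 0 t ==> unit_flow r v \<in> cube \<rho>" for v t using eq' that by blast
 have Z0: "w (inv_into O' ?f (axis 2 1)) = 0" using inv[OF m1(1)] m1(2) w(2) by simp
 have Zi: "v = v'" if vv: "v \<in> cube \<rho>" "v' \<in> cube \<rho>" "v $ 1 = v' $ 1" "v $ 2 = v' $ 2"
   "w (inv_into O' ?f v) = w (inv_into O' ?f v')" for v v'
 proof -
  obtain m m' where m: "m \<in> O'" "v = ?f m" "m' \<in> O'" "v' = ?f m'" using vv(1,2) b by blast
  have "m = m'" by (rule inj) (use m vv inv in auto)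
  then show ?thesis using m by simp
 qed
 obtain F \<epsilon> W where \<epsilon>: "\<epsilon> > 0" and W: "open W" "axis 2 1 \<in> W" "W \<subseteq> cube \<rho>" "W \<subseteq> {v. \<bar>v $ 1 * v $ 2\<bar> < \<epsilon>}"
  and Fc: "continuous_on {v. \<bar>v $ 1 * v $ 2\<bar> < \<epsilon>} F" and Fi: "inj_on F {v. \<bar>v $ 1 * v $ 2\<bar> < \<epsilon>}"
  and FW: "!!v. v \<in> W ==> F v = vec3 (v $ 1) (v $ 2) (w (inv_into O' ?f v))"
  and Ff: "!!v t. F (unit_flow t v) = unit_flow t (F v)" and F0: "F 0 = 0"
  by (rule extend_third[OF \<rho> Zc Z0 eq Zi]) (assumption | rule that)+
 let ?H = "{v :: real^3. \<bar>v $ 1 * v $ 2\<bar> < \<epsilon>}"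
 have Ho: "open ?H" by (intro open_Collect_less continuous_intros)
 have g: "open N" "continuous_on N G" "inj_on G N" "!!v t. v \<in> N ==> unit_flow t v \<in> N"
  "!!v t. G (unit_flow t v) = unit_flow t (G v)" "0 \<in> N" "axis 2 1 \<in> N" "G 0 = 0"
  using G by (auto simp: flow_embedding_def)
 let ?N = "N \<inter> G -` ?H" and ?W = "{m \<in> O'. ?f m \<in> W}"
 have HI: "unit_flow t v \<in> ?H \<longleftrightarrow> v \<in> ?H" for t v
  by (simp only: mem_Collect_eq unit_flow_invariant)
 have emb: "flow_embedding ?N (F \<circ> G)" unfolding flow_embedding_def
 proof (intro conjI allI impI)
  show "open ?N" by (rule continuous_open_preimage[OF g(2) g(1) Ho])
  show "continuous_on ?N (F \<circ> G)"
   by (rule continuous_on_compose[OF continuous_on_subset[OF g(2)] continuous_on_subset[OF Fc]]) auto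
  show "inj_on (F \<circ> G) ?N" by (rule comp_inj_on[OF inj_on_subset[OF g(3)] inj_on_subset[OF Fi]]) auto
  show "unit_flow t v \<in> ?N" if "v \<in> ?N" for t v using that g(4,5) HI[of t "G v"] by auto
  show "(F \<circ> G) (unit_flow t v) = unit_flow t ((F \<circ> G) v)" for v t by (simp add: g(5) Ff)
  show "0 \<in> ?N" using g \<epsilon> by simp
  have "G (axis 2 1) = axis 2 1" using m1(2,3) by simp
  then show "axis 2 1 \<in> ?N" using g(7) W(2,4) by auto
  show "(F \<circ> G) 0 = 0" using g F0 by simp
 qed
 have Wo: "openin M ?W" by (rule chart_preimage_open[OF O'(1) fc W(1)])
 show ?thesis
 proof (rule that[OF emb Wo])
  show "m1 \<in> ?W" using m1(1,2) W(2) by simp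
  show "coords ` ?W \<subseteq> ?N" using W(4) O'(3) by auto
  show "(F \<circ> G) (coords m) = vec3 (G (coords m) $ 1) (G (coords m) $ 2) (w m)" if "m \<in> ?W" for m
   using that FW[of "?f m"] inv[of m] by simp
 qed auto
qed

lemma flow_embedding_id: "flow_embedding UNIV (%v. v)" by (simp add: flow_embedding_def)

lemma extend_second_at_end:
 assumes O': "openin M O'" "O' \<subseteq> fst D" and m1: "m1 \<in> O'" "coords m1 = axis 2 1"
  and y: "continuous_map (subtopology M O') euclideanreal y" "y m1 = 1" "!!m. m \<in> O' ==> y m > 0"
  and sc: "!!I dl s t. icurve I dl ==> dl ` I \<subseteq> O' ==> s \<in> I ==> t \<in> I ==> y (dl t) = exp (- (\<sigma> * (t - s))) * y (dl s)"
  and mono: "!!m m'. m \<in> O' ==> m' \<in> O' ==> coords m $ 2 = coords m' $ 2 ==> coords m $ 3 = coords m' $ 3 ==>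
   \<bar>coords m $ 1\<bar> < \<bar>coords m' $ 1\<bar> ==> coords m $ 1 * coords m' $ 1 > 0 ==> \<bar>coords m $ 1\<bar> * y m < \<bar>coords m' $ 1\<bar> * y m'"
 obtains N' F W where "flow_embedding N' F" "openin M W" "m1 \<in> W" "W \<subseteq> O'" "coords ` W \<subseteq> N'"
  "!!m. m \<in> W ==> F (coords m) = vec3 (coords m $ 1) (y m) (coords m $ 3 / coords m $ 2 * y m)"
proof -
 obtain \<rho> where \<rho>: "0 < \<rho>" "\<rho> <= 1/2" and b: "cube \<rho> \<subseteq> coords ` O'"
  and Zc: "continuous_on (cube \<rho>) (%v. y (inv_into O' coords v))"
  and eq': "\<forall>v t. (\<forall>r\<in>closed_segment 0 t. unit_flow r v \<in> cube \<rho>) -->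
   y (inv_into O' coords (unit_flow t v)) = exp (- t) * y (inv_into O' coords v)"
  and inv: "!!m. m \<in> O' ==> inv_into O' coords (coords m) = m"
  and fc: "continuous_map (subtopology M O') euclidean coords"
  by (rule read_in_coordinates[OF O' subset_UNIV flow_embedding_id m1 y(1) sc]) (assumption | rule that)+
 have eq: "y (inv_into O' coords (unit_flow t v)) = exp (- t) * y (inv_into O' coords v)"
  if "!!r. r \<in> closed_segment 0 t ==> unit_flow r v \<in> cube \<rho>" for v t using eq' that by blast
 have Y0: "y (inv_into O' coords (axis 2 1)) = 1" using inv[OF m1(1)] m1(2) y(2) by simp
 have pos: "y (inv_into O' coords v) > 0" if v: "v \<in> cube \<rho>" for v
  by (rule y(3), rule inv_into_into) (use v b in blast)
 have mono': "\<bar>c\<bar> * y (inv_into O' coords (vec3 c 1 s)) < \<bar>c'\<bar> * y (inv_into O' coords (vec3 c' 1 s))"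
  if c: "\<bar>c\<bar> < \<rho>" "\<bar>c'\<bar> < \<rho>" "\<bar>s\<bar> < \<rho>" "\<bar>c\<bar> < \<bar>c'\<bar>" "c * c' > 0" for c c' s
 proof -
  have "vec3 c 1 s \<in> cube \<rho>" "vec3 c' 1 s \<in> cube \<rho>" using c \<rho> by (auto simp: cube_def)
  then obtain m m' where m: "m \<in> O'" "vec3 c 1 s = coords m" "m' \<in> O'" "vec3 c' 1 s = coords m'" using b by blast
  have e: "coords m $ 1 = c" "coords m $ 2 = 1" "coords m $ 3 = s" "coords m' $ 1 = c'" "coords m' $ 2 = 1" "coords m' $ 3 = s"
   unfolding m(2,4)[symmetric] by simp_all
  show ?thesis using mono[OF m(1,3)] c inv[OF m(1)] inv[OF m(3)] unfolding m(2,4) e by simp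
 qed
 obtain F \<epsilon> W where \<epsilon>: "\<epsilon> > 0" and W: "open W" "axis 2 1 \<in> W" "W \<subseteq> cube \<rho>" "W \<subseteq> {v. \<bar>v $ 1 * v $ 2\<bar> < \<epsilon>}"
  and Fc: "continuous_on {v. \<bar>v $ 1 * v $ 2\<bar> < \<epsilon>} F" and Fi: "inj_on F {v. \<bar>v $ 1 * v $ 2\<bar> < \<epsilon>}"
  and FW: "!!v. v \<in> W ==> F v = vec3 (v $ 1) (y (inv_into O' coords v)) (v $ 3 / v $ 2 * y (inv_into O' coords v))"
  and Ff: "!!v t. F (unit_flow t v) = unit_flow t (F v)" and F0: "F 0 = 0"
  by (rule extend_second[OF \<rho> Zc Y0 pos eq mono']) (assumption | rule that)+
 let ?H = "{v :: real^3. \<bar>v $ 1 * v $ 2\<bar> < \<epsilon>}" and ?W = "{m \<in> O'. coords m \<in> W}"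
 have HI: "unit_flow t v \<in> ?H \<longleftrightarrow> v \<in> ?H" for t v
  by (simp only: mem_Collect_eq unit_flow_invariant)
 have Ho: "open ?H" by (intro open_Collect_less continuous_intros)
 have a2: "axis 2 1 \<in> ?H" using W by blast
 have emb: "flow_embedding ?H F" unfolding flow_embedding_def using Ho Fc Fi Ff F0 HI a2 \<epsilon> by simp
 have Wo: "openin M ?W" by (rule chart_preimage_open[OF O'(1) fc W(1)])
 show ?thesis
 proof (rule that[OF emb Wo])
  show "m1 \<in> ?W" using m1 W(2) by simp
  show "coords ` ?W \<subseteq> ?H" using W(4) by auto
  show "F (coords m) = vec3 (coords m $ 1) (y m) (coords m $ 3 / coords m $ 2 * y m)" if "m \<in> ?W" for m
   using that FW[of "coords m"] inv[of m] by simp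
 qed auto
qed

end

section \<open>Reversal of time\<close>

lemma Ck_on_cong:
 "Ck_on k S f ==> open S ==> (!!x. x \<in> S ==> f x = g x) ==> Ck_on k S g"
proof (induction k arbitrary: f g)
 case 0
 then show ?case using continuous_on_cong[of S S f g] by simp
next
 case (Suc k)
 have d: "(g has_derivative frechet_derivative f (at x)) (at x)" if x: "x \<in> S" for x
  by (rule has_derivative_transform_within_open[OF Ck_on_frechet[OF Suc.prems(1) x] Suc.prems(2) x]) (use Suc.prems in auto)
 have e: "frechet_derivative f (at x) = frechet_derivative g (at x)" if "x \<in> S" for x
  by (rule frechet_derivative_at[OF d[OF that]])
 have "Ck_on k S (%x. frechet_derivative g (at x) v)" for v
  by (rule Suc.IH[of "%x. frechet_derivative f (at x) v"]) (use Suc.prems e in auto)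
 then show ?case using d by (auto simp: differentiable_def)
qed

lemma Ck_on_uminus: "Ck_on k S f ==> open S ==> Ck_on k S (%x. - f x)"
proof (induction k arbitrary: f)
 case 0
 then show ?case by (simp add: continuous_on_minus)
next
 case (Suc k)
 have d: "((%x. - f x) has_derivative (%v. - frechet_derivative f (at x) v)) (at x)" if x: "x \<in> S" for x
  by (rule has_derivative_minus[OF Ck_on_frechet[OF Suc.prems(1) x]])
 have e: "- frechet_derivative f (at x) v = frechet_derivative (%x. - f x) (at x) v" if "x \<in> S" for x v
  using frechet_derivative_at[OF d[OF that]] by metis
 have "Ck_on k S (%x. - frechet_derivative f (at x) v)" for v by (rule Suc.IH) (use Suc.prems in auto)
 then have "Ck_on k S (%x. frechet_derivative (%x. - f x) (at x) v)" for v by (rule Ck_on_cong[OF _ Suc.prems(2)]) (rule e)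
 then show ?case using d by (auto simp: differentiable_def)
qed

context vector_field_manifold
begin

lemma reverse_manifold: "vector_field_manifold M A (reverse_field X)"
proof
 show "smooth_3manifold M A" by (rule manifold)
 have X: "\<forall>c\<in>A. \<forall>d\<in>A. \<forall>x \<in> fst c \<inter> fst d. X d x = dtrans c d x (X c x)"
  "\<forall>c\<in>A. smooth_on (snd c ` fst c) (X c \<circ> chart_inv c)"
  using field unfolding smooth_vector_field_def by blast+
 show "smooth_vector_field A (reverse_field X)" unfolding smooth_vector_field_def
 proof (intro conjI ballI)
  fix c d x assume c: "c \<in> A" and d: "d \<in> A" and x: "x \<in> fst c \<inter> fst d"
  have "linear (dtrans c d x)" by (rule dtrans_linear[OF atlas_C1chart[OF c] atlas_C1chart[OF d]]) (use x in auto)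
  from linear_neg[OF this] show "reverse_field X d x = dtrans c d x (reverse_field X c x)"
   using X(1)[rule_format, OF c d x] by (simp add: reverse_field_def)
 next
  fix c assume c: "c \<in> A"
  have "reverse_field X c \<circ> chart_inv c = (%x. - (X c \<circ> chart_inv c) x)" by (auto simp: reverse_field_def)
  then show "smooth_on (snd c ` fst c) (reverse_field X c \<circ> chart_inv c)"
   using X(2)[rule_format, OF c] Ck_on_uminus is_chartD(2)[OF atlas_chart[OF c]] unfolding smooth_on_def by metis
 qed
qed

lemma reverse_field_in:
 "vector_field_manifold.field_in M A (reverse_field X) d F \<longleftrightarrow> field_in d (%v. - F v)"
proof -
 have "dtrans c d x (reverse_field X c x) = - dtrans c d x (X c x)"
  if "C1chart d" "c \<in> A" "x \<in> fst c" "x \<in> fst d" for c x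
  using linear_neg[OF dtrans_linear[OF atlas_C1chart[OF that(2)] that(1) that(3,4)]] by (simp add: reverse_field_def)
 then show ?thesis unfolding vector_field_manifold.field_in_def[OF reverse_manifold] field_in_def
  by (auto simp: minus_equation_iff)
qed

lemma icurve_reverse:
 assumes g: "icurve I \<gamma>" and J: "is_interval J" "uminus ` J \<subseteq> I"
 shows "integral_curve M A (reverse_field X) (topspace M) J (%t. \<gamma> (- t))" unfolding integral_curve_def
proof (intro conjI ballI impI J(1))
 have "continuous_map (top_of_set I) (subtopology M (topspace M)) \<gamma>" using g by (simp add: integral_curve_def)
 moreover have "continuous_map (top_of_set J) (top_of_set I) uminus" using J(2) by (auto intro!: continuous_intros)
 ultimately have "continuous_map (top_of_set J) (subtopology M (topspace M)) (\<gamma> \<circ> uminus)"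
  by (rule continuous_map_compose[rotated])
 then show "continuous_map (top_of_set J) (subtopology M (topspace M)) (%t. \<gamma> (- t))" by (simp add: o_def)
 fix t c assume t: "t \<in> J" and c: "c \<in> A" "\<gamma> (- t) \<in> fst c"
 have "- t \<in> I" using t J(2) by auto
 then have "((snd c \<circ> \<gamma>) has_vector_derivative X c (\<gamma> (- t))) (at (- t) within I)"
  using g c by (auto simp: integral_curve_def)
 then have 1: "((snd c \<circ> \<gamma>) has_vector_derivative X c (\<gamma> (- t))) (at (- t) within uminus ` J)"
  by (rule has_vector_derivative_within_subset) (rule J(2))
 have "((%s::real. - s) has_vector_derivative - 1) (at t within J)" by (auto intro!: derivative_eq_intros)
 from vector_diff_chain_within[OF this 1]
 show "((snd c \<circ> (%t. \<gamma> (- t))) has_vector_derivative reverse_field X c (\<gamma> (- t))) (at t within J)"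
  by (simp add: o_def reverse_field_def)
qed

section \<open>Charts that contain half of a connection\<close>

text \<open>A similarity of the plane moves a given point of it to \<open>(0,1,0)\<close> and keeps the estimate on the plane.\<close>

lemma plane_conformal:
 assumes sf: "saddle_form L \<mu> \<alpha>" and u: "u $ 1 = 0" "u ~= 0"
 obtains B B' where "linear B" "linear B'" "!!v. B' (B v) = v" "!!v. B (B' v) = v" "B u = axis 2 1"
  "!!v. B v $ 1 = v $ 1" "saddle_form (%v. B (L (B' v))) \<mu> \<alpha>"
proof -
 interpret saddle_form L \<mu> \<alpha> by (rule sf)
 define n where "n = (u $ 2)\<^sup>2 + (u $ 3)\<^sup>2"
 have n: "n ~= 0"
 proof
  assume "n = 0"
  then have "u $ 2 = 0 & u $ 3 = 0" by (simp add: n_def sum_power2_eq_zero_iff)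
  then show False using u by (simp add: vec3_eq_iff)
 qed
 define B where "B v = vec3 (v $ 1) ((u $ 2 * v $ 2 + u $ 3 * v $ 3) / n) ((u $ 2 * v $ 3 - u $ 3 * v $ 2) / n)" for v :: "real^3"
 define B' where "B' v = vec3 (v $ 1) (u $ 2 * v $ 2 - u $ 3 * v $ 3) (u $ 3 * v $ 2 + u $ 2 * v $ 3)" for v :: "real^3"
 have lB: "linear B" unfolding B_def by (rule linearI) (simp_all add: vec3_eq_iff add_divide_distrib diff_divide_distrib algebra_simps)
 have lB': "linear B'" unfolding B'_def by (rule linearI) (simp_all add: vec3_eq_iff algebra_simps)
 have BB': "B' (B v) = v" for v
 proof -
  have "u $ 2 * ((u $ 2 * v $ 2 + u $ 3 * v $ 3) / n) - u $ 3 * ((u $ 2 * v $ 3 - u $ 3 * v $ 2) / n) = (n * v $ 2) / n"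
   "u $ 3 * ((u $ 2 * v $ 2 + u $ 3 * v $ 3) / n) + u $ 2 * ((u $ 2 * v $ 3 - u $ 3 * v $ 2) / n) = (n * v $ 3) / n"
   unfolding times_divide_eq_right diff_divide_distrib[symmetric] add_divide_distrib[symmetric]
   by (simp_all add: n_def power2_eq_square algebra_simps)
  then show ?thesis using n by (simp add: vec3_eq_iff B_def B'_def)
 qed
 have B'B: "B (B' v) = v" for v
 proof -
  have "u $ 2 * (u $ 2 * v $ 2 - u $ 3 * v $ 3) + u $ 3 * (u $ 3 * v $ 2 + u $ 2 * v $ 3) = n * v $ 2"
   "u $ 2 * (u $ 3 * v $ 2 + u $ 2 * v $ 3) - u $ 3 * (u $ 2 * v $ 2 - u $ 3 * v $ 3) = n * v $ 3"
   by (simp_all add: n_def power2_eq_square algebra_simps)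
  then show ?thesis using n by (simp add: vec3_eq_iff B_def B'_def)
 qed
 have Bu: "B u = axis 2 1"
 proof -
  have "u $ 2 * u $ 2 + u $ 3 * u $ 3 = n" by (simp add: n_def power2_eq_square)
  then show ?thesis using u n by (simp add: vec3_eq_iff B_def axis2_vec3 mult.commute)
 qed
 have "saddle_form (%v. B (L (B' v))) \<mu> \<alpha>"
 proof (rule saddle_form.intro)
  show "linear (%v. B (L (B' v)))" using linear_compose[OF linear_compose[OF lB' lin] lB] by (simp add: o_def)
  have 1: "B v $ 1 = v $ 1" "B' v $ 1 = v $ 1" for v by (simp_all add: B_def B'_def)
  show "B (L (B' y)) $ 1 = \<mu> * y $ 1" for y by (simp only: 1 L1)
  have B'1: "B' (axis 1 1) = axis 1 1" by (simp add: vec3_eq_iff B'_def axis_def)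
  have B1: "B (axis 1 1) = axis 1 1" by (simp add: vec3_eq_iff B_def axis_def)
  show "B (L (B' (axis 1 1))) = \<mu> *\<^sub>R axis 1 1" unfolding B'1 Laxis linear_scale[OF lB] B1 ..
  fix y :: "real^3" assume y: "y $ 1 = 0"
  have gen: "a * (b / n) + c * (e / n) = (a * b + c * e) / n" for a b c e :: real by (simp add: add_divide_distrib)
  have dot: "y \<bullet> B z = (B' y \<bullet> z) / n" for z
  proof -
   have "y \<bullet> B z = y $ 2 * ((u $ 2 * z $ 2 + u $ 3 * z $ 3) / n) + y $ 3 * ((u $ 2 * z $ 3 - u $ 3 * z $ 2) / n)"
    using y by (simp add: inner_vec_def sum_3 B_def)
   also have "\<dots> = (y $ 2 * (u $ 2 * z $ 2 + u $ 3 * z $ 3) + y $ 3 * (u $ 2 * z $ 3 - u $ 3 * z $ 2)) / n"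
    by (rule gen)
   also have "y $ 2 * (u $ 2 * z $ 2 + u $ 3 * z $ 3) + y $ 3 * (u $ 2 * z $ 3 - u $ 3 * z $ 2) = B' y \<bullet> z"
    using y by (simp add: inner_vec_def sum_3 B'_def algebra_simps)
   finally show ?thesis .
  qed
  have np: "n > 0" using n unfolding n_def by (metis sum_power2_ge_zero less_le)
  have "B' y \<bullet> B' y = n * (y \<bullet> y)"
   using y by (simp add: inner_vec_def sum_3 B'_def n_def power2_eq_square algebra_simps)
  moreover have "B' y \<bullet> L (B' y) <= - \<alpha> * (B' y \<bullet> B' y)" by (rule Lplane) (simp only: 1 y)
  ultimately have "(B' y \<bullet> L (B' y)) / n <= (n * (- \<alpha> * (y \<bullet> y))) / n"
   using np by (intro divide_right_mono) (simp_all add: algebra_simps)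
  then show "y \<bullet> B (L (B' y)) <= - \<alpha> * (y \<bullet> y)" unfolding dot using n by simp
 qed (use \<mu> \<alpha> in auto)
 then show ?thesis using that lB lB' BB' B'B Bu by (simp add: B_def)
qed

text \<open>Pulling back the linearizing chart along the flow covers the whole half orbit.\<close>

lemma sink_side:
 assumes d: "field_in d L" "q \<in> fst d" "snd d q = 0" and sf: "saddle_form L \<mu> \<alpha>"
  and g: "icurve {0..} \<gamma>" "limitin M \<gamma> q at_top" and nq: "q \<notin> \<gamma> ` {0..}"
 obtains D L' where "field_in D L'" "saddle_form L' \<mu> \<alpha>" "q \<in> fst D" "snd D q = 0"
  "!!t. 0 <= t ==> \<gamma> t \<in> fst D" "snd D (\<gamma> 0) = axis 2 1"
  "!!c V. c \<in> A ==> \<gamma> 0 \<in> fst c ==> stable_tangent M A X q (\<gamma> 0) c V ==> V = {v. dtrans c D (\<gamma> 0) v $ 1 = 0}"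
proof -
 interpret saddle_form L \<mu> \<alpha> by (rule sf)
 interpret S: sink_saddle M A X L \<mu> \<alpha> d q
  by unfold_locales (use d in auto)
 note d1 = S.d1 and dc = C1chart_is_chart[OF S.d1]
 from limit_enters_ball[OF d1 d(2,3) g(2) zero_less_one]
 obtain S0 where S0: "!!t. S0 <= t ==> \<gamma> t \<in> fst d & norm (snd d (\<gamma> t)) < 1"
  unfolding eventually_at_top_linorder by blast
 define S where "S = max 0 S0"
 have S: "0 <= S" "S0 <= S" by (auto simp: S_def)
 have box: "\<gamma> t \<in> fst d" if "S <= t" for t using S0[of t] S that by simp
 let ?p = "pull_chart S d"
 have pf: "field_in ?p L" by (rule field_in_pull[OF d(1) S(1)])
 have pq: "q \<in> fst ?p" "snd ?p q = 0"
 proof -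
  have "icurve {0..S} (%t. q)" by (rule icurve_const[OF d(1,2) _ is_interval_cc]) (simp add: d(3) linear_0[OF lin])
  from pull_chart_apply[OF this refl S(1) d(2)] show "q \<in> fst ?p" "snd ?p q = 0" using d(3) by auto
 qed
 have pg: "\<gamma> t \<in> fst ?p" "snd ?p (\<gamma> t) = snd d (\<gamma> (S + t))" if t: "0 <= t" for t
 proof -
  have "icurve {0..S} (%s. \<gamma> (s + t))" by (rule icurve_shift[OF g(1) is_interval_cc]) (use t in auto)
  from pull_chart_apply[OF this _ S(1), of "\<gamma> t" d] show "\<gamma> t \<in> fst ?p" "snd ?p (\<gamma> t) = snd d (\<gamma> (S + t))"
   using box[of "S + t"] t by auto
 qed
 define u where "u = snd d (\<gamma> S)"
 have u1: "u $ 1 = 0" unfolding u_def by (rule S.staying_curve_in_plane[OF g(1), of _ 1]) (use S0 S in auto)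
 have u0: "u ~= 0"
 proof
  assume "u = 0"
  then have "snd d (\<gamma> S) = snd d q" using d(3) by (simp add: u_def)
  from inj_onD[OF is_chartD(5)[OF dc] this box[OF order_refl] d(2)] show False using nq S(1) by force
 qed
 obtain B B' where B: "linear B" "linear B'" "!!v. B' (B v) = v" "!!v. B (B' v) = v" and Bu: "B u = axis 2 1"
  and B1: "!!v. B v $ 1 = v $ 1" and sf': "saddle_form (%v. B (L (B' v))) \<mu> \<alpha>"
  by (rule plane_conformal[OF sf u1 u0]) (rule that; assumption)
 have p1: "C1chart ?p" using pf by (simp add: field_in_def)
 show ?thesis
 proof (rule that[of "(fst ?p, %x. B (snd ?p x))" "%v. B (L (B' v))"])
  show "field_in (fst ?p, %x. B (snd ?p x)) (%v. B (L (B' v)))" by (rule field_in_linear_change[OF pf B])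
  show "saddle_form (%v. B (L (B' v))) \<mu> \<alpha>" by (rule sf')
  show "q \<in> fst (fst ?p, %x. B (snd ?p x))" "snd (fst ?p, %x. B (snd ?p x)) q = 0" using pq linear_0[OF B(1)] by auto
  show "\<gamma> t \<in> fst (fst ?p, %x. B (snd ?p x))" if "0 <= t" for t using pg(1)[OF that] by simp
  show "snd (fst ?p, %x. B (snd ?p x)) (\<gamma> 0) = axis 2 1" using pg(2)[of 0] Bu by (simp add: u_def)
  fix c V assume c: "c \<in> A" "\<gamma> 0 \<in> fst c" and V: "stable_tangent M A X q (\<gamma> 0) c V"
  have "dtrans c (fst ?p, %x. B (snd ?p x)) (\<gamma> 0) v = B (dtrans c ?p (\<gamma> 0) v)" for v
   by (rule C1chart_linear(2)[OF p1 B pg(1)[OF order_refl] c(2) atlas_C1chart[OF c(1)]])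
  then show "V = {v. dtrans c (fst ?p, %x. B (snd ?p x)) (\<gamma> 0) v $ 1 = 0}"
   using S.stable_tangent_eq_plane[OF S(1) g box c V] by (simp add: B1)
 qed
qed

text \<open>The saddle itself is a point of its stable manifold, whose tangent space there is the plane.\<close>

lemma stable_plane_dim:
 assumes d: "field_in d L" "q \<in> fst d" "snd d q = 0" and sf: "saddle_form L \<mu> \<alpha>"
 shows "\<not> stable_dim M A X q 1"
proof
 assume dim: "stable_dim M A X q 1"
 interpret saddle_form L \<mu> \<alpha> by (rule sf)
 interpret S: sink_saddle M A X L \<mu> \<alpha> d q
  by unfold_locales (use d in auto)
 have d1: "C1chart d" using d(1) by (simp add: field_in_def)
 have qt: "q \<in> topspace M" using d(2) is_chartD(3)[OF C1chart_is_chart[OF d1]] by blast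
 then obtain c where c: "c \<in> A" "q \<in> fst c" using atlas_covers by blast
 have const: "icurve J (%t. q)" if "is_interval J" for J
  by (rule icurve_const[OF d(1,2) _ that]) (simp add: d(3) linear_0[OF lin])
 have lim: "limitin M (%t. q) q at_top" using qt by simp
 have "q \<in> stable_set M A X q" unfolding stable_set_def using const[OF is_interval_ci[of 0]] lim by blast
 then obtain V where V: "stable_tangent M A X q q c V" "dim V = 1" using dim c unfolding stable_dim_def by blast
 let ?p = "pull_chart 0 d" and ?T = "dtrans c (pull_chart 0 d) q"
 have Veq: "V = {v. ?T v $ 1 = 0}"
  using S.stable_tangent_eq_plane[of 0 "%t. q" c V] const[OF is_interval_ci] lim d(2) c V(1) by simp
 have p1: "C1chart ?p" by (rule C1chart_pull[OF d1]) simp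
 have qp: "q \<in> fst ?p" using pull_chart_apply(1)[OF const[OF is_interval_cc] refl order_refl d(2)] .
 note c1 = atlas_C1chart[OF c(1)]
 have "{y :: real^3. axis 1 1 \<bullet> y = 0} = ?T ` V"
 proof
  show "?T ` V \<subseteq> {y. axis 1 1 \<bullet> y = 0}" unfolding Veq by (auto simp: inner_axis')
  show "{y. axis 1 1 \<bullet> y = 0} \<subseteq> ?T ` V"
  proof
   fix y :: "real^3" assume "y \<in> {y. axis 1 1 \<bullet> y = 0}"
   then have y1: "y $ 1 = 0" by (simp add: inner_axis')
   have Ty: "?T (dtrans ?p c q y) = y" by (rule dtrans_inverse[OF p1 qp c1 c(2)])
   then have "dtrans ?p c q y \<in> V" unfolding Veq using y1 by simp
   then show "y \<in> ?T ` V" using Ty by (metis imageI)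
  qed
 qed
 moreover have "dim {y :: real^3. axis 1 1 \<bullet> y = 0} = 2"
  using dim_hyperplane[of "axis 1 1 :: real^3"] by (simp add: axis_eq_0_iff)
 ultimately have "2 <= dim V" using dim_image_le[OF dtrans_linear[OF c1 p1 c(2) qp], of V] by simp
 then show False using V(2) by simp
qed

end

section \<open>Matching the coordinates of the two ends\<close>

context saddle_form
begin

lemma plane_axis2: "plane (axis 2 1) = axis 2 1" by (simp add: vec3_eq_iff axis_def)

lemma plane_axis2_nonzero: "plane (axis 2 1) ~= 0" by (simp add: plane_axis2 axis_eq_0_iff)

lemma cross_axis2: "cross (axis 2 1) = 0"
 by (rule cross_unique[OF plane_axis2_nonzero]) (simp add: plane_axis2 linear_flow_0[OF lin])

lemma open_plane_nonzero: "open {y. plane y ~= 0}"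
proof -
 have "{y. plane y ~= 0} = - (plane -` {0})" by auto
 moreover have "closed (plane -` {0})" by (rule closed_vimage[OF closed_singleton plane_continuous])
 ultimately show ?thesis by (simp add: open_Compl)
qed

lemma cross_tendsto:
 assumes "(y \<longlongrightarrow> axis 2 1) F"
 shows "((%x. cross (y x)) \<longlongrightarrow> 0) F"
proof -
 have "isCont cross (axis 2 1)"
  using cross_continuous open_plane_nonzero plane_axis2_nonzero by (simp add: continuous_on_eq_continuous_at)
 from isCont_tendsto_compose[OF this assms] show ?thesis by (simp add: cross_axis2)
qed

lemma plane_tendsto:
 assumes "(y \<longlongrightarrow> y0) F"
 shows "((%x. plane (y x)) \<longlongrightarrow> plane y0) F"
proof -
 have "isCont plane y0" using plane_continuous[of UNIV] by (simp add: continuous_on_eq_continuous_at)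
 from isCont_tendsto_compose[OF this assms] show ?thesis .
qed

lemma mean_value_component:
 fixes g :: "real^3 => real^3"
 assumes g: "!!z. z \<in> S ==> (g has_derivative g' z) (at z)" and S: "convex S" "y \<in> S" "y' \<in> S"
  and eq: "g y $ i = g y' $ i"
 obtains z where "z \<in> S" "g' z (y' - y) $ i = 0"
proof -
 let ?c = "%t::real. y + t *\<^sub>R (y' - y)"
 have cS: "?c t \<in> S" if t: "0 <= t" "t <= 1" for t
 proof -
  have "(1 - t) *\<^sub>R y + t *\<^sub>R y' \<in> S" using convexD_alt[OF S t] .
  then show ?thesis by (simp add: algebra_simps)
 qed
 have "\<exists>t. 0 < t & t < (1::real) & g (?c 1) $ i - g (?c 0) $ i = (1 - 0) * (g' (?c t) (y' - y) $ i)"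
 proof (rule MVT2[OF zero_less_one])
  fix t :: real assume t: "0 <= t" "t <= 1"
  have "(?c has_derivative (%s. s *\<^sub>R (y' - y))) (at t)" by (auto intro!: derivative_eq_intros)
  from diff_chain_at[OF this g[OF cS[OF t]]]
  have "(g \<circ> ?c has_derivative g' (?c t) \<circ> (%s. s *\<^sub>R (y' - y))) (at t)" .
  moreover have "g' (?c t) \<circ> (%s. s *\<^sub>R (y' - y)) = (%s. s *\<^sub>R g' (?c t) (y' - y))"
   using linear_scale[OF has_derivative_linear[OF g[OF cS[OF t]]]] by auto
  ultimately have "((%t. g (?c t)) has_vector_derivative g' (?c t) (y' - y)) (at t)"
   by (simp add: has_vector_derivative_def o_def)
  then show "DERIV (%t. g (?c t) $ i) t :> g' (?c t) (y' - y) $ i" by (simp add: has_vector_derivative_vec3)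
 qed
 then obtain t where t: "0 < t" "t < 1" "g' (?c t) (y' - y) $ i = 0" using eq by auto
 then show ?thesis using that cS[of t] by simp
qed

text \<open>Points with the same crossing time and the same first coordinate lie on a curve that is nearly parallel
 to the third axis near \<open>(0,1,0)\<close>; a C1 function with a nonzero derivative in that direction separates them.
 The chord between two points of the unit circle is orthogonal to their sum, which controls its direction.\<close>

lemma crossing_injective:
 fixes g :: "real^3 => real^3"
 assumes g: "Ck_on 1 S g" and S: "open S" "axis 2 1 \<in> S"
  and nz: "frechet_derivative g (at (axis 2 1)) (axis 3 1) $ 1 ~= 0"
 shows "\<exists>r>0. \<forall>y\<in>ball (axis 2 1) r. \<forall>y'\<in>ball (axis 2 1) r.
  y $ 1 = y' $ 1 --> cross y = cross y' --> g y $ 1 = g y' $ 1 --> y = y'"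
proof (rule ccontr)
 let ?a = "axis 2 1 :: real^3"
 define \<theta> where "\<theta> y = E (cross y) (plane y)" for y
 assume "\<not> ?thesis"
 then have bad: "\<exists>y\<in>ball ?a r. \<exists>y'\<in>ball ?a r. y $ 1 = y' $ 1 & cross y = cross y' & g y $ 1 = g y' $ 1 & y ~= y'"
  if "r > 0" for r using that by blast
 have \<theta>l: "((%x. \<theta> (y x)) \<longlongrightarrow> ?a) F" if "(y \<longlongrightarrow> ?a) F" for y and F :: "nat filter"
  using E_joint_continuous[OF cross_tendsto[OF that] plane_tendsto[OF that]]
  by (simp add: \<theta>_def plane_axis2 linear_flow_0[OF lin])
 have "\<theta> ?a = ?a" by (simp add: \<theta>_def cross_axis2 plane_axis2 linear_flow_0[OF lin])
 have "((%y. \<theta> y) \<longlongrightarrow> ?a) (nhds ?a)"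
  using E_joint_continuous[OF cross_tendsto[OF filterlim_ident] plane_tendsto[OF filterlim_ident]]
  by (simp add: \<theta>_def plane_axis2 linear_flow_0[OF lin])
 then have "((%y. \<theta> y $ 2) \<longlongrightarrow> ?a $ 2) (nhds ?a)" by (rule tendsto_vec_nth)
 then have "((%y. \<theta> y $ 2) \<longlongrightarrow> 1) (nhds ?a)" by (simp add: axis_def)
 then have "\<forall>\<^sub>F y in nhds ?a. \<theta> y $ 2 > 0" by (rule order_tendstoD(1)) simp
 moreover have "\<forall>\<^sub>F y in nhds ?a. plane y ~= 0"
  using open_plane_nonzero plane_axis2_nonzero eventually_nhds by auto
 moreover have "\<forall>\<^sub>F y in nhds ?a. y \<in> S" using S eventually_nhds by auto
 ultimately have "\<forall>\<^sub>F y in nhds ?a. \<theta> y $ 2 > 0 & plane y ~= 0 & y \<in> S" by eventually_elim blast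
 then obtain r0 where r0: "r0 > 0" "!!y. dist y ?a < r0 ==> \<theta> y $ 2 > 0 & plane y ~= 0 & y \<in> S"
  unfolding eventually_nhds_metric by blast
 define R where "R y y' = - ((\<theta> y + \<theta> y') $ 3) / (\<theta> y + \<theta> y') $ 2" for y y'
 have claim: "\<exists>y\<in>ball ?a r. \<exists>y'\<in>ball ?a r. \<exists>z\<in>ball ?a r.
   frechet_derivative g (at z) (E (- cross y) (vec3 0 (R y y') 1)) $ 1 = 0" if r: "r > 0" "r <= r0" for r
 proof -
  obtain y y' where y: "y \<in> ball ?a r" "y' \<in> ball ?a r" and e: "y $ 1 = y' $ 1" "cross y = cross y'" "g y $ 1 = g y' $ 1"
   and ne: "y ~= y'" using bad[OF r(1)] by blast
  have ball: "\<theta> z $ 2 > 0 & plane z ~= 0 & z \<in> S" if "z \<in> ball ?a r" for z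
   using r0(2)[of z] that r(2) by (simp add: dist_commute)
  have n: "\<theta> z \<bullet> \<theta> z = 1" if "z \<in> ball ?a r" for z
   using cross_norm[of z] ball[OF that] by (simp add: \<theta>_def norm_eq_1)
  have \<theta>1: "\<theta> z $ 1 = 0" for z unfolding \<theta>_def by (rule E_plane0) simp
  let ?u = "\<theta> y' - \<theta> y" and ?s = "\<theta> y + \<theta> y'"
  have "?s \<bullet> ?u = 0" using n[OF y(1)] n[OF y(2)] by (simp add: inner_add_left inner_add_right inner_diff_left inner_diff_right inner_commute[of "\<theta> y'" "\<theta> y"])
  then have dot: "?s $ 2 * ?u $ 2 + ?s $ 3 * ?u $ 3 = 0" using \<theta>1 by (simp add: inner_vec_def sum_3)
  have s2: "?s $ 2 > 0" using ball[OF y(1)] ball[OF y(2)] by simp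
  have "?u $ 2 = ?u $ 3 * R y y'"
  proof -
   have r: "?s $ 2 * R y y' = - (?s $ 3)" unfolding R_def using s2 by simp
   have "?s $ 2 * (?u $ 3 * R y y') = ?u $ 3 * (?s $ 2 * R y y')" by (simp only: mult.left_commute)
   also have "\<dots> = - (?s $ 3 * ?u $ 3)" unfolding r by (simp only: mult_minus_right mult.commute)
   finally have "?s $ 2 * ?u $ 2 = ?s $ 2 * (?u $ 3 * R y y')" using dot by linarith
   then show ?thesis using s2 by simp
  qed
  then have u: "?u = ?u $ 3 *\<^sub>R vec3 0 (R y y') 1" using \<theta>1 by (simp add: vec3_eq_iff)
  have "plane y' - plane y = E (- cross y) (\<theta> y') - E (- cross y) (\<theta> y)"
   by (simp add: \<theta>_def e(2) linear_flow_cancel[OF lin])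
  also have "\<dots> = E (- cross y) ?u" by (simp add: linear_diff[OF linear_flow_linear[OF lin]])
  also have "\<dots> = ?u $ 3 *\<^sub>R E (- cross y) (vec3 0 (R y y') 1)"
   by (subst u) (simp only: linear_scale[OF linear_flow_linear[OF lin]])
  finally have "plane y' - plane y = ?u $ 3 *\<^sub>R E (- cross y) (vec3 0 (R y y') 1)" .
  moreover have "y' - y = plane y' - plane y" using plane_decomp[of y] plane_decomp[of y'] e(1) by (simp add: vec3_eq_iff)
  ultimately have d: "y' - y = ?u $ 3 *\<^sub>R E (- cross y) (vec3 0 (R y y') 1)" by simp
  have u3: "?u $ 3 ~= 0"
  proof
   assume "?u $ 3 = 0"
   then have "y' - y = 0" unfolding d by simp
   then show False using ne by simp
  qed
  have gd: "(g has_derivative frechet_derivative g (at z)) (at z)" if "z \<in> ball ?a r" for z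
   using C1_has_derivative[OF g] ball[OF that] by blast
  obtain z where z: "z \<in> ball ?a r" "frechet_derivative g (at z) (y' - y) $ 1 = 0"
   by (rule mean_value_component[where g' = "%z. frechet_derivative g (at z)" and S = "ball ?a r" and i = 1,
      OF gd convex_ball y e(3)])
  have "?u $ 3 * frechet_derivative g (at z) (E (- cross y) (vec3 0 (R y y') 1)) $ 1 = 0"
   using z(2) linear_scale[OF has_derivative_linear[OF gd[OF z(1)]]] unfolding d by simp
  then have "frechet_derivative g (at z) (E (- cross y) (vec3 0 (R y y') 1)) $ 1 = 0" using u3 by simp
  then show ?thesis using y z(1) by blast
 qed
 define r where "r n = min r0 (inverse (real (Suc n)))" for n
 have rn: "r n > 0" "r n <= r0" for n using r0(1) by (auto simp: r_def)
 have "\<forall>n. \<exists>y y' z. y \<in> ball ?a (r n) & y' \<in> ball ?a (r n) & z \<in> ball ?a (r n) &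
   frechet_derivative g (at z) (E (- cross y) (vec3 0 (R y y') 1)) $ 1 = 0"
  using claim[OF rn] by blast
 then obtain y y' z where in_ball: "!!n. y n \<in> ball ?a (r n)" "!!n. y' n \<in> ball ?a (r n)" "!!n. z n \<in> ball ?a (r n)"
  and zero: "!!n. frechet_derivative g (at (z n)) (E (- cross (y n)) (vec3 0 (R (y n) (y' n)) 1)) $ 1 = 0"
  by metis
 have lim: "x \<longlonglongrightarrow> ?a" if x: "!!n. x n \<in> ball ?a (r n)" for x
 proof -
  have "dist (x n) ?a <= inverse (real (Suc n))" for n using x[of n] by (simp add: r_def dist_commute)
  then have "(%n. dist (x n) ?a) \<longlonglongrightarrow> 0"
   by (intro Lim_null_comparison[OF _ LIMSEQ_inverse_real_of_nat]) (simp add: always_eventually)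
  then show ?thesis by (rule iffD2[OF tendsto_dist_iff])
 qed
 note yl = lim[OF in_ball(1)] and yl' = lim[OF in_ball(2)] and zl = lim[OF in_ball(3)]
 have sl: "(%n. \<theta> (y n) + \<theta> (y' n)) \<longlonglongrightarrow> ?a + ?a" by (intro tendsto_add \<theta>l yl yl')
 have "(%n. - ((\<theta> (y n) + \<theta> (y' n)) $ 3) / (\<theta> (y n) + \<theta> (y' n)) $ 2) \<longlonglongrightarrow> - ((?a + ?a) $ 3) / (?a + ?a) $ 2"
  by (intro tendsto_divide tendsto_minus tendsto_vec_nth sl) (simp add: axis_def)
 then have Rl: "(%n. R (y n) (y' n)) \<longlonglongrightarrow> 0" by (simp add: R_def axis_def)
 have "(%n. vec3 0 (R (y n) (y' n)) 1) \<longlonglongrightarrow> vec3 0 0 1" unfolding vec3_def by (intro tendsto_intros Rl)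
 moreover have "(%n. - cross (y n)) \<longlonglongrightarrow> - 0" by (rule tendsto_minus[OF cross_tendsto[OF yl]])
 ultimately have "(%n. E (- cross (y n)) (vec3 0 (R (y n) (y' n)) 1)) \<longlonglongrightarrow> E (- 0) (vec3 0 0 1)"
  by (intro E_joint_continuous)
 moreover have "E (- 0) (vec3 0 0 1) = axis 3 1" by (simp add: linear_flow_0[OF lin] vec3_eq_iff axis_def)
 ultimately have "(%n. E (- cross (y n)) (vec3 0 (R (y n) (y' n)) 1)) \<longlonglongrightarrow> axis 3 1" by simp
 from tendsto_vec_nth[OF C1_tendsto[OF g S zl this], of 1] zero
 have "(%n. 0 :: real) \<longlonglongrightarrow> frechet_derivative g (at ?a) (axis 3 1) $ 1" by simp
 then have "frechet_derivative g (at ?a) (axis 3 1) $ 1 = 0" using LIMSEQ_unique tendsto_const by blast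
 then show False using nz by simp
qed

text \<open>Near \<open>(0,1,0)\<close> the crossing times are bounded, so the flow up to the crossing is uniformly bounded.\<close>

lemma cross_lipschitz_near:
 "\<exists>r>0. \<exists>K\<ge>0. \<forall>y\<in>ball (axis 2 1) r. \<forall>z\<in>ball (axis 2 1) r. cross z - cross y <= K * norm (z - y)"
proof -
 let ?B = "\<Sum>b\<in>Basis. norm (E (- 1) b)"
 have "((%y. cross y) \<longlongrightarrow> 0) (nhds (axis 2 1))" by (rule cross_tendsto[OF filterlim_ident])
 then have "\<forall>\<^sub>F y in nhds (axis 2 1). cross y > - 1" by (rule order_tendstoD(1)) simp
 moreover have "\<forall>\<^sub>F y in nhds (axis 2 1). plane y ~= 0"
  using open_plane_nonzero plane_axis2_nonzero eventually_nhds by auto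
 ultimately have "\<forall>\<^sub>F y in nhds (axis 2 1). cross y > - 1 & plane y ~= 0" by eventually_elim blast
 then obtain r where r: "r > 0" "!!y. dist y (axis 2 1) < r ==> cross y > - 1 & plane y ~= 0"
  unfolding eventually_nhds_metric by blast
 have B0: "?B \<ge> 0" by (simp add: sum_nonneg)
 have "cross z - cross y <= ?B / \<alpha> * norm (z - y)" if yz: "y \<in> ball (axis 2 1) r" "z \<in> ball (axis 2 1) r" for y z
 proof (cases "cross y <= cross z")
  case True
  have y: "cross y > - 1" "plane y ~= 0" and z: "plane z ~= 0" using r(2)[of y] r(2)[of z] yz by (auto simp: dist_commute)
  have pd: "plane z - plane y = plane (z - y)" by (simp add: linear_diff[OF plane_linear])
  have "E (cross y) (plane (z - y)) = E (cross y + 1) (E (- 1) (plane (z - y)))"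
   using linear_flow_add[OF lin, of "cross y + 1" "- 1" "plane (z - y)"] by simp
  then have "norm (E (cross y) (plane (z - y))) <= exp (- \<alpha> * (cross y + 1)) * norm (E (- 1) (plane (z - y)))"
   using E_decay[OF E_plane0, of "plane (z - y)" "cross y + 1" "- 1"] y by simp
  also have "\<dots> <= 1 * norm (E (- 1) (plane (z - y)))" using y \<alpha> by (intro mult_right_mono) auto
  also have "\<dots> <= ?B * norm (plane (z - y))" using linear_norm_le_Basis[OF linear_flow_linear[OF lin]] by simp
  also have "\<dots> <= ?B * norm (z - y)"
  proof (rule mult_left_mono[OF _ B0])
   have "(norm (plane (z - y)))\<^sup>2 <= (norm (z - y))\<^sup>2"
    unfolding power2_norm_eq_inner by (simp add: inner_vec_def sum_3)
   then show "norm (plane (z - y)) <= norm (z - y)" by (rule power2_le_imp_le) simp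
  qed
  finally have "\<alpha> * (cross z - cross y) <= ?B * norm (z - y)"
   using cross_lipschitz[OF y(2) z True] unfolding pd by simp
  then show ?thesis using \<alpha> by (simp add: field_simps)
 next
  case False
  moreover have "0 <= ?B / \<alpha> * norm (z - y)" using B0 \<alpha> by simp
  ultimately show ?thesis by linarith
 qed
 then show ?thesis using r(1) B0 \<alpha> by (meson divide_nonneg_pos)
qed

lemma abs_hat: "\<bar>hat x\<bar> = \<bar>x\<bar> powr (1/\<mu>)" by (simp add: hat_def abs_mult abs_sgn_eq)

lemma sgn_hat: "sgn (hat x) = sgn x" by (cases "x = 0") (simp_all add: hat_def sgn_mult)

text \<open>The derivative of the logarithm of \<open>hat\<close> at \<open>w\<close> is \<open>1 / (\<mu> * w)\<close>, which exceeds any constant near zero.\<close>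

lemma ln_hat_steep:
 assumes lt: "\<bar>hat w\<bar> < \<bar>hat w'\<bar>" and s: "hat w * hat w' > 0" and K: "K * \<mu> * \<bar>w'\<bar> < 1"
 shows "ln \<bar>hat w\<bar> + K * \<bar>w' - w\<bar> < ln \<bar>hat w'\<bar>"
proof -
 have nz: "hat w ~= 0" "hat w' ~= 0" using s by auto
 then have w: "w ~= 0" "w' ~= 0" by auto
 have lw: "\<bar>w\<bar> < \<bar>w'\<bar>"
 proof (rule ccontr)
  assume "\<not> \<bar>w\<bar> < \<bar>w'\<bar>"
  then have "\<bar>w'\<bar> powr (1/\<mu>) <= \<bar>w\<bar> powr (1/\<mu>)" using \<mu> by (intro powr_mono2) auto
  then show False using lt by (simp add: abs_hat)
 qed
 have "sgn (hat w * hat w') = 1" using s by (rule sgn_pos)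
 then have "sgn (w * w') = 1" by (simp only: sgn_mult sgn_hat)
 then have ww: "w * w' > 0" by (simp only: sgn_1_pos)
 then have d: "\<bar>w' - w\<bar> = \<bar>w'\<bar> - \<bar>w\<bar>" using lw by (auto simp: zero_less_mult_iff abs_if split: if_splits)
 have l: "ln \<bar>hat x\<bar> = ln \<bar>x\<bar> / \<mu>" if "x ~= 0" for x using that by (simp add: abs_hat ln_powr)
 have "ln (\<bar>w\<bar> / \<bar>w'\<bar>) <= \<bar>w\<bar> / \<bar>w'\<bar> - 1" using w by (intro ln_le_minus_one) auto
 then have 1: "1 - \<bar>w\<bar> / \<bar>w'\<bar> <= ln \<bar>w'\<bar> - ln \<bar>w\<bar>" using w by (simp add: ln_div)
 have "\<bar>w' - w\<bar> > 0" using d lw by simp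
 then have "(K * \<mu> * \<bar>w'\<bar>) * \<bar>w' - w\<bar> < 1 * \<bar>w' - w\<bar>" using K by (intro mult_strict_right_mono)
 then have "K * \<mu> * \<bar>w' - w\<bar> * \<bar>w'\<bar> < \<bar>w'\<bar> - \<bar>w\<bar>" using d by (simp add: mult_ac)
 then have "K * \<mu> * \<bar>w' - w\<bar> < (\<bar>w'\<bar> - \<bar>w\<bar>) / \<bar>w'\<bar>" using w by (simp add: pos_less_divide_eq)
 also have "\<dots> = 1 - \<bar>w\<bar> / \<bar>w'\<bar>" using w by (simp add: diff_divide_distrib)
 finally have "\<mu> * (K * \<bar>w' - w\<bar>) < ln \<bar>w'\<bar> - ln \<bar>w\<bar>" using 1 by (simp add: mult_ac)
 then have "K * \<bar>w' - w\<bar> < (ln \<bar>w'\<bar> - ln \<bar>w\<bar>) / \<mu>" using \<mu> by (simp add: pos_less_divide_eq mult.commute)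
 then show ?thesis unfolding l[OF w(1)] l[OF w(2)] by (simp add: diff_divide_distrib)
qed

end

text \<open>Both halves of a connection meet at \<open>m1\<close>.  The last condition is transversality: the expanding coordinate
 of the second half varies along the circle on which the first two coordinates of the first half are constant.\<close>

locale matched_ends = vector_field_manifold M A X +
 P: saddle_end M A X Lp \<mu>p \<alpha>p "- 1" Dp p + Q: saddle_end M A X Lq \<mu>q \<alpha>q 1 Dq q
 for M :: "'a topology" and A :: "'a chart set" and X :: "'a vfield"
  and Lp :: "real^3 => real^3" and \<mu>p \<alpha>p :: real and Dp :: "'a chart" and p :: 'a
  and Lq :: "real^3 => real^3" and \<mu>q \<alpha>q :: real and Dq :: "'a chart" and q :: 'a +
 fixes m1 :: 'a
 assumes m1: "m1 \<in> fst Dp" "m1 \<in> fst Dq" "snd Dp m1 = axis 2 1" "snd Dq m1 = axis 2 1"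
  and indep: "dtrans Dp Dq m1 (axis 3 1) $ 1 ~= 0"
begin

lemma coords_m1: "P.coords m1 = axis 2 1" "Q.coords m1 = axis 2 1"
 by (simp_all add: P.coords_def Q.coords_def m1 P.flow_coords_axis2 Q.flow_coords_axis2)

text \<open>Near \<open>m1\<close> the three functions are jointly injective, and the crossing time of the first half is Lipschitz in the chart of
 the second one, with a constant that is small compared with the inverse of its expanding coordinate.\<close>

lemma common_neighbourhood:
 obtains O' K where "openin M O'" "m1 \<in> O'" "O' \<subseteq> fst Dp" "O' \<subseteq> fst Dq" "K \<ge> 0"
  "!!m. m \<in> O' ==> P.coords m $ 2 = exp (P.cross (snd Dp m))"
  "!!m m'. m \<in> O' ==> m' \<in> O' ==> P.coords m $ 1 = P.coords m' $ 1 ==> P.coords m $ 2 = P.coords m' $ 2 ==>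
   Q.coords m $ 1 = Q.coords m' $ 1 ==> m = m'"
  "!!m m'. m \<in> O' ==> m' \<in> O' ==> P.cross (snd Dp m') - P.cross (snd Dp m) <= K * norm (snd Dq m' - snd Dq m)"
  "!!m. m \<in> O' ==> K * \<mu>q * \<bar>snd Dq m $ 1\<bar> < 1"
proof -
 let ?a = "axis 2 1 :: real^3" and ?O = "fst Dp \<inter> fst Dq"
 let ?g = "transition Dp Dq" and ?k = "transition Dq Dp"
 have Oo: "openin M ?O" by (intro openin_Int is_chartD(1) P.Dc Q.Dc)
 have Sp: "open (snd Dp ` ?O)" and Sq: "open (snd Dq ` (fst Dq \<inter> fst Dp))"
  by (rule chart_overlap_open[OF P.Dc Q.Dc], rule chart_overlap_open[OF Q.Dc P.Dc])
 have aS: "?a \<in> snd Dp ` ?O" "?a \<in> snd Dq ` (fst Dq \<inter> fst Dp)" using m1 by (metis IntI imageI)+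
 have gm: "?g (snd Dp m) = snd Dq m" "?k (snd Dq m) = snd Dp m" if "m \<in> ?O" for m
  using transition_apply[OF P.Dc] transition_apply[OF Q.Dc] that by auto
 have nz: "frechet_derivative ?g (at ?a) (axis 3 1) $ 1 ~= 0" using indep by (simp add: m1(3))
 obtain r1 where r1: "r1 > 0" "!!y y'. y \<in> ball ?a r1 ==> y' \<in> ball ?a r1 ==>
   y $ 1 = y' $ 1 ==> P.cross y = P.cross y' ==> ?g y $ 1 = ?g y' $ 1 ==> y = y'"
  using P.crossing_injective[OF C1chart_transition[OF P.D1 Q.D1] Sp aS(1) nz] by blast
 obtain r2 K2 where r2: "r2 > 0" "K2 \<ge> 0" "!!y z. y \<in> ball ?a r2 ==> z \<in> ball ?a r2 ==>
   P.cross z - P.cross y <= K2 * norm (z - y)"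
  using P.cross_lipschitz_near by blast
 obtain r3 where r3: "r3 > 0" "cball ?a r3 \<subseteq> snd Dq ` (fst Dq \<inter> fst Dp)"
  using Sq aS(2) open_contains_cball by blast
 obtain K3 where K3: "K3 \<ge> 0" "!!x y. x \<in> cball ?a r3 ==> y \<in> cball ?a r3 ==> norm (?k x - ?k y) <= K3 * norm (x - y)"
  using C1_lipschitz[OF C1chart_transition[OF Q.D1 P.D1] compact_cball convex_cball r3(2)] by blast
 define K where "K = K2 * K3"
 define r where "r = min r1 r2"
 define r' where "r' = min r3 (1 / (\<mu>q * (K + 1)))"
 have K: "K \<ge> 0" using r2 K3 by (simp add: K_def)
 have rr: "r > 0" "r' > 0" using r1 r2 r3 K Q.\<mu> by (auto simp: r_def r'_def)
 define O1 where "O1 = {m \<in> fst Dp. snd Dp m \<in> ball ?a r}"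
 define O2 where "O2 = {m \<in> fst Dq. snd Dq m \<in> ball ?a r'}"
 define O3 where "O3 = {m \<in> fst Dp. P.coords m \<in> {v. v $ 2 > 0 & \<bar>v $ 3\<bar> < v $ 2}}"
 have "openin M O1" "openin M O2" "openin M O3" unfolding O1_def O2_def O3_def
  by (rule chart_preimage_open[OF is_chartD(1)[OF P.Dc] is_chartD(4)[OF P.Dc] open_ball],
    rule chart_preimage_open[OF is_chartD(1)[OF Q.Dc] is_chartD(4)[OF Q.Dc] open_ball],
    rule chart_preimage_open[OF is_chartD(1)[OF P.Dc] P.coords_continuous])
   (intro open_Collect_conj open_Collect_less continuous_intros)
 then have o: "openin M (O1 \<inter> O2 \<inter> O3)" by (intro openin_Int)
 have in1: "m1 \<in> O1 \<inter> O2 \<inter> O3" using m1 rr coords_m1 by (simp add: O1_def O2_def O3_def axis_def)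
 show ?thesis
 proof (rule that[OF o in1 _ _ K])
  show "O1 \<inter> O2 \<inter> O3 \<subseteq> fst Dp" "O1 \<inter> O2 \<inter> O3 \<subseteq> fst Dq" by (auto simp: O1_def O2_def)
  have e: "P.coords m $ 2 = exp (P.cross (snd Dp m))" if "m \<in> O1 \<inter> O2 \<inter> O3" for m
   using P.flow_coords_2(2)[of "snd Dp m"] that by (simp add: O3_def P.coords_def)
  then show "P.coords m $ 2 = exp (P.cross (snd Dp m))" if "m \<in> O1 \<inter> O2 \<inter> O3" for m using that .
  show "m = m'" if m: "m \<in> O1 \<inter> O2 \<inter> O3" "m' \<in> O1 \<inter> O2 \<inter> O3" and eq: "P.coords m $ 1 = P.coords m' $ 1"
   "P.coords m $ 2 = P.coords m' $ 2" "Q.coords m $ 1 = Q.coords m' $ 1" for m m'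
  proof -
   have mO: "m \<in> ?O" "m' \<in> ?O" using m by (auto simp: O1_def O2_def)
   have "snd Dp m = snd Dp m'"
   proof (rule r1(2))
    show "snd Dp m \<in> ball ?a r1" "snd Dp m' \<in> ball ?a r1" using m by (auto simp: O1_def r_def)
    show "snd Dp m $ 1 = snd Dp m' $ 1" using eq(1) by (simp add: P.coords_def P.flow_coords_1 P.hat_inject)
    show "P.cross (snd Dp m) = P.cross (snd Dp m')" using eq(2) e[OF m(1)] e[OF m(2)] by simp
    show "?g (snd Dp m) $ 1 = ?g (snd Dp m') $ 1"
     unfolding gm(1)[OF mO(1)] gm(1)[OF mO(2)] using eq(3) by (simp add: Q.coords_def Q.flow_coords_1 Q.hat_inject)
   qed
   from inj_onD[OF is_chartD(5)[OF P.Dc] this] show ?thesis using mO by blast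
  qed
  show "P.cross (snd Dp m') - P.cross (snd Dp m) <= K * norm (snd Dq m' - snd Dq m)"
   if m: "m \<in> O1 \<inter> O2 \<inter> O3" "m' \<in> O1 \<inter> O2 \<inter> O3" for m m'
  proof -
   have mO: "m \<in> ?O" "m' \<in> ?O" using m by (auto simp: O1_def O2_def)
   have "P.cross (snd Dp m') - P.cross (snd Dp m) <= K2 * norm (snd Dp m' - snd Dp m)"
    by (rule r2(3)) (use m in \<open>auto simp: O1_def r_def\<close>)
   also have "\<dots> <= K2 * (K3 * norm (snd Dq m' - snd Dq m))"
   proof (rule mult_left_mono[OF _ r2(2)])
    have "snd Dq m' \<in> cball ?a r3" "snd Dq m \<in> cball ?a r3" using m by (auto simp: O2_def r'_def)
    from K3(2)[OF this] show "norm (snd Dp m' - snd Dp m) <= K3 * norm (snd Dq m' - snd Dq m)"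
     using gm(2)[OF mO(1)] gm(2)[OF mO(2)] by simp
   qed
   finally show ?thesis by (simp add: K_def mult.assoc)
  qed
  show "K * \<mu>q * \<bar>snd Dq m $ 1\<bar> < 1" if m: "m \<in> O1 \<inter> O2 \<inter> O3" for m
  proof -
   let ?w = "\<bar>snd Dq m $ 1\<bar>"
   have "?w = \<bar>(snd Dq m - ?a) $ 1\<bar>" by (simp add: axis_def)
   also have "\<dots> <= norm (snd Dq m - ?a)" by (rule component_le_norm_cart)
   also have "\<dots> < 1 / (\<mu>q * (K + 1))" using m by (simp add: O2_def r'_def dist_norm norm_minus_commute)
   finally have "?w * (\<mu>q * (K + 1)) < 1" using Q.\<mu> K by (simp add: pos_less_divide_eq)
   moreover have "K * \<mu>q * ?w <= ?w * (\<mu>q * (K + 1))" using Q.\<mu> by (simp add: algebra_simps)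
   ultimately show ?thesis by linarith
  qed
 qed
qed

text \<open>Both ends are embedded equivariantly so that, near \<open>m1\<close>, the embeddings use the same three
 functions: the unstable coordinates of the two ends and the crossing radius of the first end.\<close>

lemma matched_embeddings:
 obtains Np Fp Nq Fq W where "flow_embedding Np Fp" "flow_embedding Nq Fq" "openin M W" "m1 \<in> W"
  "W \<subseteq> fst Dp" "W \<subseteq> fst Dq" "P.coords ` W \<subseteq> Np" "Q.coords ` W \<subseteq> Nq"
  "!!m. m \<in> W ==> P.coords m $ 2 > 0"
  "!!m. m \<in> W ==> Fp (P.coords m) = vec3 (P.coords m $ 1) (P.coords m $ 2) (Q.coords m $ 1)"
  "!!m. m \<in> W ==> Fq (Q.coords m) = vec3 (Q.coords m $ 1) (1 / P.coords m $ 2) (P.coords m $ 1)"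
proof -
 obtain O' K where o: "openin M O'" "m1 \<in> O'" and OP: "O' \<subseteq> fst Dp" and OQ: "O' \<subseteq> fst Dq" and K: "K \<ge> 0"
  and ec: "!!m. m \<in> O' ==> P.coords m $ 2 = exp (P.cross (snd Dp m))"
  and inj: "!!m m'. m \<in> O' ==> m' \<in> O' ==> P.coords m $ 1 = P.coords m' $ 1 ==> P.coords m $ 2 = P.coords m' $ 2 ==>
   Q.coords m $ 1 = Q.coords m' $ 1 ==> m = m'"
  and lip: "!!m m'. m \<in> O' ==> m' \<in> O' ==> P.cross (snd Dp m') - P.cross (snd Dp m) <= K * norm (snd Dq m' - snd Dq m)"
  and small: "!!m. m \<in> O' ==> K * \<mu>q * \<bar>snd Dq m $ 1\<bar> < 1"
  by (rule common_neighbourhood) (rule that; assumption)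
 have pos: "P.coords m $ 2 > 0" if "m \<in> O'" for m using ec[OF that] by simp
 have comp: "continuous_map (subtopology M V) euclideanreal (%m. f m $ i)"
  if "continuous_map (subtopology M V) euclidean f" for V and f :: "'a => real^3" and i
 proof -
  have "continuous_map euclidean euclideanreal (%v :: real^3. v $ i)" by (auto intro!: continuous_intros)
  from continuous_map_compose[OF that this] show ?thesis by (simp add: o_def)
 qed
 have cP: "continuous_map (subtopology M V) euclideanreal (%m. P.coords m $ i)" if "V \<subseteq> O'" for i V
  by (rule comp[OF continuous_map_from_subtopology_mono[OF P.coords_continuous]]) (use that OP in blast)
 have cQ: "continuous_map (subtopology M V) euclideanreal (%m. Q.coords m $ i)" if "V \<subseteq> O'" for i V
  by (rule comp[OF continuous_map_from_subtopology_mono[OF Q.coords_continuous]]) (use that OQ in blast)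
 have evP: "P.coords (dl t) = unit_flow (- 1 * (t - s)) (P.coords (dl s))"
  if "icurve I dl" "dl ` I \<subseteq> O'" "s \<in> I" "t \<in> I" for I dl s t
  by (rule P.coords_evolve[OF that(1) _ that(3,4)]) (use that(2) OP in blast)
 have evQ: "Q.coords (dl t) = unit_flow (1 * (t - s)) (Q.coords (dl s))"
  if "icurve I dl" "dl ` I \<subseteq> O'" "s \<in> I" "t \<in> I" for I dl s t
  by (rule Q.coords_evolve[OF that(1) _ that(3,4)]) (use that(2) OQ in blast)
 \<comment> \<open>first end: the unstable coordinate of the second end becomes the third coordinate\<close>
 obtain Np Fp Wp where Fp: "flow_embedding Np Fp" and Wp: "openin M Wp" "m1 \<in> Wp" "Wp \<subseteq> O'" "P.coords ` Wp \<subseteq> Np"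
  and FpW: "!!m. m \<in> Wp ==> Fp (P.coords m) = vec3 (P.coords m $ 1) (P.coords m $ 2) (Q.coords m $ 1)"
 proof (rule P.extend_third_at_end[OF o(1) OP subset_UNIV P.flow_embedding_id o(2) coords_m1(1) coords_m1(1) cQ[OF order_refl, of 1]])
  show "Q.coords m1 $ 1 = 0" by (simp add: coords_m1 axis_def)
  show "Q.coords (dl t) $ 1 = exp (- (- 1 * (t - s))) * Q.coords (dl s) $ 1"
   if "icurve I dl" "dl ` I \<subseteq> O'" "s \<in> I" "t \<in> I" for I dl s t using evQ[OF that] by simp
 qed (use inj that in blast)+
 \<comment> \<open>second end: first the radius, then the unstable coordinate of the first end\<close>
 obtain N2 F2 W2 where F2: "flow_embedding N2 F2" and W2: "openin M W2" "m1 \<in> W2" "W2 \<subseteq> O'" "Q.coords ` W2 \<subseteq> N2"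
  and F2W: "!!m. m \<in> W2 ==> F2 (Q.coords m) = vec3 (Q.coords m $ 1) (1 / P.coords m $ 2) (Q.coords m $ 3 / Q.coords m $ 2 * (1 / P.coords m $ 2))"
 proof (rule Q.extend_second_at_end[OF o(1) OQ o(2) coords_m1(2), of "%m. 1 / P.coords m $ 2"])
  show "continuous_map (subtopology M O') euclideanreal (%m. 1 / P.coords m $ 2)" using pos openin_subset[OF o(1)]
   by (intro continuous_map_real_divide cP[OF order_refl]) (auto simp: less_imp_neq[symmetric] dest!: pos)
  show "1 / P.coords m1 $ 2 = 1" by (simp add: coords_m1 axis_def)
  show "1 / P.coords m $ 2 > 0" if "m \<in> O'" for m using pos[OF that] by simp
  show "1 / P.coords (dl t) $ 2 = exp (- (1 * (t - s))) * (1 / P.coords (dl s) $ 2)"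
   if "icurve I dl" "dl ` I \<subseteq> O'" "s \<in> I" "t \<in> I" for I dl s t
  proof -
   have e: "1 / (exp a * c) = exp (- a) * (1 / c)" for a c :: real by (simp add: exp_minus inverse_eq_divide)
   have "P.coords (dl t) $ 2 = exp (t - s) * P.coords (dl s) $ 2" using evP[OF that] by simp
   then show ?thesis unfolding mult_1 by (simp only: e)
  qed
  fix m m' assume m: "m \<in> O'" "m' \<in> O'" and e: "Q.coords m $ 2 = Q.coords m' $ 2" "Q.coords m $ 3 = Q.coords m' $ 3"
   and lt: "\<bar>Q.coords m $ 1\<bar> < \<bar>Q.coords m' $ 1\<bar>" and sg: "Q.coords m $ 1 * Q.coords m' $ 1 > 0"
  let ?w = "snd Dq m $ 1" and ?w' = "snd Dq m' $ 1"
  let ?c = "P.cross (snd Dp m)" and ?c' = "P.cross (snd Dp m')"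
  have h: "Q.coords m $ 1 = Q.hat ?w" "Q.coords m' $ 1 = Q.hat ?w'" by (simp_all add: Q.coords_def Q.flow_coords_1)
  have "Q.plane (snd Dq m) = Q.plane (snd Dq m')"
   by (rule Q.flow_coords_plane) (use e in \<open>simp_all add: Q.coords_def\<close>)
  then have "snd Dq m' - snd Dq m = (?w' - ?w) *\<^sub>R axis 1 1"
   using Q.plane_decomp[of "snd Dq m"] Q.plane_decomp[of "snd Dq m'"] by (metis add_diff_cancel_right scaleR_left_diff_distrib)
  then have n: "norm (snd Dq m' - snd Dq m) = \<bar>?w' - ?w\<bar>" by simp
  have "ln \<bar>Q.hat ?w\<bar> + K * \<bar>?w' - ?w\<bar> < ln \<bar>Q.hat ?w'\<bar>"
   by (rule Q.ln_hat_steep) (use lt sg small[OF m(2)] in \<open>simp_all add: h\<close>)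
  then have "ln \<bar>Q.hat ?w\<bar> + (?c' - ?c) < ln \<bar>Q.hat ?w'\<bar>" using lip[OF m] unfolding n by linarith
  then have "ln \<bar>Q.hat ?w\<bar> - ?c < ln \<bar>Q.hat ?w'\<bar> - ?c'" by linarith
  then have "exp (ln \<bar>Q.hat ?w\<bar> - ?c) < exp (ln \<bar>Q.hat ?w'\<bar> - ?c')" by simp
  moreover have "\<bar>Q.hat ?w\<bar> > 0" "\<bar>Q.hat ?w'\<bar> > 0" using sg unfolding h by auto
  ultimately show "\<bar>Q.coords m $ 1\<bar> * (1 / P.coords m $ 2) < \<bar>Q.coords m' $ 1\<bar> * (1 / P.coords m' $ 2)"
   unfolding h ec[OF m(1)] ec[OF m(2)] by (simp add: exp_diff)
 qed (use that in blast)
 have F2m1: "F2 (Q.coords m1) = axis 2 1" using F2W[OF W2(2)] by (simp add: coords_m1 vec3_eq_iff axis_def)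
 obtain Nq Fq Wq where Fq: "flow_embedding Nq Fq" and Wq: "openin M Wq" "m1 \<in> Wq" "Wq \<subseteq> W2" "Q.coords ` Wq \<subseteq> Nq"
  and FqW: "!!m. m \<in> Wq ==> Fq (Q.coords m) = vec3 (F2 (Q.coords m) $ 1) (F2 (Q.coords m) $ 2) (P.coords m $ 1)"
 proof (rule Q.extend_third_at_end[OF W2(1) order_trans[OF W2(3) OQ] W2(4) F2 W2(2) F2m1 coords_m1(2) cP[OF W2(3), of 1]])
  show "P.coords m1 $ 1 = 0" by (simp add: coords_m1 axis_def)
  show "P.coords (dl t) $ 1 = exp (- (1 * (t - s))) * P.coords (dl s) $ 1"
   if "icurve I dl" "dl ` I \<subseteq> W2" "s \<in> I" "t \<in> I" for I dl s t
   using evP[OF that(1) order_trans[OF that(2) W2(3)] that(3,4)] by simp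
  fix m m' assume m: "m \<in> W2" "m' \<in> W2" and e: "F2 (Q.coords m) $ 1 = F2 (Q.coords m') $ 1"
   "F2 (Q.coords m) $ 2 = F2 (Q.coords m') $ 2" "P.coords m $ 1 = P.coords m' $ 1"
  show "m = m'" by (rule inj) (use m W2(3) e F2W[OF m(1)] F2W[OF m(2)] in auto)
 qed (use that in blast)
 show ?thesis
 proof (rule that[OF Fp Fq openin_Int[OF Wp(1) Wq(1)]])
  show "Fq (Q.coords m) = vec3 (Q.coords m $ 1) (1 / P.coords m $ 2) (P.coords m $ 1)" if "m \<in> Wp \<inter> Wq" for m
   using FqW[of m] F2W[of m] that Wq(3) by auto
 qed (use Wp Wq W2 OP OQ pos FpW in auto)
qed

end

section \<open>The model flow\<close>

text \<open>The common model: its orbit on the second axis connects \<open>(0,-1,0)\<close> to \<open>(0,1,0)\<close>.\<close>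

definition model :: "real^3 => real^3" where
 "model v = vec3 (- v $ 1) ((1 - v $ 2 * v $ 2) / 2) (v $ 3)"

lemma model_C1: "Ck_on 1 UNIV model"
proof (rule Ck_on_1I)
 fix x :: "real^3"
 have nth: "((%v :: real^3. v $ i) has_derivative (%h. h $ i)) (at x)" for i
  by (rule bounded_linear_imp_has_derivative[OF bounded_linear_vec_nth])
 have 1: "((%v :: real^3. - v $ 1) has_derivative (%h. - h $ 1)) (at x)" by (rule has_derivative_minus[OF nth])
 have "((%v :: real^3. 1 - v $ 2 * v $ 2) has_derivative (%h. 0 - (x $ 2 * h $ 2 + h $ 2 * x $ 2))) (at x)"
  by (intro has_derivative_diff has_derivative_const has_derivative_mult nth)
 from has_derivative_scaleR_right[OF this, of "1/2"]
 have "((%v :: real^3. (1/2) *\<^sub>R (1 - v $ 2 * v $ 2)) has_derivative (%h. (1/2) *\<^sub>R (0 - (x $ 2 * h $ 2 + h $ 2 * x $ 2)))) (at x)" .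
 moreover have "(%v :: real^3. (1/2) *\<^sub>R (1 - v $ 2 * v $ 2)) = (%v. (1 - v $ 2 * v $ 2) / 2)"
  "(%h :: real^3. (1/2) *\<^sub>R (0 - (x $ 2 * h $ 2 + h $ 2 * x $ 2))) = (%h. - (x $ 2 * h $ 2))"
  by (auto simp: mult.commute)
 ultimately have 2: "((%v :: real^3. (1 - v $ 2 * v $ 2) / 2) has_derivative (%h. - (x $ 2 * h $ 2))) (at x)" by (simp only:)
 show "(model has_derivative (%h. vec3 (- h $ 1) (- (x $ 2 * h $ 2)) (h $ 3))) (at x)"
  unfolding model_def vec3_def by (intro has_derivative_add has_derivative_scaleR_left 1 2 nth)
next
 show "continuous_on UNIV (%x :: real^3. vec3 (- v $ 1) (- (x $ 2 * v $ 2)) (v $ 3))" for v :: "real^3"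
  by (intro continuous_intros)
qed

text \<open>The rescalings of the second coordinate that turn the unit flow near a saddle into the model near one of its
 equilibria; for \<open>\<sigma> = 1\<close> the expanding coordinate is the third one of the model.\<close>

definition shape :: "real => real^3 => real^3" where
 "shape \<sigma> v = (if \<sigma> = 1 then vec3 (v $ 3) ((1 - v $ 2) / (1 + v $ 2)) (v $ 1)
  else vec3 (v $ 1) ((v $ 2 - 1) / (v $ 2 + 1)) (v $ 3))"

lemma shape_inj:
 assumes v: "v $ 2 > - 1" "w $ 2 > - 1" and eq: "shape \<sigma> v = shape \<sigma> w"
 shows "v = w"
proof -
 have nz: "1 + v $ 2 ~= 0" "1 + w $ 2 ~= 0" "v $ 2 + 1 ~= 0" "w $ 2 + 1 ~= 0" using v by auto
 have 2: "v $ 2 = w $ 2"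
 proof (cases "\<sigma> = 1")
  case True
  then have "(1 - v $ 2) / (1 + v $ 2) = (1 - w $ 2) / (1 + w $ 2)" using eq by (simp add: shape_def vec3_eq_iff)
  then have "(1 - v $ 2) * (1 + w $ 2) = (1 - w $ 2) * (1 + v $ 2)" using nz by (simp add: frac_eq_eq)
  then show ?thesis by (simp add: algebra_simps)
 next
  case False
  then have "(v $ 2 - 1) / (v $ 2 + 1) = (w $ 2 - 1) / (w $ 2 + 1)" using eq by (simp add: shape_def vec3_eq_iff)
  then have "(v $ 2 - 1) * (w $ 2 + 1) = (w $ 2 - 1) * (v $ 2 + 1)" using nz by (simp add: frac_eq_eq)
  then show ?thesis by (simp add: algebra_simps)
 qed
 have "v $ 1 = w $ 1 & v $ 3 = w $ 3" using eq by (cases "\<sigma> = 1") (simp_all add: shape_def vec3_eq_iff)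
 then show ?thesis using 2 by (simp add: vec3_eq_iff)
qed

lemma shape_continuous: "continuous_on {v. v $ 2 > - 1} (shape \<sigma>)"
proof (cases "\<sigma> = 1")
 case True
 then have "shape \<sigma> = (%v. vec3 (v $ 3) ((1 - v $ 2) / (1 + v $ 2)) (v $ 1))" by (simp add: shape_def[abs_def])
 then show ?thesis by (simp only:) (intro continuous_intros ballI; auto)
next
 case False
 then have "shape \<sigma> = (%v. vec3 (v $ 1) ((v $ 2 - 1) / (v $ 2 + 1)) (v $ 3))" by (simp add: shape_def[abs_def])
 then show ?thesis by (simp only:) (intro continuous_intros ballI; auto)
qed

lemma shape_flow:
 assumes \<sigma>: "\<sigma> = 1 \<or> \<sigma> = - 1" and v: "v $ 2 > - 1"
 shows "((%t. shape \<sigma> (unit_flow (\<sigma> * (t - s)) v)) has_vector_derivative model (shape \<sigma> v)) (at s within I)"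
proof -
 have nz: "1 + v $ 2 ~= 0" using v by simp
 define y where "y = v $ 2"
 have ny: "1 + y ~= 0" using nz by (simp add: y_def)
 have up: "((%t. exp (t - s) * x) has_real_derivative x) (at s within I)" for x by (auto intro!: derivative_eq_intros)
 have down: "((%t. exp (- (t - s)) * x) has_real_derivative - x) (at s within I)" for x
  by (auto intro!: derivative_eq_intros)
 show ?thesis
 proof (cases "\<sigma> = 1")
  case True
  have q: "((%t. (1 - exp (- (t - s)) * y) / (1 + exp (- (t - s)) * y)) has_real_derivative
    ((0 - (- y)) * (1 + exp (- (s - s)) * y) - (1 - exp (- (s - s)) * y) * (0 + (- y))) / ((1 + exp (- (s - s)) * y) * (1 + exp (- (s - s)) * y))) (at s within I)"
   by (rule DERIV_divide[OF DERIV_diff[OF DERIV_const down] DERIV_add[OF DERIV_const down]]) (use ny in simp)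
  have e: "((0 - (- y)) * (1 + exp (- (s - s)) * y) - (1 - exp (- (s - s)) * y) * (0 + (- y))) / ((1 + exp (- (s - s)) * y) * (1 + exp (- (s - s)) * y))
    = (1 - (1 - y) / (1 + y) * ((1 - y) / (1 + y))) / 2"
   using ny by (simp add: divide_simps) (simp add: algebra_simps)
  show ?thesis using q down[of "v $ 3"] up[of "v $ 1"] True unfolding e
   by (simp add: has_vector_derivative_vec3 forall_3 shape_def model_def y_def)
 next
  case False
  then have \<sigma>1: "\<sigma> = - 1" using \<sigma> by simp
  have q: "((%t. (exp (t - s) * y - 1) / (exp (t - s) * y + 1)) has_real_derivative
    ((y - 0) * (exp (s - s) * y + 1) - (exp (s - s) * y - 1) * (y + 0)) / ((exp (s - s) * y + 1) * (exp (s - s) * y + 1))) (at s within I)"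
   by (rule DERIV_divide[OF DERIV_diff[OF up DERIV_const] DERIV_add[OF up DERIV_const]]) (use ny in \<open>simp add: add.commute\<close>)
  have e: "((y - 0) * (exp (s - s) * y + 1) - (exp (s - s) * y - 1) * (y + 0)) / ((exp (s - s) * y + 1) * (exp (s - s) * y + 1))
    = (1 - (y - 1) / (y + 1) * ((y - 1) / (y + 1))) / 2"
   using ny by (simp add: divide_simps add.commute) (simp add: algebra_simps)
  show ?thesis using q down[of "v $ 1"] up[of "v $ 3"] \<sigma>1 unfolding e
   by (simp add: has_vector_derivative_vec3 forall_3 shape_def model_def y_def)
 qed
qed

section \<open>Conjugacies to the model\<close>

definition conjugates :: "'a topology => 'a chart set => 'a vfield => 'a set => ('a => real^3) => bool" where
 "conjugates M A X U h \<longleftrightarrow> openin M U & continuous_map (subtopology M U) euclidean h & inj_on h U &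
  (\<forall>I \<gamma>. integral_curve M A X U I \<gamma> -->
    (\<forall>t\<in>I. ((h \<circ> \<gamma>) has_vector_derivative model (h (\<gamma> t))) (at t within I)))"

definition locally_conjugates :: "'a topology => 'a chart set => 'a vfield => 'a set => ('a => real^3) => bool" where
 "locally_conjugates M A X U h \<longleftrightarrow>
  (\<forall>x\<in>U. \<exists>V. x \<in> V & V \<subseteq> U & conjugates M A X V h)"

lemma at_within_interval:
 fixes t :: real
 assumes "e > 0"
 shows "at t within (I \<inter> {t - e<..<t + e}) = at t within I"
 by (rule at_within_nhd[of t "{t - e<..<t + e}"]) (use assms in auto)

context vector_field_manifold
begin

lemma integral_curve_iff:
 assumes "openin M U"
 shows "integral_curve M A X U I \<gamma> \<longleftrightarrow> icurve I \<gamma> & \<gamma> ` I \<subseteq> U"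
 using openin_subset[OF assms] by (auto simp: integral_curve_def continuous_map_in_subtopology image_subset_iff Pi_iff)

lemma conjugates_subset:
 assumes h: "conjugates M A X U h" and V: "openin M V" "V \<subseteq> U"
 shows "conjugates M A X V h" unfolding conjugates_def
proof (intro conjI allI impI ballI V(1))
 have U: "openin M U" "continuous_map (subtopology M U) euclidean h" "inj_on h U"
  "!!I \<gamma> t. integral_curve M A X U I \<gamma> ==> t \<in> I ==> ((h \<circ> \<gamma>) has_vector_derivative model (h (\<gamma> t))) (at t within I)"
  using h unfolding conjugates_def by blast+
 show "continuous_map (subtopology M V) euclidean h" by (rule continuous_map_from_subtopology_mono[OF U(2) V(2)])
 show "inj_on h V" by (rule inj_on_subset[OF U(3) V(2)])
 fix I \<gamma> t assume g: "integral_curve M A X V I \<gamma>" and t: "t \<in> I"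
 have "integral_curve M A X U I \<gamma>"
  using g V(2) unfolding integral_curve_iff[OF V(1)] integral_curve_iff[OF U(1)] by blast
 then show "((h \<circ> \<gamma>) has_vector_derivative model (h (\<gamma> t))) (at t within I)" using t by (rule U(4))
qed

lemma conjugates_cong:
 assumes h: "conjugates M A X U h" and eq: "!!x. x \<in> U ==> h' x = h x"
 shows "conjugates M A X U h'" unfolding conjugates_def
proof (intro conjI allI impI ballI)
 have U: "openin M U" "continuous_map (subtopology M U) euclidean h" "inj_on h U"
  "!!I \<gamma> t. integral_curve M A X U I \<gamma> ==> t \<in> I ==> ((h \<circ> \<gamma>) has_vector_derivative model (h (\<gamma> t))) (at t within I)"
  using h unfolding conjugates_def by blast+
 show "openin M U" by (rule U(1))
 show "continuous_map (subtopology M U) euclidean h'" by (rule continuous_map_eq[OF U(2)]) (use eq in simp)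
 show "inj_on h' U" using U(3) eq inj_on_cong by metis
 fix I \<gamma> t assume g: "integral_curve M A X U I \<gamma>" and t: "t \<in> I"
 have gU: "\<gamma> s \<in> U" if "s \<in> I" for s using g that unfolding integral_curve_iff[OF U(1)] by blast
 have "((h' \<circ> \<gamma>) has_vector_derivative model (h (\<gamma> t))) (at t within I)"
  by (rule has_vector_derivative_transform[OF t _ U(4)[OF g t]]) (use eq gU in simp)
 then show "((h' \<circ> \<gamma>) has_vector_derivative model (h' (\<gamma> t))) (at t within I)" using eq[OF gU[OF t]] by simp
qed

text \<open>Curves that a conjugacy maps to solutions of the model are integral curves: by local existence there
 is an integral curve through each point, and solutions of the model are unique.\<close>

lemma conjugates_lift:
 assumes h: "conjugates M A X V h" and I: "is_interval I" and V: "!!t. t \<in> I ==> dl t \<in> V"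
  and sol: "!!t. t \<in> I ==> ((h \<circ> dl) has_vector_derivative model (h (dl t))) (at t within I)"
 shows "integral_curve M A X V I dl"
proof -
 have hV: "openin M V" "continuous_map (subtopology M V) euclidean h" "inj_on h V"
  "!!I \<gamma> t. integral_curve M A X V I \<gamma> ==> t \<in> I ==> ((h \<circ> \<gamma>) has_vector_derivative model (h (\<gamma> t))) (at t within I)"
  using h unfolding conjugates_def by blast+
 have ch: "is_chart M (V, h)" by (rule embedding_chart[OF hV(1-3)])
 have inv: "chart_inv (V, h) (h x) = x" if "x \<in> V" for x using chart_inv_left[OF ch] that by simp
 have "continuous_on I (h \<circ> dl)"
  by (rule has_vector_derivative_continuous_on[of I _ "%t. model (h (dl t))"]) (rule sol)
 then have "continuous_map (top_of_set I) (top_of_set (h ` V)) (h \<circ> dl)" using V by auto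
 from continuous_map_compose[OF this] chart_inv_continuous[OF ch]
 have "continuous_map (top_of_set I) M (chart_inv (V, h) \<circ> (h \<circ> dl))" by simp
 then have cont: "continuous_map (top_of_set I) M dl" by (rule continuous_map_eq) (use inv V in simp)
 have "icurve I dl" unfolding integral_curve_def
 proof (intro conjI ballI impI I)
  show "continuous_map (top_of_set I) (subtopology M (topspace M)) dl" using cont by simp
  fix t0 c assume t0: "t0 \<in> I" and c: "c \<in> A" "dl t0 \<in> fst c"
  obtain d O' \<Phi> where d: "d > 0" and O': "dl t0 \<in> O'" and \<Phi>0: "!!m. m \<in> O' ==> \<Phi> 0 m = m"
   and \<Phi>c: "!!m. m \<in> O' ==> icurve {-d..d} (%t. \<Phi> t m)"
   and \<Phi>V: "!!m t. m \<in> O' ==> t \<in> {-d..d} ==> \<Phi> t m \<in> V"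
   by (rule local_flow[OF hV(1) V[OF t0]]) (rule that; assumption)
  define \<eta> where "\<eta> t = \<Phi> (t + - t0) (dl t0)" for t
  let ?J = "{t0 - d..t0 + d}"
  have \<eta>c: "icurve ?J \<eta>" unfolding \<eta>_def by (rule icurve_shift[OF \<Phi>c[OF O'] is_interval_cc]) auto
  have \<eta>V: "\<eta> t \<in> V" if "t \<in> ?J" for t unfolding \<eta>_def by (rule \<Phi>V[OF O']) (use that in auto)
  have \<eta>0: "\<eta> t0 = dl t0" using \<Phi>0[OF O'] by (simp add: \<eta>_def)
  have \<eta>U: "integral_curve M A X V ?J \<eta>" unfolding integral_curve_iff[OF hV(1)] using \<eta>c \<eta>V by blast
  have same: "dl t = \<eta> t" if t: "t \<in> I" "t \<in> ?J" for t
  proof -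
   let ?K = "{min t t0..max t t0}"
   have "min t t0 \<in> I" "max t t0 \<in> I" using t(1) t0 by (simp_all add: min_def max_def)
   then have KI: "?K \<subseteq> I" using I unfolding is_interval_1 by (meson atLeastAtMost_iff subsetI)
   have KJ: "?K \<subseteq> ?J" using t(2) d by auto
   have "(h \<circ> dl) t = (h \<circ> \<eta>) t"
   proof (rule ode_unique_interval[OF open_UNIV model_C1, where a = "min t t0" and b = "max t t0" and ?t0.0 = t0])
    fix s assume s: "s \<in> ?K"
    show "(h \<circ> dl) s \<in> UNIV & ((h \<circ> dl) has_vector_derivative model ((h \<circ> dl) s)) (at s within ?K)"
     using has_vector_derivative_within_subset[OF sol KI] s KI by auto
    show "(h \<circ> \<eta>) s \<in> UNIV & ((h \<circ> \<eta>) has_vector_derivative model ((h \<circ> \<eta>) s)) (at s within ?K)"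
     using has_vector_derivative_within_subset[OF hV(4)[OF \<eta>U subsetD[OF KJ s]] KJ] by simp
   qed (use \<eta>0 in auto)
   then show ?thesis using inj_onD[OF hV(3)] V[OF t(1)] \<eta>V[OF t(2)] by simp
  qed
  let ?I = "I \<inter> {t0 - d<..<t0 + d}"
  have tI: "t0 \<in> ?I" using t0 d by simp
  have tJ: "t0 \<in> ?J" using d by simp
  have "\<forall>t\<in>?J. \<forall>c\<in>A. \<eta> t \<in> fst c --> ((snd c \<circ> \<eta>) has_vector_derivative X c (\<eta> t)) (at t within ?J)"
   using \<eta>c unfolding integral_curve_def by blast
  from this[rule_format, OF tJ c(1)]
  have "((snd c \<circ> \<eta>) has_vector_derivative X c (\<eta> t0)) (at t0 within ?J)" using c(2) \<eta>0 by simp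
  then have "((snd c \<circ> \<eta>) has_vector_derivative X c (\<eta> t0)) (at t0 within ?I)"
   by (rule has_vector_derivative_within_subset) auto
  then have "((snd c \<circ> dl) has_vector_derivative X c (\<eta> t0)) (at t0 within ?I)"
   by (rule has_vector_derivative_transform[OF tI, rotated]) (use same in auto)
  then show "((snd c \<circ> dl) has_vector_derivative X c (dl t0)) (at t0 within I)"
   unfolding at_within_interval[OF d] \<eta>0 .
 qed
 then show ?thesis unfolding integral_curve_iff[OF hV(1)] using V by blast
qed

text \<open>A local conjugacy that is injective on a compact set is injective on a neighbourhood of it: the pairs
 of points on which injectivity cannot fail form an open subset of the square, which contains the square
 of the compact set.\<close>

lemma locally_conjugates_injective:
 assumes loc: "locally_conjugates M A X U h" and K: "compactin M K" "K \<subseteq> U" and inj: "inj_on h K"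
 obtains V where "conjugates M A X V h" "K \<subseteq> V" "V \<subseteq> U"
proof -
 have U: "openin M U"
 proof (subst openin_subopen, rule ballI)
  fix x assume "x \<in> U"
  then show "\<exists>T. openin M T & x \<in> T & T \<subseteq> U" using loc unfolding locally_conjugates_def conjugates_def by meson
 qed
 have cont: "continuous_map (subtopology M U) euclidean h" unfolding continuous_map_def
 proof (intro conjI allI impI)
  fix T :: "(real^3) set" assume T: "openin euclidean T"
  have "openin M {x \<in> U. h x \<in> T}"
  proof (subst openin_subopen, rule ballI)
   fix x assume x: "x \<in> {x \<in> U. h x \<in> T}"
   then obtain V where V: "x \<in> V" "V \<subseteq> U" "conjugates M A X V h" using loc unfolding locally_conjugates_def by blast
   then have "openin M V" "continuous_map (subtopology M V) euclidean h" unfolding conjugates_def by blast+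
   from chart_preimage_open[OF this, of T] T have "openin M {x \<in> V. h x \<in> T}" by simp
   then show "\<exists>S. openin M S & x \<in> S & S \<subseteq> {x \<in> U. h x \<in> T}" using x V by (intro exI[of _ "{x \<in> V. h x \<in> T}"]) auto
  qed
  moreover have "{x \<in> topspace (subtopology M U). h x \<in> T} = {x \<in> U. h x \<in> T}" using openin_subset[OF U] by auto
  ultimately show "openin (subtopology M U) {x \<in> topspace (subtopology M U). h x \<in> T}"
   using openin_open_subtopology[OF U] by auto
 qed auto
 let ?P = "prod_topology M M"
 let ?W = "{z \<in> U \<times> U. fst z = snd z \<or> h (fst z) ~= h (snd z)}"
 define C where "C = \<Union>{S. openin ?P S & S \<subseteq> ?W}"
 have Co: "openin ?P C" unfolding C_def by (rule openin_Union) blast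
 have KC: "K \<times> K \<subseteq> C"
 proof (rule subsetI)
  fix z assume "z \<in> K \<times> K"
  then obtain x y where z: "z = (x, y)" and xy: "x \<in> K" "y \<in> K" by blast
  show "z \<in> C"
  proof (cases "x = y")
   case True
   obtain V where V: "x \<in> V" "V \<subseteq> U" "conjugates M A X V h"
    using loc xy(1) K(2) unfolding locally_conjugates_def by blast
   have Vo: "openin M V" and Vi: "inj_on h V" using V(3) unfolding conjugates_def by blast+
   have "openin ?P (V \<times> V)" using Vo by (simp add: openin_prod_Times_iff)
   moreover have "V \<times> V \<subseteq> ?W" using V(2) inj_onD[OF Vi] by auto
   ultimately show ?thesis unfolding C_def using z True V(1) by blast
  next
   case False
   then have "h x ~= h y" using inj_onD[OF inj _ xy] by blast
   from hausdorff[OF this] obtain S T where ST: "open S" "open T" "h x \<in> S" "h y \<in> T" "S \<inter> T = {}" by blast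
   let ?S = "{x \<in> U. h x \<in> S}" and ?T = "{x \<in> U. h x \<in> T}"
   have "openin M ?S" "openin M ?T" by (rule chart_preimage_open[OF U cont ST(1)], rule chart_preimage_open[OF U cont ST(2)])
   then have "openin ?P (?S \<times> ?T)" by (simp add: openin_prod_Times_iff)
   moreover have "?S \<times> ?T \<subseteq> ?W" using ST(5) by auto
   moreover have "z \<in> ?S \<times> ?T" using z xy ST(3,4) K(2) by auto
   ultimately show ?thesis unfolding C_def by blast
  qed
 qed
 obtain S T where ST: "openin M S" "openin M T" "K \<subseteq> S" "K \<subseteq> T" "S \<times> T \<subseteq> C"
  using Wallace_theorem_prod_topology[OF K(1) K(1) Co KC] by blast
 have CW: "C \<subseteq> ?W" unfolding C_def by blast
 let ?V = "S \<inter> T \<inter> U"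
 have Vo: "openin M ?V" using ST(1,2) U by (intro openin_Int)
 have Vi: "inj_on h ?V"
 proof (rule inj_onI)
  fix x y assume "x \<in> ?V" "y \<in> ?V" "h x = h y"
  then show "x = y" using ST(5) CW by (auto dest!: subsetD[of "S \<times> T" C "(x, y)"])
 qed
 have "conjugates M A X ?V h" unfolding conjugates_def
 proof (intro conjI allI impI ballI Vo Vi)
  show "continuous_map (subtopology M ?V) euclidean h" by (rule continuous_map_from_subtopology_mono[OF cont]) blast
  fix I \<gamma> t assume g: "integral_curve M A X ?V I \<gamma>" and t: "t \<in> I"
  have gi: "icurve I \<gamma>" "\<gamma> ` I \<subseteq> ?V" using g unfolding integral_curve_iff[OF Vo] by blast+
  then have "\<gamma> t \<in> U" using t by blast
  then obtain V where V: "\<gamma> t \<in> V" "conjugates M A X V h" using loc unfolding locally_conjugates_def by blast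
  have Vo': "openin M V" using V(2) unfolding conjugates_def by blast
  obtain e where e: "e > 0" "!!s. s \<in> I ==> \<bar>s - t\<bar> < e ==> \<gamma> s \<in> V"
   by (rule icurve_near[OF gi(1) Vo' t V(1)]) (rule that)
  let ?I = "I \<inter> {t - e<..<t + e}"
  have "is_interval ?I" using gi(1) by (intro is_interval_Int) (auto simp: integral_curve_def is_interval_oo)
  then have "icurve ?I \<gamma>" by (rule icurve_subset[OF gi(1)]) blast
  moreover have "\<gamma> ` ?I \<subseteq> V"
  proof (rule image_subsetI)
   fix s assume "s \<in> ?I"
   then show "\<gamma> s \<in> V" by (intro e(2)) auto
  qed
  ultimately have "integral_curve M A X V ?I \<gamma>" unfolding integral_curve_iff[OF Vo'] by blast
  moreover have "t \<in> ?I" using t e(1) by simp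
  ultimately have "((h \<circ> \<gamma>) has_vector_derivative model (h (\<gamma> t))) (at t within ?I)"
   using V(2) unfolding conjugates_def by blast
  then show "((h \<circ> \<gamma>) has_vector_derivative model (h (\<gamma> t))) (at t within I)"
   unfolding at_within_interval[OF e(1)] .
 qed
 then show ?thesis by (rule that) (use ST K(2) in auto)
qed

text \<open>Away from \<open>W\<close> the two compact sets are disjoint and have disjoint neighbourhoods; on \<open>W\<close> both maps agree.\<close>

lemma glue_conjugacies:
 assumes p: "conjugates M A X Up hp" and q: "conjugates M A X Uq hq"
  and W: "openin M W" "W \<subseteq> Up" "W \<subseteq> Uq" and eq: "!!x. x \<in> W ==> hp x = hq x"
  and Kp: "compactin M Kp" "Kp \<subseteq> Up" and Kq: "compactin M Kq" "Kq \<subseteq> Uq" and K: "Kp \<inter> Kq \<subseteq> W"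
 obtains U h where "locally_conjugates M A X U h" "Kp \<union> Kq \<subseteq> U"
  "!!x. x \<in> Kp ==> h x = hp x" "!!x. x \<in> Kq ==> h x = hq x"
proof -
 have cl: "closedin M (topspace M - W)" using W(1) by blast
 have sub: "Kp \<subseteq> topspace M" "Kq \<subseteq> topspace M" using Kp(1) Kq(1) compactin_subset_topspace by blast+
 have cp: "compactin M (Kp \<inter> (topspace M - W))" "compactin M (Kq \<inter> (topspace M - W))"
  by (rule compact_Int_closedin[OF Kp(1) cl], rule compact_Int_closedin[OF Kq(1) cl])
 have dj: "disjnt (Kp \<inter> (topspace M - W)) (Kq \<inter> (topspace M - W))" using K by (auto simp: disjnt_def)
 obtain S T where ST: "openin M S" "openin M T" "Kp \<inter> (topspace M - W) \<subseteq> S" "Kq \<inter> (topspace M - W) \<subseteq> T" "disjnt S T"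
  using Hausdorff_space_compact_separation[OF Hausdorff cp dj] by blast
 define Vp where "Vp = S \<inter> Up \<union> W"
 define Vq where "Vq = T \<inter> Uq \<union> W"
 define h where "h x = (if x \<in> Vp then hp x else hq x)" for x
 have Uo: "openin M Up" "openin M Uq" using p q unfolding conjugates_def by blast+
 have Vo: "openin M Vp" "openin M Vq" unfolding Vp_def Vq_def by (intro openin_Un openin_Int ST Uo W)+
 have Vs: "Vp \<subseteq> Up" "Vq \<subseteq> Uq" using W by (auto simp: Vp_def Vq_def)
 have hQ: "h x = hq x" if "x \<in> Vq" for x using that ST(5) eq[of x] by (auto simp: h_def Vp_def Vq_def disjnt_def)
 have hP: "h x = hp x" if "x \<in> Vp" for x using that by (simp add: h_def)
 have KV: "Kp \<subseteq> Vp" "Kq \<subseteq> Vq" using ST(3,4) Kp(2) Kq(2) sub by (auto simp: Vp_def Vq_def)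
 have c: "conjugates M A X Vp h" by (rule conjugates_cong[OF conjugates_subset[OF p Vo(1) Vs(1)]]) (rule hP)
 have c': "conjugates M A X Vq h" by (rule conjugates_cong[OF conjugates_subset[OF q Vo(2) Vs(2)]]) (rule hQ)
 have "locally_conjugates M A X (Vp \<union> Vq) h" unfolding locally_conjugates_def using c c' by blast
 then show ?thesis by (rule that) (use KV hP hQ in blast)+
qed

end

context saddle_end
begin

text \<open>The condition on the second coordinate keeps \<open>shape\<close> away from its pole.\<close>

definition end_region :: "(real^3) set => (real^3 => real^3) => 'a set" where
 "end_region N F = {m \<in> fst D. coords m \<in> N \<inter> F -` {v. v $ 2 > - 1}}"

definition end_map :: "(real^3 => real^3) => 'a => real^3" where
 "end_map F m = shape \<sigma> (F (coords m))"

lemma end_conjugacy: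
 assumes F: "flow_embedding N F"
 shows "conjugates M A X (end_region N F) (end_map F)" "p \<in> end_region N F" "end_map F p = vec3 0 \<sigma> 0"
proof -
 let ?H = "{v :: real^3. v $ 2 > - 1}" and ?U = "end_region N F"
 have f: "open N" "continuous_on N F" "inj_on F N" "!!v t. F (unit_flow t v) = unit_flow t (F v)" "0 \<in> N" "F 0 = 0"
  using F by (auto simp: flow_embedding_def)
 have Ho: "open ?H" by (intro open_Collect_less continuous_intros)
 have No: "open (N \<inter> F -` ?H)" by (rule continuous_open_preimage[OF f(2) f(1) Ho])
 have Uo: "openin M ?U" unfolding end_region_def by (rule chart_preimage_open[OF is_chartD(1)[OF Dc] coords_continuous No])
 have UD: "m \<in> fst D" "coords m \<in> N" "F (coords m) $ 2 > - 1" if "m \<in> ?U" for m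
  using that by (auto simp: end_region_def)
 show pU: "p \<in> ?U" using p f(5,6) by (simp add: end_region_def coords_p)
 show "end_map F p = vec3 0 \<sigma> 0" using sign by (auto simp: end_map_def coords_p f(6) shape_def vec3_eq_iff)
 have cc: "continuous_map (subtopology M ?U) (top_of_set (N \<inter> F -` ?H)) coords"
 proof (rule continuous_map_into_subtopology)
  show "continuous_map (subtopology M ?U) euclidean coords"
   by (rule continuous_map_from_subtopology_mono[OF coords_continuous]) (use UD(1) in blast)
  show "coords \<in> topspace (subtopology M ?U) \<rightarrow> N \<inter> F -` ?H" by (auto simp: end_region_def)
 qed
 have "continuous_on (N \<inter> F -` ?H) (%v. shape \<sigma> (F v))"
  by (rule continuous_on_compose2[OF shape_continuous continuous_on_subset[OF f(2)]]) auto
 then have "continuous_map (top_of_set (N \<inter> F -` ?H)) euclidean (%v. shape \<sigma> (F v))" by simp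
 from continuous_map_compose[OF cc this]
 have hc: "continuous_map (subtopology M ?U) euclidean (end_map F)" by (simp add: o_def end_map_def[abs_def])
 have hi: "inj_on (end_map F) ?U"
 proof (rule inj_onI)
  fix m m' assume m: "m \<in> ?U" "m' \<in> ?U" "end_map F m = end_map F m'"
  have "F (coords m) = F (coords m')"
   by (rule shape_inj[OF UD(3)[OF m(1)] UD(3)[OF m(2)]]) (use m(3) in \<open>simp add: end_map_def\<close>)
  from inj_onD[OF f(3) this UD(2)[OF m(1)] UD(2)[OF m(2)]]
  show "m = m'" by (rule coords_inj[OF UD(1)[OF m(1)] UD(1)[OF m(2)]])
 qed
 show "conjugates M A X ?U (end_map F)" unfolding conjugates_def
 proof (intro conjI allI impI ballI Uo hc hi)
  fix I \<gamma> t assume g: "integral_curve M A X ?U I \<gamma>" and t: "t \<in> I"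
  have gi: "icurve I \<gamma>" and gU: "!!s. s \<in> I ==> \<gamma> s \<in> ?U" using g unfolding integral_curve_iff[OF Uo] by blast+
  let ?v = "F (coords (\<gamma> t))"
  have ev: "(end_map F \<circ> \<gamma>) s = shape \<sigma> (unit_flow (\<sigma> * (s - t)) ?v)" if s: "s \<in> I" for s
  proof -
   have "coords (\<gamma> s) = unit_flow (\<sigma> * (s - t)) (coords (\<gamma> t))"
    by (rule coords_evolve[OF gi _ t s]) (use gU UD(1) in blast)
   then show ?thesis by (simp add: end_map_def f(4))
  qed
  have "((end_map F \<circ> \<gamma>) has_vector_derivative model (shape \<sigma> ?v)) (at t within I)"
   by (rule has_vector_derivative_transform[OF t ev shape_flow[OF sign UD(3)[OF gU[OF t]]]])
  then show "((end_map F \<circ> \<gamma>) has_vector_derivative model (end_map F (\<gamma> t))) (at t within I)"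
   by (simp add: end_map_def)
 qed
qed

lemma end_orbit:
 assumes F: "flow_embedding N F" "F (axis 2 1) = axis 2 1"
  and g: "icurve I \<gamma>" "!!s. s \<in> I ==> \<gamma> s \<in> fst D" and 0: "0 \<in> I" "coords (\<gamma> 0) = axis 2 1" and t: "t \<in> I"
 shows "\<gamma> t \<in> end_region N F" "end_map F (\<gamma> t) = vec3 0 ((exp t - 1) / (exp t + 1)) 0"
  "coords (\<gamma> t) = vec3 0 (exp (- (\<sigma> * t))) 0"
proof -
 have f: "!!v t. v \<in> N ==> unit_flow t v \<in> N" "!!v t. F (unit_flow t v) = unit_flow t (F v)" "axis 2 1 \<in> N"
  using F(1) by (auto simp: flow_embedding_def)
 have ct: "coords (\<gamma> t) = unit_flow (\<sigma> * t) (axis 2 1)" using coords_evolve[OF g 0(1) t] 0(2) by simp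
 have Ft: "F (coords (\<gamma> t)) = vec3 0 (exp (- (\<sigma> * t))) 0"
  unfolding ct f(2) F(2) by (simp add: vec3_eq_iff axis_def)
 show "coords (\<gamma> t) = vec3 0 (exp (- (\<sigma> * t))) 0" unfolding ct by (simp add: vec3_eq_iff axis_def)
 have "- 1 < exp (- (\<sigma> * t))" using exp_gt_zero[of "- (\<sigma> * t)"] by linarith
 then show "\<gamma> t \<in> end_region N F" using g(2)[OF t] f(1)[OF f(3), of "\<sigma> * t"] Ft by (simp add: end_region_def ct[symmetric])
 show "end_map F (\<gamma> t) = vec3 0 ((exp t - 1) / (exp t + 1)) 0"
 proof (cases "\<sigma> = 1")
  case True
  have "exp t * (1 - exp (- t)) = exp t - 1" "exp t * (1 + exp (- t)) = exp t + 1"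
   by (simp_all add: algebra_simps flip: exp_add)
  then have "(1 - exp (- t)) / (1 + exp (- t)) = (exp t - 1) / (exp t + 1)"
   by (metis exp_not_eq_zero mult_divide_mult_cancel_left)
  then show ?thesis unfolding end_map_def Ft using True by (simp add: shape_def)
 next
  case False
  then show ?thesis unfolding end_map_def Ft using sign by (simp add: shape_def)
 qed
qed

text \<open>In the flow coordinates half of a connection, with the saddle, is a segment.\<close>

lemma end_compact:
 assumes g: "icurve I \<gamma>" "!!s. s \<in> I ==> \<gamma> s \<in> fst D" and I: "I = {t. 0 <= \<sigma> * t}" and 0: "coords (\<gamma> 0) = axis 2 1"
 shows "compactin M (insert p (\<gamma> ` I))"
proof -
 have 0: "0 \<in> I" "coords (\<gamma> 0) = axis 2 1" using I 0 by auto
 have ct: "coords (\<gamma> t) = vec3 0 (exp (- (\<sigma> * t))) 0" if "t \<in> I" for t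
  by (rule end_orbit(3)[OF flow_embedding_id refl g 0 that])
 have "inj_on coords (fst D)" by (rule inj_onI) (rule coords_inj)
 then have ch: "is_chart M (fst D, coords)" by (rule embedding_chart[OF is_chartD(1)[OF Dc] coords_continuous])
 let ?S = "(%y. vec3 0 y 0) ` {0..1::real}" and ?k = "chart_inv (fst D, coords)"
 have inv: "?k (coords m) = m" if "m \<in> fst D" for m using chart_inv_left[OF ch] that by simp
 have cover: "vec3 0 y 0 \<in> coords ` insert p (\<gamma> ` I)" if y: "0 <= y" "y <= 1" for y
 proof (cases "y = 0")
  case True
  then have "coords p = vec3 0 y 0" by (simp add: coords_p vec3_eq_iff)
  then show ?thesis by (metis imageI insertI1)
 next
  case False
  let ?t = "\<sigma> * (- ln y)"
  have tI: "?t \<in> I" unfolding I using y False by simp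
  have "coords (\<gamma> ?t) = vec3 0 y 0" unfolding ct[OF tI] using y False by simp
  then show ?thesis using tI by (metis imageI insertI2)
 qed
 have sub: "coords m \<in> ?S" "m \<in> fst D" if mK: "m \<in> insert p (\<gamma> ` I)" for m
 proof -
  show "m \<in> fst D" using mK p g(2) by auto
  consider "m = p" | t where "t \<in> I" "m = \<gamma> t" using mK by blast
  then show "coords m \<in> ?S"
  proof cases
   case 1
   then have "coords m = vec3 0 0 0" by (simp add: coords_p vec3_eq_iff)
   then show ?thesis by auto
  next
   case 2
   have "exp (- (\<sigma> * t)) \<in> {0..1}" using 2(1) unfolding I by simp
   then show ?thesis unfolding 2(2) ct[OF 2(1)] by blast
  qed
 qed
 have K: "insert p (\<gamma> ` I) = ?k ` ?S"
 proof
  show "insert p (\<gamma> ` I) \<subseteq> ?k ` ?S"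
  proof
   fix m assume m: "m \<in> insert p (\<gamma> ` I)"
   show "m \<in> ?k ` ?S" using inv[OF sub(2)[OF m]] sub(1)[OF m] by (metis imageI)
  qed
  show "?k ` ?S \<subseteq> insert p (\<gamma> ` I)"
  proof (rule image_subsetI)
   fix v assume "v \<in> ?S"
   then obtain y where y: "0 <= y" "y <= 1" "v = vec3 0 y 0" by auto
   obtain m where m: "m \<in> insert p (\<gamma> ` I)" "v = coords m"
    using cover[OF y(1,2)] unfolding y(3)[symmetric] by blast
   show "?k v \<in> insert p (\<gamma> ` I)" unfolding m(2) inv[OF sub(2)[OF m(1)]] by (rule m(1))
  qed
 qed
 have "compact ?S" by (intro compact_continuous_image compact_Icc continuous_intros)
 moreover have "?S \<subseteq> coords ` fst D" using cover sub(2) by force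
 ultimately have "compactin (top_of_set (coords ` fst D)) ?S" by (simp add: compactin_subtopology)
 moreover have "continuous_map (top_of_set (coords ` fst D)) M ?k" using chart_inv_continuous[OF ch] by simp
 ultimately show ?thesis unfolding K by (rule image_compactin)
qed

end

text \<open>At \<open>(0,1,0)\<close> the linear field points into the unit circle, so circle and field span the plane.\<close>

lemma axis_field_direction:
 assumes "saddle_form L \<mu> \<alpha>"
 shows "L (axis 2 1) $ 1 = 0" "L (axis 2 1) $ 2 < 0"
proof -
 interpret saddle_form L \<mu> \<alpha> by (rule assms)
 show "L (axis 2 1) $ 1 = 0" unfolding L1 by (simp add: axis_def)
 have "axis 2 1 \<bullet> L (axis 2 1) <= - \<alpha> * (axis 2 1 \<bullet> (axis 2 1 :: real^3))" by (rule Lplane) (simp add: axis_def)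
 then show "L (axis 2 1) $ 2 < 0" using \<alpha> by (simp add: inner_axis' inner_axis_axis)
qed

context vector_field_manifold
begin

text \<open>A curve that returned would be periodic; it could converge only if it were constant.\<close>

lemma no_return:
 assumes g: "icurve UNIV \<gamma>" and lim: "limitin M \<gamma> q at_top" and q: "q \<notin> range \<gamma>" and st: "s < t"
 shows "\<gamma> s ~= \<gamma> t"
proof
 assume eq: "\<gamma> s = \<gamma> t"
 have per: "\<gamma> (r + (t - s)) = \<gamma> r" for r
 proof -
  have "icurve UNIV (%r. \<gamma> (r + (t - s)))" by (rule icurve_shift[OF g is_interval_univ]) simp
  then show ?thesis by (rule icurve_unique[OF _ g, where ?t0.0 = s]) (use eq in auto)
 qed
 have mult: "\<gamma> (s + real n * (t - s)) = \<gamma> s" for n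
 proof (induction n)
  case (Suc n)
  have "s + real (Suc n) * (t - s) = (s + real n * (t - s)) + (t - s)" by (simp add: algebra_simps)
  then show ?case using per[of "s + real n * (t - s)"] Suc by simp
 qed simp
 have qt: "q \<in> topspace M" "\<gamma> s \<in> topspace M" using lim icurve_in_space[OF g] by (auto simp: limitin_def)
 have "q ~= \<gamma> s" using q by blast
 then obtain U V where UV: "openin M U" "openin M V" "q \<in> U" "\<gamma> s \<in> V" "disjnt U V"
  using Hausdorff qt unfolding Hausdorff_space_def by meson
 then obtain T where T: "!!r. T <= r ==> \<gamma> r \<in> U" using lim unfolding limitin_def eventually_at_top_linorder by meson
 obtain n :: nat where "(T - s) / (t - s) <= real n" using real_arch_simple by blast
 then have "T <= s + real n * (t - s)" using st by (simp add: pos_divide_le_eq)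
 from T[OF this] have "\<gamma> s \<in> U" by (simp only: mult)
 then show False using UV by (auto simp: disjnt_def)
qed

text \<open>Transversality at \<open>m1\<close> provides the hypothesis of \<open>matched_ends\<close>: the derivative of the expanding coordinate
 \<open>w\<close> at \<open>q\<close> vanishes in the direction of the field, so if it vanished along the circle
 as well, it would be proportional to that of the expanding coordinate at \<open>p\<close> and the two tangent planes would coincide.\<close>

theorem generic_connection_conjugacy:
 assumes gen: "generic_12_connection M A X \<Gamma>"
 obtains U h where "conjugates M A X U h" "\<Gamma> \<subseteq> U" "h ` \<Gamma> = (%y. vec3 0 y 0) ` {- 1..1}"
proof -
 obtain p q where con: "connection M A X p q \<Gamma>" and dims: "stable_dim M A X p 1" "stable_dim M A X q 2"
  and tr: "transverse_along M A X p q \<Gamma>"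
  using gen unfolding generic_12_connection_def by blast
 obtain \<gamma> where hyp: "hyperbolic_saddle M A X p" "hyperbolic_saddle M A X q"
  and linz: "C1_linearizable M A X p" "C1_linearizable M A X q"
  and g: "icurve UNIV \<gamma>" and lim: "limitin M \<gamma> p at_bot" "limitin M \<gamma> q at_top"
  and out: "p \<notin> range \<gamma>" "q \<notin> range \<gamma>" and \<Gamma>: "\<Gamma> = M closure_of (range \<gamma>)"
  using con unfolding connection_def by blast
 interpret R: vector_field_manifold M A "reverse_field X" by (rule reverse_manifold)
 define m1 where "m1 = \<gamma> 0"
 \<comment> \<open>the chart at \<open>q\<close>\<close>
 obtain d0 L0 \<mu>q \<alpha>q where q0: "field_in d0 L0" "linear L0" "q \<in> fst d0" "snd d0 q = 0"
  "saddle_form L0 \<mu>q \<alpha>q \<or> saddle_form (%v. - L0 v) \<mu>q \<alpha>q"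
  by (rule saddle_chart[OF hyp(2) linz(2)])
 have q0s: "saddle_form L0 \<mu>q \<alpha>q" using q0(5) stable_axis_dim[OF q0(1-4) _ dims(2)] by blast
 have gq: "icurve {0..} \<gamma>" by (rule icurve_subset[OF g is_interval_ci]) simp
 have nq: "q \<notin> \<gamma> ` {0..}" using out by blast
 obtain Dq Lq where Dq: "field_in Dq Lq" "saddle_form Lq \<mu>q \<alpha>q" "q \<in> fst Dq" "snd Dq q = 0"
  and gDq: "!!t. 0 <= t ==> \<gamma> t \<in> fst Dq" and Dqm: "snd Dq (\<gamma> 0) = axis 2 1"
  and tq: "!!c V. c \<in> A ==> \<gamma> 0 \<in> fst c ==> stable_tangent M A X q (\<gamma> 0) c V ==> V = {v. dtrans c Dq (\<gamma> 0) v $ 1 = 0}"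
  by (rule sink_side[OF q0(1,3,4) q0s gq lim(2) nq]) (rule that; assumption)
 \<comment> \<open>the chart at \<open>p\<close>, in reversed time\<close>
 obtain d1 L1 \<mu>p \<alpha>p where p0: "field_in d1 L1" "linear L1" "p \<in> fst d1" "snd d1 p = 0"
  "saddle_form L1 \<mu>p \<alpha>p \<or> saddle_form (%v. - L1 v) \<mu>p \<alpha>p"
  by (rule saddle_chart[OF hyp(1) linz(1)])
 have p0s: "saddle_form (%v. - L1 v) \<mu>p \<alpha>p" using p0(5) stable_plane_dim[OF p0(1,3,4)] dims(1) by blast
 have p0f: "R.field_in d1 (%v. - L1 v)" unfolding reverse_field_in using p0(1) by simp
 define \<beta> where "\<beta> t = \<gamma> (- t)" for t
 have gp: "R.icurve {0..} \<beta>" unfolding \<beta>_def[abs_def] by (rule icurve_reverse[OF g is_interval_ci]) simp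
 have limp: "limitin M \<beta> p at_top"
  using lim(1) unfolding limitin_def \<beta>_def[abs_def] at_bot_mirror eventually_filtermap by blast
 have np: "p \<notin> \<beta> ` {0..}" using out unfolding \<beta>_def by blast
 obtain Dp Lp where Dp: "R.field_in Dp Lp" "saddle_form Lp \<mu>p \<alpha>p" "p \<in> fst Dp" "snd Dp p = 0"
  and bDp: "!!t. 0 <= t ==> \<beta> t \<in> fst Dp" and bDpm: "snd Dp (\<beta> 0) = axis 2 1"
  and tp': "!!c V. c \<in> A ==> \<beta> 0 \<in> fst c ==> unstable_tangent M A X p (\<beta> 0) c V ==> V = {v. dtrans c Dp (\<beta> 0) v $ 1 = 0}"
  by (rule R.sink_side[OF p0f p0(3,4) p0s gp limp np]) (rule that; assumption)
 have \<beta>0: "\<beta> 0 = m1" by (simp add: \<beta>_def m1_def)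
 have Dpf: "field_in Dp (%v. - 1 *\<^sub>R Lp v)" using Dp(1) unfolding reverse_field_in by simp
 have gDp: "\<gamma> t \<in> fst Dp" if "t <= 0" for t using bDp[of "- t"] that by (simp add: \<beta>_def)
 note tp = tp'[unfolded \<beta>0]
 have m1p: "m1 \<in> fst Dp" "snd Dp m1 = axis 2 1" and m1q: "m1 \<in> fst Dq" "snd Dq m1 = axis 2 1"
  using gDp[of 0] gDq[of 0] bDpm Dqm by (auto simp: m1_def \<beta>0[unfolded m1_def])
 have pq: "p ~= q" using stable_plane_dim[OF q0(1,3,4) q0s] dims(1) by blast
 interpret P: saddle_end M A X Lp \<mu>p \<alpha>p "- 1" Dp p
  by (intro saddle_end.intro saddle_end_axioms.intro vector_field_manifold_axioms Dp Dpf) simp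
 interpret Q: saddle_end M A X Lq \<mu>q \<alpha>q 1 Dq q
  by (intro saddle_end.intro saddle_end_axioms.intro vector_field_manifold_axioms Dq) (simp_all add: Dq)
 \<comment> \<open>transversality at \<open>m1\<close>\<close>
 have m1t: "m1 \<in> topspace M" unfolding m1_def by (rule icurve_in_space[OF g]) simp
 then obtain c where c: "c \<in> A" "m1 \<in> fst c" using atlas_covers by blast
 note c1 = atlas_C1chart[OF c(1)]
 have "m1 \<in> \<Gamma>"
 proof -
  have "range \<gamma> \<subseteq> topspace M" using icurve_in_space[OF g] by blast
  from closure_of_subset[OF this] show ?thesis unfolding \<Gamma> m1_def by blast
 qed
 moreover have "m1 \<in> stable_set M A X q" unfolding stable_set_def using gq lim(2) by (auto simp: m1_def)
 moreover have "m1 \<in> unstable_set M A X p" unfolding stable_set_def using gp limp \<beta>0 by blast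
 ultimately obtain V W where VW: "unstable_tangent M A X p m1 c V" "stable_tangent M A X q m1 c W"
  "{v + w |v w. v \<in> V & w \<in> W} = UNIV"
  using tr c unfolding transverse_along_def by (meson IntI)
 have V: "V = {v. dtrans c Dp m1 v $ 1 = 0}" by (rule tp[OF c VW(1)])
 have W: "W = {v. dtrans c Dq m1 v $ 1 = 0}" using tq[OF c(1)] c(2) VW(2) by (simp add: m1_def)
 let ?T = "dtrans Dp Dq m1"
 have T: "linear ?T" by (rule dtrans_linear[OF P.D1 Q.D1 m1p(1) m1q(1)])
 have chain: "?T (dtrans c Dp m1 v) = dtrans c Dq m1 v" for v by (rule dtrans_chain[OF c1 c(2) P.D1 m1p(1) Q.D1 m1q(1)])
 have indep: "?T (axis 3 1) $ 1 ~= 0"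
 proof
  assume T3: "?T (axis 3 1) $ 1 = 0"
  let ?l = "Lp (axis 2 1)"
  note lp = axis_field_direction[OF Dp(2)] and lq = axis_field_direction[OF Dq(2)]
  have "dtrans c Dp m1 (X c m1) = - ?l" using Dpf c m1p unfolding field_in_def by auto
  moreover have "dtrans c Dq m1 (X c m1) = Lq (axis 2 1)" using Dq(1) c m1q unfolding field_in_def by auto
  ultimately have "?T (- ?l) = Lq (axis 2 1)" using chain[of "X c m1"] by simp
  then have "?T ?l $ 1 = 0" using lq(1) linear_neg[OF T, of ?l] by (metis minus_equation_iff vector_uminus_component neg_equal_0_iff_equal)
  moreover have "?l = (?l $ 2) *\<^sub>R axis 2 1 + (?l $ 3) *\<^sub>R axis 3 1" using lp(1) by (simp add: vec3_eq_iff axis_def)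
  then have "?T ?l = (?l $ 2) *\<^sub>R ?T (axis 2 1) + (?l $ 3) *\<^sub>R ?T (axis 3 1)"
   by (metis linear_add[OF T] linear_scale[OF T])
  ultimately have T2: "?T (axis 2 1) $ 1 = 0" using T3 lp(2) by simp
  have plane0: "?T y $ 1 = 0" if "y $ 1 = 0" for y
  proof -
   have "y = (y $ 2) *\<^sub>R axis 2 1 + (y $ 3) *\<^sub>R axis 3 1" using that by (simp add: vec3_eq_iff axis_def)
   then have "?T y = (y $ 2) *\<^sub>R ?T (axis 2 1) + (y $ 3) *\<^sub>R ?T (axis 3 1)"
    by (metis linear_add[OF T] linear_scale[OF T])
   then show ?thesis using T2 T3 by simp
  qed
  have lc: "linear (dtrans c Dq m1)" by (rule dtrans_linear[OF c1 Q.D1 c(2) m1q(1)])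
  let ?e = "dtrans Dq c m1 (axis 1 1)"
  obtain v w where vw: "v \<in> V" "w \<in> W" "?e = v + w" using VW(3) by blast
  have "dtrans c Dq m1 v $ 1 = 0" using plane0[of "dtrans c Dp m1 v"] vw(1) unfolding V chain by simp
  then have "dtrans c Dq m1 ?e $ 1 = 0" using vw(2) unfolding vw(3) W by (simp add: linear_add[OF lc])
  then show False unfolding dtrans_inverse[OF Q.D1 m1q(1) c1 c(2)] by (simp add: axis_def)
 qed
 interpret matched_ends M A X Lp \<mu>p \<alpha>p Dp p Lq \<mu>q \<alpha>q Dq q m1
  by (intro matched_ends.intro matched_ends_axioms.intro vector_field_manifold_axioms
    P.saddle_end_axioms Q.saddle_end_axioms m1p m1q indep)
 obtain Np Fp Nq Fq W where Fp: "flow_embedding Np Fp" and Fq: "flow_embedding Nq Fq" and Wo: "openin M W" "m1 \<in> W"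
  and WD: "W \<subseteq> fst Dp" "W \<subseteq> fst Dq" "P.coords ` W \<subseteq> Np" "Q.coords ` W \<subseteq> Nq"
  and pos: "!!m. m \<in> W ==> P.coords m $ 2 > 0"
  and FpW: "!!m. m \<in> W ==> Fp (P.coords m) = vec3 (P.coords m $ 1) (P.coords m $ 2) (Q.coords m $ 1)"
  and FqW: "!!m. m \<in> W ==> Fq (Q.coords m) = vec3 (Q.coords m $ 1) (1 / P.coords m $ 2) (P.coords m $ 1)"
  by (rule matched_embeddings) (rule that; assumption)
 have Fa: "Fp (axis 2 1) = axis 2 1" "Fq (axis 2 1) = axis 2 1"
  using FpW[OF Wo(2)] FqW[OF Wo(2)] coords_m1 by (simp_all add: vec3_eq_iff axis_def)
 let ?Up = "P.end_region Np Fp" and ?Uq = "Q.end_region Nq Fq"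
 have WU: "W \<subseteq> ?Up" "W \<subseteq> ?Uq"
 proof -
  show "W \<subseteq> ?Up"
  proof
   fix m assume m: "m \<in> W"
   have "Fp (P.coords m) $ 2 > - 1" using FpW[OF m] pos[OF m] by simp
   then show "m \<in> ?Up" using m WD unfolding P.end_region_def by auto
  qed
  show "W \<subseteq> ?Uq"
  proof
   fix m assume m: "m \<in> W"
   have "0 < 1 / P.coords m $ 2" using pos[OF m] by simp
   then have "Fq (Q.coords m) $ 2 > - 1" unfolding FqW[OF m] vec3_nth by linarith
   then show "m \<in> ?Uq" using m WD unfolding Q.end_region_def by auto
  qed
 qed
 have agree: "P.end_map Fp m = Q.end_map Fq m" if m: "m \<in> W" for m
 proof -
  let ?r = "P.coords m $ 2"
  have r: "?r > 0" by (rule pos[OF m])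
  have "?r * (1 - 1 / ?r) = ?r - 1" "?r * (1 + 1 / ?r) = ?r + 1" using r by (simp_all add: algebra_simps)
  then have "(1 - 1 / ?r) / (1 + 1 / ?r) = (?r - 1) / (?r + 1)" using r by (metis less_irrefl mult_divide_mult_cancel_left)
  then show ?thesis unfolding P.end_map_def Q.end_map_def FpW[OF m] FqW[OF m] by (simp add: shape_def)
 qed
 let ?Ip = "{t. 0 <= - 1 * t} :: real set" and ?Iq = "{t. 0 <= 1 * t} :: real set"
 have Ip: "icurve ?Ip \<gamma>" and Iq: "icurve ?Iq \<gamma>" by (rule icurve_subset[OF g]; simp add: is_interval_1)+
 have Ipd: "\<gamma> s \<in> fst Dp" if "s \<in> ?Ip" for s using gDp that by simp
 have Iqd: "\<gamma> s \<in> fst Dq" if "s \<in> ?Iq" for s using gDq that by simp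
 have c0: "P.coords (\<gamma> 0) = axis 2 1" "Q.coords (\<gamma> 0) = axis 2 1" using coords_m1 by (auto simp: m1_def)
 define Kp where "Kp = insert p (\<gamma> ` ?Ip)"
 define Kq where "Kq = insert q (\<gamma> ` ?Iq)"
 have "compactin M Kp" unfolding Kp_def by (rule P.end_compact[OF Ip Ipd refl c0(1)])
 moreover have "compactin M Kq" unfolding Kq_def by (rule Q.end_compact[OF Iq Iqd refl c0(2)])
 ultimately have Kc: "compactin M Kp" "compactin M Kq" .
 have op: "\<gamma> t \<in> ?Up" "P.end_map Fp (\<gamma> t) = vec3 0 ((exp t - 1) / (exp t + 1)) 0" if "t \<in> ?Ip" for t
  by (rule P.end_orbit[OF Fp Fa(1) Ip Ipd _ c0(1) that]; simp)+
 have oq: "\<gamma> t \<in> ?Uq" "Q.end_map Fq (\<gamma> t) = vec3 0 ((exp t - 1) / (exp t + 1)) 0" if "t \<in> ?Iq" for t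
  by (rule Q.end_orbit[OF Fq Fa(2) Iq Iqd _ c0(2) that]; simp)+
 note cp = P.end_conjugacy[OF Fp] and cq = Q.end_conjugacy[OF Fq]
 have KU: "Kp \<subseteq> ?Up" "Kq \<subseteq> ?Uq" unfolding Kp_def Kq_def using cp(2) cq(2) op(1) oq(1) by auto
 have KK: "Kp \<inter> Kq \<subseteq> W"
 proof
  fix x assume x: "x \<in> Kp \<inter> Kq"
  have "x ~= p" "x ~= q" using x pq out unfolding Kp_def Kq_def by auto
  then obtain s t where st: "s <= 0" "0 <= t" "x = \<gamma> s" "x = \<gamma> t" using x unfolding Kp_def Kq_def by auto
  have "s = t"
  proof (rule ccontr)
   assume "s ~= t"
   then have "s < t" using st by simp
   from no_return[OF g lim(2) out(2) this] show False using st by simp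
  qed
  then have "s = 0" using st by simp
  then show "x \<in> W" using st(3) Wo(2) by (simp add: m1_def)
 qed
 obtain U h where loc: "locally_conjugates M A X U h" and KUh: "Kp \<union> Kq \<subseteq> U"
  and hp: "!!x. x \<in> Kp ==> h x = P.end_map Fp x" and hq: "!!x. x \<in> Kq ==> h x = Q.end_map Fq x"
  by (rule glue_conjugacies[OF cp(1) cq(1) Wo(1) WU agree Kc(1) KU(1) Kc(2) KU(2) KK]) (assumption | rule that)+
 define \<kappa> where "\<kappa> t = (exp t - 1) / (exp t + 1)" for t :: real
 have hg: "h (\<gamma> t) = vec3 0 (\<kappa> t) 0" for t
 proof (cases "t <= 0")
  case True
  then have "\<gamma> t \<in> Kp" by (auto simp: Kp_def)
  then show ?thesis using hp op(2)[of t] True by (simp add: \<kappa>_def)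
 next
  case False
  then have "\<gamma> t \<in> Kq" by (auto simp: Kq_def)
  then show ?thesis using hq oq(2)[of t] False by (simp add: \<kappa>_def)
 qed
 have hpq: "h p = vec3 0 (- 1) 0" "h q = vec3 0 1 0" using hp[of p] hq[of q] cp(3) cq(3) by (auto simp: Kp_def Kq_def)
 have KU': "Kp \<union> Kq = insert p (insert q (range \<gamma>))"
 proof -
  have "range \<gamma> = \<gamma> ` ?Ip \<union> \<gamma> ` ?Iq"
  proof -
   have "?Ip \<union> ?Iq = UNIV" by auto
   then show ?thesis by (metis image_Un)
  qed
  then show ?thesis unfolding Kp_def Kq_def by auto
 qed
 have \<Gamma>K: "\<Gamma> = Kp \<union> Kq"
 proof
  have "closedin M (Kp \<union> Kq)" by (rule compactin_imp_closedin[OF Hausdorff compactin_Un[OF Kc]])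
  then show "\<Gamma> \<subseteq> Kp \<union> Kq" unfolding \<Gamma> KU' by (intro closure_of_minimal) auto
  have cl: "x \<in> M closure_of (range \<gamma>)" if xF: "limitin M \<gamma> x F" "F ~= bot" for x F unfolding in_closure_of
  proof (intro conjI allI impI)
   show "x \<in> topspace M" using xF(1) by (simp add: limitin_def)
   fix T assume T: "x \<in> T & openin M T"
   then have "\<forall>\<^sub>F t in F. \<gamma> t \<in> T" using xF(1) by (simp add: limitin_def)
   then obtain t where "\<gamma> t \<in> T" using eventually_happens'[OF xF(2)] by blast
   then show "\<exists>y. y \<in> range \<gamma> & y \<in> T" by blast
  qed
  have "range \<gamma> \<subseteq> topspace M" using icurve_in_space[OF g] by blast
  from closure_of_subset[OF this] cl[OF lim(1)] cl[OF lim(2)]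
  show "Kp \<union> Kq \<subseteq> \<Gamma>" unfolding \<Gamma> KU' by simp
 qed
 have \<kappa>b: "- 1 < \<kappa> t" "\<kappa> t < 1" for t
 proof -
  have "exp t + 1 > 0" using exp_gt_zero[of t] by linarith
  then show "- 1 < \<kappa> t" "\<kappa> t < 1" unfolding \<kappa>_def by (simp_all add: pos_less_divide_eq pos_divide_less_eq)
 qed
 have \<kappa>s: "\<exists>t. \<kappa> t = y" if y: "- 1 < y" "y < 1" for y
 proof
  define r where "r = (1 + y) / (1 - y)"
  have r: "r > 0" "(1 - y) * r = 1 + y" using y by (simp_all add: r_def)
  have "r - 1 = y * (r + 1)" using r(2) by (simp add: algebra_simps)
  then have "(r - 1) / (r + 1) = y" using r(1) by simp
  then show "\<kappa> (ln ((1 + y) / (1 - y))) = y" using r(1) unfolding \<kappa>_def r_def[symmetric] by simp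
 qed
 have \<kappa>i: "s = t" if "\<kappa> s = \<kappa> t" for s t
 proof -
  have "exp s + 1 ~= 0" "exp t + 1 ~= 0" using exp_gt_zero[of s] exp_gt_zero[of t] by linarith+
  then have "(exp s - 1) * (exp t + 1) = (exp t - 1) * (exp s + 1)" using that by (simp add: \<kappa>_def frac_eq_eq)
  then have "exp s = exp t" by (simp add: algebra_simps)
  then show ?thesis by simp
 qed
 have hi: "inj_on h (Kp \<union> Kq)"
 proof (rule inj_onI)
  fix x y assume xy: "x \<in> Kp \<union> Kq" "y \<in> Kp \<union> Kq" "h x = h y"
  have h2: "h x $ 2 = h y $ 2" using xy(3) by simp
  show "x = y" using xy(1,2) h2 \<kappa>b \<kappa>i unfolding KU' by (auto simp: hpq hg) (metis less_irrefl)+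
 qed
 obtain U0 where U0: "conjugates M A X U0 h" "Kp \<union> Kq \<subseteq> U0"
  by (rule locally_conjugates_injective[OF loc compactin_Un[OF Kc] KUh hi])
 have "h ` \<Gamma> = (%y. vec3 0 y 0) ` {- 1..1}"
 proof
  show "h ` \<Gamma> \<subseteq> (%y. vec3 0 y 0) ` {- 1..1}"
   unfolding \<Gamma>K KU' using \<kappa>b by (auto simp: hpq hg less_imp_le)
  show "(%y. vec3 0 y 0) ` {- 1..1} \<subseteq> h ` \<Gamma>"
  proof (rule image_subsetI)
   fix y :: real assume y: "y \<in> {- 1..1}"
   then consider "y = - 1" | "y = 1" | t where "y = \<kappa> t" using \<kappa>s[of y] by fastforce
   then show "vec3 0 y 0 \<in> h ` \<Gamma>"
    unfolding \<Gamma>K KU' using hpq hg by cases (metis imageI insertI1 insertI2 rangeI)+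
  qed
 qed
 then show ?thesis using that U0 \<Gamma>K by blast
qed

end

section \<open>Topological equivalence\<close>

lemma image_of_preimage: "W \<subseteq> f ` S ==> f ` {x \<in> S. f x \<in> W} = W" by blast

text \<open>Both conjugacies are restricted to the preimages of the intersection of their images.  Maximality of
 integral curves transfers because it is expressed by extensions, which transfer in both directions.\<close>

lemma equivalence_of_conjugacies:
 assumes M: "vector_field_manifold M A X" and M': "vector_field_manifold M' A' X'"
  and h: "conjugates M A X U h" "\<Gamma> \<subseteq> U" and h': "conjugates M' A' X' U' h'" "\<Gamma>' \<subseteq> U'" and im: "h ` \<Gamma> = h' ` \<Gamma>'"
 shows "topologically_equivalent M A X \<Gamma> M' A' X' \<Gamma>'"
proof -
 interpret S: vector_field_manifold M A X by (rule M)
 interpret S': vector_field_manifold M' A' X' by (rule M')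
 have hc: "openin M U" "continuous_map (subtopology M U) euclidean h" "inj_on h U" using h(1) by (auto simp: conjugates_def)
 have hc': "openin M' U'" "continuous_map (subtopology M' U') euclidean h'" "inj_on h' U'" using h'(1) by (auto simp: conjugates_def)
 have op: "open (h ` U)" "open (h' ` U')"
  using is_chartD(2)[OF S.embedding_chart[OF hc]] is_chartD(2)[OF S'.embedding_chart[OF hc']] by simp_all
 define T where "T = h ` U \<inter> h' ` U'"
 have To: "open T" unfolding T_def using op by (rule open_Int)
 define V where "V = {x \<in> U. h x \<in> T}"
 define V' where "V' = {x \<in> U'. h' x \<in> T}"
 have Vo: "openin M V" "openin M' V'"
  unfolding V_def V'_def by (rule chart_preimage_open[OF hc(1,2) To], rule chart_preimage_open[OF hc'(1,2) To])
 have cV: "conjugates M A X V h" by (rule S.conjugates_subset[OF h(1) Vo(1)]) (auto simp: V_def)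
 have cV': "conjugates M' A' X' V' h'" by (rule S'.conjugates_subset[OF h'(1) Vo(2)]) (auto simp: V'_def)
 have im1: "h ` V = T" "h' ` V' = T" unfolding V_def V'_def by (rule image_of_preimage; simp add: T_def)+
 have ch: "is_chart M (V, h)" "is_chart M' (V', h')"
  using cV cV' S.embedding_chart S'.embedding_chart by (auto simp: conjugates_def)
 have "homeomorphic_map (subtopology M V) (top_of_set T) h" "homeomorphic_map (subtopology M' V') (top_of_set T) h'"
  using ch im1 by (auto simp: is_chart_def)
 then obtain k k' where k: "homeomorphic_maps (subtopology M V) (top_of_set T) h k"
  and k': "homeomorphic_maps (subtopology M' V') (top_of_set T) h' k'" unfolding homeomorphic_map_maps by blast
 have tV: "topspace (subtopology M V) = V" "topspace (subtopology M' V') = V'"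
  using openin_subset[OF Vo(1)] openin_subset[OF Vo(2)] by auto
 have kh: "k (h x) = x" "h x \<in> T" if "x \<in> V" for x using k that tV im1 by (auto simp: homeomorphic_maps_def)
 have kh': "k' (h' x) = x" "h' x \<in> T" if "x \<in> V'" for x using k' that tV im1 by (auto simp: homeomorphic_maps_def)
 have hk: "h (k y) = y" "k y \<in> V" if yT: "y \<in> T" for y
 proof -
  obtain x where "x \<in> V" "y = h x" using yT im1(1) by blast
  then show "h (k y) = y" "k y \<in> V" using kh(1) by simp_all
 qed
 have hk': "h' (k' y) = y" "k' y \<in> V'" if yT: "y \<in> T" for y
 proof -
  obtain x where "x \<in> V'" "y = h' x" using yT im1(2) by blast
  then show "h' (k' y) = y" "k' y \<in> V'" using kh'(1) by simp_all
 qed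
 have \<Gamma>T: "h ` \<Gamma> \<subseteq> T" using im h(2) h'(2) unfolding T_def by blast
 have \<Gamma>T': "h' ` \<Gamma>' \<subseteq> T" using \<Gamma>T unfolding im .
 have \<Gamma>V: "\<Gamma> \<subseteq> V" "\<Gamma>' \<subseteq> V'"
  unfolding V_def V'_def using \<Gamma>T \<Gamma>T' h(2) h'(2) by blast+
 have homeo: "homeomorphic_map (subtopology M V) (subtopology M' V') (k' \<circ> h)"
 proof (rule homeomorphic_map_compose)
  show "homeomorphic_map (subtopology M V) (top_of_set T) h" using k homeomorphic_maps_map by blast
  show "homeomorphic_map (top_of_set T) (subtopology M' V') k'" using k' homeomorphic_maps_sym homeomorphic_maps_map by blast
 qed
 have "(k' \<circ> h) ` \<Gamma> = k' ` h' ` \<Gamma>'" unfolding im[symmetric] by (simp add: image_comp)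
 also have "\<dots> = \<Gamma>'" using kh'(1) \<Gamma>V(2) by (force simp: image_image)
 finally have h\<Gamma>: "(k' \<circ> h) ` \<Gamma> = \<Gamma>'" .
 have fwd: "integral_curve M' A' X' V' I (%t. k' (h (\<gamma> t)))" if g: "integral_curve M A X V I \<gamma>" for I \<gamma>
 proof (rule S'.conjugates_lift[OF cV'])
  show "is_interval I" using g by (simp add: integral_curve_def)
  have gV: "\<gamma> t \<in> V" if "t \<in> I" for t using g that unfolding S.integral_curve_iff[OF Vo(1)] by blast
  fix t assume t: "t \<in> I"
  show "k' (h (\<gamma> t)) \<in> V'" by (rule hk'(2)[OF kh(2)[OF gV[OF t]]])
  have "((h \<circ> \<gamma>) has_vector_derivative model (h (\<gamma> t))) (at t within I)" using cV g t unfolding conjugates_def by blast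
  then have "((h' \<circ> (%t. k' (h (\<gamma> t)))) has_vector_derivative model (h (\<gamma> t))) (at t within I)"
   by (rule has_vector_derivative_transform[OF t, rotated]) (use hk'(1)[OF kh(2)[OF gV]] in simp)
  then show "((h' \<circ> (%t. k' (h (\<gamma> t)))) has_vector_derivative model (h' (k' (h (\<gamma> t))))) (at t within I)"
   using hk'(1)[OF kh(2)[OF gV[OF t]]] by simp
 qed
 have bwd: "integral_curve M A X V I (%t. k (h' (\<gamma> t)))" if g: "integral_curve M' A' X' V' I \<gamma>" for I \<gamma>
 proof (rule S.conjugates_lift[OF cV])
  show "is_interval I" using g by (simp add: integral_curve_def)
  have gV: "\<gamma> t \<in> V'" if "t \<in> I" for t using g that unfolding S'.integral_curve_iff[OF Vo(2)] by blast
  fix t assume t: "t \<in> I"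
  show "k (h' (\<gamma> t)) \<in> V" by (rule hk(2)[OF kh'(2)[OF gV[OF t]]])
  have "((h' \<circ> \<gamma>) has_vector_derivative model (h' (\<gamma> t))) (at t within I)" using cV' g t unfolding conjugates_def by blast
  then have "((h \<circ> (%t. k (h' (\<gamma> t)))) has_vector_derivative model (h' (\<gamma> t))) (at t within I)"
   by (rule has_vector_derivative_transform[OF t, rotated]) (use hk(1)[OF kh'(2)[OF gV]] in simp)
  then show "((h \<circ> (%t. k (h' (\<gamma> t)))) has_vector_derivative model (h (k (h' (\<gamma> t))))) (at t within I)"
   using hk(1)[OF kh'(2)[OF gV[OF t]]] by simp
 qed
 have "\<exists>J \<gamma>' \<tau>. maximal_integral_curve M' A' X' V' J \<gamma>' & strict_mono_on I \<tau> & \<tau> ` I = J & (\<forall>t\<in>I. (k' \<circ> h) (\<gamma> t) = \<gamma>' (\<tau> t))"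
  if mx: "maximal_integral_curve M A X V I \<gamma>" for I \<gamma>
 proof -
  have I: "open I" "I ~= {}" "integral_curve M A X V I \<gamma>"
   and max: "!!J dl. open J ==> I \<subseteq> J ==> integral_curve M A X V J dl ==> (!!t. t \<in> I ==> dl t = \<gamma> t) ==> J = I"
   using mx unfolding maximal_integral_curve_def by blast+
  have gV: "\<gamma> t \<in> V" if "t \<in> I" for t using I(3) that unfolding S.integral_curve_iff[OF Vo(1)] by blast
  have "maximal_integral_curve M' A' X' V' I (%t. k' (h (\<gamma> t)))" unfolding maximal_integral_curve_def
  proof (intro conjI allI impI I(1,2) fwd[OF I(3)])
   fix J dl assume d: "open J & I \<subseteq> J & integral_curve M' A' X' V' J dl & (\<forall>t\<in>I. dl t = k' (h (\<gamma> t)))"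
   have "k (h' (dl t)) = \<gamma> t" if t: "t \<in> I" for t
    using d t hk'(1)[OF kh(2)[OF gV[OF t]]] kh(1)[OF gV[OF t]] by simp
   then show "J = I" using max[of J "%t. k (h' (dl t))"] bwd[of J dl] d by blast
  qed
  moreover have "strict_mono_on I (%t. t)" by (simp add: strict_mono_on_def)
  ultimately show ?thesis by (intro exI[of _ I] exI[of _ "%t. k' (h (\<gamma> t))"] exI[of _ "%t. t"]) simp
 qed
 then show ?thesis unfolding topologically_equivalent_def using Vo \<Gamma>V homeo h\<Gamma> by blast
qed

theorem theorem1p9:
 fixes M :: "'a topology" and A :: "'a chart set" and X :: "'a vfield" and \<Gamma> :: "'a set"
  and M' :: "'b topology" and A' :: "'b chart set" and X' :: "'b vfield" and \<Gamma>' :: "'b set"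
 assumes "smooth_3manifold M A" and "smooth_vector_field A X"
  and "smooth_3manifold M' A'" and "smooth_vector_field A' X'"
  and "generic_12_connection M A X \<Gamma>"
  and "generic_12_connection M' A' X' \<Gamma>'"
 shows "topologically_equivalent M A X \<Gamma> M' A' X' \<Gamma>'"
proof -
 have S: "vector_field_manifold M A X" "vector_field_manifold M' A' X'"
  using assms(1-4) by (simp_all add: vector_field_manifold_def)
 obtain U h where h: "conjugates M A X U h" "\<Gamma> \<subseteq> U" "h ` \<Gamma> = (%y. vec3 0 y 0) ` {- 1..1}"
  by (rule vector_field_manifold.generic_connection_conjugacy[OF S(1) assms(5)])
 obtain U' h' where h': "conjugates M' A' X' U' h'" "\<Gamma>' \<subseteq> U'" "h' ` \<Gamma>' = (%y. vec3 0 y 0) ` {- 1..1}"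
  by (rule vector_field_manifold.generic_connection_conjugacy[OF S(2) assms(6)])
 show ?thesis by (rule equivalence_of_conjugacies[OF S h(1,2) h'(1,2)]) (simp add: h(3) h'(3))
qed

end
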